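(* Let $F$ be a holomorphic function on an open $\mathbb{C}^\times$-invariant subset of $\mathbb{C}^n$, homogeneous of degree two. Consider on an open subset of $\mathbb{R}^{n+1}\otimes\mathbb{R}^3$ the function $$L=2\,r^0\,\mathrm{Im}\,F(\chi),\qquad \chi^A=\frac{x^A}{r^0}-\frac{x^0}{r^0}\,\mathrm{Re}\frac{z^A}{z^0}-i\,\mathrm{Im}\frac{z^A}{z^0}\quad(A=1,\dots,n),\qquad r^0=|\vec x^{\,0}|,$$ on a domain where the associated matrix $L_{x^Ix^J}$ is invertible and the hyperkähler potential below is non-vanishing. Then $L$ satisfies $L_{x^Ix^J}=-L_{z^I\bar z^J}$, $L_{x^Iz^J}=L_{x^Jz^I}$ and defines through the Legendre transform construction a hyperkähler cone $N_c$ of real dimension $4n+4$, and the quaternionic Kähler metric $g$ on the $4n$-dimensional base of the Swann fibration of $N_c$ is the Ferrara–Sabharwal metric: in suitable local coordinates $\psi_0,\psi_A,\tilde\psi^A\in\mathbb{R}$, $\mathcal{X}^A\in\mathbb{C}$ ($A=1,\dots,n$, with $\mathcal{X}^1$ real and positive) on the base, where $\tilde\psi^A$ and $\mathcal{X}^A$ are the inhomogeneous coordinates specified in the context, $$2s\,g=g_{PSK}-\Big(\frac{dR}{2R}\Big)^2-\frac{g_T}{R}-\frac{\alpha^2}{R^2},$$ where, with $F_A,F_{AB}$ the derivatives of $F$ at $\mathcal{X}$, $N_{AB}=\mathrm{Im}F_{AB}(\mathcal{X})$ and matrix notation $(\bar{\mathcal X}N\mathcal X)=\bar{\mathcal X}^AN_{AB}\mathcal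 X^B$ etc., $$R=-2(\bar{\mathcal X}N\mathcal X),\qquad \alpha=d\psi_0+\tfrac12(\tilde\psi^Ad\psi_A-\psi_Ad\tilde\psi^A),$$ $$g_{PSK}=\frac{(\bar{\mathcal X}N\mathcal X)(d\bar{\mathcal X}Nd\mathcal X)-(d\bar{\mathcal X}N\mathcal X)(\bar{\mathcal X}Nd\mathcal X)}{(\bar{\mathcal X}N\mathcal X)^2},$$ $$g_T=\tfrac12\big((\mathrm{Im}\,\tau)^{-1}\big)^{AB}(d\psi_A+\tau_{AC}\,d\tilde\psi^C)(d\psi_B+\bar\tau_{BD}\,d\tilde\psi^D),\qquad \tau_{AB}=F_{AB}(\mathcal X)-2i\,\frac{(N\bar{\mathcal X})_A(N\bar{\mathcal X})_B}{(\bar{\mathcal X}N\bar{\mathcal X})}.$$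
   Context: Indices $I,J$ run over $0,\dots,n$ and $A,B,C,D$ over $1,\dots,n$; repeated indices are summed. On $\mathbb{R}^{n+1}\otimes\mathbb{R}^3$ with coordinates $\vec x^{\,I}=(x^I_1,x^I_2,x^I_3)$ put $x^I=x^I_1$, $z^I=\frac12(x^I_2+ix^I_3)$. **Legendre transform construction.** Let $L$ be a real function on an open $S\subset\mathbb{R}^{n+1}\otimes\mathbb{R}^3$ with $L_{x^Ix^J}=-L_{z^I\bar z^J}$ and $L_{x^Iz^J}=L_{x^Jz^I}$. Then the associated hyperkähler space is the extended Gibbons–Hawking space over $S$ with fiber coordinates $\psi_I$, Higgs field $U_{IJ}=-\frac12L_{x^Ix^J}$ (assumed invertible) and local connection 1-forms $A_I=\mathrm{Im}(L_{x^Iz^J}dz^J)+d\phi_I$, with $\phi_I$ arbitrary real functions (gauge shifts, which may be absorbed in $\psi_I$): its symplectic forms are $\vec\Omega=-\frac12U_{IJ}d\vec x^{\,I}\wedge d\vec x^{\,J}-d\vec x^{\,K}\wedge(d\psi_K+A_K)$, with $(\vec a\wedge\vec b)_i=\varepsilon_{ijk}a_j\wedge b_k$, and its metric is $G=\frac12U_{IJ}d\vec x^{\,I}\cdot d\vec x^{\,J}+\frac12U^{IJ}(d\psi_I+A_I)(d\psi_J+A_J)$. **Hyperkähler cone, Swann fibration.** The space is a hyperkähler cone when the rotations and simultaneous scalings of the $\vec x^{\,I}$ (the action $\vec x^{\,I}\mapsto\bar q\,\vec x^{\,I}q$ of $\mathbb{H}^\times/\mathbb{Z}_2$) lift to $N_c$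 so that twice the lift of the scaling generator $\vec x^{\,K}\cdot\partial/\partial\vec x^{\,K}$ is a vector field $X$ with $\nabla_YX=Y$ for all $Y$ ($\nabla$ the Levi-Civita connection), the lifted rotations rotating the triplet $\vec\Omega$. The hyperkähler potential is then $U=\frac12G(X,X)=2U_{IJ}\vec x^{\,I}\cdot\vec x^{\,J}$. Locally $N_c$ is, up to a sign of the metric, a Swann bundle over the $4n$-dimensional quotient by the lifted $\mathbb{H}^\times/\mathbb{Z}_2$-action. The quaternionic Kähler metric $g$ on this base, with non-zero constant $s$ (proportional to its scalar curvature), is characterized by: $s\,g$ pulls back to the restriction of $U^{-1}G$ to the $G$-orthogonal complement of the orbits (extended by zero along the orbits). **Inhomogeneous coordinates.** On the set where $\vec x^{\,0},\vec x^{\,1}$ are non-collinear one uniquely writes $\vec x^{\,I}=\bar q\,\vec\rho^{\,I}q$, $q\in\mathbb{H}^\times/\mathbb{Z}_2$, with $\vec\rho^{\,0}=\mathbf i$, $\vec\rho^{\,1}=\rho^1_1\mathbf i+\rho^1_2\mathbf j$, $\rho^1_2>0$ (vectors identified with imaginary quaternions, components along $\mathbf i,\mathbf j,\mathbf k$). Then $\tilde\psi^A=\rho^A_1=\vec x^{\,0}\cdot\vec x^{\,A}/|\vec x^{\,0}|^2$ and $\mathcal X^A=\frac12(\rho^A_2+i\rho^A_3)$. The coordinates $\psi_0,\psi_A$ are fiber coordinates in a suitable gauge, invariant under the lifted action. *)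

theory Defs
  imports "HOL-Analysis.Analysis"
begin

definition dird :: "('a::real_normed_vector \<Rightarrow> 'b::real_normed_vector) \<Rightarrow> 'a \<Rightarrow> 'a \<Rightarrow> 'b" where
  "dird f p v = frechet_derivative f (at p) v"

primrec Ck_on :: "nat \<Rightarrow> 'a::real_normed_vector set \<Rightarrow> ('a \<Rightarrow> 'b::real_normed_vector) \<Rightarrow> bool" where
  "Ck_on 0 M f = continuous_on M f"
| "Ck_on (Suc k) M f =
     ((\<forall>p\<in>M. f differentiable (at p)) \<and> (\<forall>v. Ck_on k M (\<lambda>p. dird f p v)))"

definition smooth_on :: "'a::real_normed_vector set \<Rightarrow> ('a \<Rightarrow> 'b::real_normed_vector) \<Rightarrow> bool" where
  "smooth_on M f \<longleftrightarrow> (\<forall>k. Ck_on k M f)"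

definition lie_bracket :: "('e::real_normed_vector \<Rightarrow> 'e) \<Rightarrow> ('e \<Rightarrow> 'e) \<Rightarrow> 'e \<Rightarrow> 'e" where
  "lie_bracket V W p = dird W p (V p) - dird V p (W p)"

text \<open>Lie derivative of a (vector-valued) bilinear form field, evaluated on constant fields.\<close>

definition lie_deriv_form ::
  "('e::real_normed_vector \<Rightarrow> 'e) \<Rightarrow> ('e \<Rightarrow> 'e \<Rightarrow> 'e \<Rightarrow> 'b::real_normed_vector) \<Rightarrow> 'e \<Rightarrow> 'e \<Rightarrow> 'e \<Rightarrow> 'b"
  where
  "lie_deriv_form V \<omega> p u v =
     dird (\<lambda>q. \<omega> q u v) p (V p) + \<omega> p (dird V p u) v + \<omega> p u (dird V p v)"

text \<open>Christoffel symbols and Levi-Civita connection of a pseudo-Riemannian metric \<open>G\<close>;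
  \<open>levi_civita G p Y X\<close> is the covariant derivative of the field \<open>X\<close> at \<open>p\<close> in the direction \<open>Y\<close>.\<close>

definition christoffel :: "('e::real_normed_vector \<Rightarrow> 'e \<Rightarrow> 'e \<Rightarrow> real) \<Rightarrow> 'e \<Rightarrow> 'e \<Rightarrow> 'e \<Rightarrow> 'e" where
  "christoffel G p u v = (THE w. \<forall>z. 2 * G p w z =
     dird (\<lambda>q. G q v z) p u + dird (\<lambda>q. G q u z) p v - dird (\<lambda>q. G q u v) p z)"

definition levi_civita :: "('e::real_normed_vector \<Rightarrow> 'e \<Rightarrow> 'e \<Rightarrow> real) \<Rightarrow> 'e \<Rightarrow> 'e \<Rightarrow> ('e \<Rightarrow> 'e) \<Rightarrow> 'e" where
  "levi_civita G p Y X = dird X p Y + christoffel G p Y (X p)"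

definition pseudo_metric_on :: "'e::real_normed_vector set \<Rightarrow> ('e \<Rightarrow> 'e \<Rightarrow> 'e \<Rightarrow> real) \<Rightarrow> bool" where
  "pseudo_metric_on M G \<longleftrightarrow>
     (\<forall>p\<in>M. bilinear (G p) \<and> (\<forall>u v. G p u v = G p v u) \<and> (\<forall>u. (\<forall>v. G p u v = 0) \<longrightarrow> u = 0))
     \<and> (\<forall>u v. smooth_on M (\<lambda>p. G p u v))"

definition closed_2form_on :: "'e::real_normed_vector set \<Rightarrow> ('e \<Rightarrow> 'e \<Rightarrow> 'e \<Rightarrow> 'b::real_normed_vector) \<Rightarrow> bool" where
  "closed_2form_on M \<omega> \<longleftrightarrow>
     (\<forall>p\<in>M. bilinear (\<omega> p) \<and> (\<forall>u v. \<omega> p u v = - \<omega> p v u))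
     \<and> (\<forall>u v. smooth_on M (\<lambda>p. \<omega> p u v))
     \<and> (\<forall>p\<in>M. \<forall>u v w. dird (\<lambda>q. \<omega> q v w) p u + dird (\<lambda>q. \<omega> q w u) p v
                          + dird (\<lambda>q. \<omega> q u v) p w = 0)"

text \<open>\<open>G\<close> is (pseudo-)hyperkaehler with triplet of symplectic forms \<open>\<Omega>\<close>: three
  \<open>G\<close>-orthogonal, parallel almost complex structures obeying the quaternion algebra, related to
  the closed forms by \<open>\<Omega>\<^sub>i(u,v) = G(u, J\<^sub>i v)\<close>.\<close>

definition hyperkaehler_on ::
  "'e::real_normed_vector set \<Rightarrow> ('e \<Rightarrow> 'e \<Rightarrow> 'e \<Rightarrow> real) \<Rightarrow> ('e \<Rightarrow> 'e \<Rightarrow> 'e \<Rightarrow> real^3) \<Rightarrow> bool"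
  where
  "hyperkaehler_on M G \<Omega> \<longleftrightarrow> open M \<and> pseudo_metric_on M G \<and> closed_2form_on M \<Omega> \<and>
     (\<exists>J :: 3 \<Rightarrow> 'e \<Rightarrow> 'e \<Rightarrow> 'e.
        (\<forall>i v. smooth_on M (\<lambda>p. J i p v)) \<and>
        (\<forall>p\<in>M. (\<forall>i. linear (J i p)) \<and>
           (\<forall>i u v. \<Omega> p u v $ i = G p u (J i p v)) \<and>
           (\<forall>i u v. G p (J i p u) (J i p v) = G p u v) \<and>
           (\<forall>i v. J i p (J i p v) = - v) \<and>
           (\<forall>v. J 1 p (J 2 p v) = J 3 p v \<and> J 2 p (J 1 p v) = - J 3 p v) \<and>
           (\<forall>i u v. dird (\<lambda>q. J i q v) p u + christoffel G p u (J i p v)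
                      - J i p (christoffel G p u v) = 0)))"

text \<open>The index set \<open>{0,\<dots>,n}\<close> is \<open>'n option\<close>, with \<open>None\<close> for \<open>0\<close> and \<open>Some A\<close> for
  \<open>A \<in> {1,\<dots>,n}\<close>; the fixed index \<open>1\<close> is a parameter \<open>o1 :: 'n\<close> wherever it is needed.\<close>

type_synonym 'n config = "((real^3)^('n option))"
type_synonym 'n total = "'n config \<times> (real^('n option))"

definition zc :: "'n::finite config \<Rightarrow> 'n option \<Rightarrow> complex" where
  "zc x I = Complex (x $ I $ 2 / 2) (x $ I $ 3 / 2)"

text \<open>Partial derivatives in the coordinates \<open>x = x\<^sub>1\<close>, \<open>z = (x\<^sub>2 + i x\<^sub>3)/2\<close>; the factor in
  \<open>z\<close> makes \<open>\<partial>\<^sub>z = \<partial>\<^sub>2 - i \<partial>\<^sub>3\<close>.\<close>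

definition basis_vec :: "'n::finite option \<Rightarrow> 3 \<Rightarrow> 'n config" where
  "basis_vec I i = axis I (axis i 1)"

definition pd_x :: "'n::finite option \<Rightarrow> ('n config \<Rightarrow> 'b::real_normed_vector) \<Rightarrow> 'n config \<Rightarrow> 'b" where
  "pd_x I f x = dird f x (basis_vec I 1)"

definition pd_z :: "'n::finite option \<Rightarrow> ('n config \<Rightarrow> complex) \<Rightarrow> 'n config \<Rightarrow> complex" where
  "pd_z I f x = dird f x (basis_vec I 2) - \<i> * dird f x (basis_vec I 3)"

definition pd_zbar :: "'n::finite option \<Rightarrow> ('n config \<Rightarrow> complex) \<Rightarrow> 'n config \<Rightarrow> complex" where
  "pd_zbar I f x = dird f x (basis_vec I 2) + \<i> * dird f x (basis_vec I 3)"

definition legendre_equations :: "'n::finite config set \<Rightarrow> ('n config \<Rightarrow> real) \<Rightarrow> bool" where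
  "legendre_equations S L \<longleftrightarrow> (let Lc = (\<lambda>x. complex_of_real (L x)) in
     \<forall>x\<in>S. \<forall>I J. pd_x I (pd_x J Lc) x = - pd_z I (pd_zbar J Lc) x
                \<and> pd_x I (pd_z J Lc) x = pd_x J (pd_z I Lc) x)"

definition hessian_xx :: "('n::finite config \<Rightarrow> real) \<Rightarrow> 'n config \<Rightarrow> real^('n option)^('n option)" where
  "hessian_xx L x = (\<chi> I J. pd_x I (pd_x J L) x)"

definition higgs :: "('n::finite config \<Rightarrow> real) \<Rightarrow> 'n config \<Rightarrow> real^('n option)^('n option)" where
  "higgs L x = (\<chi> I J. - (1/2) * hessian_xx L x $ I $ J)"

text \<open>\<open>A\<^sub>I = Im(L\<^bsub>x\<^sup>I z\<^sup>J\<^esub> dz\<^sup>J) + d\<phi>\<^sub>I\<close>; as \<open>zc\<close> is linear, \<open>dz\<^sup>J(u) = zc u J\<close>.\<close>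

definition connection_form ::
  "('n::finite config \<Rightarrow> real) \<Rightarrow> ('n config \<Rightarrow> real^('n option)) \<Rightarrow> 'n option \<Rightarrow> 'n config \<Rightarrow> 'n config \<Rightarrow> real"
  where
  "connection_form L \<phi> I x u =
     Im (\<Sum>J\<in>UNIV. pd_z J (pd_x I (\<lambda>y. complex_of_real (L y))) x * zc u J)
     + dird (\<lambda>y. \<phi> y $ I) x u"

definition theta ::
  "('n::finite config \<Rightarrow> real) \<Rightarrow> ('n config \<Rightarrow> real^('n option)) \<Rightarrow> 'n option \<Rightarrow> 'n total \<Rightarrow> 'n total \<Rightarrow> real"
  where
  "theta L \<phi> I p v = snd v $ I + connection_form L \<phi> I (fst p) (fst v)"

definition wedge :: "('e \<Rightarrow> real^3) \<Rightarrow> ('e \<Rightarrow> real) \<Rightarrow> 'e \<Rightarrow> 'e \<Rightarrow> real^3" where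
  "wedge a b v w = b w *\<^sub>R a v - b v *\<^sub>R a w"

definition cross_wedge :: "('e \<Rightarrow> real^3) \<Rightarrow> ('e \<Rightarrow> real^3) \<Rightarrow> 'e \<Rightarrow> 'e \<Rightarrow> real^3" where
  "cross_wedge a b v w = cross3 (a v) (b w) - cross3 (a w) (b v)"

text \<open>The product \<open>a b\<close> of one-forms in a line element is \<open>a \<otimes> b + b \<otimes> a\<close>. With the wedge
  product \<open>a \<otimes> b - b \<otimes> a\<close>, this is the normalisation for which the metric and the forms below
  are compatible and for which \<open>G(X,X)/2 = 2 U\<^sub>I\<^sub>J x\<^sup>I \<cdot> x\<^sup>J\<close> for the cone field \<open>X\<close>.\<close>

definition sprod :: "('e \<Rightarrow> 'b::comm_ring) \<Rightarrow> ('e \<Rightarrow> 'b) \<Rightarrow> 'e \<Rightarrow> 'e \<Rightarrow> 'b" where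
  "sprod a b v w = a v * b w + b v * a w"

definition sympl ::
  "('n::finite config \<Rightarrow> real) \<Rightarrow> ('n config \<Rightarrow> real^('n option)) \<Rightarrow> 'n total \<Rightarrow> 'n total \<Rightarrow> 'n total \<Rightarrow> real^3"
  where
  "sympl L \<phi> p v w =
     - (1/2) *\<^sub>R (\<Sum>I\<in>UNIV. \<Sum>J\<in>UNIV. higgs L (fst p) $ I $ J *\<^sub>R
          cross_wedge (\<lambda>t. fst t $ I) (\<lambda>t. fst t $ J) v w)
     - (\<Sum>K\<in>UNIV. wedge (\<lambda>t. fst t $ K) (theta L \<phi> K p) v w)"

definition gh_metric ::
  "('n::finite config \<Rightarrow> real) \<Rightarrow> ('n config \<Rightarrow> real^('n option)) \<Rightarrow> 'n total \<Rightarrow> 'n total \<Rightarrow> 'n total \<Rightarrow> real"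
  where
  "gh_metric L \<phi> p v w =
     1/2 * (\<Sum>I\<in>UNIV. \<Sum>J\<in>UNIV. higgs L (fst p) $ I $ J *
          (\<Sum>i\<in>UNIV. sprod (\<lambda>t. fst t $ I $ i) (\<lambda>t. fst t $ J $ i) v w))
     + 1/2 * (\<Sum>I\<in>UNIV. \<Sum>J\<in>UNIV. matrix_inv (higgs L (fst p)) $ I $ J *
          sprod (theta L \<phi> I p) (theta L \<phi> J p) v w)"

definition hk_potential :: "('n::finite config \<Rightarrow> real) \<Rightarrow> 'n config \<Rightarrow> real" where
  "hk_potential L x = 2 * (\<Sum>I\<in>UNIV. \<Sum>J\<in>UNIV. higgs L x $ I $ J * (x $ I \<bullet> x $ J))"

text \<open>The space over \<open>S\<close> is a hyperkaehler cone, the action of the scalings and rotations being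
  lifted to the vector fields \<open>Sc\<close> and \<open>R a\<close> (rotation about the axis \<open>a\<close>). The action is in
  general only local because \<open>S\<close> need not be invariant, so it is given by its generators, which
  represent the Lie algebra. For the linear fields \<open>x \<mapsto> a \<times> x\<close> the \<open>lie_bracket\<close> gives minus
  the field of \<open>a \<times> b\<close>. That the rotations rotate the triplet means that the pullback of \<open>\<Omega>\<close>
  by (the lift of) a rotation \<open>\<rho>\<close> is \<open>\<rho> \<Omega>\<close>, hence infinitesimally that the Lie derivative of
  \<open>\<Omega>\<close> is \<open>a \<times> \<Omega>\<close>.\<close>

definition hk_cone ::
  "'n::finite config set \<Rightarrow> ('n config \<Rightarrow> real) \<Rightarrow> ('n config \<Rightarrow> real^('n option)) \<Rightarrow>
   ('n total \<Rightarrow> 'n total) \<Rightarrow> (real^3 \<Rightarrow> 'n total \<Rightarrow> 'n total) \<Rightarrow> bool"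
  where
  "hk_cone S L \<phi> Sc R \<longleftrightarrow>
     hyperkaehler_on (S \<times> UNIV) (gh_metric L \<phi>) (sympl L \<phi>) \<and>
     smooth_on (S \<times> UNIV) Sc \<and> (\<forall>a. smooth_on (S \<times> UNIV) (R a)) \<and>
     (\<forall>p\<in>S \<times> UNIV.
        fst (Sc p) = fst p \<and>
        (\<forall>a. fst (R a p) = (\<chi> I. cross3 a (fst p $ I))) \<and>
        linear (\<lambda>a. R a p) \<and>
        (\<forall>a. lie_bracket Sc (R a) p = 0) \<and>
        (\<forall>a b. lie_bracket (R a) (R b) p = - R (cross3 a b) p) \<and>
        (\<forall>Y. levi_civita (gh_metric L \<phi>) p Y (\<lambda>q. 2 *\<^sub>R Sc q) = Y) \<and>
        (\<forall>a u v. lie_deriv_form (R a) (sympl L \<phi>) p u v = cross3 a (sympl L \<phi> p u v)))"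

definition orbit_tangent ::
  "('n::finite total \<Rightarrow> 'n total) \<Rightarrow> (real^3 \<Rightarrow> 'n total \<Rightarrow> 'n total) \<Rightarrow> 'n total \<Rightarrow> 'n total set"
  where
  "orbit_tangent Sc R p = span (insert (Sc p) (range (\<lambda>a. R a p)))"

definition orbit_complement ::
  "('n::finite config \<Rightarrow> real) \<Rightarrow> ('n config \<Rightarrow> real^('n option)) \<Rightarrow>
   ('n total \<Rightarrow> 'n total) \<Rightarrow> (real^3 \<Rightarrow> 'n total \<Rightarrow> 'n total) \<Rightarrow> 'n total \<Rightarrow> 'n total set"
  where
  "orbit_complement L \<phi> Sc R p = {v. \<forall>u\<in>orbit_tangent Sc R p. gh_metric L \<phi> p v u = 0}"

text \<open>\<open>g\<close> is the metric of the base of the Swann fibration, in terms of a projection \<open>\<pi>\<close> (defined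
  on \<open>M\<close>) to coordinates of the base: \<open>s g\<close> pulls back to the restriction of \<open>U\<^sup>-\<^sup>1 G\<close>, with
  \<open>U = G(X,X)/2\<close> and \<open>X = 2 Sc\<close>, to the complement of the orbits, extended by zero.\<close>

definition swann_base_metric ::
  "('n::finite config \<Rightarrow> real) \<Rightarrow> ('n config \<Rightarrow> real^('n option)) \<Rightarrow>
   ('n total \<Rightarrow> 'n total) \<Rightarrow> (real^3 \<Rightarrow> 'n total \<Rightarrow> 'n total) \<Rightarrow>
   'n total set \<Rightarrow> ('n total \<Rightarrow> 'b::real_normed_vector) \<Rightarrow> real \<Rightarrow> ('b \<Rightarrow> 'b \<Rightarrow> 'b \<Rightarrow> real) \<Rightarrow> bool"
  where
  "swann_base_metric L \<phi> Sc R M \<pi> s g \<longleftrightarrow>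
     (\<forall>p\<in>M. \<forall>v\<in>orbit_complement L \<phi> Sc R p. \<forall>w\<in>orbit_complement L \<phi> Sc R p.
        \<forall>a\<in>orbit_tangent Sc R p. \<forall>b\<in>orbit_tangent Sc R p.
        s * g (\<pi> p) (dird \<pi> p (v + a)) (dird \<pi> p (w + b)) =
        gh_metric L \<phi> p v w / (1/2 * gh_metric L \<phi> p (2 *\<^sub>R Sc p) (2 *\<^sub>R Sc p)))"

text \<open>Quaternions as pairs of real and imaginary part.\<close>

definition qmult :: "real \<times> (real^3) \<Rightarrow> real \<times> (real^3) \<Rightarrow> real \<times> (real^3)" where
  "qmult p q = (fst p * fst q - snd p \<bullet> snd q,
                fst p *\<^sub>R snd q + fst q *\<^sub>R snd p + cross3 (snd p) (snd q))"

definition qcnj :: "real \<times> (real^3) \<Rightarrow> real \<times> (real^3)" where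
  "qcnj q = (fst q, - snd q)"

definition inhomogeneous :: "'n \<Rightarrow> 'n::finite config \<Rightarrow> 'n config" where
  "inhomogeneous o1 x = (THE \<rho>.
     (\<exists>q. q \<noteq> 0 \<and> (\<forall>I. (0, x $ I) = qmult (qmult (qcnj q) (0, \<rho> $ I)) q)) \<and>
     \<rho> $ None = axis 1 1 \<and> \<rho> $ Some o1 $ 2 > 0 \<and> \<rho> $ Some o1 $ 3 = 0)"

definition psi_tilde :: "'n \<Rightarrow> 'n::finite config \<Rightarrow> real^'n" where
  "psi_tilde o1 x = (\<chi> A. inhomogeneous o1 x $ Some A $ 1)"

definition cal_X :: "'n \<Rightarrow> 'n::finite config \<Rightarrow> complex^'n" where
  "cal_X o1 x = (\<chi> A. zc (inhomogeneous o1 x) (Some A))"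

text \<open>Base coordinates \<open>(\<psi>\<^sub>I, \<psi>\<^sup>~\<^sup>A, X\<^sup>A)\<close>; since \<open>X\<^sup>1\<close> is real, the base is locally the real
  hypersurface with tangent space \<open>base_tangent o1\<close>.\<close>

type_synonym 'n base = "(real^('n option)) \<times> (real^'n) \<times> (complex^'n)"

definition base_tangent :: "'n \<Rightarrow> 'n::finite base set" where
  "base_tangent o1 = {(a, b, c). Im (c $ o1) = 0}"

definition base_proj :: "'n \<Rightarrow> ('n::finite total \<Rightarrow> real^('n option)) \<Rightarrow> 'n total \<Rightarrow> 'n base" where
  "base_proj o1 \<Psi> p = (\<Psi> p, psi_tilde o1 (fst p), cal_X o1 (fst p))"

definition noncollinear_part :: "'n \<Rightarrow> 'n::finite config set \<Rightarrow> 'n total set" where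
  "noncollinear_part o1 S = {x\<in>S. \<not> collinear {0, x $ None, x $ Some o1}} \<times> UNIV"

text \<open>\<open>\<Psi>\<close> are fiber coordinates in some gauge (shifts of \<open>\<psi>\<^sub>I\<close> by functions on the space, which
  may involve the fiber coordinates), invariant under the lifted action, and together with the
  inhomogeneous coordinates they are local coordinates of the quotient by the action.\<close>

definition invariant_coordinates ::
  "'n \<Rightarrow> 'n::finite config set \<Rightarrow> ('n total \<Rightarrow> 'n total) \<Rightarrow> (real^3 \<Rightarrow> 'n total \<Rightarrow> 'n total) \<Rightarrow>
   ('n total \<Rightarrow> real^('n option)) \<Rightarrow> bool"
  where
  "invariant_coordinates o1 S Sc R \<Psi> \<longleftrightarrow>
     smooth_on (noncollinear_part o1 S) \<Psi> \<and>
     smooth_on (noncollinear_part o1 S) (base_proj o1 \<Psi>) \<and>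
     inj_on (\<lambda>p. (fst p, \<Psi> p)) (noncollinear_part o1 S) \<and>
     (\<forall>p\<in>noncollinear_part o1 S.
        bij (dird (\<lambda>q. (fst q, \<Psi> q)) p) \<and>
        dird \<Psi> p (Sc p) = 0 \<and> (\<forall>a. dird \<Psi> p (R a p) = 0) \<and>
        Im (cal_X o1 (fst p) $ o1) = 0 \<and> Re (cal_X o1 (fst p) $ o1) > 0 \<and>
        range (dird (base_proj o1 \<Psi>) p) = base_tangent o1 \<and>
        {v. dird (base_proj o1 \<Psi>) p v = 0} = orbit_tangent Sc R p)"

definition holomorphic_vec_on :: "(complex^'n::finite \<Rightarrow> complex) \<Rightarrow> (complex^'n) set \<Rightarrow> bool" where
  "holomorphic_vec_on F D \<longleftrightarrow>
     (\<forall>X\<in>D. \<exists>F'. (F has_derivative F') (at X) \<and> (\<forall>c v. F' (c *s v) = c * F' v))"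

definition chi_coord :: "'n::finite config \<Rightarrow> complex^'n" where
  "chi_coord x = (let r0 = norm (x $ None) in
     \<chi> A. complex_of_real (x $ Some A $ 1 / r0)
          - complex_of_real (x $ None $ 1 / r0 * Re (zc x (Some A) / zc x None))
          - \<i> * complex_of_real (Im (zc x (Some A) / zc x None)))"

definition cmap_L :: "(complex^'n::finite \<Rightarrow> complex) \<Rightarrow> 'n config \<Rightarrow> real" where
  "cmap_L F x = 2 * norm (x $ None) * Im (F (chi_coord x))"

definition F1 :: "(complex^'n::finite \<Rightarrow> complex) \<Rightarrow> 'n \<Rightarrow> complex^'n \<Rightarrow> complex" where
  "F1 F A X = dird F X (axis A 1)"

definition F2 :: "(complex^'n::finite \<Rightarrow> complex) \<Rightarrow> 'n \<Rightarrow> 'n \<Rightarrow> complex^'n \<Rightarrow> complex" where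
  "F2 F A B X = dird (F1 F A) X (axis B 1)"

definition Nmat :: "(complex^'n::finite \<Rightarrow> complex) \<Rightarrow> complex^'n \<Rightarrow> 'n \<Rightarrow> 'n \<Rightarrow> complex" where
  "Nmat F X A B = complex_of_real (Im (F2 F A B X))"

definition Nform :: "(complex^'n::finite \<Rightarrow> complex) \<Rightarrow> complex^'n \<Rightarrow> complex^'n \<Rightarrow> complex^'n \<Rightarrow> complex" where
  "Nform F X a b = (\<Sum>A\<in>UNIV. \<Sum>B\<in>UNIV. a $ A * Nmat F X A B * b $ B)"

definition cnjv :: "complex^'n::finite \<Rightarrow> complex^'n" where
  "cnjv a = (\<chi> A. cnj (a $ A))"

definition tau :: "(complex^'n::finite \<Rightarrow> complex) \<Rightarrow> complex^'n \<Rightarrow> 'n \<Rightarrow> 'n \<Rightarrow> complex" where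
  "tau F X A B = F2 F A B X
     - 2 * \<i> * ((\<Sum>C\<in>UNIV. Nmat F X A C * cnj (X $ C)) * (\<Sum>C\<in>UNIV. Nmat F X B C * cnj (X $ C)))
       / Nform F X (cnjv X) (cnjv X)"

definition R_FS :: "(complex^'n::finite \<Rightarrow> complex) \<Rightarrow> complex^'n \<Rightarrow> complex" where
  "R_FS F X = - 2 * Nform F X (cnjv X) X"

definition dR_FS :: "(complex^'n::finite \<Rightarrow> complex) \<Rightarrow> 'n base \<Rightarrow> 'n base \<Rightarrow> complex" where
  "dR_FS F b t = (case b of (\<psi>, \<psi>t, X) \<Rightarrow> case t of (d\<psi>, d\<psi>t, dX) \<Rightarrow> dird (R_FS F) X dX)"

definition alpha_FS :: "'n::finite base \<Rightarrow> 'n base \<Rightarrow> complex" where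
  "alpha_FS b t = (case b of (\<psi>, \<psi>t, X) \<Rightarrow> case t of (d\<psi>, d\<psi>t, dX) \<Rightarrow>
     complex_of_real (d\<psi> $ None
       + 1/2 * (\<Sum>A\<in>UNIV. \<psi>t $ A * d\<psi> $ Some A - \<psi> $ Some A * d\<psi>t $ A)))"

definition g_PSK :: "(complex^'n::finite \<Rightarrow> complex) \<Rightarrow> 'n base \<Rightarrow> 'n base \<Rightarrow> 'n base \<Rightarrow> complex" where
  "g_PSK F b v w = (case b of (\<psi>, \<psi>t, X) \<Rightarrow>
     let dX = (\<lambda>t::'n base. snd (snd t)); Q = Nform F X in
     (Q (cnjv X) X *
        (\<Sum>A\<in>UNIV. \<Sum>B\<in>UNIV. Nmat F X A B * sprod (\<lambda>t. cnj (dX t $ A)) (\<lambda>t. dX t $ B) v w)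
      - sprod (\<lambda>t. Q (cnjv (dX t)) X) (\<lambda>t. Q (cnjv X) (dX t)) v w)
     / (Q (cnjv X) X)^2)"

definition g_T :: "(complex^'n::finite \<Rightarrow> complex) \<Rightarrow> 'n base \<Rightarrow> 'n base \<Rightarrow> 'n base \<Rightarrow> complex" where
  "g_T F b v w = (case b of (\<psi>, \<psi>t, X) \<Rightarrow>
     let d\<psi> = (\<lambda>A (t::'n base). complex_of_real (fst t $ Some A));
         d\<psi>t = (\<lambda>A (t::'n base). complex_of_real (fst (snd t) $ A));
         Im_tau = (\<chi> A B. Im (tau F X A B)) :: real^'n^'n
     in 1/2 * (\<Sum>A\<in>UNIV. \<Sum>B\<in>UNIV. complex_of_real (matrix_inv Im_tau $ A $ B) *
          sprod (\<lambda>t. d\<psi> A t + (\<Sum>C\<in>UNIV. tau F X A C * d\<psi>t C t))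
                (\<lambda>t. d\<psi> B t + (\<Sum>D\<in>UNIV. cnj (tau F X B D) * d\<psi>t D t)) v w))"

definition ferrara_sabharwal ::
  "(complex^'n::finite \<Rightarrow> complex) \<Rightarrow> 'n base \<Rightarrow> 'n base \<Rightarrow> 'n base \<Rightarrow> complex" where
  "ferrara_sabharwal F b v w = (let R = R_FS F (snd (snd b)) in
     g_PSK F b v w
     - sprod (\<lambda>t. dR_FS F b t / (2 * R)) (\<lambda>t. dR_FS F b t / (2 * R)) v w
     - g_T F b v w / R
     - sprod (alpha_FS b) (alpha_FS b) v w / R^2)"

text \<open>Where the denominator in \<open>\<tau>\<close> is non-zero, i.e. where the formula for the metric makes sense.\<close>

definition tau_defined_part :: "'n \<Rightarrow> (complex^'n \<Rightarrow> complex) \<Rightarrow> 'n::finite config set \<Rightarrow> 'n total set" where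
  "tau_defined_part o1 F S = {p\<in>noncollinear_part o1 S.
     (let X = cal_X o1 (fst p) in Nform F X (cnjv X) (cnjv X) \<noteq> 0)}"

end

(*
The complex linear form m on R^3 that is isotropic and annihilates x^0 governs everything:
chi^A = m(x^A), and the derivative of chi along v is a multiple of chi plus m(v^A - psi~^A v^0).
With Euler's relation the second derivatives of L become algebra in F_A(chi), F_AB(chi). They obey
the Legendre equations, and in the frame v^0, v^A - psi~^A v^0 the Higgs field is block diagonal
with blocks 2Q/r^0 and -N/r^0, where Q = (conj X) N X.

For any solution of the Legendre equations the derivatives of the Higgs field are totally symmetric,
which makes the three forms closed; the complex structures are then parallel because the forms are
closed and the structures obey the quaternion algebra (Hitchin's lemma). If the Higgs field is
homogeneous of degree -1 and rotation invariant, the space is a cone.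

The coordinates X are a scalar multiple of chi, so F_AB(X) = F_AB(chi), and
psi_A - (x^0_1/r^0) Re F_A(chi), together with an analogous shift of psi_0, are invariant under the
lifted action. Orthogonality to the orbits fixes the scalars by which a tangent vector exceeds
its projection to the base. Substituting them into the metric gives the Ferrara-Sabharwal metric by
(Im tau)^-1 = N^-1 - (X X^dagger + conj)/Q.
*)
theory Submission
  imports Defs "HOL-Complex_Analysis.Cauchy_Integral_Formula"
begin

text \<open>\<open>chi\<close> and \<open>rho2\<close> single out the first axis and are not
  rotation invariant; only \<open>nn\<close> and combinations such as \<open>rho2\<close> times
  \<open>qq\<close> are. So the invariance of the Higgs field is read off from an expression in
  inner products, and the fibre coordinates need shifts before they descend to the quotient; the
  arbitrary \<phi> is absorbed in the same step.

  The metric may be indefinite, so the orthogonal space of an orbit need not be a complement. It is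
  one because the scaling field and the rotations about orthonormal axes have a multiple of the
  identity as Gram matrix, the multiple being half the hyperkaehler potential.

  The constants: the potential is -4 r Q, and on vectors orthogonal to the orbits G is -2 r Q times
  the Ferrara-Sabharwal form; hence the 2 in 2 s g.

  F is only assumed complex differentiable in several variables, but its derivatives up to third
  order, and smoothness, are needed. They come from Cauchy's formula along coordinate lines.\<close>

section \<open>Directional derivatives and the classes C^k\<close>

lemma dird_eq: "(f has_derivative f') (at p) \<Longrightarrow> dird f p v = f' v"
  unfolding dird_def by (metis frechet_derivative_at)

lemma has_derivative_dird: "f differentiable (at p) \<Longrightarrow> (f has_derivative dird f p) (at p)"
  by (simp add: dird_def[abs_def] frechet_derivative_works[symmetric])

lemma has_derivative_cong_open:
  assumes "open M" "p \<in> M" "\<And>q. q \<in> M \<Longrightarrow> f q = g q"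
  shows "(f has_derivative f') (at p) \<longleftrightarrow> (g has_derivative f') (at p)"
proof
  show "(g has_derivative f') (at p)" if "(f has_derivative f') (at p)"
    using has_derivative_transform_within_open[OF that assms(1,2)] assms(3) by simp
  show "(f has_derivative f') (at p)" if "(g has_derivative f') (at p)"
    using has_derivative_transform_within_open[OF that assms(1,2)] assms(3) by simp
qed

lemma differentiable_cong_open:
  assumes "open M" "p \<in> M" "\<And>q. q \<in> M \<Longrightarrow> f q = g q"
  shows "f differentiable (at p) \<longleftrightarrow> g differentiable (at p)"
  using has_derivative_cong_open[of M p f g, OF assms] unfolding differentiable_def by simp

lemma dird_cong_open:
  assumes "open M" "p \<in> M" "\<And>q. q \<in> M \<Longrightarrow> f q = g q"
  shows "dird f p v = dird g p v"
  using has_derivative_cong_open[of M p f g, OF assms] unfolding dird_def frechet_derivative_def by simp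

lemma linear_dird: "f differentiable (at p) \<Longrightarrow> linear (dird f p)"
  by (rule has_derivative_linear[OF has_derivative_dird])

lemma Ck_on_cong:
  assumes "open M" "\<And>p. p \<in> M \<Longrightarrow> f p = g p"
  shows "Ck_on k M f \<longleftrightarrow> Ck_on k M g"
  using assms(2)
proof (induction k arbitrary: f g)
  case 0
  then show ?case unfolding Ck_on.simps(1) by (intro continuous_on_cong[OF refl])
next
  case (Suc k)
  have "Ck_on k M (\<lambda>p. dird f p v) = Ck_on k M (\<lambda>p. dird g p v)" for v
    by (rule Suc.IH) (use dird_cong_open assms(1) Suc.prems in blast)
  moreover have "\<forall>p\<in>M. f differentiable (at p) \<longleftrightarrow> g differentiable (at p)"
    using differentiable_cong_open assms(1) Suc.prems by blast
  ultimately show ?case by simp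
qed

lemma Ck_on_SucD: "Ck_on (Suc k) M f \<Longrightarrow> Ck_on k M f"
proof (induction k arbitrary: f)
  case 0
  then show ?case
    using differentiable_imp_continuous_within[THEN continuous_at_imp_continuous_within, of f]
    by (simp add: continuous_on_eq_continuous_within)
next
  case (Suc k)
  then show ?case by simp
qed

text \<open>\<open>Ck_on\<close> is defined through \<open>frechet_derivative\<close>; this rule
  lets an explicit derivative formula take its place and drives the inductions on \<open>k\<close>
  below.\<close>

lemma Ck_on_SucI:
  assumes "open M" "\<And>p. p \<in> M \<Longrightarrow> (f has_derivative f' p) (at p)"
    "\<And>v. Ck_on k M (\<lambda>p. f' p v)"
  shows "Ck_on (Suc k) M f"
proof -
  have "Ck_on k M (\<lambda>p. dird f p v)" for v
    using Ck_on_cong[OF assms(1), of "\<lambda>p. dird f p v" "\<lambda>p. f' p v" k] assms(2,3) dird_eq by metis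
  then show ?thesis using assms(2) by (auto simp: differentiable_def)
qed

lemma Ck_on_deriv: "Ck_on (Suc k) M f \<Longrightarrow> Ck_on k M (\<lambda>p. dird f p v)"
  by simp

lemma Ck_on_has_derivative:
  "Ck_on (Suc k) M f \<Longrightarrow> p \<in> M \<Longrightarrow> (f has_derivative dird f p) (at p)"
  by (simp add: has_derivative_dird)

lemma Ck_on_const: "open M \<Longrightarrow> Ck_on k M (\<lambda>_. c)"
proof (induction k arbitrary: c)
  case (Suc k)
  show ?case by (rule Ck_on_SucI[where f'="\<lambda>_ _. 0"]) (use Suc in auto)
qed simp

lemma Ck_on_compose_linear:
  assumes "bounded_linear h" "open M"
  shows "Ck_on k M f \<Longrightarrow> Ck_on k M (\<lambda>p. h (f p))"
proof (induction k arbitrary: f)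
  case 0
  then show ?case using assms(1) by (simp add: bounded_linear.continuous_on)
next
  case (Suc k)
  have "((\<lambda>p. h (f p)) has_derivative (\<lambda>v. h (dird f p v))) (at p)" if "p \<in> M" for p
    using bounded_linear.has_derivative[OF assms(1) Ck_on_has_derivative[OF Suc.prems that]] .
  then show ?case
    by (rule Ck_on_SucI[OF assms(2)]) (use Suc in auto)
qed

lemma Ck_on_linear: "open M \<Longrightarrow> bounded_linear h \<Longrightarrow> Ck_on k M h"
proof (cases k)
  case 0
  assume "bounded_linear h"
  then show ?thesis unfolding 0
    using linear_continuous_on by simp
next
  case (Suc k')
  assume "open M" "bounded_linear h"
  then show ?thesis unfolding Suc
    by (intro Ck_on_SucI[where f'="\<lambda>_. h"]) (auto intro: bounded_linear_imp_has_derivative Ck_on_const)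
qed

lemma Ck_on_add:
  assumes "open M"
  shows "Ck_on k M f \<Longrightarrow> Ck_on k M g \<Longrightarrow> Ck_on k M (\<lambda>p. f p + g p)"
proof (induction k arbitrary: f g)
  case 0
  then show ?case by (simp add: continuous_on_add)
next
  case (Suc k)
  have "((\<lambda>p. f p + g p) has_derivative (\<lambda>v. dird f p v + dird g p v)) (at p)" if "p \<in> M" for p
    by (rule has_derivative_add[OF Suc.prems[THEN Ck_on_has_derivative, OF that]])
  then show ?case
    by (rule Ck_on_SucI[OF assms(1)]) (use Suc in auto)
qed

lemma Ck_on_bilinear:
  assumes "bounded_bilinear h" "open M"
  shows "Ck_on k M f \<Longrightarrow> Ck_on k M g \<Longrightarrow> Ck_on k M (\<lambda>p. h (f p) (g p))"
proof (induction k arbitrary: f g)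
  case 0
  then show ?case using assms(1) by (simp add: bounded_bilinear.continuous_on)
next
  case (Suc k)
  have "Ck_on k M f" "Ck_on k M g" using Suc.prems Ck_on_SucD by blast+
  then show ?case
    by (intro Ck_on_SucI[where f'="\<lambda>p v. h (f p) (dird g p v) + h (dird f p v) (g p)"])
      (use assms Suc in \<open>auto intro!: bounded_bilinear.FDERIV[OF assms(1)] has_derivative_dird Ck_on_add\<close>)
qed

lemma Ck_on_sum:
  assumes "open M" "\<And>i. i \<in> I \<Longrightarrow> Ck_on k M (f i)"
  shows "Ck_on k M (\<lambda>p. \<Sum>i\<in>I. f i p)"
  using assms(2)
  by (induction I rule: infinite_finite_induct) (auto intro: Ck_on_const Ck_on_add assms(1))

lemma Ck_on_compose:
  fixes f :: "'a::real_normed_vector \<Rightarrow> 'b::euclidean_space" and g :: "'b \<Rightarrow> 'c::real_normed_vector"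
  assumes "open M" "f ` M \<subseteq> N"
  shows "Ck_on k M f \<Longrightarrow> Ck_on k N g \<Longrightarrow> Ck_on k M (\<lambda>p. g (f p))"
proof (induction k arbitrary: g)
  case 0
  then show ?case using assms(2) by (simp add: continuous_on_compose2)
next
  case (Suc k)
  \<comment> \<open>\<open>Ck_on\<close> only knows derivatives in constant directions, whereas the
    chain rule differentiates \<open>g\<close> in the direction \<open>dird f p v\<close>, which
    moves with \<open>p\<close>. Expanding it in the basis restores constant directions.\<close>
  let ?f' = "\<lambda>p v. \<Sum>b\<in>Basis. (dird f p v \<bullet> b) *\<^sub>R dird g (f p) b"
  show ?case
  proof (rule Ck_on_SucI[where f'="?f'"])
    show "open M" by fact
  next
    fix p assume p: "p \<in> M"
    have df: "(f has_derivative dird f p) (at p)" using Suc.prems(1) p by (simp add: has_derivative_dird)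
    have dg: "(g has_derivative dird g (f p)) (at (f p))"
      using Suc.prems(2) p assms(2) by (simp add: has_derivative_dird image_subset_iff)
    have lin: "linear (dird g (f p))" using dg has_derivative_linear by blast
    have rep: "dird g (f p) w = (\<Sum>b\<in>Basis. (w \<bullet> b) *\<^sub>R dird g (f p) b)" for w
      using arg_cong[OF euclidean_representation[of w], of "dird g (f p)"] lin
      by (simp add: linear_sum linear_scale o_def)
    have "(\<lambda>v. dird g (f p) (dird f p v)) = ?f' p"
      by (rule ext, rule rep)
    then show "((\<lambda>p. g (f p)) has_derivative ?f' p) (at p)"
      using has_derivative_compose[OF df dg] by (simp only:)
  next
    fix v
    have "Ck_on k M (\<lambda>p. dird g (f p) b)" for b
      using Suc.prems by (intro Suc.IH Ck_on_SucD[OF Suc.prems(1)]) auto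
    moreover have "Ck_on k M (\<lambda>p. dird f p v \<bullet> b)" for b
      using Suc.prems by (intro Ck_on_compose_linear[OF bounded_linear_inner_left assms(1)]) auto
    ultimately show "Ck_on k M (\<lambda>p. ?f' p v)"
      by (intro Ck_on_sum[OF assms(1)] Ck_on_bilinear[OF bounded_bilinear_scaleR assms(1)]) auto
  qed
qed

lemma Ck_on_subset: "Ck_on k N f \<Longrightarrow> M \<subseteq> N \<Longrightarrow> Ck_on k M f"
  by (induction k arbitrary: f) (auto intro: continuous_on_subset)

text \<open>The derivative of the inverse is a polynomial in the inverse itself, so the induction
  hypothesis covers it.\<close>

lemma Ck_on_inverse:
  "Ck_on k {x::'a::real_normed_field. x \<noteq> 0} inverse"
proof (induction k)
  case 0
  show ?case by (auto intro!: continuous_intros)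
next
  case (Suc k)
  have o: "open {x::'a. x \<noteq> 0}" by (simp add: open_Collect_neq)
  show ?case
  proof (rule Ck_on_SucI[OF o])
    show "(inverse has_derivative (\<lambda>h. - (inverse x * h * inverse x))) (at x)"
      if "x \<in> {x. x \<noteq> 0}" for x :: 'a
      using that has_derivative_inverse'[of x UNIV] by simp
    fix v :: 'a
    show "Ck_on k {x. x \<noteq> 0} (\<lambda>x. - (inverse x * v * inverse x))"
      by (intro Ck_on_compose_linear[OF bounded_linear_minus[OF bounded_linear_ident] o]
          Ck_on_bilinear[OF bounded_bilinear_mult o] Ck_on_const[OF o] Suc)
  qed
qed

lemma Ck_on_sqrt: "Ck_on k {0<..} sqrt"
proof (induction k)
  case 0
  show ?case by (auto intro!: continuous_intros)
next
  case (Suc k)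
  have o: "open {0::real<..}" by simp
  show ?case
  proof (rule Ck_on_SucI[OF o])
    show "(sqrt has_derivative (\<lambda>h. inverse (sqrt x) * (h / 2))) (at x)"
      if "x \<in> {0<..}" for x
      using that by (auto intro!: derivative_eq_intros simp: field_simps)
    fix v :: real
    have "Ck_on k {0<..} (\<lambda>x. inverse (sqrt x))"
      by (rule Ck_on_compose[OF o _ Suc Ck_on_inverse]) auto
    then show "Ck_on k {0<..} (\<lambda>x. inverse (sqrt x) * (v / 2))"
      by (intro Ck_on_bilinear[OF bounded_bilinear_mult o] Ck_on_const[OF o])
  qed
qed

section \<open>Closure properties of smooth maps\<close>

named_theorems smooth_intros

lemma smooth_on_cong:
  "open M \<Longrightarrow> (\<And>p. p \<in> M \<Longrightarrow> f p = g p) \<Longrightarrow> smooth_on M f \<longleftrightarrow> smooth_on M g"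
  unfolding smooth_on_def using Ck_on_cong by blast

lemma smooth_on_subset: "smooth_on N f \<Longrightarrow> M \<subseteq> N \<Longrightarrow> smooth_on M f"
  unfolding smooth_on_def using Ck_on_subset by blast

lemma smooth_on_differentiable: "smooth_on M f \<Longrightarrow> p \<in> M \<Longrightarrow> f differentiable (at p)"
  unfolding smooth_on_def by (metis Ck_on.simps(2))

lemma smooth_on_has_derivative:
  "smooth_on M f \<Longrightarrow> p \<in> M \<Longrightarrow> (f has_derivative dird f p) (at p)"
  using smooth_on_differentiable has_derivative_dird by blast

lemma smooth_on_linear_dird: "smooth_on M f \<Longrightarrow> p \<in> M \<Longrightarrow> linear (dird f p)"
  using smooth_on_differentiable linear_dird by blast

lemma smooth_on_dird: "smooth_on M f \<Longrightarrow> smooth_on M (\<lambda>p. dird f p v)"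
  unfolding smooth_on_def using Ck_on_deriv by blast

lemma smooth_on_const [smooth_intros]: "open M \<Longrightarrow> smooth_on M (\<lambda>_. c)"
  by (simp add: smooth_on_def Ck_on_const)

lemma smooth_on_linear: "open M \<Longrightarrow> bounded_linear h \<Longrightarrow> smooth_on M h"
  by (simp add: smooth_on_def Ck_on_linear)

lemma smooth_on_id [smooth_intros]: "open M \<Longrightarrow> smooth_on M (\<lambda>x. x)"
  by (simp add: smooth_on_linear)

lemma smooth_on_compose_linear:
  "bounded_linear h \<Longrightarrow> open M \<Longrightarrow> smooth_on M f \<Longrightarrow> smooth_on M (\<lambda>p. h (f p))"
  by (simp add: smooth_on_def Ck_on_compose_linear)

lemma smooth_on_add [smooth_intros]:
  "open M \<Longrightarrow> smooth_on M f \<Longrightarrow> smooth_on M g \<Longrightarrow> smooth_on M (\<lambda>p. f p + g p)"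
  by (simp add: smooth_on_def Ck_on_add)

lemma smooth_on_minus [smooth_intros]:
  "open M \<Longrightarrow> smooth_on M f \<Longrightarrow> smooth_on M (\<lambda>p. - f p)"
  by (rule smooth_on_compose_linear[OF bounded_linear_minus[OF bounded_linear_ident]])

lemma smooth_on_diff [smooth_intros]:
  "open M \<Longrightarrow> smooth_on M f \<Longrightarrow> smooth_on M g \<Longrightarrow> smooth_on M (\<lambda>p. f p - g p)"
  using smooth_on_add[of M f "\<lambda>p. - g p"] smooth_on_minus[of M g] by simp

lemma smooth_on_bilinear:
  "bounded_bilinear h \<Longrightarrow> open M \<Longrightarrow> smooth_on M f \<Longrightarrow> smooth_on M g \<Longrightarrow> smooth_on M (\<lambda>p. h (f p) (g p))"
  by (simp add: smooth_on_def Ck_on_bilinear)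

lemmas smooth_on_mult [smooth_intros] = smooth_on_bilinear[OF bounded_bilinear_mult]
  and smooth_on_scaleR [smooth_intros] = smooth_on_bilinear[OF bounded_bilinear_scaleR]
  and smooth_on_inner [smooth_intros] = smooth_on_bilinear[OF bounded_bilinear_inner]

lemmas smooth_on_of_real [smooth_intros] = smooth_on_compose_linear[OF bounded_linear_of_real]
  and smooth_on_Re [smooth_intros] = smooth_on_compose_linear[OF bounded_linear_Re]
  and smooth_on_Im [smooth_intros] = smooth_on_compose_linear[OF bounded_linear_Im]
  and smooth_on_cnj [smooth_intros] = smooth_on_compose_linear[OF bounded_linear_cnj]
  and smooth_on_fst [smooth_intros] = smooth_on_compose_linear[OF bounded_linear_fst]
  and smooth_on_snd [smooth_intros] = smooth_on_compose_linear[OF bounded_linear_snd]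
  and smooth_on_nth [smooth_intros] = smooth_on_compose_linear[OF bounded_linear_vec_nth]

lemma smooth_on_sum [smooth_intros]:
  "open M \<Longrightarrow> (\<And>i. i \<in> I \<Longrightarrow> smooth_on M (f i)) \<Longrightarrow> smooth_on M (\<lambda>p. \<Sum>i\<in>I. f i p)"
  by (simp add: smooth_on_def Ck_on_sum)

lemma smooth_on_prod [smooth_intros]:
  fixes f :: "'i \<Rightarrow> 'a::real_normed_vector \<Rightarrow> 'b::{real_normed_algebra,comm_ring_1}"
  assumes "open M" "\<And>i. i \<in> I \<Longrightarrow> smooth_on M (f i)"
  shows "smooth_on M (\<lambda>p. \<Prod>i\<in>I. f i p)"
  using assms(2)
  by (induction I rule: infinite_finite_induct) (auto intro: smooth_intros assms(1))

lemma smooth_on_power [smooth_intros]: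
  fixes f :: "'a::real_normed_vector \<Rightarrow> 'b::real_normed_algebra_1"
  shows "open M \<Longrightarrow> smooth_on M f \<Longrightarrow> smooth_on M (\<lambda>p. f p ^ n)"
  by (induction n) (auto intro: smooth_intros)

lemma smooth_on_compose:
  fixes f :: "'a::real_normed_vector \<Rightarrow> 'b::euclidean_space"
  shows "open M \<Longrightarrow> f ` M \<subseteq> N \<Longrightarrow> smooth_on M f \<Longrightarrow> smooth_on N g \<Longrightarrow> smooth_on M (\<lambda>p. g (f p))"
  unfolding smooth_on_def using Ck_on_compose by blast

lemma smooth_on_inverse [smooth_intros]:
  fixes f :: "'a::real_normed_vector \<Rightarrow> 'b::{euclidean_space,real_normed_field}"
  shows "open M \<Longrightarrow> smooth_on M f \<Longrightarrow> (\<And>p. p \<in> M \<Longrightarrow> f p \<noteq> 0) \<Longrightarrow> smooth_on M (\<lambda>p. inverse (f p))"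
  by (rule smooth_on_compose[of M f "{x. x \<noteq> 0}"]) (auto simp: smooth_on_def Ck_on_inverse)

lemma smooth_on_divide [smooth_intros]:
  fixes f g :: "'a::real_normed_vector \<Rightarrow> 'b::{euclidean_space,real_normed_field}"
  shows "open M \<Longrightarrow> smooth_on M f \<Longrightarrow> smooth_on M g \<Longrightarrow> (\<And>p. p \<in> M \<Longrightarrow> g p \<noteq> 0) \<Longrightarrow> smooth_on M (\<lambda>p. f p / g p)"
  unfolding divide_inverse by (intro smooth_intros)

lemma smooth_on_sqrt [smooth_intros]:
  "open M \<Longrightarrow> smooth_on M f \<Longrightarrow> (\<And>p. p \<in> M \<Longrightarrow> f p > 0) \<Longrightarrow> smooth_on M (\<lambda>p. sqrt (f p))"
  by (rule smooth_on_compose[of M f "{0<..}"]) (auto simp: smooth_on_def Ck_on_sqrt)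

lemma smooth_on_norm [smooth_intros]:
  fixes f :: "'a::real_normed_vector \<Rightarrow> 'b::real_inner"
  shows "open M \<Longrightarrow> smooth_on M f \<Longrightarrow> (\<And>p. p \<in> M \<Longrightarrow> f p \<noteq> 0) \<Longrightarrow> smooth_on M (\<lambda>p. norm (f p))"
  unfolding norm_eq_sqrt_inner by (intro smooth_intros) auto

lemma smooth_on_euclidean:
  fixes f :: "'a::real_normed_vector \<Rightarrow> 'b::euclidean_space"
  assumes "open M" "\<And>b. b \<in> Basis \<Longrightarrow> smooth_on M (\<lambda>p. f p \<bullet> b)"
  shows "smooth_on M f"
proof -
  have "smooth_on M (\<lambda>p. \<Sum>b\<in>Basis. (f p \<bullet> b) *\<^sub>R b)"
    by (intro smooth_intros assms)
  then show ?thesis by (simp add: euclidean_representation)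
qed

lemma smooth_on_vec:
  fixes f :: "'a::real_normed_vector \<Rightarrow> 'b::euclidean_space^'n"
  assumes "open M" "\<And>i. smooth_on M (\<lambda>p. f p $ i)"
  shows "smooth_on M f"
proof (rule smooth_on_euclidean[OF assms(1)])
  fix b :: "'b^'n" assume "b \<in> Basis"
  then obtain i u where "b = axis i u" by (auto simp: Basis_vec_def)
  then show "smooth_on M (\<lambda>p. f p \<bullet> b)"
    using smooth_on_compose_linear[OF bounded_linear_inner_left assms(1) assms(2)[of i], of u] by (simp add: inner_axis)
qed

lemma smooth_on_Pair [smooth_intros]:
  fixes f :: "'a::real_normed_vector \<Rightarrow> 'b::euclidean_space" and g :: "'a \<Rightarrow> 'c::euclidean_space"
  assumes "open M" "smooth_on M f" "smooth_on M g"
  shows "smooth_on M (\<lambda>p. (f p, g p))"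
proof (rule smooth_on_euclidean[OF assms(1)])
  fix b :: "'b \<times> 'c"
  show "smooth_on M (\<lambda>p. (f p, g p) \<bullet> b)"
    by (cases b) (simp, intro smooth_intros assms)
qed

lemma smooth_on_dird_var [smooth_intros]:
  fixes f :: "'a::euclidean_space \<Rightarrow> 'b::real_normed_vector"
  assumes "open M" "smooth_on M f" "smooth_on M V"
  shows "smooth_on M (\<lambda>p. dird f p (V p))"
proof -
  have "dird f p (V p) = (\<Sum>b\<in>Basis. (V p \<bullet> b) *\<^sub>R dird f p b)" if "p \<in> M" for p
    using arg_cong[OF euclidean_representation[of "V p"], of "dird f p"]
      smooth_on_linear_dird[OF assms(2) that] by (simp add: linear_sum linear_scale o_def)
  moreover have "smooth_on M (\<lambda>p. \<Sum>b\<in>Basis. (V p \<bullet> b) *\<^sub>R dird f p b)"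
    by (intro smooth_intros assms smooth_on_dird)
  ultimately show ?thesis
    using smooth_on_cong[OF assms(1), of "\<lambda>p. dird f p (V p)"
        "\<lambda>p. \<Sum>b\<in>Basis. (V p \<bullet> b) *\<^sub>R dird f p b"] by simp
qed

subsection \<open>Symmetry of second derivatives\<close>

lemma mean_value_dird:
  fixes f :: "'a::real_normed_vector \<Rightarrow> real"
  assumes "h > 0" "\<And>s. 0 \<le> s \<Longrightarrow> s \<le> h \<Longrightarrow> f differentiable (at (p + s *\<^sub>R u))"
  shows "\<exists>s. 0 < s \<and> s < h \<and> f (p + h *\<^sub>R u) - f p = h * dird f (p + s *\<^sub>R u) u"
proof -
  have "((\<lambda>s. f (p + s *\<^sub>R u)) has_derivative (\<lambda>t. t * dird f (p + s *\<^sub>R u) u)) (at s)"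
    if "0 \<le> s" "s \<le> h" for s
  proof -
    have d: "(f has_derivative dird f (p + s *\<^sub>R u)) (at (p + s *\<^sub>R u))"
      using assms(2)[OF that] has_derivative_dird by blast
    have "((\<lambda>s. p + s *\<^sub>R u) has_derivative (\<lambda>t. t *\<^sub>R u)) (at s)"
      by (auto intro!: derivative_eq_intros)
    from has_derivative_compose[OF this d]
    have "((\<lambda>s. f (p + s *\<^sub>R u)) has_derivative (\<lambda>t. dird f (p + s *\<^sub>R u) (t *\<^sub>R u))) (at s)" .
    then show ?thesis using linear_scale[OF has_derivative_linear[OF d]] by simp
  qed
  then have "\<exists>s\<in>{0<..<h}. f (p + h *\<^sub>R u) - f (p + 0 *\<^sub>R u) = (h - 0) * dird f (p + s *\<^sub>R u) u"
    using mvt_simple[OF assms(1), where f="\<lambda>s. f (p + s *\<^sub>R u)" and f'="\<lambda>s t. t * dird f (p + s *\<^sub>R u) u"]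
    by (auto intro: has_derivative_at_withinI)
  then show ?thesis by auto
qed

text \<open>The mean value theorem is applied to the difference of \<open>f\<close> at points
  shifted by \<open>h v\<close>, along \<open>u\<close>, and then to the derivative of
  \<open>f\<close> in direction \<open>u\<close>, along \<open>v\<close>. The left side is symmetric
  in \<open>u\<close> and \<open>v\<close>, which is what makes mixed derivatives commute.\<close>

lemma second_difference:
  fixes f :: "'a::real_normed_vector \<Rightarrow> real"
  assumes "open M" "Ck_on 2 M f" "h > 0"
    and "\<And>s t. 0 \<le> s \<Longrightarrow> s \<le> h \<Longrightarrow> 0 \<le> t \<Longrightarrow> t \<le> h \<Longrightarrow> p + s *\<^sub>R u + t *\<^sub>R v \<in> M"
  shows "\<exists>s t. 0 < s \<and> s < h \<and> 0 < t \<and> t < h \<and>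
    f (p + h *\<^sub>R u + h *\<^sub>R v) - f (p + h *\<^sub>R u) - f (p + h *\<^sub>R v) + f p
      = h\<^sup>2 * dird (\<lambda>q. dird f q u) (p + s *\<^sub>R u + t *\<^sub>R v) v"
proof -
  define g where "g q = f (q + h *\<^sub>R v) - f q" for q
  have fd: "f differentiable (at q)" if "q \<in> M" for q using assms(2) that by (simp add: numeral_2_eq_2)
  have fd2: "(\<lambda>q. dird f q u) differentiable (at q)" if "q \<in> M" for q
    using assms(2) that by (simp add: numeral_2_eq_2)
  have in1: "p + s *\<^sub>R u \<in> M" "p + s *\<^sub>R u + h *\<^sub>R v \<in> M" if "0 \<le> s" "s \<le> h" for s
    using assms(3) assms(4)[of s 0] assms(4)[of s h] that by auto
  have shift: "((\<lambda>q. q + h *\<^sub>R v) has_derivative (\<lambda>t. t)) (at q)" for q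
    by (auto intro!: derivative_eq_intros)
  have gd: "(g has_derivative (\<lambda>w. dird f (q + h *\<^sub>R v) w - dird f q w)) (at q)"
    if "q \<in> M" "q + h *\<^sub>R v \<in> M" for q
    unfolding g_def
    using has_derivative_diff[OF has_derivative_compose[OF shift has_derivative_dird[OF fd[OF that(2)]]]
        has_derivative_dird[OF fd[OF that(1)]]] .
  obtain s where s: "0 < s" "s < h" "g (p + h *\<^sub>R u) - g p = h * dird g (p + s *\<^sub>R u) u"
    using mean_value_dird[OF assms(3), where f=g and p=p and u=u] gd in1 unfolding differentiable_def by blast
  have "dird g (p + s *\<^sub>R u) u = dird f (p + s *\<^sub>R u + h *\<^sub>R v) u - dird f (p + s *\<^sub>R u) u"
    using dird_eq[OF gd[of "p + s *\<^sub>R u"]] in1[of s] s by simp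
  moreover obtain t where t: "0 < t" "t < h"
    "dird f (p + s *\<^sub>R u + h *\<^sub>R v) u - dird f (p + s *\<^sub>R u) u
      = h * dird (\<lambda>q. dird f q u) (p + s *\<^sub>R u + t *\<^sub>R v) v"
    using mean_value_dird[OF assms(3), where f="\<lambda>q. dird f q u" and p="p + s *\<^sub>R u" and u=v] assms(4)[of s] fd2 s by force
  ultimately show ?thesis
    using s t by (intro exI[of _ s] exI[of _ t]) (simp add: g_def power2_eq_square algebra_simps)
qed

text \<open>If the mixed derivatives differed at \<open>p\<close>, continuity would keep them apart
  near \<open>p\<close>. But the second difference over a small parallelogram is h^2 times a value
  of each of them at a point of that parallelogram.\<close>

lemma dird_commute_real:
  fixes f :: "'a::real_normed_vector \<Rightarrow> real"
  assumes "open M" "Ck_on 2 M f" "p \<in> M"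
  shows "dird (\<lambda>q. dird f q u) p v = dird (\<lambda>q. dird f q v) p u"
proof (rule ccontr)
  define a where "a q = dird (\<lambda>q. dird f q u) q v" for q
  define b where "b q = dird (\<lambda>q. dird f q v) q u" for q
  assume "\<not> ?thesis"
  then have e: "\<bar>a p - b p\<bar> / 2 > 0" (is "?e > 0") by (simp add: a_def b_def)
  have "continuous_on M a" "continuous_on M b"
    using assms(2) by (simp_all add: numeral_2_eq_2 a_def[abs_def] b_def[abs_def])
  then have "isCont a p" "isCont b p"
    using assms(1,3) continuous_on_eq_continuous_at by blast+
  then obtain d1 d2 where d: "d1 > 0" "\<And>q. dist q p < d1 \<Longrightarrow> dist (a q) (a p) < ?e"
    "d2 > 0" "\<And>q. dist q p < d2 \<Longrightarrow> dist (b q) (b p) < ?e"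
    using e unfolding continuous_at_eps_delta by metis
  obtain d3 where d3: "d3 > 0" "ball p d3 \<subseteq> M" using assms(1,3) open_contains_ball by blast
  define d where "d = min d1 (min d2 d3)"
  have dpos: "d > 0" using d(1,3) d3(1) by (simp add: d_def)
  \<comment> \<open>The denominator keeps the parallelogram spanned by \<open>h u\<close> and
    \<open>h v\<close> within distance \<open>d\<close> of \<open>p\<close>; the added 1 covers the
    case that \<open>u\<close> and \<open>v\<close> vanish.\<close>
  define h where "h = d / (2 * (norm u + norm v + 1))"
  have h: "h > 0" using dpos by (simp add: h_def add_nonneg_pos)
  have near: "dist (p + s *\<^sub>R u + t *\<^sub>R v) p < d" if "0 \<le> s" "s \<le> h" "0 \<le> t" "t \<le> h" for s t
  proof -
    have "dist (p + s *\<^sub>R u + t *\<^sub>R v) p = norm (s *\<^sub>R u + t *\<^sub>R v)"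
      by (simp add: dist_norm)
    also have "\<dots> \<le> s * norm u + t * norm v"
      using norm_triangle_ineq[of "s *\<^sub>R u" "t *\<^sub>R v"] that by simp
    also have "\<dots> \<le> h * norm u + h * norm v"
      using that by (intro add_mono mult_right_mono) auto
    also have "\<dots> < h * (2 * (norm u + norm v + 1))"
      using h by (simp add: algebra_simps add_nonneg_pos)
    also have "\<dots> = d"
    proof -
      have "2 * (norm u + norm v + 1) > 0" by (smt (verit) norm_ge_zero)
      then show ?thesis by (simp add: h_def)
    qed
    finally show ?thesis .
  qed
  then have inM: "p + s *\<^sub>R u + t *\<^sub>R v \<in> M" if "0 \<le> s" "s \<le> h" "0 \<le> t" "t \<le> h" for s t
    using that d3(2) by (auto simp: d_def mem_ball dist_commute)
  then have inM': "p + s *\<^sub>R v + t *\<^sub>R u \<in> M" if "0 \<le> s" "s \<le> h" "0 \<le> t" "t \<le> h" for s t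
    using that by (metis add.assoc add.commute)
  obtain s t where st: "0 < s" "s < h" "0 < t" "t < h"
    "f (p + h *\<^sub>R u + h *\<^sub>R v) - f (p + h *\<^sub>R u) - f (p + h *\<^sub>R v) + f p = h\<^sup>2 * a (p + s *\<^sub>R u + t *\<^sub>R v)"
    using second_difference[OF assms(1,2) h inM] unfolding a_def by blast
  obtain s' t' where st': "0 < s'" "s' < h" "0 < t'" "t' < h"
    "f (p + h *\<^sub>R v + h *\<^sub>R u) - f (p + h *\<^sub>R v) - f (p + h *\<^sub>R u) + f p = h\<^sup>2 * b (p + s' *\<^sub>R v + t' *\<^sub>R u)"
    using second_difference[OF assms(1,2) h inM'] unfolding b_def by blast
  have "f (p + h *\<^sub>R v + h *\<^sub>R u) = f (p + h *\<^sub>R u + h *\<^sub>R v)" by (simp add: ac_simps)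
  then have "h\<^sup>2 * a (p + s *\<^sub>R u + t *\<^sub>R v) = h\<^sup>2 * b (p + s' *\<^sub>R v + t' *\<^sub>R u)"
    using st(5) st'(5) by linarith
  then have "a (p + s *\<^sub>R u + t *\<^sub>R v) = b (p + s' *\<^sub>R v + t' *\<^sub>R u)" using h by simp
  moreover have "dist (a (p + s *\<^sub>R u + t *\<^sub>R v)) (a p) < ?e"
    using near[of s t] st by (intro d(2)) (auto simp: d_def)
  moreover have "dist (p + s' *\<^sub>R v + t' *\<^sub>R u) p < d"
    using near[of t' s'] st' by (simp add: algebra_simps)
  then have "dist (b (p + s' *\<^sub>R v + t' *\<^sub>R u)) (b p) < ?e"
    by (intro d(4)) (auto simp: d_def)
  ultimately show False by (simp add: dist_real_def abs_if split: if_splits)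
qed

lemma dird_bounded_linear:
  assumes "bounded_linear h" "f differentiable (at p)"
  shows "dird (\<lambda>q. h (f q)) p v = h (dird f p v)"
  by (rule dird_eq) (use bounded_linear.has_derivative[OF assms(1) has_derivative_dird[OF assms(2)]] in simp)

lemma dird_commute:
  fixes f :: "'a::real_normed_vector \<Rightarrow> 'b::euclidean_space"
  assumes "open M" "smooth_on M f" "p \<in> M"
  shows "dird (\<lambda>q. dird f q u) p v = dird (\<lambda>q. dird f q v) p u"
proof (rule euclidean_eqI)
  fix b :: 'b
  have D: "dird (\<lambda>q. dird f q u) p v \<bullet> b = dird (\<lambda>q. dird (\<lambda>q. f q \<bullet> b) q u) p v" for u v
  proof -
    have "dird (\<lambda>q. dird (\<lambda>q. f q \<bullet> b) q u) p v = dird (\<lambda>q. dird f q u \<bullet> b) p v"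
      by (rule dird_cong_open[OF assms(1,3)])
        (simp add: dird_bounded_linear[OF bounded_linear_inner_left] smooth_on_differentiable[OF assms(2)])
    also have "\<dots> = dird (\<lambda>q. dird f q u) p v \<bullet> b"
      by (rule dird_bounded_linear[OF bounded_linear_inner_left])
        (use smooth_on_differentiable smooth_on_dird assms in blast)
    finally show ?thesis by simp
  qed
  have "smooth_on M (\<lambda>q. f q \<bullet> b)"
    by (intro smooth_on_compose_linear[OF bounded_linear_inner_left] assms)
  then show "dird (\<lambda>q. dird f q u) p v \<bullet> b = dird (\<lambda>q. dird f q v) p u \<bullet> b"
    unfolding D using dird_commute_real[OF assms(1) _ assms(3)] unfolding smooth_on_def by blast
qed

subsection \<open>Holomorphic functions of several variables\<close>

lemma holomorphic_vec_on_has_derivative: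
  assumes "holomorphic_vec_on F D" "X \<in> D"
  shows "(F has_derivative (\<lambda>v. \<Sum>A\<in>UNIV. F1 F A X * v $ A)) (at X)"
proof -
  obtain F' where F': "(F has_derivative F') (at X)" "\<And>c v. F' (c *s v) = c * F' v"
    using assms unfolding holomorphic_vec_on_def by blast
  have "F' v = (\<Sum>A\<in>UNIV. F1 F A X * v $ A)" for v
  proof -
    have "F' v = F' (\<Sum>A\<in>UNIV. v $ A *s axis A 1)" by (simp add: basis_expansion)
    also have "\<dots> = (\<Sum>A\<in>UNIV. F' (v $ A *s axis A 1))"
      using has_derivative_linear[OF F'(1)] by (simp add: linear_sum o_def)
    finally show ?thesis by (simp add: F'(2) F1_def dird_eq[OF F'(1)] mult.commute)
  qed
  then have "F' = (\<lambda>v. \<Sum>A\<in>UNIV. F1 F A X * v $ A)" by (rule ext)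
  then show ?thesis using F'(1) by simp
qed

lemma holomorphic_vec_on_continuous:
  "holomorphic_vec_on F D \<Longrightarrow> continuous_on D F"
  by (meson continuous_at_imp_continuous_on has_derivative_continuous holomorphic_vec_on_has_derivative)

lemma smult_axis: "z *s axis A 1 = (axis A z :: complex^'n)"
  by (simp add: vec_eq_iff axis_def)

lemma bounded_linear_axis: "bounded_linear (axis A :: complex \<Rightarrow> complex^'n)"
proof (intro bounded_linear_intro[where K=1])
  show "norm (axis A x :: complex^'n) \<le> norm x * 1" for x
    by (simp add: norm_eq_sqrt_inner inner_axis_axis)
qed (auto simp: vec_eq_iff axis_def)

lemma holomorphic_vec_on_line:
  assumes "holomorphic_vec_on F D" "X + z *s axis A 1 \<in> D"
  shows "((\<lambda>w. F (X + w *s axis A 1)) has_field_derivative F1 F A (X + z *s axis A 1)) (at z)"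
proof -
  have "((\<lambda>w. X + w *s axis A 1) has_derivative (\<lambda>h. h *s axis A 1)) (at z)"
    unfolding smult_axis
    by (auto intro!: derivative_eq_intros bounded_linear_imp_has_derivative bounded_linear_axis)
  from has_derivative_compose[OF this holomorphic_vec_on_has_derivative[OF assms]]
  have "((\<lambda>w. F (X + w *s axis A 1)) has_derivative
     (\<lambda>h. \<Sum>B\<in>UNIV. F1 F B (X + z *s axis A 1) * (h *s axis A 1) $ B)) (at z)" .
  moreover have "(\<Sum>B\<in>UNIV. F1 F B (X + z *s axis A 1) * (h *s axis A 1) $ B)
      = F1 F A (X + z *s axis A 1) * h" for h
  proof -
    have "F1 F B (X + z *s axis A 1) * (h *s axis A 1) $ B
        = (if B = A then F1 F A (X + z *s axis A 1) * h else 0)" for B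
      by (auto simp: axis_def)
    then show ?thesis by (simp add: sum.delta)
  qed
  ultimately show ?thesis by (simp add: has_field_derivative_def)
qed

text \<open>Cauchy's formula for the first derivative on a circle in the complex line through
  \<open>X\<close> in direction \<open>A\<close>, written over the unit interval. It expresses a
  derivative of \<open>F\<close> through values of \<open>F\<close>, so that \<open>F1\<close> can
  be differentiated under the integral sign.\<close>

lemma F1_integral:
  assumes "holomorphic_vec_on F D" "\<delta> > 0" "\<And>z. cmod z \<le> \<delta> \<Longrightarrow> X + z *s axis A 1 \<in> D"
  shows "F1 F A X = integral (cbox 0 1)
    (\<lambda>t::real. F (X + (of_real \<delta> * exp (2 * of_real pi * \<i> * of_real t)) *s axis A 1)
       * exp (- (2 * of_real pi * \<i> * of_real t)) / of_real \<delta>)"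
proof -
  define f where "f w = F (X + w *s axis A 1)" for w
  have df: "(f has_field_derivative F1 F A (X + z *s axis A 1)) (at z)" if "cmod z \<le> \<delta>" for z
    unfolding f_def by (rule holomorphic_vec_on_line[OF assms(1) assms(3)[OF that]])
  have hol: "f holomorphic_on ball 0 \<delta>"
    using df unfolding holomorphic_on_def field_differentiable_def
    by (metis has_field_derivative_at_within less_imp_le mem_ball_0)
  have cont: "continuous_on (cball 0 \<delta>) f"
    by (intro continuous_at_imp_continuous_on ballI DERIV_isCont[OF df]) simp
  have 0: "(0::complex) \<in> ball 0 \<delta>" using assms(2) by simp
  note C = Cauchy_derivative_integral_circlepath[OF cont hol 0]
  have "((\<lambda>u. f u / (u - 0)^2) has_contour_integral contour_integral (circlepath 0 \<delta>) (\<lambda>u. f u / (u - 0)^2)) (circlepath 0 \<delta>)"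
    using C(1) has_contour_integral_integral by blast
  then have "((\<lambda>t. f (circlepath 0 \<delta> t) / (circlepath 0 \<delta> t)^2 * vector_derivative (circlepath 0 \<delta>) (at t))
      has_integral contour_integral (circlepath 0 \<delta>) (\<lambda>u. f u / u^2)) {0..1}"
    unfolding has_contour_integral by simp
  then have "integral {0..1} (\<lambda>t. f (circlepath 0 \<delta> t) / (circlepath 0 \<delta> t)^2 * vector_derivative (circlepath 0 \<delta>) (at t))
     = contour_integral (circlepath 0 \<delta>) (\<lambda>u. f u / u^2)"
    by (rule integral_unique)
  moreover have "f (circlepath 0 \<delta> t) / (circlepath 0 \<delta> t)^2 * vector_derivative (circlepath 0 \<delta>) (at t)
     = (2 * of_real pi * \<i>) * (F (X + (of_real \<delta> * exp (2 * of_real pi * \<i> * of_real t)) *s axis A 1)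
       * exp (- (2 * of_real pi * \<i> * of_real t)) / of_real \<delta>)" for t
  proof -
    have vd: "vector_derivative (circlepath 0 \<delta>) (at t) = 2 * of_real pi * \<i> * of_real \<delta> * exp (2 * of_real pi * \<i> * of_real t)"
      by (simp add: vector_derivative_circlepath)
    have cp: "circlepath 0 \<delta> t = of_real \<delta> * exp (2 * of_real pi * \<i> * of_real t)"
      by (simp add: circlepath)
    show ?thesis unfolding vd cp f_def using assms(2)
      by (simp add: exp_minus field_simps power2_eq_square)
  qed
  ultimately have I: "contour_integral (circlepath 0 \<delta>) (\<lambda>u. f u / u^2)
     = (2 * of_real pi * \<i>) * integral {0..1}
      (\<lambda>t::real. F (X + (of_real \<delta> * exp (2 * of_real pi * \<i> * of_real t)) *s axis A 1)
       * exp (- (2 * of_real pi * \<i> * of_real t)) / of_real \<delta>)"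
    by (simp only: integral_mult_right)
  have "F1 F A X = 1 / (2 * of_real pi * \<i>) * contour_integral (circlepath 0 \<delta>) (\<lambda>u. f u / u^2)"
    using DERIV_unique[OF df[of 0] C(2)] assms(2) by simp
  also have "\<dots> = integral {0..1}
      (\<lambda>t::real. F (X + (of_real \<delta> * exp (2 * of_real pi * \<i> * of_real t)) *s axis A 1)
       * exp (- (2 * of_real pi * \<i> * of_real t)) / of_real \<delta>)"
    unfolding I by simp
  finally show ?thesis by (simp add: cbox_interval)
qed

lemma smult_axis_norm: "norm (z *s axis A 1 :: complex^'n) = cmod z"
  unfolding smult_axis by (simp add: norm_eq_sqrt_inner inner_axis_axis)

text \<open>One radius has to serve all centres near \<open>X0\<close>, because the contour must
  stay fixed while the integral is differentiated in \<open>X\<close>.\<close>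

lemma polydisc_nhd:
  assumes "open D" "X0 \<in> (D :: (complex^'n) set)"
  obtains \<delta> where "\<delta> > 0" "ball X0 \<delta> \<subseteq> D"
    "\<And>X A z. X \<in> ball X0 \<delta> \<Longrightarrow> cmod z \<le> \<delta> \<Longrightarrow> X + z *s axis A 1 \<in> D"
proof -
  obtain e where e: "e > 0" "ball X0 e \<subseteq> D" using assms open_contains_ball by blast
  have "X + z *s axis A 1 \<in> D" if "X \<in> ball X0 (e/2)" "cmod z \<le> e/2" for X A z
  proof -
    have "dist X0 (X + z *s axis A 1) \<le> dist X0 X + norm (z *s axis A 1 :: complex^'n)"
      by (metis add_diff_cancel_left' dist_commute dist_norm dist_triangle2)
    then have "dist X0 (X + z *s axis A 1) < e" using that by (simp add: smult_axis_norm)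
    then show ?thesis using e(2) by auto
  qed
  moreover have "ball X0 (e/2) \<subseteq> D" using e by auto
  ultimately show ?thesis using that[of "e/2"] e(1) by simp
qed

lemma circle_param_continuous:
  assumes "continuous_on D f" "\<And>X z. X \<in> U \<Longrightarrow> cmod z \<le> \<delta> \<Longrightarrow> X + z *s axis A 1 \<in> D" "\<delta> > 0"
  shows "continuous_on (U \<times> cbox 0 1)
    (\<lambda>(X, t::real). f (X + (of_real \<delta> * exp (2 * of_real pi * \<i> * of_real t)) *s axis A 1)
       * exp (- (2 * of_real pi * \<i> * of_real t)) / of_real \<delta>)"
proof -
  have c: "continuous_on (U \<times> cbox 0 1)
    (\<lambda>p. fst p + axis A (of_real \<delta> * exp (2 * of_real pi * \<i> * of_real (snd p :: real))))"
    by (intro continuous_intros bounded_linear.continuous_on[OF bounded_linear_axis])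
  have "cmod (exp (2 * of_real pi * \<i> * of_real t)) = 1" for t
    using norm_exp_i_times[of "2 * pi * t"] by (simp add: mult_ac)
  then have "fst p + axis A (of_real \<delta> * exp (2 * of_real pi * \<i> * of_real (snd p :: real))) \<in> D"
    if "p \<in> U \<times> cbox 0 1" for p
    using that assms(2)[of "fst p" "of_real \<delta> * exp (2 * of_real pi * \<i> * of_real (snd p))"] assms(3)
    unfolding smult_axis by (auto simp: norm_mult)
  then have "continuous_on (U \<times> cbox 0 1)
    (\<lambda>p. f (fst p + axis A (of_real \<delta> * exp (2 * of_real pi * \<i> * of_real (snd p :: real)))))"
    by (intro continuous_on_compose2[OF assms(1) c]) auto
  then show ?thesis unfolding smult_axis case_prod_beta
    using assms(3) by (intro continuous_intros) auto
qed

text \<open>Continuity comes before differentiability: \<open>leibniz_rule\<close> asks for a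
  continuous derivative of the integrand, and that derivative is built from the functions
  \<open>F1 F B\<close>.\<close>

lemma F1_continuous:
  assumes "open D" "holomorphic_vec_on F D"
  shows "continuous_on D (F1 F A)"
proof (intro continuous_at_imp_continuous_on ballI)
  fix X0 assume "X0 \<in> D"
  then obtain \<delta> where d: "\<delta> > 0" "ball X0 \<delta> \<subseteq> D"
    "\<And>X A z. X \<in> ball X0 \<delta> \<Longrightarrow> cmod z \<le> \<delta> \<Longrightarrow> X + z *s axis A 1 \<in> D"
    using polydisc_nhd assms(1) by metis
  have F1: "F1 F A X = integral (cbox 0 1)
    (\<lambda>t::real. F (X + (of_real \<delta> * exp (2 * of_real pi * \<i> * of_real t)) *s axis A 1)
       * exp (- (2 * of_real pi * \<i> * of_real t)) / of_real \<delta>)" if "X \<in> ball X0 \<delta>" for X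
    by (rule F1_integral[OF assms(2) d(1) d(3)[OF that]])
  have "continuous_on (ball X0 \<delta>) (F1 F A)"
    using integral_continuous_on_param[OF circle_param_continuous[where U="ball X0 \<delta>" and A=A,
          OF holomorphic_vec_on_continuous[OF assms(2)] d(3) d(1)]]
    by (subst continuous_on_cong[OF refl F1])
  then show "isCont (F1 F A) X0" using d(1) continuous_on_eq_continuous_at[of "ball X0 \<delta>"]
    by (metis centre_in_ball open_ball)
qed

lemma continuous_on_slice:
  assumes "continuous_on (U \<times> T) g" "X \<in> U"
  shows "continuous_on T (\<lambda>t. g (X, t))"
proof (rule continuous_on_compose2[OF assms(1)])
  show "continuous_on T (Pair X)" by (intro continuous_intros)
qed (use assms(2) in auto)

lemma holomorphic_F1:
  assumes "open D" "holomorphic_vec_on F D"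
  shows "holomorphic_vec_on (F1 F A) D"
  unfolding holomorphic_vec_on_def
proof
  fix X0 assume "X0 \<in> D"
  then obtain \<delta> where d: "\<delta> > 0" "ball X0 \<delta> \<subseteq> D"
    "\<And>X A z. X \<in> ball X0 \<delta> \<Longrightarrow> cmod z \<le> \<delta> \<Longrightarrow> X + z *s axis A 1 \<in> D"
    using polydisc_nhd assms(1) by metis
  define w where "w t = (of_real \<delta> * exp (2 * of_real pi * \<i> * of_real t)) *s (axis A 1 :: complex^'a)" for t :: real
  define k where "k t = exp (- (2 * of_real pi * \<i> * of_real t)) / of_real \<delta>" for t :: real
  define P :: "'a \<Rightarrow> (complex^'a) \<Rightarrow>\<^sub>L complex" where "P B = Blinfun (\<lambda>v. v $ B)" for B
  have P: "blinfun_apply (P B) v = v $ B" for B v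
    unfolding P_def by (simp add: bounded_linear_Blinfun_apply bounded_linear_vec_nth)
  \<comment> \<open>The derivative of the integrand, packaged as a \<open>blinfun\<close> because
    differentiation under the integral sign integrates the derivative itself, as an element of a
    Banach space.\<close>
  define H where "H X t = (\<Sum>B\<in>UNIV. blinfun_mult_right (F1 F B (X + w t) * k t) o\<^sub>L P B)" for X t
  have H: "blinfun_apply (H X t) v = (\<Sum>B\<in>UNIV. F1 F B (X + w t) * k t * v $ B)" for X t v
    by (simp add: H_def blinfun.sum_left P)
  have inD: "X + w t \<in> D" if "X \<in> ball X0 \<delta>" for X t
  proof -
    have "cmod (exp (2 * of_real pi * \<i> * of_real t)) = 1"
      using norm_exp_i_times[of "2 * pi * t"] by (simp add: mult_ac)
    then show ?thesis unfolding w_def using d(1) by (intro d(3)[OF that]) (simp add: norm_mult)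
  qed
  have contF: "continuous_on (ball X0 \<delta> \<times> cbox 0 1) (\<lambda>(X, t). f (X + w t) * k t)"
    if "continuous_on D f" for f :: "complex^'a \<Rightarrow> complex"
    using circle_param_continuous[where U="ball X0 \<delta>" and A=A, OF that d(3) d(1)] unfolding w_def k_def by simp
  have contH: "continuous_on (ball X0 \<delta> \<times> cbox 0 1) (\<lambda>(X, t). H X t)"
  proof -
    have "bounded_linear (\<lambda>c. blinfun_mult_right c o\<^sub>L P B)" for B
      by (rule bounded_linear_compose[OF bounded_bilinear.bounded_linear_left[OF bounded_bilinear_blinfun_compose]
            bounded_linear_blinfun_mult_right])
    then show ?thesis
      unfolding H_def case_prod_beta
      by (intro continuous_on_sum) (rule bounded_linear.continuous_on, assumption,
          use contF[OF F1_continuous[OF assms]] in \<open>simp add: case_prod_beta\<close>)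
  qed
  have der: "((\<lambda>X. integral (cbox 0 1) (\<lambda>t. F (X + w t) * k t)) has_derivative
     integral (cbox 0 1) (H X0)) (at X0 within ball X0 \<delta>)"
  proof (rule leibniz_rule)
    fix X t assume X: "X \<in> ball X0 \<delta>" and "t \<in> cbox (0::real) 1"
    have "((\<lambda>X. X + w t) has_derivative (\<lambda>v. v)) (at X)" by (auto intro!: derivative_eq_intros)
    from has_derivative_compose[OF this holomorphic_vec_on_has_derivative[OF assms(2) inD[OF X, of t]]]
    have "((\<lambda>X. F (X + w t) * k t) has_derivative (\<lambda>v. (\<Sum>B\<in>UNIV. F1 F B (X + w t) * v $ B) * k t)) (at X)"
      by (rule has_derivative_mult_left)
    moreover have "(\<lambda>v. (\<Sum>B\<in>UNIV. F1 F B (X + w t) * v $ B) * k t) = blinfun_apply (H X t)"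
      by (rule ext) (simp add: H sum_distrib_left sum_distrib_right mult_ac)
    ultimately show "((\<lambda>X. F (X + w t) * k t) has_derivative blinfun_apply (H X t)) (at X within ball X0 \<delta>)"
      by (metis has_derivative_at_withinI)
  next
    fix X assume "X \<in> ball X0 \<delta>"
    then show "(\<lambda>t. F (X + w t) * k t) integrable_on cbox 0 1"
      using continuous_on_slice[OF contF[OF holomorphic_vec_on_continuous[OF assms(2)]]] by (intro integrable_continuous) simp
  qed (use d contH in auto)
  have "((F1 F A) has_derivative integral (cbox 0 1) (H X0)) (at X0)"
  proof -
    have "((F1 F A) has_derivative integral (cbox 0 1) (H X0)) (at X0 within ball X0 \<delta>)"
    proof (rule has_derivative_transform[OF _ _ der])
      show "F1 F A X = integral (cbox 0 1) (\<lambda>t. F (X + w t) * k t)" if "X \<in> ball X0 \<delta>" for X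
        using F1_integral[OF assms(2) d(1) d(3)[OF that], where A=A] by (simp add: w_def k_def)
    qed (use d(1) in simp)
    then show ?thesis using d(1) at_within_open[of X0 "ball X0 \<delta>"] by simp
  qed
  \<comment> \<open>Complex linearity passes from the integrand to the integral.\<close>
  moreover have "blinfun_apply (integral (cbox 0 1) (H X0)) (c *s v)
      = c * blinfun_apply (integral (cbox 0 1) (H X0)) v" for c v
  proof -
    have "continuous_on (cbox 0 1) (H X0)"
      using continuous_on_slice[OF contH, of X0] d(1) by simp
    then have int: "H X0 integrable_on cbox 0 1" by (rule integrable_continuous)
    have "blinfun_apply (H X0 t) (c *s v) = c * blinfun_apply (H X0 t) v" for t
      by (simp add: H sum_distrib_left mult_ac)
    then show ?thesis unfolding blinfun_apply_integral[OF int] by simp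
  qed
  ultimately show "\<exists>F'. (F1 F A has_derivative F') (at X0) \<and> (\<forall>c v. F' (c *s v) = c * F' v)"
    by blast
qed

lemma smooth_on_holomorphic:
  assumes "open D" "holomorphic_vec_on F D"
  shows "smooth_on D F"
proof -
  have "Ck_on k D F" for k
    using assms(2)
  proof (induction k arbitrary: F)
    case 0
    then show ?case by (simp add: holomorphic_vec_on_continuous)
  next
    case (Suc k)
    have "Ck_on k D (\<lambda>X. F1 F A X * v $ A)" for A and v :: "complex^'a"
      by (intro Ck_on_compose_linear[OF bounded_linear_mult_left assms(1)] Suc.IH
          holomorphic_F1 assms(1) Suc.prems)
    then show ?case
      by (intro Ck_on_SucI[OF assms(1) holomorphic_vec_on_has_derivative[OF Suc.prems]] Ck_on_sum assms(1))
  qed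
  then show ?thesis by (simp add: smooth_on_def)
qed

subsection \<open>Euler relations\<close>

text \<open>Differentiating the homogeneity relation in \<open>X\<close> lowers the degree by one.
  The factor \<open>c\<close> stays on the left, so that natural exponents suffice for every
  \<open>k\<close>.\<close>

lemma F1_homogeneous:
  assumes "open D" "holomorphic_vec_on G D" "X \<in> D" "c \<noteq> 0"
    and "\<And>X c. X \<in> D \<Longrightarrow> c \<noteq> 0 \<Longrightarrow> c *s X \<in> D"
    and "\<And>X c. X \<in> D \<Longrightarrow> c \<noteq> 0 \<Longrightarrow> G (c *s X) = c ^ k * G X"
  shows "c * F1 G A (c *s X) = c ^ k * F1 G A X"
proof -
  have bl: "bounded_linear (\<lambda>X::complex^'a. c *s X)"
    by (intro linear_linear[THEN iffD2] linearI) (auto simp: vec_eq_iff algebra_simps)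
  have "((\<lambda>X. G (c *s X)) has_derivative (\<lambda>v. \<Sum>A\<in>UNIV. F1 G A (c *s X) * (c *s v) $ A)) (at X)"
    by (rule has_derivative_compose[OF bounded_linear_imp_has_derivative[OF bl]
          holomorphic_vec_on_has_derivative[OF assms(2) assms(5)[OF assms(3,4)]]])
  then have "dird (\<lambda>X. G (c *s X)) X (axis A 1) = (\<Sum>B\<in>UNIV. F1 G B (c *s X) * (c *s axis A 1) $ B)"
    by (rule dird_eq)
  also have "\<dots> = (\<Sum>B\<in>UNIV. if B = A then c * F1 G A (c *s X) else 0)"
    by (rule sum.cong) (auto simp: axis_def)
  finally have 1: "dird (\<lambda>X. G (c *s X)) X (axis A 1) = c * F1 G A (c *s X)" by simp
  have "dird (\<lambda>X. G (c *s X)) X (axis A 1) = dird (\<lambda>X. c ^ k * G X) X (axis A 1)"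
    by (rule dird_cong_open[OF assms(1,3)]) (use assms(4,6) in auto)
  also have "\<dots> = c ^ k * F1 G A X"
    unfolding F1_def
    by (rule dird_bounded_linear[OF bounded_linear_mult_right])
      (use holomorphic_vec_on_has_derivative[OF assms(2,3)] in \<open>auto simp: differentiable_def\<close>)
  finally show ?thesis using 1 by simp
qed

lemma euler_relation:
  assumes "open D" "holomorphic_vec_on G D" "X \<in> D"
    and "\<And>X c. X \<in> D \<Longrightarrow> c \<noteq> 0 \<Longrightarrow> G (c *s X) = c ^ k * G X"
  shows "(\<Sum>A\<in>UNIV. F1 G A X * X $ A) = of_nat k * G X"
proof -
  have bl: "bounded_linear (\<lambda>c::complex. c *s X)"
    by (intro linear_linear[THEN iffD2] linearI) (auto simp: vec_eq_iff algebra_simps)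
  have "((\<lambda>c. G (c *s X)) has_derivative (\<lambda>v. \<Sum>A\<in>UNIV. F1 G A (1 *s X) * (v *s X) $ A)) (at 1)"
    by (rule has_derivative_compose[OF bounded_linear_imp_has_derivative[OF bl]
          holomorphic_vec_on_has_derivative[OF assms(2)]]) (use assms(3) in simp)
  from dird_eq[OF this, of 1] have "dird (\<lambda>c. G (c *s X)) 1 1 = (\<Sum>A\<in>UNIV. F1 G A X * X $ A)"
    by simp
  moreover have "dird (\<lambda>c. G (c *s X)) 1 1 = dird (\<lambda>c. c ^ k * G X) 1 1"
    by (rule dird_cong_open[of "- {0}"]) (use assms(3,4) in auto)
  moreover have "((\<lambda>c. c ^ k * G X) has_derivative (\<lambda>v. of_nat k * G X * v)) (at 1)"
    by (auto intro!: derivative_eq_intros)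
  from dird_eq[OF this, of 1] have "dird (\<lambda>c. c ^ k * G X) 1 1 = of_nat k * G X"
    by simp
  ultimately show ?thesis by simp
qed

subsection \<open>Levi-Civita connection and parallel complex structures\<close>

text \<open>The Leibniz rule for a field of linear maps applied to a field of vectors, as needed for
  the complex structures, the connection and the inverse Higgs field. Only evaluations at constant
  vectors are assumed differentiable, hence the expansion in the basis.\<close>

lemma dird_field_apply:
  fixes f :: "'e::real_normed_vector \<Rightarrow> 'a::euclidean_space \<Rightarrow> 'b::real_normed_vector"
  assumes "open M" "p \<in> M" "\<And>q. q \<in> M \<Longrightarrow> linear (f q)"
    and "\<And>z. (\<lambda>q. f q z) differentiable (at p)" "h differentiable (at p)"
  shows "dird (\<lambda>q. f q (h q)) p u = dird (\<lambda>q. f q (h p)) p u + f p (dird h p u)"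
    and "(\<lambda>q. f q (h q)) differentiable (at p)"
proof -
  have rep: "f q z = (\<Sum>b\<in>Basis. (z \<bullet> b) *\<^sub>R f q b)" if "q \<in> M" for q z
    using arg_cong[OF euclidean_representation[of z], of "f q"] assms(3)[OF that]
    by (simp add: linear_sum linear_scale)
  have dh: "((\<lambda>q. h q \<bullet> b) has_derivative (\<lambda>v. dird h p v \<bullet> b)) (at p)" for b
    by (rule has_derivative_inner_left[OF has_derivative_dird[OF assms(5)]])
  have df: "((\<lambda>q. f q z) has_derivative (\<lambda>v. dird (\<lambda>q. f q z) p v)) (at p)" for z
    using has_derivative_dird[OF assms(4)] .
  have 1: "((\<lambda>q. \<Sum>b\<in>Basis. (h q \<bullet> b) *\<^sub>R f q b) has_derivative
      (\<lambda>v. \<Sum>b\<in>Basis. (h p \<bullet> b) *\<^sub>R dird (\<lambda>q. f q b) p v + (dird h p v \<bullet> b) *\<^sub>R f p b)) (at p)"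
    by (intro has_derivative_sum has_derivative_scaleR dh df)
  have 2: "((\<lambda>q. f q (h q)) has_derivative
      (\<lambda>v. \<Sum>b\<in>Basis. (h p \<bullet> b) *\<^sub>R dird (\<lambda>q. f q b) p v + (dird h p v \<bullet> b) *\<^sub>R f p b)) (at p)"
    by (rule has_derivative_transform_within_open[OF 1 assms(1,2)]) (simp add: rep[symmetric])
  have "((\<lambda>q. \<Sum>b\<in>Basis. (h p \<bullet> b) *\<^sub>R f q b) has_derivative
      (\<lambda>v. \<Sum>b\<in>Basis. (h p \<bullet> b) *\<^sub>R dird (\<lambda>q. f q b) p v)) (at p)"
    by (intro has_derivative_sum has_derivative_scaleR_right df)
  then have 3: "((\<lambda>q. f q (h p)) has_derivative
      (\<lambda>v. \<Sum>b\<in>Basis. (h p \<bullet> b) *\<^sub>R dird (\<lambda>q. f q b) p v)) (at p)"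
    by (rule has_derivative_transform_within_open[OF _ assms(1,2)]) (simp add: rep[symmetric])
  show "dird (\<lambda>q. f q (h q)) p u = dird (\<lambda>q. f q (h p)) p u + f p (dird h p u)"
    unfolding dird_eq[OF 2] dird_eq[OF 3] rep[OF assms(2), of "dird h p u"] by (simp add: sum.distrib)
  show "(\<lambda>q. f q (h q)) differentiable (at p)" using 2 differentiableI by blast
qed

lemma linear_dird_param:
  fixes f :: "'e::real_normed_vector \<Rightarrow> 'a::real_vector \<Rightarrow> 'b::real_normed_vector"
  assumes "open M" "p \<in> M" "\<And>q. q \<in> M \<Longrightarrow> linear (f q)" "\<And>z. (\<lambda>q. f q z) differentiable (at p)"
  shows "linear (\<lambda>z. dird (\<lambda>q. f q z) p u)"
proof (rule linearI)
  fix a b r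
  have "dird (\<lambda>q. f q (a + b)) p u = dird (\<lambda>q. f q a + f q b) p u"
    by (rule dird_cong_open[OF assms(1,2)]) (use assms(3) linear_add in blast)
  also have "\<dots> = dird (\<lambda>q. f q a) p u + dird (\<lambda>q. f q b) p u"
    by (rule dird_eq[OF has_derivative_add[OF assms(4)[THEN has_derivative_dird] assms(4)[THEN has_derivative_dird]]])
  finally show "dird (\<lambda>q. f q (a + b)) p u = dird (\<lambda>q. f q a) p u + dird (\<lambda>q. f q b) p u" .
  have "dird (\<lambda>q. f q (r *\<^sub>R a)) p u = dird (\<lambda>q. r *\<^sub>R f q a) p u"
    by (rule dird_cong_open[OF assms(1,2)]) (use assms(3) linear_scale in blast)
  also have "\<dots> = r *\<^sub>R dird (\<lambda>q. f q a) p u"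
    by (rule dird_eq[OF has_derivative_scaleR_right[OF assms(4)[THEN has_derivative_dird]]])
  finally show "dird (\<lambda>q. f q (r *\<^sub>R a)) p u = r *\<^sub>R dird (\<lambda>q. f q a) p u" .
qed

lemma smooth_on_field_apply:
  fixes f :: "'e::real_normed_vector \<Rightarrow> 'a::euclidean_space \<Rightarrow> 'b::real_normed_vector"
  assumes "open M" "\<And>q. q \<in> M \<Longrightarrow> linear (f q)" "\<And>z. smooth_on M (\<lambda>q. f q z)" "smooth_on M h"
  shows "smooth_on M (\<lambda>q. f q (h q))"
proof -
  have "f q (h q) = (\<Sum>b\<in>Basis. (h q \<bullet> b) *\<^sub>R f q b)" if "q \<in> M" for q
    using arg_cong[OF euclidean_representation[of "h q"], of "f q"] assms(2)[OF that]
    by (simp add: linear_sum linear_scale)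
  moreover have "smooth_on M (\<lambda>q. \<Sum>b\<in>Basis. (h q \<bullet> b) *\<^sub>R f q b)"
    by (intro smooth_intros assms)
  ultimately show ?thesis
    using smooth_on_cong[OF assms(1), of "\<lambda>q. f q (h q)" "\<lambda>q. \<Sum>b\<in>Basis. (h q \<bullet> b) *\<^sub>R f q b"] by simp
qed

lemma bilinear_linear_right: "bilinear B \<Longrightarrow> linear (B x)"
  and bilinear_linear_left: "bilinear B \<Longrightarrow> linear (\<lambda>x. B x y)"
  unfolding bilinear_def by auto

lemma nondegenerate_representation:
  fixes B :: "'e::euclidean_space \<Rightarrow> 'e \<Rightarrow> real"
  assumes "bilinear B" "\<And>u. (\<And>v. B u v = 0) \<Longrightarrow> u = 0" "linear l"
  obtains w where "\<And>z. B w z = l z"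
proof -
  have riesz: "k z = (\<Sum>b\<in>Basis. k b *\<^sub>R b) \<bullet> z" if "linear k" for k :: "'e \<Rightarrow> real" and z
  proof -
    have "k z = k (\<Sum>b\<in>Basis. (z \<bullet> b) *\<^sub>R b)" by (simp add: euclidean_representation)
    also have "\<dots> = (\<Sum>b\<in>Basis. (z \<bullet> b) * k b)" using that by (simp add: linear_sum linear_scale)
    finally show ?thesis by (simp add: inner_sum_left inner_commute[of z] mult.commute)
  qed
  define f where "f w = (\<Sum>b\<in>Basis. B w b *\<^sub>R b)" for w
  have f: "B w z = f w \<bullet> z" for w z
    unfolding f_def by (rule riesz[OF bilinear_linear_right[OF assms(1)]])
  have "linear f"
    unfolding f_def using bilinear_linear_left[OF assms(1)]
    by (intro linear_compose_sum ballI linearI) (auto simp: linear_add[OF bilinear_linear_left[OF assms(1)]]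
        linear_scale[OF bilinear_linear_left[OF assms(1)]] scaleR_add_left)
  moreover have "inj f"
    by (subst linear_injective_0[OF \<open>linear f\<close>]) (use assms(2) f in auto)
  ultimately have "surj f" by (rule linear_injective_imp_surjective) simp
  then obtain w where "(\<Sum>b\<in>Basis. l b *\<^sub>R b) = f w" by (metis surj_def)
  then show ?thesis using that[of w] riesz[OF assms(3)] f[of w] by metis
qed

lemma pseudo_metricD:
  assumes "pseudo_metric_on M G" "p \<in> M"
  shows "bilinear (G p)" "G p u v = G p v u" "(\<And>v. G p u v = 0) \<Longrightarrow> u = 0"
    "(\<lambda>q. G q u v) differentiable (at p)"
proof -
  have *: "bilinear (G p) \<and> (\<forall>u v. G p u v = G p v u) \<and> (\<forall>u. (\<forall>v. G p u v = 0) \<longrightarrow> u = 0)"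
    using assms unfolding pseudo_metric_on_def by simp
  then show "bilinear (G p)" "G p u v = G p v u" by simp_all
  show "(\<And>v. G p u v = 0) \<Longrightarrow> u = 0" using * by simp
  have "smooth_on M (\<lambda>p. G p u v)" using assms unfolding pseudo_metric_on_def by simp
  then show "(\<lambda>q. G q u v) differentiable (at p)" using assms(2) by (rule smooth_on_differentiable)
qed

lemma pseudo_metric_eqI:
  assumes "pseudo_metric_on M G" "p \<in> M" "\<And>z. G p u z = G p v z"
  shows "u = v"
proof -
  have "G p (u - v) z = 0" for z
    using assms(3) bilinear_lsub[OF pseudo_metricD(1)[OF assms(1,2)]] by simp
  then show ?thesis using pseudo_metricD(3)[OF assms(1,2)] by fastforce
qed

text \<open>\<open>christoffel\<close> is a definite description. A solution exists because the
  right side is linear in \<open>z\<close> and \<open>G\<close> is nondegenerate; nondegeneracy also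
  makes it unique.\<close>

lemma christoffel_koszul:
  fixes G :: "'e::euclidean_space \<Rightarrow> 'e \<Rightarrow> 'e \<Rightarrow> real"
  assumes "open M" "pseudo_metric_on M G" "p \<in> M"
  shows "2 * G p (christoffel G p u v) z =
     dird (\<lambda>q. G q v z) p u + dird (\<lambda>q. G q u z) p v - dird (\<lambda>q. G q u v) p z"
proof -
  note PM = pseudo_metricD[OF assms(2)]
  let ?l = "\<lambda>z. dird (\<lambda>q. G q v z) p u + dird (\<lambda>q. G q u z) p v - dird (\<lambda>q. G q u v) p z"
  have lin: "linear (\<lambda>z. dird (\<lambda>q. G q v z) p u)" for u v
    by (rule linear_dird_param[OF assms(1,3)]) (use PM(1,4) assms(3) bilinear_linear_right in blast)+
  have "linear (\<lambda>z. (1/2) *\<^sub>R ?l z)"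
    using lin[of v u] lin[of u v] linear_dird[OF PM(4)[OF assms(3), of u v]]
    by (intro linear_compose_scale_right linear_compose_sub linear_compose_add)
  note l = this
  have "\<exists>w. \<forall>z. G p w z = (1/2) *\<^sub>R ?l z"
    by (rule nondegenerate_representation[OF PM(1)[OF assms(3)] PM(3)[OF assms(3)] l]) blast+
  then obtain w where w: "\<forall>z. G p w z = (1/2) *\<^sub>R ?l z" by blast
  have "christoffel G p u v = w"
    unfolding christoffel_def
  proof (rule the_equality)
    show "\<forall>z. 2 * G p w z = ?l z" using w by (simp add: mult.commute)
    fix w' assume w': "\<forall>z. 2 * G p w' z = ?l z"
    show "w' = w"
    proof (rule pseudo_metric_eqI[OF assms(2,3)])
      show "G p w' z = G p w z" for z using w[rule_format, of z] w'[rule_format, of z] by simp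
    qed
  qed
  then show ?thesis using w by (simp add: mult.commute)
qed

lemma christoffel_sym:
  fixes G :: "'e::euclidean_space \<Rightarrow> 'e \<Rightarrow> 'e \<Rightarrow> real"
  assumes "open M" "pseudo_metric_on M G" "p \<in> M"
  shows "christoffel G p u v = christoffel G p v u"
proof (rule pseudo_metric_eqI[OF assms(2,3)])
  fix z
  have "dird (\<lambda>q. G q u v) p z = dird (\<lambda>q. G q v u) p z"
    by (rule dird_cong_open[OF assms(1,3)]) (rule pseudo_metricD(2)[OF assms(2)])
  then show "G p (christoffel G p u v) z = G p (christoffel G p v u) z"
    using christoffel_koszul[OF assms, of u v z] christoffel_koszul[OF assms, of v u z] by linarith
qed

lemma metric_compatible:
  fixes G :: "'e::euclidean_space \<Rightarrow> 'e \<Rightarrow> 'e \<Rightarrow> real"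
  assumes "open M" "pseudo_metric_on M G" "p \<in> M"
  shows "dird (\<lambda>q. G q v w) p u = G p (christoffel G p u v) w + G p v (christoffel G p u w)"
proof -
  have s: "dird (\<lambda>q. G q a b) p c = dird (\<lambda>q. G q b a) p c" for a b c
    by (rule dird_cong_open[OF assms(1,3)]) (rule pseudo_metricD(2)[OF assms(2)])
  show ?thesis
    using christoffel_koszul[OF assms, of u v w] christoffel_koszul[OF assms, of u w v]
      pseudo_metricD(2)[OF assms(2,3), of v "christoffel G p u w"] s[of v w u] by linarith
qed

text \<open>The algebraic content of Hitchin's lemma. \<open>T i u v w\<close> stands for the
  covariant derivative along \<open>u\<close> of the \<open>i\<close>-th form, evaluated on
  \<open>v\<close> and \<open>w\<close>: \<open>anti\<close> and \<open>cyc\<close> say that the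
  form is skew and closed, \<open>mv\<close> comes from differentiating J_i^2 = -1, and
  \<open>P\<close> from differentiating J_c = J_a J_b.\<close>

lemma quaternionic_torsion_zero:
  fixes T :: "'i \<Rightarrow> 'e::real_vector \<Rightarrow> 'e \<Rightarrow> 'e \<Rightarrow> real" and J :: "'i \<Rightarrow> 'e \<Rightarrow> 'e"
  assumes J: "\<And>i v. J i (J i v) = - v" "\<And>i v. J i (- v) = - J i v"
      "\<And>v. J a (J b v) = J c v" "\<And>v. J b (J a v) = - J c v" "\<And>v. J b (J c v) = J a v"
      "\<And>v. J c (J b v) = - J a v" "\<And>v. J c (J a v) = J b v" "\<And>v. J a (J c v) = - J b v"
    and n: "\<And>i u v w. T i (- u) v w = - T i u v w" "\<And>i u v w. T i u (- v) w = - T i u v w"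
      "\<And>i u v w. T i u v (- w) = - T i u v w"
    and anti: "\<And>i u v w. T i u v w = - T i u w v"
    and cyc: "\<And>i u v w. T i u v w + T i v w u + T i w u v = 0"
    and mv: "\<And>i u v w. T i u (J i v) w = T i u v (J i w)"
    and P: "\<And>u v w. T c u v w = T a u v (J b w) - T b u (J a v) w"
  shows "T a u v w = 0"
proof -
  have mv1: "T i (J i u) v w = T i u v (J i w)" for i u v w
  proof -
    \<comment> \<open>Four instances of closedness combine to the quasi-Kaehler identity, which
      every almost Kaehler structure satisfies.\<close>
    have "T i (J i u) (J i v) w = - T i u v w" for v
      using cyc[of i u v w] cyc[of i "J i u" "J i v" w] cyc[of i "J i u" v "J i w"] cyc[of i u "J i v" "J i w"]
      by (simp add: mv J n)
    from this[of "- J i v"] have "T i (J i u) v w = T i u (J i v) w" using J n by (metis minus_minus)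
    then show ?thesis using mv by simp
  qed
  have Q: "T c u v w = T a u (J b v) w - T b u v (J a w)" for u v w
    using P[of u w v] anti[of c u v w] anti[of a u w "J b v"] anti[of b u "J a w" v] by simp
  \<comment> \<open>In a slot of \<open>T a\<close> the structure \<open>J c\<close> is replaced by
    \<open>J a\<close> after \<open>J b\<close>, and \<open>J a\<close> then moves to the last slot;
    likewise for the cyclic permutations. This gives the terms a normal form.\<close>
  have r: "T a (J c u) v w = T a (J b u) v (J a w)" "T a u (J c v) w = T a u (J b v) (J a w)"
    "T b (J a u) v w = T b (J c u) v (J b w)" "T b u (J a v) w = T b u (J c v) (J b w)"
    "T c (J b u) v w = T c (J a u) v (J c w)" "T c u (J b v) w = T c u (J a v) (J c w)" for u v w
    using mv1[of a "J b u" v w] mv[of a u "J b v" w] mv1[of b "J c u" v w] mv[of b u "J c v" w]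
      mv1[of c "J a u" v w] mv[of c u "J a v" w] by (simp_all add: J)
  \<comment> \<open>In this normal form the instances of \<open>P\<close> and \<open>Q\<close> are a
    linear system that forces the value to vanish.\<close>
  show ?thesis
    using P[of "J c u" "J b v" "J c w"] Q[of u "J b v" w] P[of "J b u" "J b v" "J b w"] Q[of "J a u" "J b v" "J a w"]
      Q[of "J b u" v w] Q[of "J a u" "J c v" w] P[of u v "J b w"] Q[of "J c u" v "J a w"]
    by (simp add: J n mv mv1 r)
qed

lemma parallel_complex_structures:
  fixes G :: "'e::euclidean_space \<Rightarrow> 'e \<Rightarrow> 'e \<Rightarrow> real" and J :: "3 \<Rightarrow> 'e \<Rightarrow> 'e \<Rightarrow> 'e"
  assumes M: "open M" "pseudo_metric_on M G" "closed_2form_on M \<Omega>"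
    and smJ: "\<And>i v. smooth_on M (\<lambda>p. J i p v)"
    and linJ: "\<And>i p. p \<in> M \<Longrightarrow> linear (J i p)"
    and \<Omega>: "\<And>i u v p. p \<in> M \<Longrightarrow> \<Omega> p u v $ i = G p u (J i p v)"
    and orth: "\<And>i u v p. p \<in> M \<Longrightarrow> G p (J i p u) (J i p v) = G p u v"
    and sq: "\<And>i v p. p \<in> M \<Longrightarrow> J i p (J i p v) = - v"
    and q: "\<And>v p. p \<in> M \<Longrightarrow> J 1 p (J 2 p v) = J 3 p v" "\<And>v p. p \<in> M \<Longrightarrow> J 2 p (J 1 p v) = - J 3 p v"
    and p: "p \<in> M"
  shows "dird (\<lambda>q. J i q v) p u + christoffel G p u (J i p v) - J i p (christoffel G p u v) = 0"
proof -
  define \<Gamma> where "\<Gamma> = christoffel G p"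
  define N where "N i u w = dird (\<lambda>q. J i q w) p u + \<Gamma> u (J i p w) - J i p (\<Gamma> u w)" for i u w
  define T where "T i u v w = G p v (N i u w)" for i u v w
  note PM = pseudo_metricD[OF M(2)] and bil = pseudo_metricD(1)[OF M(2) p]
  note Ga = linear_add[OF bilinear_linear_right[OF bil]] linear_diff[OF bilinear_linear_right[OF bil]]
    linear_neg[OF bilinear_linear_right[OF bil]]
    linear_add[OF bilinear_linear_left[OF bil]] linear_diff[OF bilinear_linear_left[OF bil]]
    linear_neg[OF bilinear_linear_left[OF bil]]
  have dJ: "(\<lambda>q. J i q v) differentiable (at p)" for i v
    using smooth_on_differentiable smJ p by blast
  have skew: "G p (J i p v) w = - G p v (J i p w)" for i v w
    using orth[OF p, of i v "J i p w"] by (simp add: sq[OF p] Ga)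
  have \<Gamma>lin: "linear (\<Gamma> u)" for u
  proof (rule linearI)
    have lin: "linear (\<lambda>v. dird (\<lambda>q. G q v z) p u)" for z u
      by (rule linear_dird_param[OF M(1) p]) (use PM(1,4) p bilinear_linear_left in blast)+
    have lin2: "linear (\<lambda>v. dird (\<lambda>q. G q u v) p z)" for z u
      by (rule linear_dird_param[OF M(1) p]) (use PM(1,4) p bilinear_linear_right in blast)+
    have lin3: "linear (dird (\<lambda>q. G q u z) p)" for u z by (rule linear_dird[OF PM(4)[OF p]])
    note K = christoffel_koszul[OF M(1,2) p, folded \<Gamma>_def]
    show "\<Gamma> u (a + b) = \<Gamma> u a + \<Gamma> u b" for a b
    proof (rule pseudo_metric_eqI[OF M(2) p])
      show "G p (\<Gamma> u (a + b)) z = G p (\<Gamma> u a + \<Gamma> u b) z" for z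
        using K[of u "a + b" z] K[of u a z] K[of u b z]
        by (simp add: Ga linear_add[OF lin] linear_add[OF lin2] linear_add[OF lin3])
    qed
    show "\<Gamma> u (r *\<^sub>R a) = r *\<^sub>R \<Gamma> u a" for r a
    proof (rule pseudo_metric_eqI[OF M(2) p])
      show "G p (\<Gamma> u (r *\<^sub>R a)) z = G p (r *\<^sub>R \<Gamma> u a) z" for z
        using K[of u "r *\<^sub>R a" z] arg_cong[OF K[of u a z], of "\<lambda>t. r * t"]
        by (simp add: linear_scale[OF bilinear_linear_left[OF bil]] linear_scale[OF lin] linear_scale[OF lin2]
            linear_scale[OF lin3] algebra_simps)
    qed
  qed
  have \<Gamma>sym: "\<Gamma> u v = \<Gamma> v u" for u v unfolding \<Gamma>_def by (rule christoffel_sym[OF M(1,2) p])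
  have Om: "\<Omega> p u v $ i = - \<Omega> p v u $ i" for u v i
    using M(3) p unfolding closed_2form_on_def by (metis vector_uminus_component)
  have dOm: "(\<lambda>q. \<Omega> q u v) differentiable (at p)" for u v
    using M(3) p smooth_on_differentiable unfolding closed_2form_on_def by blast
  have T: "T i u v w = dird (\<lambda>q. \<Omega> q v w) p u $ i - \<Omega> p (\<Gamma> u v) w $ i - \<Omega> p v (\<Gamma> u w) $ i" for i u v w
  proof -
    have "dird (\<lambda>q. \<Omega> q v w) p u $ i = dird (\<lambda>q. \<Omega> q v w $ i) p u"
      by (rule dird_bounded_linear[OF bounded_linear_vec_nth dOm, symmetric])
    also have "\<dots> = dird (\<lambda>q. G q v (J i q w)) p u"
      by (rule dird_cong_open[OF M(1) p]) (rule \<Omega>)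
    also have "\<dots> = dird (\<lambda>q. G q v (J i p w)) p u + G p v (dird (\<lambda>q. J i q w) p u)"
      by (rule dird_field_apply(1)[OF M(1) p _ _ dJ]) (use PM(1,4) p bilinear_linear_right in blast)+
    also have "dird (\<lambda>q. G q v (J i p w)) p u = G p (\<Gamma> u v) (J i p w) + G p v (\<Gamma> u (J i p w))"
      unfolding \<Gamma>_def by (rule metric_compatible[OF M(1,2) p])
    finally show ?thesis by (simp add: T_def N_def Ga \<Omega>[OF p])
  qed
  have Jneg: "J i p (- v) = - J i p v" for i v using linear_neg[OF linJ[OF p]] .
  have N1: "N i u (J i p w) = - J i p (N i u w)" for i u w
  proof -
    have "dird (\<lambda>q. J i q (J i q w)) p u = dird (\<lambda>q. J i q (J i p w)) p u + J i p (dird (\<lambda>q. J i q w) p u)"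
      by (rule dird_field_apply(1)[OF M(1) p linJ dJ dJ])
    moreover have "dird (\<lambda>q. J i q (J i q w)) p u = dird (\<lambda>_. - w) p u"
      by (rule dird_cong_open[OF M(1) p]) (rule sq)
    moreover have "dird (\<lambda>_. - w) p u = 0" by (rule dird_eq) simp
    ultimately have "dird (\<lambda>q. J i q (J i p w)) p u = - J i p (dird (\<lambda>q. J i q w) p u)"
      by (simp add: eq_neg_iff_add_eq_0)
    then show ?thesis
      by (simp add: N_def sq[OF p] linear_neg[OF \<Gamma>lin] linear_add[OF linJ[OF p]] linear_diff[OF linJ[OF p]])
  qed
  have other: "J 2 q (J 3 q v) = J 1 q v" "J 3 q (J 2 q v) = - J 1 q v" "J 3 q (J 1 q v) = J 2 q v"
     "J 1 q (J 3 q v) = - J 2 q v" if "q \<in> M" for q v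
  proof -
    have Jneg: "J i q (- v) = - J i q v" for i v using linear_neg[OF linJ[OF that]] .
    show "J 1 q (J 3 q v) = - J 2 q v" using q(1)[OF that, of v] sq[OF that] by metis
    show "J 3 q (J 2 q v) = - J 1 q v" using q(1)[OF that, of "J 2 q v"] sq[OF that] Jneg by metis
    show "J 2 q (J 3 q v) = J 1 q v" using q(2)[OF that, of v] sq[OF that] Jneg by (metis minus_minus)
    show "J 3 q (J 1 q v) = J 2 q v" using q(2)[OF that, of "J 1 q v"] sq[OF that] Jneg by (metis minus_minus)
  qed
  have N3: "N c u w = N a u (J b p w) + J a p (N b u w)"
    if abc: "\<And>q v. q \<in> M \<Longrightarrow> J a q (J b q v) = J c q v" for a b c u w
  proof -
    have "dird (\<lambda>q. J c q w) p u = dird (\<lambda>q. J a q (J b q w)) p u"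
      by (rule dird_cong_open[OF M(1) p]) (rule abc[symmetric])
    also have "\<dots> = dird (\<lambda>q. J a q (J b p w)) p u + J a p (dird (\<lambda>q. J b q w) p u)"
      by (rule dird_field_apply(1)[OF M(1) p linJ dJ dJ])
    finally show ?thesis
      by (simp add: N_def abc[OF p] linear_add[OF linJ[OF p]] linear_diff[OF linJ[OF p]])
  qed
  have Nlin1: "N i (- u) w = - N i u w" for i u w
    using linear_neg[OF linear_dird[OF dJ]] linear_neg[OF \<Gamma>lin] linear_neg[OF linJ[OF p]]
    by (simp add: N_def \<Gamma>sym[of "- u"] \<Gamma>sym[of u])
  have Nlin2: "linear (N i u)" for i u
  proof -
    have "linear (\<lambda>w. dird (\<lambda>q. J i q w) p u)" by (rule linear_dird_param[OF M(1) p linJ dJ])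
    then show ?thesis unfolding N_def
      using linear_compose[OF linJ[OF p] \<Gamma>lin] linear_compose[OF \<Gamma>lin linJ[OF p]]
      by (intro linear_compose_sub linear_compose_add) (simp_all add: o_def)
  qed
  have zero: "N j u v = 0" if TT: "\<And>u v w. T j u v w = 0" for j u v
    by (rule pseudo_metric_eqI[OF M(2) p])
      (use TT[of u _ v] pseudo_metricD(2)[OF M(2) p] linear_0[OF bilinear_linear_right[OF bil]] in \<open>simp add: T_def\<close>)
  have cyc: "T i u v w + T i v w u + T i w u v = 0" for i u v w
  proof -
    have "dird (\<lambda>q. \<Omega> q v w) p u + dird (\<lambda>q. \<Omega> q w u) p v + dird (\<lambda>q. \<Omega> q u v) p w = 0"
      using M(3) p unfolding closed_2form_on_def by blast
    then have "dird (\<lambda>q. \<Omega> q v w) p u $ i + dird (\<lambda>q. \<Omega> q w u) p v $ i + dird (\<lambda>q. \<Omega> q u v) p w $ i = 0"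
      by (metis vector_add_component zero_index)
    then show ?thesis
      using Om[of "\<Gamma> u v" w i] Om[of "\<Gamma> v w" u i] Om[of "\<Gamma> w u" v i] \<Gamma>sym[of u v] \<Gamma>sym[of v w] \<Gamma>sym[of w u]
      by (simp add: T)
  qed
  have anti: "T i u v w = - T i u w v" for i u v w
  proof -
    have "dird (\<lambda>q. \<Omega> q v w) p u = dird (\<lambda>q. - \<Omega> q w v) p u"
      by (rule dird_cong_open[OF M(1) p]) (use M(3) in \<open>unfold closed_2form_on_def, blast\<close>)
    also have "\<dots> = - dird (\<lambda>q. \<Omega> q w v) p u"
      by (rule dird_eq[OF has_derivative_minus[OF has_derivative_dird[OF dOm]]])
    finally show ?thesis using Om[of "\<Gamma> u v" w i] Om[of v "\<Gamma> u w" i] by (simp add: T)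
  qed
  have mv: "T i u (J i p v) w = T i u v (J i p w)" for i u v w
    by (simp add: T_def N1 skew Ga)
  have neg: "T i (- u) v w = - T i u v w \<and> T i u (- v) w = - T i u v w \<and> T i u v (- w) = - T i u v w" for i u v w
    by (simp add: T_def Nlin1 Ga linear_neg[OF Nlin2])
  have P: "T c u v w = T a u v (J b p w) - T b u (J a p v) w"
    if "\<And>q v. q \<in> M \<Longrightarrow> J a q (J b q v) = J c q v" for a b c u v w
    by (simp add: T_def N3[OF that] Ga skew)
  \<comment> \<open>The algebraic lemma disposes only of its first structure, so it is applied to
    the three cyclic permutations of 1, 2, 3.\<close>
  have "T 1 u v w = 0" for u v w
  proof (rule quaternionic_torsion_zero[where J="\<lambda>i. J i p" and a=1 and b=2 and c=3])
    show "T 3 u v w = T 1 u v (J 2 p w) - T 2 u (J 1 p v) w" for u v w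
      by (rule P) (rule q(1))
  qed (rule sq[OF p] Jneg q[OF p] other[OF p] neg[THEN conjunct1] neg[THEN conjunct2, THEN conjunct1]
      neg[THEN conjunct2, THEN conjunct2] anti cyc mv)+
  moreover have "T 2 u v w = 0" for u v w
  proof (rule quaternionic_torsion_zero[where J="\<lambda>i. J i p" and a=2 and b=3 and c=1])
    show "T 1 u v w = T 2 u v (J 3 p w) - T 3 u (J 2 p v) w" for u v w
      by (rule P) (rule other(1))
  qed (rule sq[OF p] Jneg q[OF p] other[OF p] neg[THEN conjunct1] neg[THEN conjunct2, THEN conjunct1]
      neg[THEN conjunct2, THEN conjunct2] anti cyc mv)+
  moreover have "T 3 u v w = 0" for u v w
  proof (rule quaternionic_torsion_zero[where J="\<lambda>i. J i p" and a=3 and b=1 and c=2])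
    show "T 2 u v w = T 3 u v (J 1 p w) - T 1 u (J 3 p v) w" for u v w
      by (rule P) (rule other(3))
  qed (rule sq[OF p] Jneg q[OF p] other[OF p] neg[THEN conjunct1] neg[THEN conjunct2, THEN conjunct1]
      neg[THEN conjunct2, THEN conjunct2] anti cyc mv)+
  ultimately have "T i u v w = 0" for u v w
    using exhaust_3[of i] by auto
  then have "N i u v = 0" by (rule zero)
  then show ?thesis by (simp add: N_def \<Gamma>_def)
qed

subsection \<open>The Legendre equations\<close>

definition D2 :: "('n::finite config \<Rightarrow> real) \<Rightarrow> 'n config \<Rightarrow> 'n option \<Rightarrow> 3 \<Rightarrow> 'n option \<Rightarrow> 3 \<Rightarrow> real" where
  "D2 L x I i J j = dird (\<lambda>y. dird L y (basis_vec J j)) x (basis_vec I i)"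

lemma dird_of_real:
  "f differentiable (at p) \<Longrightarrow> dird (\<lambda>q. complex_of_real (f q)) p v = of_real (dird f p v)"
  by (rule dird_bounded_linear[OF bounded_linear_of_real])

lemma
  assumes "open S" "smooth_on S L" "x \<in> S"
  shows pd_xx: "pd_x I (pd_x J (\<lambda>x. complex_of_real (L x))) x = of_real (D2 L x I 1 J 1)"
    and pd_xz: "pd_x I (pd_z J (\<lambda>x. complex_of_real (L x))) x = Complex (D2 L x I 1 J 2) (- D2 L x I 1 J 3)"
    and pd_zx: "pd_z I (pd_x J (\<lambda>x. complex_of_real (L x))) x = Complex (D2 L x I 2 J 1) (- D2 L x I 3 J 1)"
    and pd_zzbar: "pd_z I (pd_zbar J (\<lambda>x. complex_of_real (L x))) x =
      Complex (D2 L x I 2 J 2 + D2 L x I 3 J 3) (D2 L x I 2 J 3 - D2 L x I 3 J 2)"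
proof -
  have d: "dird (\<lambda>x. complex_of_real (L x)) y v = of_real (dird L y v)" if "y \<in> S" for y v
    by (rule dird_of_real[OF smooth_on_differentiable[OF assms(2) that]])
  have df: "(\<lambda>y. dird L y v) differentiable (at x)" for v
    by (rule smooth_on_differentiable[OF smooth_on_dird[OF assms(2)] assms(3)])
  have hd: "((\<lambda>y. dird L y v) has_derivative dird (\<lambda>y. dird L y v) x) (at x)" for v
    by (rule has_derivative_dird[OF df])
  have xx: "dird (pd_x J (\<lambda>x. complex_of_real (L x))) x v = of_real (dird (\<lambda>y. dird L y (basis_vec J 1)) x v)" for v
    unfolding dird_of_real[OF df, symmetric]
    by (rule dird_cong_open[OF assms(1,3)]) (simp add: pd_x_def d)
  have z: "dird (pd_z J (\<lambda>x. complex_of_real (L x))) x v = of_real (dird (\<lambda>y. dird L y (basis_vec J 2)) x v)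
       - \<i> * of_real (dird (\<lambda>y. dird L y (basis_vec J 3)) x v)" for v
  proof -
    have "dird (pd_z J (\<lambda>x. complex_of_real (L x))) x v = dird (\<lambda>y. complex_of_real (dird L y (basis_vec J 2))
       - \<i> * of_real (dird L y (basis_vec J 3))) x v"
      by (rule dird_cong_open[OF assms(1,3)]) (simp add: pd_z_def d)
    also have "\<dots> = of_real (dird (\<lambda>y. dird L y (basis_vec J 2)) x v)
       - \<i> * of_real (dird (\<lambda>y. dird L y (basis_vec J 3)) x v)"
      by (rule dird_eq) (intro has_derivative_diff has_derivative_mult_right has_derivative_of_real hd)
    finally show ?thesis .
  qed
  have zb: "dird (pd_zbar J (\<lambda>x. complex_of_real (L x))) x v = of_real (dird (\<lambda>y. dird L y (basis_vec J 2)) x v)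
       + \<i> * of_real (dird (\<lambda>y. dird L y (basis_vec J 3)) x v)" for v
  proof -
    have "dird (pd_zbar J (\<lambda>x. complex_of_real (L x))) x v = dird (\<lambda>y. complex_of_real (dird L y (basis_vec J 2))
       + \<i> * of_real (dird L y (basis_vec J 3))) x v"
      by (rule dird_cong_open[OF assms(1,3)]) (simp add: pd_zbar_def d)
    also have "\<dots> = of_real (dird (\<lambda>y. dird L y (basis_vec J 2)) x v)
       + \<i> * of_real (dird (\<lambda>y. dird L y (basis_vec J 3)) x v)"
      by (rule dird_eq) (intro has_derivative_add has_derivative_mult_right has_derivative_of_real hd)
    finally show ?thesis .
  qed
  show "pd_x I (pd_x J (\<lambda>x. complex_of_real (L x))) x = of_real (D2 L x I 1 J 1)"
    unfolding pd_x_def[of I] xx by (simp add: D2_def)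
  show "pd_x I (pd_z J (\<lambda>x. complex_of_real (L x))) x = Complex (D2 L x I 1 J 2) (- D2 L x I 1 J 3)"
    unfolding pd_x_def[of I] z by (simp add: D2_def complex_eq_iff)
  show "pd_z I (pd_x J (\<lambda>x. complex_of_real (L x))) x = Complex (D2 L x I 2 J 1) (- D2 L x I 3 J 1)"
    unfolding pd_z_def[of I] xx by (simp add: D2_def complex_eq_iff)
  show "pd_z I (pd_zbar J (\<lambda>x. complex_of_real (L x))) x =
      Complex (D2 L x I 2 J 2 + D2 L x I 3 J 3) (D2 L x I 2 J 3 - D2 L x I 3 J 2)"
    unfolding pd_z_def[of I] zb by (simp add: D2_def complex_eq_iff)
qed

text \<open>Real and imaginary parts. The first Legendre equation gives the trace condition and the
  exchange of the vector indices 2 and 3, the second one the exchange of 1 with 2 and with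
  3.\<close>

lemma legendre_equations_iff:
  assumes "open S" "smooth_on S L"
  shows "legendre_equations S L \<longleftrightarrow> (\<forall>x\<in>S. \<forall>I J.
     D2 L x I 1 J 1 + D2 L x I 2 J 2 + D2 L x I 3 J 3 = 0 \<and> D2 L x I 2 J 3 = D2 L x I 3 J 2 \<and>
     D2 L x I 1 J 2 = D2 L x J 1 I 2 \<and> D2 L x I 1 J 3 = D2 L x J 1 I 3)"
  unfolding legendre_equations_def Let_def
  by (intro ball_cong refl all_cong1) (auto simp: pd_xx[OF assms] pd_xz[OF assms] pd_zzbar[OF assms] complex_eq_iff)

lemma D2_commute:
  assumes "open S" "smooth_on S L" "x \<in> S"
  shows "D2 L x I i J j = D2 L x J j I i"
  unfolding D2_def by (rule dird_commute[OF assms])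

lemma higgs_D2: "higgs L x $ I $ J = - (1/2) * D2 L x I 1 J 1"
  by (simp add: higgs_def hessian_xx_def pd_x_def[abs_def] D2_def)

lemma config_expansion: "(v :: 'n::finite config) = (\<Sum>I\<in>UNIV. \<Sum>i\<in>UNIV. v $ I $ i *\<^sub>R basis_vec I i)"
proof -
  have "(\<Sum>I\<in>UNIV. \<Sum>i\<in>UNIV. v $ I $ i *\<^sub>R basis_vec I i) $ K $ k = v $ K $ k" for K k
  proof -
    have "(\<Sum>i\<in>UNIV. v $ I $ i *\<^sub>R basis_vec I i $ K $ k) = (if I = K then v $ K $ k else 0)" for I
    proof (cases "I = K")
      case True
      have "v $ I $ i *\<^sub>R basis_vec I i $ K $ k = (if i = k then v $ K $ k else 0)" for i
        using True by (simp add: basis_vec_def axis_def)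
      then show ?thesis using True by simp
    next
      case False
      then show ?thesis by (simp add: basis_vec_def axis_def)
    qed
    then show ?thesis by simp
  qed
  then show ?thesis by (simp add: vec_eq_iff)
qed

lemma linear_config_expansion:
  assumes "linear f"
  shows "f (v :: 'n::finite config) = (\<Sum>I\<in>UNIV. \<Sum>i\<in>UNIV. v $ I $ i *\<^sub>R f (basis_vec I i))"
  by (subst config_expansion[of v]) (simp add: linear_sum[OF assms] linear_scale[OF assms])

locale gh_space =
  fixes S :: "'n::finite config set" and L :: "'n config \<Rightarrow> real" and \<phi> :: "'n config \<Rightarrow> real^('n option)"
  assumes open_S: "open S" and smooth_L: "smooth_on S L" and smooth_phi: "smooth_on S \<phi>"
    and legendre: "legendre_equations S L"
    and invertible_hessian: "x \<in> S \<Longrightarrow> invertible (hessian_xx L x)"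
begin

abbreviation "U x I J \<equiv> higgs L x $ I $ J"

definition T3 where "T3 x K k I i J j = dird (\<lambda>y. D2 L y I i J j) x (basis_vec K k)"

definition W :: "'n config \<Rightarrow> 'n option \<Rightarrow> 'n option \<Rightarrow> 'n option \<Rightarrow> real^3" where
  "W x I J K = (\<chi> k. dird (\<lambda>y. U y I J) x (basis_vec K k))"

lemma smooth_D2: "smooth_on S (\<lambda>x. D2 L x I i J j)"
  unfolding D2_def by (intro smooth_on_dird smooth_L)

lemma smooth_higgs: "smooth_on S (\<lambda>x. U x I J)"
  unfolding higgs_D2 by (intro smooth_intros open_S smooth_D2)

text \<open>Together with the symmetry of second derivatives, the Hessian is symmetric in the vector
  indices alone. With \<open>D2_trace\<close> this is the rotationally covariant form of the
  Legendre equations: for each pair \<open>I\<close>, \<open>J\<close> a symmetric traceless 3 by 3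
  matrix.\<close>

lemma D2_swap: "x \<in> S \<Longrightarrow> D2 L x I i J j = D2 L x I j J i"
proof -
  assume x: "x \<in> S"
  note c = D2_commute[OF open_S smooth_L x]
  have l: "D2 L x I 2 J 3 = D2 L x I 3 J 2" "D2 L x I 1 J 2 = D2 L x J 1 I 2" "D2 L x I 1 J 3 = D2 L x J 1 I 3" for I J
    using legendre x unfolding legendre_equations_iff[OF open_S smooth_L] by blast+
  show ?thesis
    using exhaust_3[of i] exhaust_3[of j] l[of I J] c[of I 2 J 1] c[of I 3 J 1] by auto
qed

lemma D2_trace: "x \<in> S \<Longrightarrow> D2 L x I 1 J 1 + D2 L x I 2 J 2 + D2 L x I 3 J 3 = 0"
  using legendre unfolding legendre_equations_iff[OF open_S smooth_L] by blast

lemma T3_sym1: "x \<in> S \<Longrightarrow> T3 x K k I i J j = T3 x K k J j I i"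
  unfolding T3_def
  by (rule dird_cong_open[OF open_S]) (auto intro: D2_commute[OF open_S smooth_L])

lemma T3_sym2: "x \<in> S \<Longrightarrow> T3 x K k I i J j = T3 x I i K k J j"
  unfolding T3_def D2_def by (rule dird_commute[OF open_S smooth_on_dird[OF smooth_L]])

lemma T3_swap: "x \<in> S \<Longrightarrow> T3 x K k I i J j = T3 x K k I j J i"
  unfolding T3_def by (rule dird_cong_open[OF open_S]) (auto intro: D2_swap)

lemma T3_trace: "x \<in> S \<Longrightarrow> T3 x K k I 1 J 1 + T3 x K k I 2 J 2 + T3 x K k I 3 J 3 = 0"
proof -
  assume x: "x \<in> S"
  have d: "((\<lambda>y. D2 L y I i J i) has_derivative dird (\<lambda>y. D2 L y I i J i) x) (at x)" for i
    by (rule smooth_on_has_derivative[OF smooth_D2 x])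
  have "T3 x K k I 1 J 1 + T3 x K k I 2 J 2 + T3 x K k I 3 J 3 =
     dird (\<lambda>y. D2 L y I 1 J 1 + D2 L y I 2 J 2 + D2 L y I 3 J 3) x (basis_vec K k)"
    unfolding T3_def
    by (rule dird_eq[OF has_derivative_add[OF has_derivative_add[OF d d] d], symmetric])
  also have "\<dots> = dird (\<lambda>y. 0) x (basis_vec K k)"
    by (rule dird_cong_open[OF open_S x]) (rule D2_trace)
  also have "\<dots> = 0" by (rule dird_eq) simp
  finally show ?thesis .
qed

lemma W_T3: "x \<in> S \<Longrightarrow> W x I J K $ k = - (1/2) * T3 x K k I 1 J 1"
  unfolding W_def T3_def higgs_D2 vec_lambda_beta
  by (rule dird_bounded_linear[OF bounded_linear_mult_right smooth_on_differentiable[OF smooth_D2]])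

lemma W_sym1: "x \<in> S \<Longrightarrow> W x I J K = W x J I K"
  using T3_sym1 by (simp add: vec_eq_iff W_T3)

lemma W_sym2: "x \<in> S \<Longrightarrow> W x I J K = W x I K J"
proof -
  assume x: "x \<in> S"
  \<comment> \<open>The vector index \<open>k\<close> is carried from \<open>K\<close> to
    \<open>J\<close> by alternately exchanging the order of derivatives and swapping vector
    indices.\<close>
  have "T3 x K k I 1 J 1 = T3 x J k I 1 K 1" for k
    using T3_sym2[OF x, of K k I 1 J 1] T3_swap[OF x, of I 1 K k J 1] T3_sym1[OF x, of I 1 K 1 J k]
      T3_sym2[OF x, of I 1 J k K 1] by simp
  then show ?thesis using x by (simp add: vec_eq_iff W_T3)
qed

lemma dU: "x \<in> S \<Longrightarrow> dird (\<lambda>y. U y I J) x v = (\<Sum>K\<in>UNIV. W x I J K \<bullet> v $ K)"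
  using linear_config_expansion[OF smooth_on_linear_dird[OF smooth_higgs], of x I J v]
  by (simp add: W_def inner_vec_def mult.commute)

definition A :: "'n config \<Rightarrow> 'n config \<Rightarrow> real^('n option)" where
  "A x v = (\<chi> I. connection_form L \<phi> I x v)"

lemma connection_form_eq:
  assumes "x \<in> S"
  shows "connection_form L \<phi> I x v = (1/2) * (\<Sum>J\<in>UNIV. D2 L x J 2 I 1 * v $ J $ 3 - D2 L x J 3 I 1 * v $ J $ 2)
     + dird (\<lambda>y. \<phi> y $ I) x v"
  unfolding connection_form_def Im_sum
  by (simp add: pd_zx[OF open_S smooth_L assms] zc_def sum_distrib_left algebra_simps)

lemma smooth_phi_nth: "smooth_on S (\<lambda>x. \<phi> x $ I)"
  by (intro smooth_intros open_S smooth_phi)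

lemma smooth_A: "smooth_on S (\<lambda>x. A x v)"
proof (rule smooth_on_vec[OF open_S])
  fix I
  have *: "smooth_on S (\<lambda>x. (1/2) * (\<Sum>J\<in>UNIV. D2 L x J 2 I 1 * v $ J $ 3 - D2 L x J 3 I 1 * v $ J $ 2)
     + dird (\<lambda>y. \<phi> y $ I) x v)"
    by (intro smooth_intros open_S smooth_D2 smooth_on_dird smooth_phi)
  show "smooth_on S (\<lambda>x. A x v $ I)"
    by (rule smooth_on_cong[OF open_S, THEN iffD2, OF _ *]) (simp add: A_def connection_form_eq)
qed

lemma linear_A: "x \<in> S \<Longrightarrow> linear (A x)"
  by (rule linearI)
    (auto simp: A_def vec_eq_iff connection_form_eq sum.distrib algebra_simps sum_distrib_left
      linear_add[OF smooth_on_linear_dird[OF smooth_phi_nth]] linear_scale[OF smooth_on_linear_dird[OF smooth_phi_nth]] sum_subtractf)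

definition B :: "'n config \<Rightarrow> 'n config \<Rightarrow> 'n config \<Rightarrow> real^('n option)" where
  "B x u v = dird (\<lambda>y. A y v) x u"

text \<open>The Bogomolny equations: the curvature of the connection is dual to the differential of
  the Higgs field. The gauge shift drops out because the second derivatives of \<phi>
  commute.\<close>

lemma curvature:
  assumes x: "x \<in> S"
  shows "(B x u v - B x v u) $ I = (\<Sum>J\<in>UNIV. \<Sum>K\<in>UNIV. W x I J K \<bullet> cross3 (u $ J) (v $ K))"
proof -
  have phi2: "dird (\<lambda>y. dird (\<lambda>y. \<phi> y $ I) y v) x u = dird (\<lambda>y. dird (\<lambda>y. \<phi> y $ I) y u) x v"
    by (rule dird_commute[OF open_S smooth_phi_nth x])
  have d: "((\<lambda>y. D2 L y J j I 1) has_derivative dird (\<lambda>y. D2 L y J j I 1) x) (at x)" for J j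
    by (rule smooth_on_has_derivative[OF smooth_D2 x])
  have dp: "((\<lambda>y. dird (\<lambda>y. \<phi> y $ I) y v) has_derivative dird (\<lambda>y. dird (\<lambda>y. \<phi> y $ I) y v) x) (at x)" for v
    by (rule smooth_on_has_derivative[OF smooth_on_dird[OF smooth_phi_nth] x])
  have dD: "dird (\<lambda>y. D2 L y J j I 1) x u = (\<Sum>K\<in>UNIV. \<Sum>k\<in>UNIV. u $ K $ k * T3 x K k J j I 1)" for J j u
    using linear_config_expansion[OF smooth_on_linear_dird[OF smooth_D2 x], of J j I 1 u] by (simp add: T3_def)
  have Bc: "B x u v $ I = (1/2) * (\<Sum>J\<in>UNIV. dird (\<lambda>y. D2 L y J 2 I 1) x u * v $ J $ 3 - dird (\<lambda>y. D2 L y J 3 I 1) x u * v $ J $ 2)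
     + dird (\<lambda>y. dird (\<lambda>y. \<phi> y $ I) y v) x u" for u v
  proof -
    have "B x u v $ I = dird (\<lambda>y. A y v $ I) x u"
      unfolding B_def
      by (rule dird_bounded_linear[OF bounded_linear_vec_nth smooth_on_differentiable[OF smooth_A x], symmetric])
    also have "\<dots> = dird (\<lambda>x. (1/2) * (\<Sum>J\<in>UNIV. D2 L x J 2 I 1 * v $ J $ 3 - D2 L x J 3 I 1 * v $ J $ 2)
     + dird (\<lambda>y. \<phi> y $ I) x v) x u"
      by (rule dird_cong_open[OF open_S x]) (simp add: A_def connection_form_eq)
    also have "\<dots> = (1/2) * (\<Sum>J\<in>UNIV. dird (\<lambda>y. D2 L y J 2 I 1) x u * v $ J $ 3 - dird (\<lambda>y. D2 L y J 3 I 1) x u * v $ J $ 2)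
     + dird (\<lambda>y. dird (\<lambda>y. \<phi> y $ I) y v) x u"
      by (rule dird_eq) (intro has_derivative_add has_derivative_mult_right has_derivative_sum has_derivative_diff
          has_derivative_mult_left d dp)
    finally show ?thesis .
  qed
  \<comment> \<open>For fixed \<open>J\<close> and \<open>K\<close> these numbers form a symmetric
    traceless 3 by 3 matrix whose first row is -2 times \<open>W x I J K\<close>; the symmetry and
    the trace condition reduce the claim to that row and two further entries.\<close>
  define t where "t K k J j = T3 x K k J j I 1" for K k J j
  have t_sym: "t K k J j = t J j K k" for K k J j unfolding t_def by (rule T3_sym2[OF x])
  have t_swap: "t K k J j = t K j J k" for K k J j
    unfolding t_def using T3_sym2[OF x, of K k J j I 1] T3_sym1[OF x, of J j K k I 1]
      T3_sym2[OF x, of J j I 1 K k] T3_swap[OF x, of I 1 J j K k]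
      T3_sym2[OF x, of K j J k I 1] T3_sym1[OF x, of J k K j I 1]
      T3_sym2[OF x, of J k I 1 K j] by simp
  have t_trace: "t K 1 J 1 + t K 2 J 2 + t K 3 J 3 = 0" for K J
    unfolding t_def using T3_trace[OF x, of I 1 K J]
      T3_sym2[OF x, of K _ J _ I 1] T3_sym1[OF x, of J _ K _ I 1] T3_sym2[OF x, of J _ I 1 K _] T3_sym1[OF x, of I 1 J _ K _]
    by metis
  have W: "W x I J K $ k = - (1/2) * t J 1 K k" for J K k
    unfolding t_def W_T3[OF x] using T3_sym1[OF x, of K k I 1 J 1] T3_sym2[OF x, of K k J 1 I 1] by simp
  have "(B x u v - B x v u) $ I = (1/2) * (\<Sum>J\<in>UNIV. \<Sum>K\<in>UNIV.
      (\<Sum>k\<in>UNIV. u $ K $ k * t K k J 2) * v $ J $ 3 - (\<Sum>k\<in>UNIV. u $ K $ k * t K k J 3) * v $ J $ 2)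
     - (1/2) * (\<Sum>J\<in>UNIV. \<Sum>K\<in>UNIV.
      (\<Sum>k\<in>UNIV. v $ K $ k * t K k J 2) * u $ J $ 3 - (\<Sum>k\<in>UNIV. v $ K $ k * t K k J 3) * u $ J $ 2)"
    unfolding vector_minus_component Bc dD phi2
    by (simp add: t_def sum_distrib_right sum_subtractf)
  also have "(\<Sum>J\<in>UNIV. \<Sum>K\<in>UNIV.
      (\<Sum>k\<in>UNIV. u $ K $ k * t K k J 2) * v $ J $ 3 - (\<Sum>k\<in>UNIV. u $ K $ k * t K k J 3) * v $ J $ 2)
    = (\<Sum>J\<in>UNIV. \<Sum>K\<in>UNIV.
      (\<Sum>k\<in>UNIV. u $ J $ k * t J k K 2) * v $ K $ 3 - (\<Sum>k\<in>UNIV. u $ J $ k * t J k K 3) * v $ K $ 2)"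
    by (rule sum.swap)
  also have "(1/2) * \<dots> - (1/2) * (\<Sum>J\<in>UNIV. \<Sum>K\<in>UNIV.
      (\<Sum>k\<in>UNIV. v $ K $ k * t K k J 2) * u $ J $ 3 - (\<Sum>k\<in>UNIV. v $ K $ k * t K k J 3) * u $ J $ 2)
    = (\<Sum>J\<in>UNIV. \<Sum>K\<in>UNIV. (1/2) * ((\<Sum>k\<in>UNIV. u $ J $ k * t J k K 2) * v $ K $ 3 - (\<Sum>k\<in>UNIV. u $ J $ k * t J k K 3) * v $ K $ 2)
      - (1/2) * ((\<Sum>k\<in>UNIV. v $ K $ k * t K k J 2) * u $ J $ 3 - (\<Sum>k\<in>UNIV. v $ K $ k * t K k J 3) * u $ J $ 2))"
    by (simp only: sum_distrib_left sum_subtractf[symmetric])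
  also have "\<dots> = (\<Sum>J\<in>UNIV. \<Sum>K\<in>UNIV. W x I J K \<bullet> cross3 (u $ J) (v $ K))"
  proof (intro sum.cong refl)
    fix J K
    have e: "t K k J j = t J k K j" for k j using t_swap[of K k J j] t_sym[of K j J k] by simp
    have 33: "t J 3 K 3 = - t J 1 K 1 - t J 2 K 2" using t_trace[of J K] by simp
    have s: "t J 2 K 1 = t J 1 K 2" "t J 3 K 1 = t J 1 K 3" "t J 3 K 2 = t J 2 K 3"
      by (rule t_swap)+
    show "(1/2) * ((\<Sum>k\<in>UNIV. u $ J $ k * t J k K 2) * v $ K $ 3 - (\<Sum>k\<in>UNIV. u $ J $ k * t J k K 3) * v $ K $ 2)
      - (1/2) * ((\<Sum>k\<in>UNIV. v $ K $ k * t K k J 2) * u $ J $ 3 - (\<Sum>k\<in>UNIV. v $ K $ k * t K k J 3) * u $ J $ 2)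
      = W x I J K \<bullet> cross3 (u $ J) (v $ K)"
      unfolding e inner_vec_def sum_3 W cross3_def 33 s by (simp add: 33 s field_simps)
  qed
  finally show ?thesis .
qed

end

subsection \<open>The Gibbons-Hawking metric and its complex structures\<close>

lemma matrix_inv_mult:
  fixes A :: "real^'n^'n"
  assumes "invertible A"
  shows "A ** matrix_inv A = mat 1" "matrix_inv A ** A = mat 1"
proof -
  have "\<exists>A'. A ** A' = mat 1 \<and> A' ** A = mat 1" using assms by (simp add: invertible_def)
  from someI_ex[OF this] show "A ** matrix_inv A = mat 1" "matrix_inv A ** A = mat 1"
    unfolding matrix_inv_def by blast+
qed

text \<open>Cramer's rule. It presents the inverse as a quotient of determinants, from which its
  smoothness is evident.\<close>

lemma matrix_inv_entry:
  fixes A :: "real^'n^'n"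
  assumes "invertible A"
  shows "matrix_inv A $ i $ j = det (\<chi> a b. if b = i then axis j 1 $ a else A $ a $ b) / det A"
proof -
  have "A *v (matrix_inv A *v axis j 1) = axis j 1"
    by (simp add: matrix_vector_mul_assoc matrix_inv_mult[OF assms])
  moreover have "det A \<noteq> 0" using assms invertible_det_nz by blast
  ultimately have "matrix_inv A *v axis j 1 = (\<chi> k. det(\<chi> a b. if b=k then axis j 1 $ a else A$a$b) / det A)"
    using cramer by blast
  then have "(matrix_inv A *v axis j 1) $ i = det(\<chi> a b. if b=i then axis j 1 $ a else A$a$b) / det A"
    by simp
  moreover have "(matrix_inv A *v axis j 1) $ i = matrix_inv A $ i $ j"
    by (simp add: matrix_vector_mult_def axis_def if_distrib cong: if_cong)
  ultimately show ?thesis by simp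
qed

lemma smooth_on_det:
  fixes A :: "'a::real_normed_vector \<Rightarrow> real^'n^'n"
  assumes "open M" "\<And>i j. smooth_on M (\<lambda>p. A p $ i $ j)"
  shows "smooth_on M (\<lambda>p. det (A p))"
  unfolding det_def by (intro smooth_intros assms)

lemma smooth_on_matrix_inv:
  fixes A :: "'a::real_normed_vector \<Rightarrow> real^'n^'n"
  assumes "open M" "\<And>i j. smooth_on M (\<lambda>p. A p $ i $ j)" "\<And>p. p \<in> M \<Longrightarrow> invertible (A p)"
  shows "smooth_on M (\<lambda>p. matrix_inv (A p) $ i $ j)"
proof -
  have "smooth_on M (\<lambda>p. det (\<chi> a b. if b = i then axis j 1 $ a else A p $ a $ b) / det (A p))"
  proof (intro smooth_on_divide smooth_on_det assms)
    show "smooth_on M (\<lambda>p. (\<chi> a b. if b = i then axis j 1 $ a else A p $ a $ b) $ a $ b)" for a b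
      using assms(1,2) by (cases "b = i") (simp_all add: smooth_on_const)
    show "det (A p) \<noteq> 0" if "p \<in> M" for p using assms(3)[OF that] invertible_det_nz by blast
  qed
  then show ?thesis
    using smooth_on_cong[OF assms(1), of "\<lambda>p. matrix_inv (A p) $ i $ j"] matrix_inv_entry[OF assms(3)] by simp
qed

lemma symmetric_matrix_inner:
  fixes A :: "real^'n^'n"
  assumes "transpose A = A"
  shows "(A *v s) \<bullet> t = s \<bullet> (A *v t)"
  using dot_lmul_matrix[of s A t] transpose_matrix_vector[of A s] assms by simp

text \<open>The operators below separate the two factors of the configuration space:
  \<open>slice a\<close> and \<open>tens a\<close> are adjoint to each other,
  \<open>crossv a\<close> acts on the space factor only, \<open>blockmul A\<close> on the index
  factor only, and the last two therefore commute.\<close>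

definition slice :: "real^3 \<Rightarrow> (real^3)^'i::finite \<Rightarrow> real^'i" where
  "slice a v = (\<chi> I. v $ I \<bullet> a)"

definition tens :: "real^3 \<Rightarrow> real^'i::finite \<Rightarrow> (real^3)^'i" where
  "tens a t = (\<chi> I. t $ I *\<^sub>R a)"

definition crossv :: "real^3 \<Rightarrow> (real^3)^'i::finite \<Rightarrow> (real^3)^'i" where
  "crossv a v = (\<chi> I. cross3 a (v $ I))"

definition blockmul :: "real^'i^'i::finite \<Rightarrow> (real^3)^'i \<Rightarrow> (real^3)^'i" where
  "blockmul A v = (\<chi> I. \<Sum>J\<in>UNIV. A $ I $ J *\<^sub>R v $ J)"

lemma slice_blockmul: "slice a (blockmul A v) = A *v slice a v"
  by (simp add: slice_def blockmul_def vec_eq_iff matrix_vector_mult_def inner_sum_left)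

lemma tens_inner: "tens a t \<bullet> v = t \<bullet> slice a v"
  by (simp add: tens_def slice_def inner_vec_def[of "_ :: (real^3)^_"] inner_vec_def[of "_ :: real^_" "\<chi> I. _ I"] inner_commute)

lemma cross_sum_right: "cross3 a (\<Sum>i\<in>S. f i) = (\<Sum>i\<in>S. cross3 a (f i))"
  by (induction S rule: infinite_finite_induct) (auto simp: cross_add_right)

lemma crossv_blockmul: "crossv a (blockmul A v) = blockmul A (crossv a v)"
  by (simp add: crossv_def blockmul_def vec_eq_iff[where 'a="real^3"] cross_sum_right cross_mult_right)

lemma crossv_inner: "crossv a v \<bullet> w = - (v \<bullet> crossv a w)"
proof -
  have "cross3 a x \<bullet> y = - (x \<bullet> cross3 a y)" for x y by (simp add: cross3_simps)
  then show ?thesis by (simp add: crossv_def inner_vec_def[where 'a="real^3"] sum_negf)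
qed

lemma blockmul_inner:
  assumes "transpose A = A"
  shows "blockmul A v \<bullet> w = v \<bullet> blockmul A w"
proof -
  have s: "A $ I $ J = A $ J $ I" for I J using assms by (simp add: transpose_def vec_eq_iff)
  have "blockmul A v \<bullet> w = (\<Sum>I\<in>UNIV. \<Sum>J\<in>UNIV. A $ I $ J * (v $ J \<bullet> w $ I))"
    by (simp add: blockmul_def inner_vec_def[where 'a="real^3"] inner_sum_left)
  also have "\<dots> = (\<Sum>I\<in>UNIV. \<Sum>J\<in>UNIV. A $ J $ I * (v $ I \<bullet> w $ J))"
    by (rule sum.swap)
  also have "\<dots> = v \<bullet> blockmul A w"
    by (simp add: blockmul_def inner_vec_def[where 'a="real^3"] inner_sum_right s)
  finally show ?thesis .
qed

lemma linear_slice: "linear (slice a)"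
  and linear_tens: "linear (tens a)"
  and linear_crossv: "linear (crossv a)"
  and linear_blockmul: "linear (blockmul A)"
  by (auto intro!: linearI simp: slice_def tens_def crossv_def blockmul_def vec_eq_iff[where 'a="real^3"]
      vec_eq_iff[where 'a=real] inner_add_left scaleR_add_left cross_add_right cross_mult_right
      scaleR_add_right sum.distrib scaleR_sum_right mult.commute)

lemma slice_eq_0D: "(\<And>a. slice a v = 0) \<Longrightarrow> v = 0"
  by (metis (no_types, lifting) inner_eq_zero_iff slice_def vec_eq_iff vec_lambda_beta zero_index)

lemma tens_slice_crossv:
  "crossv a (crossv b v) = tens b (slice a v) - (a \<bullet> b) *\<^sub>R v"
  "crossv a (tens b t) = tens (cross3 a b) t"
  "slice a (crossv b v) = slice (cross3 a b) v"
  "slice a (tens b t) = (a \<bullet> b) *\<^sub>R t"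
  "crossv (cross3 a b) v = tens b (slice a v) - tens a (slice b v)"
  "slice 0 v = 0" "tens 0 t = 0"
proof -
  have c: "cross3 a (cross3 b x) = (x \<bullet> a) *\<^sub>R b - (a \<bullet> b) *\<^sub>R x"
    "cross3 (cross3 a b) x = (x \<bullet> a) *\<^sub>R b - (x \<bullet> b) *\<^sub>R a"
    "cross3 b x \<bullet> a = x \<bullet> cross3 a b" "a \<bullet> cross3 b x = x \<bullet> cross3 a b" for x
    by (simp_all add: vec_eq_iff forall_3 cross3_simps)
  show "crossv a (crossv b v) = tens b (slice a v) - (a \<bullet> b) *\<^sub>R v"
    "crossv a (tens b t) = tens (cross3 a b) t"
    "crossv (cross3 a b) v = tens b (slice a v) - tens a (slice b v)"
    by (simp_all add: tens_def slice_def crossv_def vec_eq_iff[where 'a="real^3"] c cross_mult_right)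
  show "slice 0 v = 0" "tens 0 t = 0" by (simp_all add: tens_def slice_def vec_eq_iff)
  show "slice a (crossv b v) = slice (cross3 a b) v" "slice a (tens b t) = (a \<bullet> b) *\<^sub>R t"
    by (simp_all add: vec_eq_iff tens_def slice_def crossv_def c inner_commute[of b] mult.commute)
qed

lemma transpose_matrix_inv:
  fixes A :: "real^'n^'n"
  assumes "invertible A" "transpose A = A"
  shows "transpose (matrix_inv A) = matrix_inv A"
proof -
  have "transpose (matrix_inv A) ** A = transpose (A ** matrix_inv A)"
    by (simp add: matrix_transpose_mul assms(2))
  also have "\<dots> = mat 1" by (simp add: matrix_inv_mult[OF assms(1)])
  finally have "transpose (matrix_inv A) ** A = mat 1" .
  then have "transpose (matrix_inv A) ** A ** matrix_inv A = matrix_inv A" by simp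
  then show ?thesis
    by (simp add: matrix_mul_assoc[symmetric] matrix_inv_mult[OF assms(1)])
qed

lemma dird_fst:
  assumes "f differentiable (at (fst p))"
  shows "((\<lambda>q. f (fst q)) has_derivative (\<lambda>u. dird f (fst p) (fst u))) (at p)"
  by (rule has_derivative_compose[OF has_derivative_fst[OF has_derivative_ident] has_derivative_dird[OF assms]])

lemma smooth_on_compose_fst:
  fixes S :: "'a::euclidean_space set"
  assumes "open S" "smooth_on S f"
  shows "smooth_on (S \<times> UNIV) (\<lambda>p :: 'a \<times> 'b::euclidean_space. f (fst p))"
  by (rule smooth_on_compose[OF _ _ _ assms(2)])
    (auto intro!: smooth_intros open_Times assms(1))

context gh_space
begin

abbreviation H where "H x \<equiv> higgs L x"
abbreviation V where "V x \<equiv> matrix_inv (higgs L x)"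
abbreviation Mt :: "'n total set" where "Mt \<equiv> S \<times> UNIV"

definition th :: "'n total \<Rightarrow> 'n total \<Rightarrow> real^('n option)" where
  "th p v = snd v + A (fst p) (fst v)"

lemma theta_th: "theta L \<phi> I p v = th p v $ I"
  by (simp add: theta_def th_def A_def)

lemma open_Mt: "open Mt" by (intro open_Times open_S) simp

lemma inv_H: "x \<in> S \<Longrightarrow> invertible (H x)"
proof -
  assume x: "x \<in> S"
  have "H x = (- (1/2)) *\<^sub>R hessian_xx L x" by (simp add: vec_eq_iff higgs_def)
  then show ?thesis using scalar_invertible[OF _ invertible_hessian[OF x], of "- (1/2)"] by simp
qed

lemma transpose_H: "x \<in> S \<Longrightarrow> transpose (H x) = H x"
  using D2_commute[OF open_S smooth_L] by (simp add: transpose_def vec_eq_iff higgs_D2)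

lemma transpose_V: "x \<in> S \<Longrightarrow> transpose (V x) = V x"
  by (rule transpose_matrix_inv[OF inv_H transpose_H])

lemma HV: "x \<in> S \<Longrightarrow> H x *v (V x *v t) = t" and VH: "x \<in> S \<Longrightarrow> V x *v (H x *v t) = t"
  by (simp_all add: matrix_vector_mul_assoc matrix_inv_mult inv_H)

lemma V_inner: "x \<in> S \<Longrightarrow> (V x *v s) \<bullet> t = s \<bullet> (V x *v t)"
  and blockH_inner: "x \<in> S \<Longrightarrow> blockmul (H x) v \<bullet> w = v \<bullet> blockmul (H x) w"
  by (simp_all add: symmetric_matrix_inner blockmul_inner transpose_H transpose_V)

lemma linear_th: "fst p \<in> S \<Longrightarrow> linear (th p)"
  by (rule linearI) (auto simp: th_def linear_add[OF linear_A] linear_scale[OF linear_A] scaleR_add_right)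

abbreviation G where "G \<equiv> gh_metric L \<phi>"
abbreviation Om where "Om \<equiv> sympl L \<phi>"

lemma gh_metric_eq:
  assumes "fst p \<in> S"
  shows "G p v w = blockmul (H (fst p)) (fst v) \<bullet> fst w + (V (fst p) *v th p v) \<bullet> th p w"
proof -
  let ?x = "fst p"
  have h: "(\<Sum>I\<in>UNIV. \<Sum>J\<in>UNIV. H ?x $ I $ J * (a $ I \<bullet> b $ J)) = a \<bullet> blockmul (H ?x) b" for a b :: "'n config"
    by (simp add: blockmul_def inner_vec_def[where 'a="real^3"] inner_sum_right)
  have v: "(\<Sum>I\<in>UNIV. \<Sum>J\<in>UNIV. V ?x $ I $ J * (s $ I * t $ J)) = (V ?x *v t) \<bullet> s" for s t
    by (simp add: matrix_vector_mult_def inner_vec_def sum_distrib_right sum_distrib_left mult_ac)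
  have "(\<Sum>I\<in>UNIV. \<Sum>J\<in>UNIV. H ?x $ I $ J * (\<Sum>i\<in>UNIV. sprod (\<lambda>t. fst t $ I $ i) (\<lambda>t. fst t $ J $ i) v w))
     = (\<Sum>I\<in>UNIV. \<Sum>J\<in>UNIV. H ?x $ I $ J * (fst v $ I \<bullet> fst w $ J)) + (\<Sum>I\<in>UNIV. \<Sum>J\<in>UNIV. H ?x $ I $ J * (fst w $ I \<bullet> fst v $ J))"
    by (simp add: sprod_def inner_vec_def sum.distrib distrib_left mult.commute)
  also have "\<dots> = 2 * (blockmul (H ?x) (fst v) \<bullet> fst w)"
    unfolding h using blockH_inner[OF assms, of "fst v" "fst w"] blockH_inner[OF assms, of "fst w" "fst v"]
    by (simp add: inner_commute)
  finally have 1: "(\<Sum>I\<in>UNIV. \<Sum>J\<in>UNIV. H ?x $ I $ J * (\<Sum>i\<in>UNIV. sprod (\<lambda>t. fst t $ I $ i) (\<lambda>t. fst t $ J $ i) v w))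
     = 2 * (blockmul (H ?x) (fst v) \<bullet> fst w)" .
  have "(\<Sum>I\<in>UNIV. \<Sum>J\<in>UNIV. V ?x $ I $ J * sprod (theta L \<phi> I p) (theta L \<phi> J p) v w)
    = (\<Sum>I\<in>UNIV. \<Sum>J\<in>UNIV. V ?x $ I $ J * (th p v $ I * th p w $ J)) + (\<Sum>I\<in>UNIV. \<Sum>J\<in>UNIV. V ?x $ I $ J * (th p w $ I * th p v $ J))"
    by (simp add: sprod_def theta_th sum.distrib distrib_left mult.commute)
  also have "\<dots> = 2 * ((V ?x *v th p v) \<bullet> th p w)"
    unfolding v using V_inner[OF assms, of "th p v" "th p w"] by (simp add: inner_commute)
  finally have 2: "(\<Sum>I\<in>UNIV. \<Sum>J\<in>UNIV. V ?x $ I $ J * sprod (theta L \<phi> I p) (theta L \<phi> J p) v w)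
    = 2 * ((V ?x *v th p v) \<bullet> th p w)" .
  show ?thesis unfolding gh_metric_def 1 2 by simp
qed

lemma sympl_eq:
  "Om p v w = - (\<Sum>I\<in>UNIV. \<Sum>J\<in>UNIV. H (fst p) $ I $ J *\<^sub>R cross3 (fst v $ I) (fst w $ J))
     - (\<Sum>K\<in>UNIV. th p w $ K *\<^sub>R fst v $ K - th p v $ K *\<^sub>R fst w $ K)"
  if "fst p \<in> S"
proof -
  let ?x = "fst p"
  have "(\<Sum>I\<in>UNIV. \<Sum>J\<in>UNIV. H ?x $ I $ J *\<^sub>R cross3 (fst w $ I) (fst v $ J))
     = (\<Sum>I\<in>UNIV. \<Sum>J\<in>UNIV. H ?x $ J $ I *\<^sub>R cross3 (fst w $ J) (fst v $ I))"
    by (rule sum.swap)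
  also have "\<dots> = - (\<Sum>I\<in>UNIV. \<Sum>J\<in>UNIV. H ?x $ I $ J *\<^sub>R cross3 (fst v $ I) (fst w $ J))"
  proof -
    have "H ?x $ J $ I *\<^sub>R cross3 (fst w $ J) (fst v $ I) = - (H ?x $ I $ J *\<^sub>R cross3 (fst v $ I) (fst w $ J))" for I J
    proof -
      have "transpose (H ?x) $ I $ J = H ?x $ I $ J" unfolding transpose_H[OF that] ..
      then have "H ?x $ J $ I = H ?x $ I $ J" by (simp add: transpose_def)
      then show ?thesis by (subst cross_skew) simp
    qed
    then show ?thesis by (simp add: sum_negf)
  qed
  finally have s: "(\<Sum>I\<in>UNIV. \<Sum>J\<in>UNIV. H ?x $ I $ J *\<^sub>R cross3 (fst w $ I) (fst v $ J)) =
     - (\<Sum>I\<in>UNIV. \<Sum>J\<in>UNIV. H ?x $ I $ J *\<^sub>R cross3 (fst v $ I) (fst w $ J))" .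
  have "(\<Sum>I\<in>UNIV. \<Sum>J\<in>UNIV. H ?x $ I $ J *\<^sub>R cross_wedge (\<lambda>t. fst t $ I) (\<lambda>t. fst t $ J) v w)
     = 2 *\<^sub>R (\<Sum>I\<in>UNIV. \<Sum>J\<in>UNIV. H ?x $ I $ J *\<^sub>R cross3 (fst v $ I) (fst w $ J))"
    unfolding cross_wedge_def by (simp add: scaleR_diff_right sum_subtractf s scaleR_2)
  then show ?thesis unfolding sympl_def by (simp add: wedge_def theta_th)
qed

lemma sympl_inner:
  assumes "fst p \<in> S"
  shows "Om p v w \<bullet> e = blockmul (H (fst p)) (fst v) \<bullet> crossv e (fst w)
     - th p w \<bullet> slice e (fst v) + th p v \<bullet> slice e (fst w)"
proof -
  let ?x = "fst p"
  have c: "- (cross3 a b \<bullet> e) = b \<bullet> cross3 a e" "b \<bullet> cross3 a e = a \<bullet> cross3 e b" for a b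
    by (simp_all add: cross3_simps)
  have "(\<Sum>I\<in>UNIV. \<Sum>J\<in>UNIV. H ?x $ I $ J *\<^sub>R cross3 (fst v $ I) (fst w $ J)) \<bullet> e
     = (\<Sum>I\<in>UNIV. \<Sum>J\<in>UNIV. - (H ?x $ I $ J * (fst v $ I \<bullet> cross3 e (fst w $ J))))"
    unfolding c(2)[symmetric] c(1)[symmetric] by (simp add: inner_sum_left)
  also have "\<dots> = - (fst v \<bullet> blockmul (H ?x) (crossv e (fst w)))"
    by (simp add: blockmul_def crossv_def inner_vec_def[where 'a="real^3"] inner_sum_right sum_negf)
  finally have 1: "(\<Sum>I\<in>UNIV. \<Sum>J\<in>UNIV. H ?x $ I $ J *\<^sub>R cross3 (fst v $ I) (fst w $ J)) \<bullet> e
     = - (blockmul (H ?x) (fst v) \<bullet> crossv e (fst w))"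
    using blockH_inner[OF assms] by simp
  have 2: "(\<Sum>K\<in>UNIV. th p w $ K *\<^sub>R fst v $ K - th p v $ K *\<^sub>R fst w $ K) \<bullet> e
     = th p w \<bullet> slice e (fst v) - th p v \<bullet> slice e (fst w)"
    by (simp add: slice_def inner_vec_def[where 'a=real and 'b="'n option"] inner_sum_left inner_diff_left sum_subtractf)
  show ?thesis unfolding sympl_eq[OF assms] inner_diff_left inner_minus_left 1 2 by simp
qed

definition lift :: "'n total \<Rightarrow> 'n config \<Rightarrow> real^('n option) \<Rightarrow> 'n total" where
  "lift p h t = (h, t - A (fst p) h)"

lemma fst_lift [simp]: "fst (lift p h t) = h" and th_lift [simp]: "th p (lift p h t) = t"
  by (simp_all add: lift_def th_def)

lemma total_eqI: "fst v = fst w \<Longrightarrow> th p v = th p w \<Longrightarrow> v = w"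
  by (simp add: th_def prod_eq_iff)

text \<open>Forced by the requirement that the form contracted with \<open>e\<close> be the metric
  applied to \<open>Js e p w\<close>: both components are read off from \<open>sympl_inner\<close>
  and the block form \<open>gh_metric_eq\<close> of the metric.\<close>

definition Js :: "real^3 \<Rightarrow> 'n total \<Rightarrow> 'n total \<Rightarrow> 'n total" where
  "Js e p w = lift p (crossv e (fst w) - tens e (V (fst p) *v th p w)) (H (fst p) *v slice e (fst w))"

lemma fst_Js [simp]: "fst (Js e p w) = crossv e (fst w) - tens e (V (fst p) *v th p w)"
  and th_Js [simp]: "th p (Js e p w) = H (fst p) *v slice e (fst w)"
  by (simp_all add: Js_def)

lemma sympl_Js:
  assumes "fst p \<in> S"
  shows "Om p v w \<bullet> e = G p v (Js e p w)"
proof -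
  have "blockmul (H (fst p)) (fst v) \<bullet> tens e (V (fst p) *v th p w) = th p w \<bullet> slice e (fst v)"
    using tens_inner[of e "V (fst p) *v th p w" "blockmul (H (fst p)) (fst v)"] V_inner[OF assms]
    by (simp add: inner_commute slice_blockmul VH[OF assms])
  moreover have "(V (fst p) *v th p v) \<bullet> (H (fst p) *v slice e (fst w)) = th p v \<bullet> slice e (fst w)"
    using V_inner[OF assms] VH[OF assms] by simp
  ultimately show ?thesis
    unfolding sympl_inner[OF assms] gh_metric_eq[OF assms] by (simp add: inner_diff_right)
qed

lemma Js_Js:
  assumes "fst p \<in> S" 
  shows "a \<bullet> b = 0 \<Longrightarrow> Js a p (Js b p w) = Js (cross3 a b) p w"
    and "a \<bullet> a = 1 \<Longrightarrow> Js a p (Js a p w) = - w"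
  by (rule total_eqI[of _ _ p];
      simp add: VH HV assms linear_diff[OF linear_crossv] linear_diff[OF linear_slice] tens_slice_crossv
        linear_diff[OF linear_tens] linear_neg[OF linear_th[OF assms]] matrix_vector_mult_diff_distrib
        linear_0[OF linear_tens] linear_0[OF linear_slice] cross_refl linear_neg[OF matrix_vector_mul_linear])+

lemma linear_Js: "fst p \<in> S \<Longrightarrow> linear (Js e p)"
proof -
  assume p: "fst p \<in> S"
  have "linear (\<lambda>w. V (fst p) *v th p w)" "linear (\<lambda>w. H (fst p) *v slice e (fst w))"
    using linear_compose[OF linear_th[OF p] matrix_vector_mul_linear]
      linear_compose[OF linear_compose[OF linear_fst linear_slice] matrix_vector_mul_linear]
    by (simp_all add: o_def)
  note l = this
  note l1 = linear_compose[OF l(1) linear_tens, unfolded o_def]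
  show ?thesis
    by (rule linearI; rule total_eqI[of _ _ p])
      (simp_all add: linear_add[OF linear_th[OF p]] linear_scale[OF linear_th[OF p]] linear_add[OF linear_crossv]
        linear_scale[OF linear_crossv] linear_add[OF l1] linear_scale[OF l1] linear_add[OF l(2)] linear_scale[OF l(2)]
        matrix_vector_right_distrib linear_add[OF linear_tens] linear_scale[OF linear_tens]
        linear_add[OF linear_slice] linear_scale[OF linear_slice] matrix_vector_mult_scaleR scaleR_diff_right)
qed

end

section \<open>Closedness of the symplectic forms and the hyperkaehler structure\<close>

lemma sum_triple_swap12:
  "(\<Sum>I\<in>A. \<Sum>J\<in>B. \<Sum>K\<in>C. f I J K) = (\<Sum>J\<in>B. \<Sum>I\<in>A. \<Sum>K\<in>C. f I J K)"
  by (rule sum.swap)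

lemma sum_triple_swap23:
  "(\<Sum>I\<in>A. \<Sum>J\<in>B. \<Sum>K\<in>C. f I J K) = (\<Sum>I\<in>A. \<Sum>K\<in>C. \<Sum>J\<in>B. f I J K)"
  by (intro sum.cong refl sum.swap)

text \<open>Both sides equal det(a, b, c) d: they expand \<open>d\<close> in the basis dual to
  \<open>a\<close>, \<open>b\<close>, \<open>c\<close> and in that basis itself.\<close>

lemma cross3_cyclic:
  "(d \<bullet> a) *\<^sub>R cross3 b c + (d \<bullet> b) *\<^sub>R cross3 c a + (d \<bullet> c) *\<^sub>R cross3 a b =
   (d \<bullet> cross3 a b) *\<^sub>R c + (d \<bullet> cross3 b c) *\<^sub>R a + (d \<bullet> cross3 c a) *\<^sub>R b"
  by (simp add: vec_eq_iff forall_3 cross3_simps)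

lemma jacobi_cross3: "cross3 a (cross3 b c) = cross3 (cross3 a b) c + cross3 b (cross3 a c)"
  by (simp add: vec_eq_iff forall_3 cross3_simps)

context gh_space
begin

text \<open>A cyclic relabelling of the summation indices leaves \<open>W\<close> unchanged by its
  total symmetry. It brings the terms of an exterior derivative under one sum.\<close>

lemma W_rot:
  assumes "x \<in> S"
  shows "(\<Sum>I\<in>UNIV. \<Sum>J\<in>UNIV. \<Sum>K\<in>UNIV. g (W x I J K) I J K) =
     (\<Sum>I\<in>UNIV. \<Sum>J\<in>UNIV. \<Sum>K\<in>UNIV. g (W x I J K) J K I)" (is ?l)
    and "(\<Sum>I\<in>UNIV. \<Sum>J\<in>UNIV. \<Sum>K\<in>UNIV. g (W x I J K) I J K) =
     (\<Sum>I\<in>UNIV. \<Sum>J\<in>UNIV. \<Sum>K\<in>UNIV. g (W x I J K) K I J)" (is ?r)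
proof -
  have *: "(\<Sum>I\<in>UNIV. \<Sum>J\<in>UNIV. \<Sum>K\<in>UNIV. g (W x I J K) I J K) =
     (\<Sum>I\<in>UNIV. \<Sum>J\<in>UNIV. \<Sum>K\<in>UNIV. g (W x I J K) J K I)" for g :: "real^3 \<Rightarrow> 'n option \<Rightarrow> 'n option \<Rightarrow> 'n option \<Rightarrow> 'a"
  proof -
    have "(\<Sum>I\<in>UNIV. \<Sum>J\<in>UNIV. \<Sum>K\<in>UNIV. g (W x I J K) J K I)
      = (\<Sum>J\<in>UNIV. \<Sum>I\<in>UNIV. \<Sum>K\<in>UNIV. g (W x I J K) J K I)"
      by (rule sum_triple_swap12)
    also have "\<dots> = (\<Sum>J\<in>UNIV. \<Sum>K\<in>UNIV. \<Sum>I\<in>UNIV. g (W x I J K) J K I)"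
      by (rule sum_triple_swap23)
    also have "\<dots> = (\<Sum>J\<in>UNIV. \<Sum>K\<in>UNIV. \<Sum>I\<in>UNIV. g (W x J K I) J K I)"
    proof -
      have eq: "W x I J K = W x J K I" for I J K
        using W_sym1[OF assms, of I J K] W_sym2[OF assms, of J I K] by simp
      show ?thesis by (intro sum.cong refl arg_cong[where f="\<lambda>w. g w _ _ _"] eq)
    qed
    finally show ?thesis by simp
  qed
  show ?l by (rule *)
  show ?r by (subst *, subst *) simp
qed

lemma smooth_V: "smooth_on S (\<lambda>x. V x $ I $ J)"
  by (rule smooth_on_matrix_inv[OF open_S smooth_higgs inv_H])

lemma smooth_theta: "smooth_on Mt (\<lambda>p. theta L \<phi> I p v)"
  unfolding theta_th th_def vector_add_component
  by (intro smooth_intros open_Mt smooth_on_compose_fst[OF open_S] smooth_A smooth_on_nth[OF open_S])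

lemma smooth_gh_metric: "smooth_on Mt (\<lambda>p. G p u v)"
  unfolding gh_metric_def sprod_def
  by (intro smooth_intros open_Mt smooth_on_compose_fst[OF open_S smooth_higgs]
      smooth_on_compose_fst[OF open_S smooth_V] smooth_theta)

lemma smooth_sympl: "smooth_on Mt (\<lambda>p. Om p u v)"
  unfolding sympl_def wedge_def
  by (intro smooth_intros open_Mt smooth_on_compose_fst[OF open_S smooth_higgs] smooth_theta)

lemma bilinear_gh_metric: "p \<in> Mt \<Longrightarrow> bilinear (G p)"
  unfolding bilinear_def
proof (intro conjI allI linearI)
  assume "p \<in> Mt"
  then have p: "fst p \<in> S" by auto
  note l = linear_add[OF linear_th[OF p]] linear_scale[OF linear_th[OF p]] linear_add[OF linear_blockmul]
    linear_scale[OF linear_blockmul] inner_add_left inner_add_right matrix_vector_right_distrib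
    matrix_vector_mult_scaleR
  fix v w u :: "'n total" and c
  show "G p v (w + u) = G p v w + G p v u" "G p v (c *\<^sub>R w) = c *\<^sub>R G p v w"
    "G p (v + u) w = G p v w + G p u w" "G p (c *\<^sub>R v) w = c *\<^sub>R G p v w"
    by (simp_all add: gh_metric_eq[OF p] l algebra_simps)
qed

lemma pseudo_metric_gh: "pseudo_metric_on Mt G"
  unfolding pseudo_metric_on_def
proof (intro conjI ballI allI impI)
  fix p assume p': "p \<in> Mt"
  then have p: "fst p \<in> S" by auto
  show "bilinear (G p)" by (rule bilinear_gh_metric[OF p'])
  show "G p u v = G p v u" for u v
    unfolding gh_metric_eq[OF p]
    using blockH_inner[OF p, of "fst u" "fst v"] V_inner[OF p, of "th p u" "th p v"] by (simp add: inner_commute)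
  fix u assume u: "\<forall>v. G p u v = 0"
  have 1: "blockmul (H (fst p)) (fst u) = 0"
  proof -
    have "G p u (lift p (blockmul (H (fst p)) (fst u)) 0) = 0" using u by blast
    then show ?thesis by (simp add: gh_metric_eq[OF p])
  qed
  have 2: "V (fst p) *v th p u = 0"
  proof -
    have "G p u (lift p 0 (V (fst p) *v th p u)) = 0" using u by blast
    then show ?thesis by (simp add: gh_metric_eq[OF p])
  qed
  have "th p u = 0" using HV[OF p, of "th p u"] 2 by simp
  moreover have "fst u = 0"
  proof (rule slice_eq_0D)
    fix a
    have "H (fst p) *v slice a (fst u) = 0"
      unfolding slice_blockmul[symmetric] 1 by (rule linear_0[OF linear_slice])
    then show "slice a (fst u) = 0" using VH[OF p, of "slice a (fst u)"] by simp
  qed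
  ultimately show "u = 0" using total_eqI[of u 0 p] linear_0[OF linear_th[OF p]] by simp
qed (rule smooth_gh_metric)

lemma has_derivative_H:
  assumes "p \<in> Mt"
  shows "((\<lambda>q. H (fst q) $ I $ J) has_derivative (\<lambda>u. \<Sum>K\<in>UNIV. W (fst p) I J K \<bullet> fst u $ K)) (at p)"
proof -
  have "fst p \<in> S" using assms by auto
  from dird_fst[OF smooth_on_differentiable[OF smooth_higgs[of I J] this]] show ?thesis
    by (simp add: dU[OF \<open>fst p \<in> S\<close>])
qed

lemma has_derivative_th:
  assumes "p \<in> Mt"
  shows "((\<lambda>q. th q v) has_derivative (\<lambda>u. B (fst p) (fst u) (fst v))) (at p)"
proof -
  have "fst p \<in> S" using assms by auto
  from dird_fst[OF smooth_on_differentiable[OF smooth_A this]] 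
  have "((\<lambda>q. snd v + A (fst q) (fst v)) has_derivative (\<lambda>u. 0 + B (fst p) (fst u) (fst v))) (at p)"
    by (intro has_derivative_add has_derivative_const) (simp add: B_def)
  then show ?thesis by (simp add: th_def)
qed

lemma dird_sympl:
  assumes p: "p \<in> Mt"
  shows "dird (\<lambda>q. Om q v w) p u =
    - (\<Sum>I\<in>UNIV. \<Sum>J\<in>UNIV. (\<Sum>K\<in>UNIV. W (fst p) I J K \<bullet> fst u $ K) *\<^sub>R cross3 (fst v $ I) (fst w $ J))
     - (\<Sum>K\<in>UNIV. B (fst p) (fst u) (fst w) $ K *\<^sub>R fst v $ K - B (fst p) (fst u) (fst v) $ K *\<^sub>R fst w $ K)"
proof -
  have "dird (\<lambda>q. Om q v w) p u = dird (\<lambda>q.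
     - (\<Sum>I\<in>UNIV. \<Sum>J\<in>UNIV. H (fst q) $ I $ J *\<^sub>R cross3 (fst v $ I) (fst w $ J))
     - (\<Sum>K\<in>UNIV. th q w $ K *\<^sub>R fst v $ K - th q v $ K *\<^sub>R fst w $ K)) p u"
    by (rule dird_cong_open[OF open_Mt p]) (auto intro!: sympl_eq)
  also have "\<dots> = - (\<Sum>I\<in>UNIV. \<Sum>J\<in>UNIV. (\<Sum>K\<in>UNIV. W (fst p) I J K \<bullet> fst u $ K) *\<^sub>R cross3 (fst v $ I) (fst w $ J))
     - (\<Sum>K\<in>UNIV. B (fst p) (fst u) (fst w) $ K *\<^sub>R fst v $ K - B (fst p) (fst u) (fst v) $ K *\<^sub>R fst w $ K)"
    by (rule dird_eq)
      (intro has_derivative_diff has_derivative_minus has_derivative_sum has_derivative_scaleR_left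
        has_derivative_H[OF p] bounded_linear.has_derivative[OF bounded_linear_vec_nth has_derivative_th[OF p]])
  finally show ?thesis .
qed

lemma closed_sympl: "closed_2form_on Mt Om"
  unfolding closed_2form_on_def
proof (intro conjI ballI allI)
  fix p assume p': "p \<in> Mt"
  then have p: "fst p \<in> S" by auto
  note l = linear_add[OF linear_th[OF p]] linear_scale[OF linear_th[OF p]]
  show "bilinear (Om p)"
    unfolding bilinear_def
  proof (intro conjI allI linearI)
    fix v w u :: "'n total" and c
    show "Om p v (w + u) = Om p v w + Om p v u" "Om p v (c *\<^sub>R w) = c *\<^sub>R Om p v w"
      "Om p (v + u) w = Om p v w + Om p u w" "Om p (c *\<^sub>R v) w = c *\<^sub>R Om p v w"
      by (simp_all add: sympl_eq[OF p] l cross_add_left cross_add_right cross_mult_left cross_mult_right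
          algebra_simps sum.distrib sum_subtractf scaleR_sum_right)
  qed
  show "Om p u v = - Om p v u" for u v
  proof -
    have "Om p u v \<bullet> e = - (Om p v u \<bullet> e)" for e
      unfolding sympl_inner[OF p]
      using blockH_inner[OF p, of "fst u" "crossv e (fst v)"] crossv_inner[of e "fst u" "blockmul (H (fst p)) (fst v)"]
      by (simp add: crossv_blockmul inner_commute)
    then have "(Om p u v + Om p v u) \<bullet> e = 0" for e by (simp add: inner_add_left)
    then have "Om p u v + Om p v u = 0" using inner_eq_zero_iff by blast
    then show ?thesis by (simp add: eq_neg_iff_add_eq_0)
  qed
  fix u v w :: "'n total"
  let ?x = "fst p" and ?u = "fst u" and ?v = "fst v" and ?w = "fst w"
  \<comment> \<open>\<open>?Q\<close> is the contribution of the differentiated Higgs field and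
    \<open>?F\<close> that of the curvature. Closedness says that their cyclic sums agree, which
    after relabelling is \<open>cross3_cyclic\<close> under the sum.\<close>
  let ?Q = "\<lambda>a b c. \<Sum>I\<in>UNIV. \<Sum>J\<in>UNIV. (\<Sum>K\<in>UNIV. W ?x I J K \<bullet> a $ K) *\<^sub>R cross3 (b $ I) (c $ J)"
  let ?F = "\<lambda>a b c. \<Sum>K\<in>UNIV. (B ?x a b - B ?x b a) $ K *\<^sub>R c $ K"
  have F: "?F a b c = (\<Sum>I\<in>UNIV. \<Sum>J\<in>UNIV. \<Sum>K\<in>UNIV. (W ?x I J K \<bullet> cross3 (a $ J) (b $ K)) *\<^sub>R c $ I)" for a b c :: "'n config"
    unfolding curvature[OF p] by (simp add: scaleR_sum_left)
  have Q: "?Q a b c = (\<Sum>I\<in>UNIV. \<Sum>J\<in>UNIV. \<Sum>K\<in>UNIV. (W ?x I J K \<bullet> a $ K) *\<^sub>R cross3 (b $ I) (c $ J))" for a b c :: "'n config"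
    by (simp add: scaleR_sum_left)
  let ?T = "\<lambda>f. \<Sum>I\<in>UNIV. \<Sum>J\<in>UNIV. \<Sum>K\<in>UNIV. f (W ?x I J K) (?u $ I) (?v $ J) (?w $ K)"
  have c: "?Q ?u ?v ?w = ?T (\<lambda>d a b c. (d \<bullet> a) *\<^sub>R cross3 b c)" "?Q ?v ?w ?u = ?T (\<lambda>d a b c. (d \<bullet> b) *\<^sub>R cross3 c a)"
    "?Q ?w ?u ?v = ?T (\<lambda>d a b c. (d \<bullet> c) *\<^sub>R cross3 a b)"
    "?F ?u ?v ?w = ?T (\<lambda>d a b c. (d \<bullet> cross3 a b) *\<^sub>R c)" "?F ?v ?w ?u = ?T (\<lambda>d a b c. (d \<bullet> cross3 b c) *\<^sub>R a)"
    "?F ?w ?u ?v = ?T (\<lambda>d a b c. (d \<bullet> cross3 c a) *\<^sub>R b)"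
    unfolding Q F
    using W_rot(1)[OF p, of "\<lambda>d I J K. (d \<bullet> ?u $ K) *\<^sub>R cross3 (?v $ I) (?w $ J)"]
      W_rot(2)[OF p, of "\<lambda>d I J K. (d \<bullet> ?v $ K) *\<^sub>R cross3 (?w $ I) (?u $ J)"]
      W_rot(2)[OF p, of "\<lambda>d I J K. (d \<bullet> cross3 (?u $ J) (?v $ K)) *\<^sub>R ?w $ I"]
      W_rot(1)[OF p, of "\<lambda>d I J K. (d \<bullet> cross3 (?w $ J) (?u $ K)) *\<^sub>R ?v $ I"]
    by simp_all
  have "?Q ?u ?v ?w + ?Q ?v ?w ?u + ?Q ?w ?u ?v =
     ?T (\<lambda>d a b c. (d \<bullet> a) *\<^sub>R cross3 b c + (d \<bullet> b) *\<^sub>R cross3 c a + (d \<bullet> c) *\<^sub>R cross3 a b)"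
    unfolding c by (simp add: sum.distrib)
  also have "\<dots> = ?F ?u ?v ?w + ?F ?v ?w ?u + ?F ?w ?u ?v"
    unfolding cross3_cyclic c by (simp add: sum.distrib)
  finally have QF: "?Q ?u ?v ?w + ?Q ?v ?w ?u + ?Q ?w ?u ?v = ?F ?u ?v ?w + ?F ?v ?w ?u + ?F ?w ?u ?v" .
  have "dird (\<lambda>q. Om q v w) p u + dird (\<lambda>q. Om q w u) p v + dird (\<lambda>q. Om q u v) p w =
     ?F ?u ?v ?w + ?F ?v ?w ?u + ?F ?w ?u ?v - (?Q ?u ?v ?w + ?Q ?v ?w ?u + ?Q ?w ?u ?v)"
    unfolding dird_sympl[OF p'] by (simp add: sum.distrib sum_subtractf scaleR_diff_left)
  then show "dird (\<lambda>q. Om q v w) p u + dird (\<lambda>q. Om q w u) p v + dird (\<lambda>q. Om q u v) p w = 0"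
    using QF by simp
qed (rule smooth_sympl)

lemma smooth_Js: "smooth_on Mt (\<lambda>p. Js e p v)"
proof -
  have t: "smooth_on Mt (\<lambda>p. th p v $ I)" for I
    using smooth_theta[of I v] by (simp add: theta_th)
  have h: "smooth_on Mt (\<lambda>p. crossv e (fst v) - tens e (V (fst p) *v th p v))" (is "smooth_on Mt ?h")
    unfolding crossv_def tens_def matrix_vector_mult_def
    by (rule smooth_on_vec[OF open_Mt], simp, intro smooth_intros open_Mt t smooth_on_compose_fst[OF open_S smooth_V])
  have "smooth_on Mt (\<lambda>p. A (fst p) (?h p))"
    by (rule smooth_on_field_apply[OF open_Mt _ _ h])
      (auto intro: linear_A smooth_on_compose_fst[OF open_S smooth_A])
  moreover have "smooth_on Mt (\<lambda>p. H (fst p) *v slice e (fst v))"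
    unfolding matrix_vector_mult_def
    by (rule smooth_on_vec[OF open_Mt], simp, intro smooth_intros open_Mt smooth_on_compose_fst[OF open_S smooth_higgs])
  ultimately show ?thesis unfolding Js_def lift_def by (intro smooth_on_Pair smooth_on_diff open_Mt h)
qed

lemma hyperkaehler_gh: "hyperkaehler_on Mt G Om"
  unfolding hyperkaehler_on_def
proof (intro conjI exI[of _ "\<lambda>i. Js (axis i 1)"] allI ballI)
  let ?J = "\<lambda>i. Js (axis (i::3) (1::real))"
  have comp: "Om p u v $ i = G p u (?J i p v)" if "p \<in> Mt" for p u v i
    using sympl_Js[of p u v "axis i 1"] that by (auto simp: inner_axis)
  have sq: "?J i p (?J i p v) = - v" if "p \<in> Mt" for i p v
    using that by (intro Js_Js(2)) (auto simp: inner_axis_axis)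
  have prod: "?J 1 p (?J 2 p v) = ?J 3 p v" "?J 2 p (?J 1 p v) = - ?J 3 p v" if "p \<in> Mt" for p v
  proof -
    have p: "fst p \<in> S" using that by auto
    have "Js (- axis 3 1) p v = - Js (axis 3 1) p v"
      by (rule total_eqI[of _ _ p])
        (simp_all add: linear_neg[OF linear_th[OF p]] crossv_def tens_def slice_def vec_eq_iff matrix_vector_mult_def sum_negf)
    then show "?J 1 p (?J 2 p v) = ?J 3 p v" "?J 2 p (?J 1 p v) = - ?J 3 p v"
      using Js_Js(1)[OF p, of "axis 1 1" "axis 2 1" v] Js_Js(1)[OF p, of "axis 2 1" "axis 1 1" v]
      by (simp_all add: cross_basis inner_axis_axis)
  qed
  have skew: "Om p u v = - Om p v u" if "p \<in> Mt" for p u v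
    using closed_sympl that unfolding closed_2form_on_def by blast
  \<comment> \<open>A structure that squares to -1 and whose associated form is skew is
    orthogonal.\<close>
  have orth: "G p (?J i p u) (?J i p v) = G p u v" if "p \<in> Mt" for p i u v
  proof -
    note PM = pseudo_metricD[OF pseudo_metric_gh that]
    have "G p (?J i p u) (?J i p v) = - Om p v (?J i p u) $ i"
      using comp[OF that, of "?J i p u" v i] skew[OF that, of "?J i p u" v] by simp
    also have "\<dots> = - G p v (- u)" using comp[OF that] sq[OF that] by simp
    finally show ?thesis using PM(2)[of u v] linear_neg[OF bilinear_linear_right[OF PM(1)]] by simp
  qed
  have lin: "linear (?J i p)" if "p \<in> Mt" for i p using that by (intro linear_Js) auto
  show "open Mt" "pseudo_metric_on Mt G" "closed_2form_on Mt Om"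
    by (rule open_Mt pseudo_metric_gh closed_sympl)+
  show "smooth_on Mt (\<lambda>p. ?J i p v)" for i v by (rule smooth_Js)
  fix p assume p: "p \<in> Mt"
  show "linear (?J i p)" "Om p u v $ i = G p u (?J i p v)" "G p (?J i p u) (?J i p v) = G p u v"
    "?J i p (?J i p v) = - v" "?J 1 p (?J 2 p v) = ?J 3 p v" "?J 2 p (?J 1 p v) = - ?J 3 p v" for i u v
    by (rule lin comp orth sq prod p)+
  show "dird (\<lambda>q. ?J i q v) p u + christoffel G p u (?J i p v) - ?J i p (christoffel G p u v) = 0" for i u v
    by (rule parallel_complex_structures[where J="?J", OF open_Mt pseudo_metric_gh closed_sympl smooth_Js lin comp orth sq prod p])
qed

end

subsection \<open>Hyperkaehler cones\<close>

locale gh_cone = gh_space S L \<phi> for S :: "'n::finite config set" and L \<phi> +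
  assumes higgs_homogeneous: "x \<in> S \<Longrightarrow> dird (\<lambda>y. higgs L y $ I $ J) x x = - higgs L x $ I $ J"
    and higgs_rotation: "x \<in> S \<Longrightarrow> dird (\<lambda>y. higgs L y $ I $ J) x (crossv a x) = 0"
begin

lemma W_hom: "x \<in> S \<Longrightarrow> (\<Sum>K\<in>UNIV. W x I J K \<bullet> x $ K) = - U x I J"
  using higgs_homogeneous[of x I J] dU[of x I J x] by simp

lemma W_rotation: "x \<in> S \<Longrightarrow> (\<Sum>K\<in>UNIV. cross3 (W x I J K) (x $ K)) = 0"
proof -
  assume x: "x \<in> S"
  have "(\<Sum>K\<in>UNIV. cross3 (W x I J K) (x $ K)) \<bullet> a = 0" for a
  proof -
    have "cross3 w y \<bullet> a = - (w \<bullet> cross3 a y)" for w y by (simp add: cross3_simps)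
    then have "(\<Sum>K\<in>UNIV. cross3 (W x I J K) (x $ K)) \<bullet> a = - (\<Sum>K\<in>UNIV. W x I J K \<bullet> crossv a x $ K)"
      by (simp add: inner_sum_left crossv_def sum_negf)
    then show ?thesis using higgs_rotation[OF x, of I J a] dU[OF x, of I J "crossv a x"] by simp
  qed
  then show ?thesis using inner_eq_zero_iff by blast
qed

lemma W_rotation_inner: "x \<in> S \<Longrightarrow> (\<Sum>K\<in>UNIV. W x I J K \<bullet> cross3 (x $ K) c) = 0"
proof -
  assume x: "x \<in> S"
  have "w \<bullet> cross3 y c = cross3 w y \<bullet> c" for w y by (simp add: cross3_simps)
  then have "(\<Sum>K\<in>UNIV. W x I J K \<bullet> cross3 (x $ K) c) = (\<Sum>K\<in>UNIV. cross3 (W x I J K) (x $ K)) \<bullet> c"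
    by (simp add: inner_sum_left)
  then show ?thesis using W_rotation[OF x] by simp
qed

section \<open>The lifted scaling and rotations\<close>

text \<open>The vertical part of the lifted rotation about \<open>a\<close>. By
  \<open>dird_mu_curvature\<close> its differential is the contraction of the curvature with the
  rotation field, which is what makes the lift preserve the connection.\<close>

definition mu :: "real^3 \<Rightarrow> 'n config \<Rightarrow> real^('n option)" where
  "mu a x = H x *v slice a x"

text \<open>Scalings lift horizontally, because the curvature contracted with the scaling field
  vanishes (\<open>curvature_scaling\<close>).\<close>

definition Sc :: "'n total \<Rightarrow> 'n total" where
  "Sc p = lift p (fst p) 0"

definition Rt :: "real^3 \<Rightarrow> 'n total \<Rightarrow> 'n total" where
  "Rt a p = lift p (crossv a (fst p)) (mu a (fst p))"

lemma fst_Sc [simp]: "fst (Sc p) = fst p" and th_Sc [simp]: "th p (Sc p) = 0"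
  and fst_Rt [simp]: "fst (Rt a p) = crossv a (fst p)" and th_Rt [simp]: "th p (Rt a p) = mu a (fst p)"
  by (simp_all add: Sc_def Rt_def)

lemma bounded_linear_crossv: "bounded_linear (crossv a :: _ \<Rightarrow> (real^3)^'i::finite)"
  by (rule linear_conv_bounded_linear[THEN iffD1, OF linear_crossv])

lemma smooth_mu: "smooth_on S (mu a)"
  unfolding mu_def matrix_vector_mult_def slice_def
  by (rule smooth_on_vec[OF open_S], simp, intro smooth_intros open_S smooth_higgs)

lemma dird_mu:
  assumes x: "x \<in> S"
  shows "dird (mu a) x v $ I = (\<Sum>J\<in>UNIV. (\<Sum>K\<in>UNIV. W x I J K \<bullet> v $ K) * (x $ J \<bullet> a)) + (H x *v slice a v) $ I"
proof -
  have "dird (mu a) x v $ I = dird (\<lambda>y. mu a y $ I) x v"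
    by (rule dird_bounded_linear[OF bounded_linear_vec_nth smooth_on_differentiable[OF smooth_mu x], symmetric])
  also have "\<dots> = (\<Sum>J\<in>UNIV. U x I J * (v $ J \<bullet> a) + dird (\<lambda>y. U y I J) x v * (x $ J \<bullet> a))"
    unfolding mu_def matrix_vector_mult_def slice_def vec_lambda_beta
    by (rule dird_eq)
      (intro has_derivative_sum has_derivative_mult smooth_on_has_derivative[OF smooth_higgs x]
        has_derivative_inner_left bounded_linear_imp_has_derivative bounded_linear_vec_nth)
  finally show ?thesis
    by (simp add: dU[OF x] matrix_vector_mult_def slice_def sum.distrib)
qed

lemma dird_mu_curvature:
  assumes x: "x \<in> S"
  shows "dird (mu a) x v = B x v (crossv a x) - B x (crossv a x) v"
proof -
  have "dird (mu a) x v $ I = (B x v (crossv a x) - B x (crossv a x) v) $ I" for I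
  proof -
    \<comment> \<open>The double cross product splits into a term for \<open>W_hom\<close>, the
      derivative of the Higgs field that occurs in \<open>dird_mu\<close>, and a term that
      \<open>W_rotation_inner\<close> kills.\<close>
    have id: "w \<bullet> cross3 c (cross3 a y) = - ((w \<bullet> y) * (c \<bullet> a)) + (w \<bullet> c) * (y \<bullet> a) - w \<bullet> cross3 y (cross3 c a)" for w c y
      by (simp add: cross3_simps)
    have "(B x v (crossv a x) - B x (crossv a x) v) $ I =
      (\<Sum>J\<in>UNIV. \<Sum>K\<in>UNIV. - ((W x I J K \<bullet> x $ K) * (v $ J \<bullet> a)) + (W x I J K \<bullet> v $ J) * (x $ K \<bullet> a)
         - W x I J K \<bullet> cross3 (x $ K) (cross3 (v $ J) a))"
      unfolding curvature[OF x] crossv_def vec_lambda_beta id ..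
    also have "\<dots> = - (\<Sum>J\<in>UNIV. (\<Sum>K\<in>UNIV. W x I J K \<bullet> x $ K) * (v $ J \<bullet> a))
       + (\<Sum>J\<in>UNIV. \<Sum>K\<in>UNIV. (W x I J K \<bullet> v $ J) * (x $ K \<bullet> a))
       - (\<Sum>J\<in>UNIV. \<Sum>K\<in>UNIV. W x I J K \<bullet> cross3 (x $ K) (cross3 (v $ J) a))"
      by (simp add: sum.distrib sum_subtractf sum_negf sum_distrib_right)
    also have "(\<Sum>J\<in>UNIV. \<Sum>K\<in>UNIV. W x I J K \<bullet> cross3 (x $ K) (cross3 (v $ J) a)) = 0"
      by (simp add: W_rotation_inner[OF x])
    also have "(\<Sum>J\<in>UNIV. \<Sum>K\<in>UNIV. (W x I J K \<bullet> v $ J) * (x $ K \<bullet> a)) =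
       (\<Sum>K\<in>UNIV. (\<Sum>J\<in>UNIV. W x I K J \<bullet> v $ J) * (x $ K \<bullet> a))"
      unfolding sum_distrib_right
    proof (subst sum.swap, intro sum.cong refl)
      fix J K
      show "(W x I K J \<bullet> v $ K) * (x $ J \<bullet> a) = (W x I J K \<bullet> v $ K) * (x $ J \<bullet> a)"
        by (simp only: W_sym2[OF x, of I K J])
    qed
    finally show ?thesis
      unfolding dird_mu[OF x] W_hom[OF x]
      by (simp add: matrix_vector_mult_def slice_def sum_negf)
  qed
  then show ?thesis by (simp add: vec_eq_iff)
qed

lemma curvature_scaling: "x \<in> S \<Longrightarrow> B x x v = B x v x"
proof -
  assume x: "x \<in> S"
  have "(B x x v - B x v x) $ I = 0" for I
  proof -
    have "(B x x v - B x v x) $ I = (\<Sum>K\<in>UNIV. \<Sum>J\<in>UNIV. W x I J K \<bullet> cross3 (x $ J) (v $ K))"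
      unfolding curvature[OF x] by (rule sum.swap)
    also have "\<dots> = (\<Sum>K\<in>UNIV. \<Sum>J\<in>UNIV. W x I K J \<bullet> cross3 (x $ J) (v $ K))"
      by (intro sum.cong refl arg_cong2[where f="(\<bullet>)"] W_sym2[OF x])
    also have "\<dots> = 0" by (simp add: W_rotation_inner[OF x])
    finally show ?thesis .
  qed
  then show ?thesis by (simp add: vec_eq_iff)
qed

lemma dird_mu_rotation: "x \<in> S \<Longrightarrow> dird (mu a) x (crossv b x) = mu (cross3 a b) x"
  using dird_mu[of x a "crossv b x"] higgs_rotation[of x _ _ b] dU[of x _ _ "crossv b x"]
  by (simp add: vec_eq_iff mu_def tens_slice_crossv)

text \<open>The connection term inside \<open>lift\<close> is differentiated as well. Its
  contribution \<open>- B\<close> is not tensorial by itself; in Lie brackets it antisymmetrises to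
  the curvature.\<close>

lemma dird_lift:
  assumes p: "p \<in> Mt" and h: "smooth_on S h" and t: "smooth_on S t"
  shows "fst (dird (\<lambda>q. lift q (h (fst q)) (t (fst q))) p u) = dird h (fst p) (fst u)"
    and "th p (dird (\<lambda>q. lift q (h (fst q)) (t (fst q))) p u) = dird t (fst p) (fst u) - B (fst p) (fst u) (h (fst p))"
proof -
  have x: "fst p \<in> S" using p by auto
  let ?x = "fst p"
  have dA: "dird (\<lambda>y. A y (h y)) ?x v = dird (\<lambda>y. A y (h ?x)) ?x v + A ?x (dird h ?x v)"
    "(\<lambda>y. A y (h y)) differentiable (at ?x)" for v
    by (rule dird_field_apply[OF open_S x linear_A]; use smooth_on_differentiable[OF _ x] smooth_A h in blast)+
  have "((\<lambda>q. lift q (h (fst q)) (t (fst q))) has_derivative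
     (\<lambda>u. (dird h ?x (fst u), dird t ?x (fst u) - dird (\<lambda>y. A y (h y)) ?x (fst u)))) (at p)"
    unfolding lift_def
    by (intro has_derivative_Pair has_derivative_diff dird_fst smooth_on_differentiable[OF _ x] h t dird_fst[OF dA(2)])
  from dird_eq[OF this, of u]
  have d: "dird (\<lambda>q. lift q (h (fst q)) (t (fst q))) p u =
    (dird h ?x (fst u), dird t ?x (fst u) - dird (\<lambda>y. A y (h y)) ?x (fst u))" .
  show "fst (dird (\<lambda>q. lift q (h (fst q)) (t (fst q))) p u) = dird h (fst p) (fst u)" by (simp add: d)
  show "th p (dird (\<lambda>q. lift q (h (fst q)) (t (fst q))) p u) = dird t (fst p) (fst u) - B (fst p) (fst u) (h (fst p))"
    by (simp add: d th_def dA(1) B_def)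
qed

lemma dird_Sc:
  assumes "p \<in> Mt"
  shows "fst (dird Sc p u) = fst u" "th p (dird Sc p u) = - B (fst p) (fst u) (fst p)"
proof -
  have id: "dird (\<lambda>x. x) x v = v" for x v :: "'n config" by (rule dird_eq) simp
  have 0: "dird (\<lambda>x. 0 :: real^'n option) x v = 0" for x v :: "'n config" by (rule dird_eq) simp
  show "fst (dird Sc p u) = fst u" "th p (dird Sc p u) = - B (fst p) (fst u) (fst p)"
    using dird_lift[OF assms smooth_on_id[OF open_S] smooth_on_const[OF open_S, of 0], of u]
    by (simp_all add: Sc_def[abs_def] id 0)
qed

lemma dird_Rt:
  assumes p: "p \<in> Mt"
  shows "fst (dird (Rt a) p u) = crossv a (fst u)"
    "th p (dird (Rt a) p u) = - B (fst p) (crossv a (fst p)) (fst u)"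
proof -
  have x: "fst p \<in> S" using p by auto
  have c: "dird (crossv a) x v = crossv a v" for x v :: "'n config"
    by (rule dird_eq[OF bounded_linear_imp_has_derivative[OF bounded_linear_crossv]])
  show "fst (dird (Rt a) p u) = crossv a (fst u)"
    "th p (dird (Rt a) p u) = - B (fst p) (crossv a (fst p)) (fst u)"
    using dird_lift[OF assms smooth_on_linear[OF open_S bounded_linear_crossv] smooth_mu, of a a u]
    by (simp_all add: Rt_def[abs_def] c dird_mu_curvature[OF x])
qed

lemma smooth_lift:
  assumes "smooth_on S h" "smooth_on S t"
  shows "smooth_on Mt (\<lambda>q. lift q (h (fst q)) (t (fst q)))"
  unfolding lift_def
  by (intro smooth_on_Pair smooth_on_diff open_Mt smooth_on_compose_fst[OF open_S] assms
      smooth_on_field_apply[OF open_S linear_A smooth_A])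

lemma smooth_Sc: "smooth_on Mt Sc"
  unfolding Sc_def[abs_def] by (rule smooth_lift[OF smooth_on_id[OF open_S] smooth_on_const[OF open_S]])

lemma smooth_Rt: "smooth_on Mt (Rt a)"
  unfolding Rt_def[abs_def]
  by (rule smooth_lift[OF smooth_on_linear[OF open_S bounded_linear_crossv] smooth_mu])

lemma lie_Sc_Rt: "p \<in> Mt \<Longrightarrow> lie_bracket Sc (Rt a) p = 0"
proof -
  assume p: "p \<in> Mt"
  then have x: "fst p \<in> S" by auto
  show ?thesis unfolding lie_bracket_def
    by (rule total_eqI[of _ _ p])
      (simp_all add: dird_Sc[OF p] dird_Rt[OF p] linear_diff[OF linear_th[OF x]] linear_0[OF linear_th[OF x]])
qed

lemma lie_Rt_Rt: "p \<in> Mt \<Longrightarrow> lie_bracket (Rt a) (Rt b) p = - Rt (cross3 a b) p"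
proof -
  assume p: "p \<in> Mt"
  then have x: "fst p \<in> S" by auto
  have "crossv b (crossv a y) - crossv a (crossv b y) = - crossv (cross3 a b) y" for y :: "'n config"
    unfolding tens_slice_crossv by (simp add: inner_commute)
  moreover have "- B (fst p) (crossv b (fst p)) (crossv a (fst p)) + B (fst p) (crossv a (fst p)) (crossv b (fst p))
    = - mu (cross3 a b) (fst p)"
    unfolding dird_mu_rotation[OF x, of a b, symmetric] dird_mu_curvature[OF x, of a "crossv b (fst p)"] by simp
  ultimately show ?thesis unfolding lie_bracket_def
    by (intro total_eqI[of _ _ p])
      (simp_all add: dird_Rt[OF p] linear_diff[OF linear_th[OF x]] linear_neg[OF linear_th[OF x]])
qed

lemma linear_Rt: "p \<in> Mt \<Longrightarrow> linear (\<lambda>a. Rt a p)"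
proof -
  assume p: "p \<in> Mt"
  then have x: "fst p \<in> S" by auto
  have s: "slice (a + b) y = slice a y + slice b y" "slice (c *\<^sub>R a) y = c *\<^sub>R slice a y"
    "crossv (a + b) y = crossv a y + crossv b y" "crossv (c *\<^sub>R a) y = c *\<^sub>R crossv a y" for a b c and y :: "'n config"
    by (simp_all add: slice_def crossv_def vec_eq_iff inner_add_right cross_add_left cross_mult_left)
  show ?thesis
    by (rule linearI; rule total_eqI[of _ _ p])
      (simp_all add: linear_add[OF linear_th[OF x]] linear_scale[OF linear_th[OF x]] mu_def s
        matrix_vector_right_distrib matrix_vector_mult_scaleR)
qed

lemma lie_deriv_sympl:
  assumes p: "p \<in> Mt"
  shows "lie_deriv_form (Rt a) Om p u v = cross3 a (Om p u v)"
proof -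
  have x: "fst p \<in> S" using p by auto
  let ?x = "fst p" and ?\<xi> = "crossv a (fst p)"
  have W0: "(\<Sum>K\<in>UNIV. W ?x I J K \<bullet> ?\<xi> $ K) = 0" for I J
    using higgs_rotation[OF x, of I J a] dU[OF x] by simp
  have "lie_deriv_form (Rt a) Om p u v =
     - (\<Sum>I\<in>UNIV. \<Sum>J\<in>UNIV. H ?x $ I $ J *\<^sub>R (cross3 (cross3 a (fst u $ I)) (fst v $ J) + cross3 (fst u $ I) (cross3 a (fst v $ J))))
     - (\<Sum>K\<in>UNIV. th p v $ K *\<^sub>R cross3 a (fst u $ K) - th p u $ K *\<^sub>R cross3 a (fst v $ K))"
    unfolding lie_deriv_form_def dird_sympl[OF p] sympl_eq[OF x] fst_Rt W0 dird_Rt[OF p]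
    by (simp add: crossv_def scaleR_add_right sum.distrib sum_subtractf sum_negf)
  also have "\<dots> = cross3 a (Om p u v)"
    unfolding sympl_eq[OF x] jacobi_cross3[symmetric]
    by (simp add: Cross3.right_diff_distrib cross_sum_right cross_mult_right)
  finally show ?thesis .
qed

lemma dird_metric:
  assumes p: "p \<in> Mt"
  shows "dird (\<lambda>q. G q v w) p u =
    (\<Sum>I\<in>UNIV. \<Sum>J\<in>UNIV. (\<Sum>K\<in>UNIV. W (fst p) I J K \<bullet> fst u $ K) * (fst v $ J \<bullet> fst w $ I))
    - (\<Sum>I\<in>UNIV. \<Sum>J\<in>UNIV. (\<Sum>K\<in>UNIV. W (fst p) I J K \<bullet> fst u $ K) *
         ((V (fst p) *v th p v) $ J * (V (fst p) *v th p w) $ I))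
    + (V (fst p) *v B (fst p) (fst u) (fst v)) \<bullet> th p w + (V (fst p) *v th p v) \<bullet> B (fst p) (fst u) (fst w)"
proof -
  let ?x = "fst p"
  have x: "?x \<in> S" using p by auto
  have lV: "linear ((*v) (V y))" and lH: "linear ((*v) (H y))" for y by (rule matrix_vector_mul_linear)+
  have smV: "smooth_on Mt (\<lambda>q. V (fst q) *v t)" for t
    unfolding matrix_vector_mult_def
    by (rule smooth_on_vec[OF open_Mt], simp, intro smooth_intros open_Mt smooth_on_compose_fst[OF open_S smooth_V])
  have smH: "smooth_on Mt (\<lambda>q. H (fst q) *v t)" for t
    unfolding matrix_vector_mult_def
    by (rule smooth_on_vec[OF open_Mt], simp, intro smooth_intros open_Mt smooth_on_compose_fst[OF open_S smooth_higgs])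
  note d = smooth_on_differentiable[OF _ p]
  have dth: "(\<lambda>q. th q v) differentiable (at p)" for v using has_derivative_th[OF p] differentiableI by blast
  have dirdth: "dird (\<lambda>q. th q v) p u = B ?x (fst u) (fst v)" for v by (rule dird_eq[OF has_derivative_th[OF p]])
  define DH where "DH t = dird (\<lambda>q. H (fst q) *v t) p u" for t
  have DH: "DH t $ I = (\<Sum>J\<in>UNIV. (\<Sum>K\<in>UNIV. W ?x I J K \<bullet> fst u $ K) * t $ J)" for t I
  proof -
    have "DH t $ I = dird (\<lambda>q. (H (fst q) *v t) $ I) p u"
      unfolding DH_def by (rule dird_bounded_linear[OF bounded_linear_vec_nth d[OF smH], symmetric])
    also have "\<dots> = (\<Sum>J\<in>UNIV. (\<Sum>K\<in>UNIV. W ?x I J K \<bullet> fst u $ K) * t $ J)"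
      unfolding matrix_vector_mult_def vec_lambda_beta
      by (rule dird_eq) (intro has_derivative_sum has_derivative_mult_left has_derivative_H[OF p])
    finally show ?thesis .
  qed
  \<comment> \<open>Obtained by differentiating the relation H V = 1.\<close>
  have DV: "dird (\<lambda>q. V (fst q) *v t) p u = - (V ?x *v DH (V ?x *v t))" for t
  proof -
    have "dird (\<lambda>q. H (fst q) *v (V (fst q) *v t)) p u = dird (\<lambda>q. t) p u"
      by (rule dird_cong_open[OF open_Mt p]) (auto simp: HV)
    also have "\<dots> = 0" by (rule dird_eq) simp
    also have "dird (\<lambda>q. H (fst q) *v (V (fst q) *v t)) p u = DH (V ?x *v t) + H ?x *v dird (\<lambda>q. V (fst q) *v t) p u"
      unfolding DH_def by (rule dird_field_apply(1)[OF open_Mt p lH d[OF smH] d[OF smV]])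
    finally have "H ?x *v dird (\<lambda>q. V (fst q) *v t) p u = - DH (V ?x *v t)"
      by (simp add: eq_neg_iff_add_eq_0 add.commute)
    then have "V ?x *v (H ?x *v dird (\<lambda>q. V (fst q) *v t) p u) = V ?x *v (- DH (V ?x *v t))" by simp
    then show ?thesis by (simp add: VH[OF x] linear_neg[OF lV])
  qed
  have Vth: "((\<lambda>q. V (fst q) *v th q v) has_derivative dird (\<lambda>q. V (fst q) *v th q v) p) (at p)"
    by (rule has_derivative_dird[OF dird_field_apply(2)[OF open_Mt p lV d[OF smV] dth]])
  have dVth: "dird (\<lambda>q. V (fst q) *v th q v) p u = - (V ?x *v DH (V ?x *v th p v)) + V ?x *v B ?x (fst u) (fst v)"
    unfolding dird_field_apply(1)[OF open_Mt p lV d[OF smV] dth] DV dirdth ..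
  have 1: "dird (\<lambda>q. (V (fst q) *v th q v) \<bullet> th q w) p u =
     (V ?x *v th p v) \<bullet> B ?x (fst u) (fst w) + (- (V ?x *v DH (V ?x *v th p v)) + V ?x *v B ?x (fst u) (fst v)) \<bullet> th p w"
  proof -
    have "dird (\<lambda>q. (V (fst q) *v th q v) \<bullet> th q w) p u =
      (V ?x *v th p v) \<bullet> dird (\<lambda>q. th q w) p u + dird (\<lambda>q. V (fst q) *v th q v) p u \<bullet> th p w"
      by (rule dird_eq[OF has_derivative_inner[OF Vth has_derivative_dird[OF dth]]])
    then show ?thesis unfolding dVth dirdth .
  qed
  have 2: "((\<lambda>q. \<Sum>I\<in>UNIV. \<Sum>J\<in>UNIV. H (fst q) $ I $ J * (fst v $ J \<bullet> fst w $ I)) has_derivative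
     (\<lambda>u. \<Sum>I\<in>UNIV. \<Sum>J\<in>UNIV. (\<Sum>K\<in>UNIV. W ?x I J K \<bullet> fst u $ K) * (fst v $ J \<bullet> fst w $ I))) (at p)"
    by (intro has_derivative_sum has_derivative_mult_left has_derivative_H[OF p])
  have "dird (\<lambda>q. G q v w) p u = dird (\<lambda>q. (\<Sum>I\<in>UNIV. \<Sum>J\<in>UNIV. H (fst q) $ I $ J * (fst v $ J \<bullet> fst w $ I))
      + (V (fst q) *v th q v) \<bullet> th q w) p u"
    by (rule dird_cong_open[OF open_Mt p])
      (auto simp: gh_metric_eq blockmul_def inner_vec_def[where 'a="real^3"] inner_sum_left)
  also have "\<dots> = (\<Sum>I\<in>UNIV. \<Sum>J\<in>UNIV. (\<Sum>K\<in>UNIV. W ?x I J K \<bullet> fst u $ K) * (fst v $ J \<bullet> fst w $ I))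
      + dird (\<lambda>q. (V (fst q) *v th q v) \<bullet> th q w) p u"
    by (rule dird_eq[OF has_derivative_add[OF 2 has_derivative_dird[OF differentiableI[OF
              has_derivative_inner[OF Vth has_derivative_dird[OF dth]]]]]])
  also have "(V ?x *v DH (V ?x *v th p v)) \<bullet> th p w =
     (\<Sum>I\<in>UNIV. \<Sum>J\<in>UNIV. (\<Sum>K\<in>UNIV. W ?x I J K \<bullet> fst u $ K) * ((V ?x *v th p v) $ J * (V ?x *v th p w) $ I))"
    unfolding V_inner[OF x] inner_vec_def[of "DH _"] DH by (simp add: sum_distrib_right mult.assoc)
  note VD = this
  show ?thesis unfolding calculation 1 by (simp add: inner_add_left inner_diff_left VD)
qed

lemma levi_civita_Sc:
  assumes p: "p \<in> Mt"
  shows "levi_civita G p Y (\<lambda>q. 2 *\<^sub>R Sc q) = Y"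
proof -
  let ?x = "fst p"
  have x: "?x \<in> S" using p by auto
  let ?X = "2 *\<^sub>R Sc p"
  note PM = pseudo_metricD[OF pseudo_metric_gh p]
  have dX: "dird (\<lambda>q. 2 *\<^sub>R Sc q) p Y = 2 *\<^sub>R dird Sc p Y"
    by (rule dird_bounded_linear[OF bounded_linear_scaleR_right smooth_on_differentiable[OF smooth_Sc p]])
  have thX: "th p ?X = 0" and fX: "fst ?X = 2 *\<^sub>R ?x" by (simp_all add: linear_scale[OF linear_th[OF x]])
  have lB: "B ?x a (c *\<^sub>R b) = c *\<^sub>R B ?x a b" "B ?x (c *\<^sub>R b) a = c *\<^sub>R B ?x b a" for a b c
  proof -
    have "linear (\<lambda>b. B ?x a b)" unfolding B_def
      by (rule linear_dird_param[OF open_S x linear_A smooth_on_differentiable[OF smooth_A x]])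
    then show "B ?x a (c *\<^sub>R b) = c *\<^sub>R B ?x a b" by (rule linear_scale)
    show "B ?x (c *\<^sub>R b) a = c *\<^sub>R B ?x b a"
      unfolding B_def by (rule linear_scale[OF smooth_on_linear_dird[OF smooth_A x]])
  qed
  have "christoffel G p Y ?X = Y - dird (\<lambda>q. 2 *\<^sub>R Sc q) p Y"
  proof (rule pseudo_metric_eqI[OF pseudo_metric_gh p])
    fix Z :: "'n total"
    \<comment> \<open>By the total symmetry of \<open>W\<close> the two sums differ by a sum of
      double cross products with \<open>?x\<close>, which rotation invariance kills. They are the
      first and the last term of the Koszul formula, which enter it with opposite signs.\<close>
    have cyc: "(\<Sum>I\<in>UNIV. \<Sum>J\<in>UNIV. (\<Sum>K\<in>UNIV. W ?x I J K \<bullet> fst Y $ K) * (fst ?X $ J \<bullet> fst Z $ I))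
       = (\<Sum>I\<in>UNIV. \<Sum>J\<in>UNIV. (\<Sum>K\<in>UNIV. W ?x I J K \<bullet> fst Z $ K) * (fst Y $ J \<bullet> fst ?X $ I))" (is "?a = ?b")
    proof -
      have "?a = (\<Sum>I\<in>UNIV. \<Sum>J\<in>UNIV. \<Sum>K\<in>UNIV. (W ?x I J K \<bullet> fst Y $ K) * (fst ?X $ J \<bullet> fst Z $ I))"
        by (simp add: sum_distrib_right)
      also have "\<dots> = (\<Sum>I\<in>UNIV. \<Sum>J\<in>UNIV. \<Sum>K\<in>UNIV. (W ?x I J K \<bullet> fst Y $ J) * (fst ?X $ I \<bullet> fst Z $ K))"
        by (rule W_rot(2)[OF x, of "\<lambda>w I J K. (w \<bullet> fst Y $ K) * (fst ?X $ J \<bullet> fst Z $ I)"])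
      also have "\<dots> = (\<Sum>I\<in>UNIV. \<Sum>J\<in>UNIV. \<Sum>K\<in>UNIV. (W ?x I J K \<bullet> fst Z $ K) * (fst Y $ J \<bullet> fst ?X $ I)
          + 2 * (W ?x I J K \<bullet> cross3 (?x $ I) (cross3 (fst Y $ J) (fst Z $ K))))"
      proof (intro sum.cong refl)
        fix I J K
        show "(W ?x I J K \<bullet> fst Y $ J) * (fst ?X $ I \<bullet> fst Z $ K) = (W ?x I J K \<bullet> fst Z $ K) * (fst Y $ J \<bullet> fst ?X $ I)
          + 2 * (W ?x I J K \<bullet> cross3 (?x $ I) (cross3 (fst Y $ J) (fst Z $ K)))"
          unfolding fX by (simp add: cross3_simps)
      qed
      also have "\<dots> = ?b + 2 * (\<Sum>I\<in>UNIV. \<Sum>J\<in>UNIV. \<Sum>K\<in>UNIV. (W ?x I J K \<bullet> cross3 (?x $ I) (cross3 (fst Y $ J) (fst Z $ K))))"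
        by (simp add: sum.distrib sum_distrib_right sum_distrib_left)
      also have "(\<Sum>I\<in>UNIV. \<Sum>J\<in>UNIV. \<Sum>K\<in>UNIV. (W ?x I J K \<bullet> cross3 (?x $ I) (cross3 (fst Y $ J) (fst Z $ K))))
         = (\<Sum>I\<in>UNIV. \<Sum>J\<in>UNIV. \<Sum>K\<in>UNIV. (W ?x I J K \<bullet> cross3 (?x $ K) (cross3 (fst Y $ I) (fst Z $ J))))"
        by (rule W_rot(2)[OF x, of "\<lambda>w I J K. w \<bullet> cross3 (?x $ I) (cross3 (fst Y $ J) (fst Z $ K))"])
      also have "\<dots> = 0" by (simp add: W_rotation_inner[OF x])
      finally show ?thesis by simp
    qed
    have "2 * G p (christoffel G p Y ?X) Z =
       dird (\<lambda>q. G q ?X Z) p Y + dird (\<lambda>q. G q Y Z) p ?X - dird (\<lambda>q. G q Y ?X) p Z"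
      by (rule christoffel_koszul[OF open_Mt pseudo_metric_gh p])
    also have "dird (\<lambda>q. G q ?X Z) p Y = ?a + 2 * ((V ?x *v B ?x (fst Y) ?x) \<bullet> th p Z)"
      unfolding dird_metric[OF p] thX fX by (simp add: lB matrix_vector_mult_scaleR)
    also have "dird (\<lambda>q. G q Y ?X) p Z = ?b + 2 * ((V ?x *v th p Y) \<bullet> B ?x (fst Z) ?x)"
      unfolding dird_metric[OF p] thX fX by (simp add: lB)
    \<comment> \<open>Along the scaling field the Higgs field has degree -1 and its inverse degree
      1, hence the opposite signs of the first two terms.\<close>
    also have "dird (\<lambda>q. G q Y Z) p ?X = - 2 * (blockmul (H ?x) (fst Y) \<bullet> fst Z) + 2 * ((V ?x *v th p Y) \<bullet> th p Z)
       + 2 * ((V ?x *v B ?x ?x (fst Y)) \<bullet> th p Z) + 2 * ((V ?x *v th p Y) \<bullet> B ?x ?x (fst Z))"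
    proof -
      have "(\<Sum>I\<in>UNIV. \<Sum>J\<in>UNIV. U ?x I J * (fst Y $ J \<bullet> fst Z $ I)) = blockmul (H ?x) (fst Y) \<bullet> fst Z"
        by (simp add: blockmul_def inner_vec_def[where 'a="real^3"] inner_sum_left)
      moreover have "(\<Sum>I\<in>UNIV. \<Sum>J\<in>UNIV. U ?x I J * ((V ?x *v th p Y) $ J * (V ?x *v th p Z) $ I)) = th p Y \<bullet> (V ?x *v th p Z)"
      proof -
        have "(\<Sum>I\<in>UNIV. \<Sum>J\<in>UNIV. U ?x I J * (s $ J * t $ I)) = (H ?x *v s) \<bullet> t" for s t
          by (simp add: matrix_vector_mult_def inner_vec_def sum_distrib_right mult.assoc)
        then show ?thesis by (simp add: HV[OF x])
      qed
      ultimately show ?thesis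
        unfolding dird_metric[OF p] fX using V_inner[OF x, of "th p Y" "th p Z"]
        by (simp add: lB matrix_vector_mult_scaleR sum_distrib_left[symmetric] mult.assoc
            W_hom[OF x] sum_negf)
    qed
    finally have "2 * G p (christoffel G p Y ?X) Z = 2 * (- (blockmul (H ?x) (fst Y) \<bullet> fst Z) + (V ?x *v th p Y) \<bullet> th p Z
       + 2 * ((V ?x *v B ?x (fst Y) ?x) \<bullet> th p Z))"
      unfolding cyc curvature_scaling[OF x] by simp
    also have "\<dots> = 2 * G p (Y - dird (\<lambda>q. 2 *\<^sub>R Sc q) p Y) Z"
      unfolding dX gh_metric_eq[OF x]
      by (simp add: dird_Sc[OF p] linear_diff[OF linear_th[OF x]] linear_scale[OF linear_th[OF x]]
          linear_diff[OF linear_blockmul] linear_scale[OF linear_blockmul] matrix_vector_right_distrib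
          matrix_vector_mult_scaleR inner_diff_left inner_add_left linear_neg[OF linear_blockmul]
          linear_neg[OF matrix_vector_mul_linear] algebra_simps)
    finally show "G p (christoffel G p Y ?X) Z = G p (Y - dird (\<lambda>q. 2 *\<^sub>R Sc q) p Y) Z" by simp
  qed
  then show ?thesis by (simp add: levi_civita_def)
qed

theorem hk_cone_gh: "hk_cone S L \<phi> Sc Rt"
  unfolding hk_cone_def
  using hyperkaehler_gh smooth_Sc smooth_Rt lie_Sc_Rt lie_Rt_Rt linear_Rt levi_civita_Sc lie_deriv_sympl
  by (simp add: crossv_def)

lemma hk_potential_blockmul: "hk_potential L x = 2 * (x \<bullet> blockmul (H x) x)"
  by (simp add: hk_potential_def blockmul_def inner_vec_def[where 'a="real^3"] inner_sum_right)

lemma hk_potential_eq: "fst p \<in> S \<Longrightarrow> 1/2 * G p (2 *\<^sub>R Sc p) (2 *\<^sub>R Sc p) = hk_potential L (fst p)"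
  by (simp add: gh_metric_eq linear_scale[OF linear_th] linear_scale[OF linear_blockmul] hk_potential_blockmul
      inner_commute)

end

subsection \<open>An isotropic covector\<close>

text \<open>For \<open>x\<close> off the first axis, \<open>isotropic x\<close> is the complex linear form on \<open>\<real>\<^sup>3\<close>, unique up to a
  factor, that is isotropic and vanishes on \<open>x\<close>; \<open>\<chi>\<^sup>A\<close> is its value on \<open>x\<^sup>A\<close> for \<open>x = x\<^sup>0\<close>. It is the
  gradient of a function, so its derivative is symmetric.\<close>

definition rho2 :: "real^3 \<Rightarrow> real" where "rho2 x = (x $ 2)^2 + (x $ 3)^2"

definition isotropic :: "real^3 \<Rightarrow> real^3 \<Rightarrow> complex" where
  "isotropic x a = Complex ((a $ 1 - x $ 1 * (a $ 2 * x $ 2 + a $ 3 * x $ 3) / rho2 x) / norm x)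
     (- (x $ 2 * a $ 3 - x $ 3 * a $ 2) / rho2 x)"

lemma inner_3: "x \<bullet> y = x $ 1 * y $ 1 + x $ 2 * y $ 2 + x $ 3 * y $ (3::3)" for x y :: "real^3"
  by (simp add: inner_vec_def sum_3)

lemma norm_rho2: "(norm x)^2 = (x $ 1)^2 + rho2 x" for x :: "real^3"
  unfolding power2_norm_eq_inner inner_3 rho2_def by (simp add: power2_eq_square)

lemma norm_pos_rho2: "rho2 x \<noteq> 0 \<Longrightarrow> norm x > 0"
  by (auto simp: rho2_def)

lemma isotropic_linear:
  "isotropic x (a + b) = isotropic x a + isotropic x b"
  "isotropic x (a - b) = isotropic x a - isotropic x b"
  "isotropic x (c *\<^sub>R a) = of_real c * isotropic x a"
  "isotropic x 0 = 0"
  "isotropic x (- a) = - isotropic x a"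
  by (simp_all add: isotropic_def complex_eq_iff algebra_simps add_divide_distrib diff_divide_distrib)

lemma isotropic_self: "rho2 x \<noteq> 0 \<Longrightarrow> isotropic x x = 0"
  by (simp add: isotropic_def complex_eq_iff rho2_def power2_eq_square)

lemma isotropic_e1: "isotropic x (axis 1 1) = of_real (1 / norm x)"
  by (simp add: isotropic_def complex_eq_iff axis_def)

text \<open>For \<open>a = x\<close> this says that \<open>isotropic x\<close> is an eigenvector of
  the generator of rotations about \<open>x\<close>, with eigenvalue \<open>\<i> * norm x\<close>.
  It controls how \<open>chi\<close> moves under rotations.\<close>

lemma isotropic_cross:
  assumes "rho2 x \<noteq> 0"
  shows "isotropic x (cross3 a b) = \<i> / of_real (norm x) * (of_real (a \<bullet> x) * isotropic x b - of_real (b \<bullet> x) * isotropic x a)"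
proof -
  \<comment> \<open>Norm and \<open>rho2\<close> become independent unknowns tied by polynomial
    relations, which turns each component into a problem for \<open>algebra\<close>.\<close>
  define r q where "r = norm x" and "q = rho2 x"
  have r: "r \<noteq> 0" "r * r = x $ 1 * x $ 1 + q" and q: "q = x $ 2 * x $ 2 + x $ 3 * x $ 3" "q \<noteq> 0"
    using assms norm_rho2[of x] by (auto simp: r_def q_def rho2_def power2_eq_square)
  show ?thesis
    unfolding isotropic_def r_def[symmetric] q_def[symmetric]
  proof (rule complex_eqI)
    show "Re (Complex ((cross3 a b $ 1 - x $ 1 * (cross3 a b $ 2 * x $ 2 + cross3 a b $ 3 * x $ 3) / q) / r)
          (- (x $ 2 * cross3 a b $ 3 - x $ 3 * cross3 a b $ 2) / q)) =
      Re (\<i> / of_real r * (of_real (a \<bullet> x) * Complex ((b $ 1 - x $ 1 * (b $ 2 * x $ 2 + b $ 3 * x $ 3) / q) / r)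
          (- (x $ 2 * b $ 3 - x $ 3 * b $ 2) / q) - of_real (b \<bullet> x) *
           Complex ((a $ 1 - x $ 1 * (a $ 2 * x $ 2 + a $ 3 * x $ 3) / q) / r)
          (- (x $ 2 * a $ 3 - x $ 3 * a $ 2) / q)))"
      using r(1) q(2) by (simp add: cross3_simps inner_3 field_simps) (use r(2) q(1) in algebra)
    show "Im (Complex ((cross3 a b $ 1 - x $ 1 * (cross3 a b $ 2 * x $ 2 + cross3 a b $ 3 * x $ 3) / q) / r)
          (- (x $ 2 * cross3 a b $ 3 - x $ 3 * cross3 a b $ 2) / q)) =
      Im (\<i> / of_real r * (of_real (a \<bullet> x) * Complex ((b $ 1 - x $ 1 * (b $ 2 * x $ 2 + b $ 3 * x $ 3) / q) / r)
          (- (x $ 2 * b $ 3 - x $ 3 * b $ 2) / q) - of_real (b \<bullet> x) *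
           Complex ((a $ 1 - x $ 1 * (a $ 2 * x $ 2 + a $ 3 * x $ 3) / q) / r)
          (- (x $ 2 * a $ 3 - x $ 3 * a $ 2) / q)))"
      using r(1) q(2) by (simp add: cross3_simps inner_3 field_simps) (use r(2) q(1) in algebra)
  qed
qed

text \<open>The real and imaginary parts of \<open>isotropic x\<close> are orthogonal covectors of
  equal length, the square of which is the inverse of \<open>rho2 x\<close>, and both vanish on
  \<open>x\<close>. The formula is the expansion of the inner product in this orthogonal
  frame.\<close>

lemma isotropic_inner:
  assumes "rho2 x \<noteq> 0"
  shows "a \<bullet> b = (a \<bullet> x) * (b \<bullet> x) / (norm x)^2 + rho2 x * Re (isotropic x a * cnj (isotropic x b))"
proof -
  define r q where "r = norm x" and "q = rho2 x"
  have r: "r \<noteq> 0" "r * r = x $ 1 * x $ 1 + q" and q: "q = x $ 2 * x $ 2 + x $ 3 * x $ 3" "q \<noteq> 0"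
    using assms norm_rho2[of x] by (auto simp: r_def q_def rho2_def power2_eq_square)
  show ?thesis
    unfolding isotropic_def r_def[symmetric] q_def[symmetric]
    using r(1) q(2) by (simp add: inner_3 power2_eq_square field_simps) (use r(2) q(1) in algebra)
qed

lemma isotropic_isotropic:
  assumes "rho2 x \<noteq> 0"
  shows "(\<Sum>i\<in>UNIV. isotropic x (axis i 1) * isotropic x (axis i 1)) = 0"
proof -
  define r q where "r = norm x" and "q = rho2 x"
  have r: "r \<noteq> 0" "r * r = x $ 1 * x $ 1 + q" and q: "q = x $ 2 * x $ 2 + x $ 3 * x $ 3" "q \<noteq> 0"
    using assms norm_rho2[of x] by (auto simp: r_def q_def rho2_def power2_eq_square)
  show ?thesis
    unfolding isotropic_def r_def[symmetric] q_def[symmetric] sum_3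
  proof (rule complex_eqI)
  qed (use r(1) q(2) in \<open>simp add: axis_def power2_eq_square field_simps; use r(2) q(1) in algebra\<close>)+
qed

lemma isotropic_expand: "isotropic x a = (\<Sum>i\<in>UNIV. of_real (a $ i) * isotropic x (axis i 1))"
  by (simp add: sum_3 isotropic_def complex_eq_iff axis_def algebra_simps add_divide_distrib diff_divide_distrib)

lemma has_derivative_norm_inner:
  fixes x :: "'a::real_inner"
  assumes "x \<noteq> 0"
  shows "(norm has_derivative (\<lambda>v. (x \<bullet> v) / norm x)) (at x)"
  using has_derivative_norm[OF assms] by (simp add: sgn_div_norm inner_commute divide_inverse mult.commute)

lemma has_derivative_Complex:
  assumes "(f has_derivative f') F" "(g has_derivative g') F"
  shows "((\<lambda>x. Complex (f x) (g x)) has_derivative (\<lambda>v. Complex (f' v) (g' v))) F"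
  unfolding Complex_eq
  by (intro has_derivative_add has_derivative_mult_right has_derivative_of_real assms)

lemma has_derivative_isotropic:
  assumes "rho2 x \<noteq> 0"
  shows "((\<lambda>x. isotropic x a) has_derivative
     (\<lambda>v. - (of_real (x \<bullet> v) * isotropic x a + of_real (x \<bullet> a) * isotropic x v) / of_real ((norm x)^2)
        + of_real (x $ 1 / norm x) * isotropic x a * isotropic x v)) (at x)"
proof -
  define r q where "r = norm x" and "q = rho2 x"
  have r: "r \<noteq> 0" "r * r = x $ 1 * x $ 1 + q" and q: "q = x $ 2 * x $ 2 + x $ 3 * x $ 3" "q \<noteq> 0"
    using assms norm_rho2[of x] by (auto simp: r_def q_def rho2_def power2_eq_square)
  have x0: "x \<noteq> 0" using r(1) r_def by auto
  have nth: "((\<lambda>x. x $ i) has_derivative (\<lambda>v. v $ i)) (at x)" for i :: 3 and x :: "real^3"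
    by (intro bounded_linear_imp_has_derivative bounded_linear_vec_nth)
  have dq: "(rho2 has_derivative (\<lambda>v. 2 * (x $ 2 * v $ 2 + x $ 3 * v $ 3))) (at x)"
    unfolding rho2_def[abs_def] by (auto intro!: derivative_eq_intros nth simp: algebra_simps)
  have dr: "(norm has_derivative (\<lambda>v. (x \<bullet> v) / r)) (at x)"
    unfolding r_def by (rule has_derivative_norm_inner[OF x0])
  have ds: "((\<lambda>x. a $ 2 * x $ 2 + a $ 3 * x $ 3) has_derivative (\<lambda>v. a $ 2 * v $ 2 + a $ 3 * v $ 3)) (at x)"
    by (intro has_derivative_add has_derivative_mult_right nth)
  define s where "s = a $ 2 * x $ 2 + a $ 3 * x $ 3"
  have "((\<lambda>x. (a $ 1 - x $ 1 * (a $ 2 * x $ 2 + a $ 3 * x $ 3) / rho2 x) / norm x) has_derivative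
     (\<lambda>v. (- (((x $ 1 * (a $ 2 * v $ 2 + a $ 3 * v $ 3) + v $ 1 * s) * q - x $ 1 * s * (2 * (x $ 2 * v $ 2 + x $ 3 * v $ 3))) / (q * q)) * r
        - (a $ 1 - x $ 1 * s / q) * ((x \<bullet> v) / r)) / (r * r))) (at x)"
    using has_derivative_divide'[OF has_derivative_diff[OF has_derivative_const[of "a $ 1"] has_derivative_divide'[OF has_derivative_mult[OF nth[of 1] ds] dq]] dr]
      assms r(1) unfolding r_def[symmetric] q_def[symmetric] s_def[symmetric] by simp
  note D1 = this
  have "((\<lambda>x. - (x $ 2 * a $ 3 - x $ 3 * a $ 2) / rho2 x) has_derivative
     (\<lambda>v. (- (v $ 2 * a $ 3 - v $ 3 * a $ 2) * q - (- (x $ 2 * a $ 3 - x $ 3 * a $ 2)) * (2 * (x $ 2 * v $ 2 + x $ 3 * v $ 3))) / (q * q))) (at x)"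
    using has_derivative_divide'[OF has_derivative_minus[OF has_derivative_diff[OF has_derivative_mult_left[OF nth[of 2]] has_derivative_mult_left[OF nth[of 3]]]] dq, of "a $ 3" "a $ 2"]
      assms unfolding q_def[symmetric] by simp
  note D2 = this
  show ?thesis
  proof (rule has_derivative_eq_rhs[OF has_derivative_Complex[OF D1 D2, folded isotropic_def], OF ext])
    fix v
    show "Complex ((- (((x $ 1 * (a $ 2 * v $ 2 + a $ 3 * v $ 3) + v $ 1 * s) * q - x $ 1 * s * (2 * (x $ 2 * v $ 2 + x $ 3 * v $ 3))) / (q * q)) * r
        - (a $ 1 - x $ 1 * s / q) * ((x \<bullet> v) / r)) / (r * r))
       ((- (v $ 2 * a $ 3 - v $ 3 * a $ 2) * q - (- (x $ 2 * a $ 3 - x $ 3 * a $ 2)) * (2 * (x $ 2 * v $ 2 + x $ 3 * v $ 3))) / (q * q))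
      = - (of_real (x \<bullet> v) * isotropic x a + of_real (x \<bullet> a) * isotropic x v) / of_real ((norm x)^2)
        + of_real (x $ 1 / norm x) * isotropic x a * isotropic x v"
      unfolding isotropic_def r_def[symmetric] q_def[symmetric] s_def
    proof (rule complex_eqI, goal_cases)
      case 1
      show ?case
        using r(1) q(2) by (simp add: inner_3 power2_eq_square Re_divide Im_divide divide_simps) (use r(2) q(1) in algebra)
    next
      case 2
      show ?case
        using r(1) q(2) by (simp add: inner_3 power2_eq_square Re_divide Im_divide divide_simps) (use r(2) q(1) in algebra)
    qed
  qed
qed

subsection \<open>The potential of the c-map\<close>

lemma chi_coord_isotropic:
  assumes "zc x None \<noteq> 0"
  shows "chi_coord x $ A = isotropic (x $ None) (x $ Some A)"
proof -
  have "rho2 (x $ None) \<noteq> 0" using assms by (auto simp: zc_def rho2_def complex_eq_iff)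
  moreover have "4 * (x $ None $ 2 * x $ None $ 2) + 4 * (x $ None $ 3 * x $ None $ 3) = 4 * rho2 (x $ None)"
    by (simp add: rho2_def power2_eq_square)
  ultimately have "4 * (x $ None $ 2 * x $ None $ 2) + 4 * (x $ None $ 3 * x $ None $ 3) \<noteq> 0" by simp
  then show ?thesis
    by (simp add: chi_coord_def Let_def isotropic_def complex_eq_iff zc_def Re_divide Im_divide rho2_def
        power2_eq_square divide_simps)
       (auto simp: algebra_simps)
qed

lemma has_derivative_nth:
  "((\<lambda>x. x $ I) has_derivative (\<lambda>v. v $ I)) (at (x :: 'a::real_normed_vector^'i::finite))"
  by (intro bounded_linear_imp_has_derivative bounded_linear_vec_nth)

lemma has_derivative_nth3:
  "((\<lambda>x. x $ I $ i) has_derivative (\<lambda>v. v $ I $ i)) (at (x :: 'n::finite config))"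
  by (intro bounded_linear.has_derivative[OF bounded_linear_vec_nth] has_derivative_nth)

lemma dird_dird_congI:
  assumes "open S" "x \<in> S" "\<And>y. y \<in> S \<Longrightarrow> f y = g y" "(g has_derivative g') (at x)"
  shows "dird f x v = g' v"
  using dird_cong_open[OF assms(1,2,3)] dird_eq[OF assms(4)] by simp

locale cmap =
  fixes F :: "complex^'n::finite \<Rightarrow> complex" and D :: "(complex^'n) set" and S :: "'n config set"
  assumes open_D: "open D"
    and D_scale: "X \<in> D \<Longrightarrow> c \<noteq> 0 \<Longrightarrow> c *s X \<in> D"
    and holF: "holomorphic_vec_on F D"
    and F_hom: "X \<in> D \<Longrightarrow> c \<noteq> 0 \<Longrightarrow> F (c *s X) = c^2 * F X"
    and openS: "open S"
    and z0: "x \<in> S \<Longrightarrow> zc x None \<noteq> 0"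
    and chi_D: "x \<in> S \<Longrightarrow> chi_coord x \<in> D"
begin

abbreviation L where "L \<equiv> cmap_L F"
abbreviation chi where "chi \<equiv> chi_coord"
abbreviation F3 where "F3 A B C \<equiv> F1 (F2 F A B) C"

lemma hol1: "holomorphic_vec_on (F1 F A) D" by (rule holomorphic_F1[OF open_D holF])
lemma F2_F1: "F2 F A B = F1 (F1 F A) B" by (simp add: F2_def F1_def fun_eq_iff)
lemma hol2: "holomorphic_vec_on (F2 F A B) D" unfolding F2_F1 by (rule holomorphic_F1[OF open_D hol1])

lemma F1_hom: "X \<in> D \<Longrightarrow> c \<noteq> 0 \<Longrightarrow> F1 F A (c *s X) = c ^ 1 * F1 F A X"
  using F1_homogeneous[OF open_D holF _ _ D_scale F_hom, of X c A] by (simp add: power2_eq_square)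

lemma F2_hom: "X \<in> D \<Longrightarrow> c \<noteq> 0 \<Longrightarrow> F2 F A B (c *s X) = c ^ 0 * F2 F A B X"
  using F1_homogeneous[OF open_D hol1[of A] _ _ D_scale F1_hom, of X c B] unfolding F2_F1 by simp

lemma euler0: "X \<in> D \<Longrightarrow> (\<Sum>A\<in>UNIV. F1 F A X * X $ A) = 2 * F X"
  using euler_relation[OF open_D holF _ F_hom, of X] by simp

lemma euler1: "X \<in> D \<Longrightarrow> (\<Sum>B\<in>UNIV. F2 F A B X * X $ B) = F1 F A X"
  using euler_relation[OF open_D hol1 _ F1_hom, of X A] by (simp add: F2_F1)

lemma euler2: "X \<in> D \<Longrightarrow> (\<Sum>C\<in>UNIV. F3 A B C X * X $ C) = 0"
  using euler_relation[OF open_D hol2 _ F2_hom, of X A B] by simp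

lemma F2_sym: "X \<in> D \<Longrightarrow> F2 F A B X = F2 F B A X"
  unfolding F2_def F1_def by (rule dird_commute[OF open_D smooth_on_holomorphic[OF open_D holF]])

abbreviation x0 :: "'n config \<Rightarrow> real^3" where "x0 x \<equiv> x $ None"
abbreviation r :: "'n config \<Rightarrow> real" where "r x \<equiv> norm (x $ None)"
abbreviation cc :: "'n config \<Rightarrow> real" where "cc x \<equiv> x $ None $ 1"
abbreviation m :: "'n config \<Rightarrow> real^3 \<Rightarrow> complex" where "m x \<equiv> isotropic (x $ None)"

definition ps :: "'n config \<Rightarrow> 'n \<Rightarrow> real" where "ps x A = (x0 x \<bullet> x $ Some A) / (r x)^2"
definition dps :: "'n config \<Rightarrow> 'n \<Rightarrow> 'n config \<Rightarrow> real" where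
  "dps x A v = (x0 x \<bullet> v $ Some A + v $ None \<bullet> x $ Some A - 2 * ps x A * (x0 x \<bullet> v $ None)) / (r x)^2"
text \<open>\<open>d\<chi>\<^sup>A(v) = al(v) \<chi>\<^sup>A + mw\<^sup>A(v)\<close>; by Euler's relation only the second term survives in the
  derivatives of functions of \<open>\<chi>\<close> that are homogeneous of degree zero.\<close>

definition al :: "'n config \<Rightarrow> 'n config \<Rightarrow> complex" where
  "al x v = - of_real ((x0 x \<bullet> v $ None) / (r x)^2) + of_real (cc x / r x) * m x (v $ None)"
definition mw :: "'n config \<Rightarrow> 'n \<Rightarrow> 'n config \<Rightarrow> complex" where
  "mw x A v = m x (v $ Some A - ps x A *\<^sub>R v $ None)"

lemma rho: "x \<in> S \<Longrightarrow> rho2 (x $ None) \<noteq> 0"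
  using z0 by (fastforce simp: zc_def rho2_def complex_eq_iff)

lemma r_pos: "x \<in> S \<Longrightarrow> r x > 0"
  using rho norm_pos_rho2 by blast

lemma chi_eq: "x \<in> S \<Longrightarrow> chi x $ A = m x (x $ Some A)"
  using chi_coord_isotropic z0 by blast

lemma has_derivative_r: "x \<in> S \<Longrightarrow> (r has_derivative (\<lambda>v. (x0 x \<bullet> v $ None) / r x)) (at x)"
  using has_derivative_compose[OF has_derivative_nth[of None x] has_derivative_norm_inner] r_pos[of x] by auto

lemma has_derivative_m:
  "x \<in> S \<Longrightarrow> ((\<lambda>y. m y a) has_derivative (\<lambda>v. - (of_real (x0 x \<bullet> v $ None) * m x a + of_real (x0 x \<bullet> a) * m x (v $ None)) / of_real ((r x)^2)
        + of_real (cc x / r x) * m x a * m x (v $ None))) (at x)"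
  using has_derivative_compose[OF has_derivative_nth[of None x] has_derivative_isotropic[OF rho, of x a]] by simp

lemma has_derivative_ps: "x \<in> S \<Longrightarrow> ((\<lambda>y. ps y A) has_derivative dps x A) (at x)"
proof -
  assume x: "x \<in> S"
  have "((\<lambda>y. (x0 y \<bullet> y $ Some A) / (r y)^2) has_derivative
     (\<lambda>v. ((x0 x \<bullet> v $ Some A + v $ None \<bullet> x $ Some A) * (r x)^2 - (x0 x \<bullet> x $ Some A) * (2 * r x * ((x0 x \<bullet> v $ None) / r x)))
       / ((r x)^2 * (r x)^2))) (at x)"
    using r_pos[OF x]
    by (intro has_derivative_divide' has_derivative_inner has_derivative_nth)
      (auto intro!: derivative_eq_intros has_derivative_r x)
  then show ?thesis
    unfolding ps_def dps_def
    by (rule has_derivative_eq_rhs) (use r_pos[OF x] in \<open>auto simp: fun_eq_iff field_simps power2_eq_square\<close>)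
qed

lemma m_expand: "m x a = (\<Sum>i\<in>UNIV. of_real (a $ i) * m x (axis i 1))"
  by (rule isotropic_expand)

lemma has_derivative_chi_nth:
  assumes x: "x \<in> S"
  shows "((\<lambda>y. chi y $ A) has_derivative (\<lambda>v. al x v * chi x $ A + mw x A v)) (at x)"
proof -
  have "((\<lambda>y. m y (y $ Some A)) has_derivative (\<lambda>v. dird (\<lambda>y. m y (x $ Some A)) x v + m x (v $ Some A))) (at x)"
  proof -
    have l: "linear (m y)" for y :: "'n config" by (rule linearI) (simp_all add: isotropic_linear scaleR_conv_of_real[where 'a=complex])
    have dm: "(\<lambda>y. m y a) differentiable (at x)" for a
      using has_derivative_m[OF x] differentiableI by blast
    have dn: "(\<lambda>y. y $ Some A) differentiable (at x)"
      using has_derivative_nth differentiableI by blast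
    show ?thesis
      by (rule has_derivative_eq_rhs[OF has_derivative_dird[OF dird_field_apply(2)[OF openS x l dm dn]]])
        (simp add: fun_eq_iff dird_field_apply(1)[OF openS x l dm dn] dird_eq[OF has_derivative_nth])
  qed
  then have "((\<lambda>y. chi y $ A) has_derivative (\<lambda>v. dird (\<lambda>y. m y (x $ Some A)) x v + m x (v $ Some A))) (at x)"
    by (rule has_derivative_transform_within_open[OF _ openS x]) (simp add: chi_eq)
  moreover have "dird (\<lambda>y. m y (x $ Some A)) x v + m x (v $ Some A) = al x v * chi x $ A + mw x A v" for v
    unfolding dird_eq[OF has_derivative_m[OF x]] al_def mw_def chi_eq[OF x] ps_def isotropic_linear
    using r_pos[OF x] by (simp add: field_simps)
  ultimately show ?thesis by simp
qed

lemma has_derivative_chi: "x \<in> S \<Longrightarrow> (chi has_derivative (\<lambda>v. \<chi> A. al x v * chi x $ A + mw x A v)) (at x)"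
  by (subst has_derivative_componentwise_within) 
    (auto simp: Basis_vec_def inner_axis intro!: has_derivative_inner_left has_derivative_chi_nth)

lemma smooth_chi: "smooth_on S chi"
proof (rule smooth_on_vec[OF openS])
  fix A
  have nth: "smooth_on S (\<lambda>x. x $ I $ i)" for I i by (intro smooth_intros openS)
  have "smooth_on S (\<lambda>x. m x (x $ Some A))"
    unfolding isotropic_def Complex_eq rho2_def
    by (intro smooth_intros openS nth) (use rho r_pos in \<open>force simp: rho2_def\<close>)+
  then show "smooth_on S (\<lambda>x. chi x $ A)"
    using smooth_on_cong[OF openS, of "\<lambda>x. chi x $ A"] chi_eq by simp
qed

lemma smooth_hol_chi: "holomorphic_vec_on g D \<Longrightarrow> smooth_on S (\<lambda>x. g (chi x))"
  by (rule smooth_on_compose[OF openS _ smooth_chi smooth_on_holomorphic[OF open_D]]) (auto intro: chi_D)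

lemma smooth_r: "smooth_on S r"
  by (intro smooth_intros openS) (use r_pos in force)

lemma smooth_L: "smooth_on S L"
  unfolding cmap_L_def[abs_def] by (intro smooth_intros openS smooth_r smooth_hol_chi holF)

text \<open>\<open>k\<close> is the degree of homogeneity and \<open>e\<close> is Euler's relation:
  the part of the derivative of \<open>chi\<close> along \<open>chi\<close> itself only reproduces
  the function.\<close>

lemma has_derivative_hol_chi:
  assumes x: "x \<in> S" and g: "holomorphic_vec_on g D" and e: "(\<Sum>A\<in>UNIV. F1 g A (chi x) * chi x $ A) = k * g (chi x)"
  shows "((\<lambda>y. g (chi y)) has_derivative (\<lambda>v. k * g (chi x) * al x v + (\<Sum>A\<in>UNIV. F1 g A (chi x) * mw x A v))) (at x)"
proof -
  have "((\<lambda>y. g (chi y)) has_derivative (\<lambda>v. \<Sum>A\<in>UNIV. F1 g A (chi x) * (\<chi> A. al x v * chi x $ A + mw x A v) $ A)) (at x)"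
    by (rule has_derivative_compose[OF has_derivative_chi[OF x] holomorphic_vec_on_has_derivative[OF g chi_D[OF x]]])
  moreover have "(\<Sum>A\<in>UNIV. F1 g A (chi x) * (\<chi> A. al x v * chi x $ A + mw x A v) $ A) =
     k * g (chi x) * al x v + (\<Sum>A\<in>UNIV. F1 g A (chi x) * mw x A v)" for v
    unfolding e[symmetric] by (simp add: sum.distrib sum_distrib_right sum_distrib_left distrib_left mult_ac)
  ultimately show ?thesis by simp
qed

abbreviation f0 where "f0 x \<equiv> F (chi x)"
abbreviation f1 where "f1 x A \<equiv> F1 F A (chi x)"
abbreviation f2 where "f2 x A B \<equiv> F2 F A B (chi x)"

lemma has_derivative_f0:
  "x \<in> S \<Longrightarrow> (f0 has_derivative (\<lambda>v. 2 * f0 x * al x v + (\<Sum>A\<in>UNIV. f1 x A * mw x A v))) (at x)"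
  by (rule has_derivative_hol_chi[OF _ holF euler0[OF chi_D]])

lemma has_derivative_f1:
  "x \<in> S \<Longrightarrow> ((\<lambda>y. f1 y A) has_derivative (\<lambda>v. f1 x A * al x v + (\<Sum>B\<in>UNIV. f2 x A B * mw x B v))) (at x)"
  using has_derivative_hol_chi[OF _ hol1, of x A 1] euler1[OF chi_D, of x A] by (simp add: F2_F1)

lemma has_derivative_f2:
  "x \<in> S \<Longrightarrow> ((\<lambda>y. f2 y A B) has_derivative (\<lambda>v. \<Sum>C\<in>UNIV. F3 A B C (chi x) * mw x C v)) (at x)"
  using has_derivative_hol_chi[OF _ hol2, of x A B 0] euler2[OF chi_D, of x A B] by simp

subsection \<open>Derivatives of the potential\<close>

lemma basis_vec_simps:
  "basis_vec (Some A) i $ None = 0" "basis_vec None i $ None = axis i 1" "basis_vec None i $ Some B = 0"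
  "basis_vec (Some A) i $ Some B = (if B = A then axis i 1 else 0)"
  by (simp_all add: basis_vec_def axis_def)

lemma dL:
  "x \<in> S \<Longrightarrow> dird L x u = - (2 / r x) * (x0 x \<bullet> u $ None) * Im (f0 x) + 4 * cc x * Im (f0 x * m x (u $ None))
     + 2 * r x * Im (\<Sum>A\<in>UNIV. f1 x A * mw x A u)"
proof -
  assume x: "x \<in> S"
  have "(L has_derivative (\<lambda>u. (2 * ((x0 x \<bullet> u $ None) / r x)) * Im (f0 x) + (2 * r x) * Im (2 * f0 x * al x u + (\<Sum>A\<in>UNIV. f1 x A * mw x A u)))) (at x)"
    unfolding cmap_L_def[abs_def]
    by (rule has_derivative_eq_rhs[OF has_derivative_mult[OF has_derivative_mult_right[OF has_derivative_r[OF x]]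
            bounded_linear.has_derivative[OF bounded_linear_Im has_derivative_f0[OF x]]]]) (auto simp: fun_eq_iff)
  from dird_eq[OF this, of u] show ?thesis
    using r_pos[OF x] by (simp add: al_def field_simps power2_eq_square)
qed

lemma dL_A: "x \<in> S \<Longrightarrow> dird L x (basis_vec (Some A) j) = 2 * r x * Im (f1 x A * m x (axis j 1))"
proof -
  assume x: "x \<in> S"
  have "f1 x B * mw x B (basis_vec (Some A) j) = (if B = A then f1 x A * m x (axis j 1) else 0)" for B
    by (simp add: mw_def basis_vec_simps isotropic_linear)
  then show ?thesis by (simp add: dL[OF x] basis_vec_simps isotropic_linear)
qed

lemma dL_0: "x \<in> S \<Longrightarrow> dird L x (basis_vec None j) = - (2 / r x) * x0 x $ j * Im (f0 x) + 4 * cc x * Im (f0 x * m x (axis j 1))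
    - 2 * r x * Im (\<Sum>A\<in>UNIV. f1 x A * of_real (ps x A) * m x (axis j 1))"
proof -
  assume x: "x \<in> S"
  have "(\<Sum>A\<in>UNIV. f1 x A * mw x A (basis_vec None j)) = - (\<Sum>A\<in>UNIV. f1 x A * of_real (ps x A) * m x (axis j 1))"
    by (simp add: mw_def basis_vec_simps isotropic_linear sum_negf mult.assoc)
  then show ?thesis by (simp add: dL[OF x] basis_vec_simps inner_axis)
qed

lemma m_axis1: "m x (axis 1 1) = of_real (1 / r x)" by (rule isotropic_e1)

lemma dL_A1: "x \<in> S \<Longrightarrow> dird L x (basis_vec (Some A) 1) = 2 * Im (f1 x A)"
  unfolding dL_A m_axis1 using r_pos[of x] by simp

lemma dL_01: "x \<in> S \<Longrightarrow> dird L x (basis_vec None 1) = 2 * (cc x / r x) * Im (f0 x) - 2 * (\<Sum>A\<in>UNIV. ps x A * Im (f1 x A))"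
  unfolding dL_0 m_axis1 using r_pos[of x] by (simp add: sum_distrib_left sum_distrib_right field_simps)

end

section \<open>The Legendre equations for the potential of the c-map\<close>

lemma antisymmetric_double_sum:
  fixes f :: "'i \<Rightarrow> 'i \<Rightarrow> real"
  assumes "\<And>i j. i \<in> A \<Longrightarrow> j \<in> A \<Longrightarrow> f i j = - f j i"
  shows "(\<Sum>i\<in>A. \<Sum>j\<in>A. f i j) = 0"
proof -
  have "(\<Sum>i\<in>A. \<Sum>j\<in>A. f i j) = (\<Sum>i\<in>A. \<Sum>j\<in>A. f j i)" by (rule sum.swap)
  also have "\<dots> = (\<Sum>i\<in>A. \<Sum>j\<in>A. - f i j)" by (intro sum.cong refl) (rule assms)
  finally show ?thesis by (simp add: sum_negf)
qed

context cmap
begin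

definition dm :: "'n config \<Rightarrow> real^3 \<Rightarrow> real^3 \<Rightarrow> complex" where
  "dm x a v = - (of_real (x0 x \<bullet> v) * m x a + of_real (x0 x \<bullet> a) * m x v) / of_real ((r x)^2) + of_real (cc x / r x) * m x a * m x v"

lemma has_derivative_m': "x \<in> S \<Longrightarrow> ((\<lambda>y. m y a) has_derivative (\<lambda>v. dm x a (v $ None))) (at x)"
  unfolding dm_def by (rule has_derivative_m)

definition df1 where "df1 x A v = f1 x A * al x v + (\<Sum>B\<in>UNIV. f2 x A B * mw x B v)"
definition df0 where "df0 x v = 2 * f0 x * al x v + (\<Sum>A\<in>UNIV. f1 x A * mw x A v)"

lemma al_basis: "al x (basis_vec (Some A) i) = 0"
  "al x (basis_vec None i) = - of_real (x0 x $ i / (r x)^2) + of_real (cc x / r x) * m x (axis i 1)"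
  by (simp_all add: al_def basis_vec_simps isotropic_linear inner_axis)

lemma mw_basis: "mw x B (basis_vec (Some A) i) = (if B = A then m x (axis i 1) else 0)"
  "mw x B (basis_vec None i) = - of_real (ps x B) * m x (axis i 1)"
  by (simp_all add: mw_def basis_vec_simps isotropic_linear)

lemma df1_basis: "df1 x A (basis_vec (Some B) i) = f2 x A B * m x (axis i 1)"
  "df1 x A (basis_vec None i) = f1 x A * al x (basis_vec None i) - (\<Sum>B\<in>UNIV. f2 x A B * of_real (ps x B)) * m x (axis i 1)"
proof -
  have "f2 x A C * mw x C (basis_vec (Some B) i) = (if C = B then f2 x A B * m x (axis i 1) else 0)" for C
    by (simp add: mw_basis)
  then show "df1 x A (basis_vec (Some B) i) = f2 x A B * m x (axis i 1)"
    by (simp add: df1_def al_basis)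
  show "df1 x A (basis_vec None i) = f1 x A * al x (basis_vec None i) - (\<Sum>B\<in>UNIV. f2 x A B * of_real (ps x B)) * m x (axis i 1)"
    by (simp add: df1_def mw_basis sum_negf sum_distrib_right mult.assoc)
qed

lemma D2_A:
  assumes x: "x \<in> S"
  shows "D2 L x I i (Some A) j = Im (of_real (2 * (x0 x \<bullet> basis_vec I i $ None) / r x) * (f1 x A * m x (axis j 1))
     + of_real (2 * r x) * (df1 x A (basis_vec I i) * m x (axis j 1) + f1 x A * dm x (axis j 1) (basis_vec I i $ None)))"
  unfolding D2_def
proof (rule dird_dird_congI[OF openS x])
  show "dird L y (basis_vec (Some A) j) = Im (of_real (2 * r y) * (f1 y A * m y (axis j 1)))" if "y \<in> S" for y
    using dL_A[OF that, of A j] by simp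
  show "((\<lambda>y. Im (of_real (2 * r y) * (f1 y A * m y (axis j 1)))) has_derivative
    (\<lambda>v. Im (of_real (2 * (x0 x \<bullet> v $ None) / r x) * (f1 x A * m x (axis j 1))
     + of_real (2 * r x) * (df1 x A v * m x (axis j 1) + f1 x A * dm x (axis j 1) (v $ None))))) (at x)"
    by (rule has_derivative_eq_rhs[OF bounded_linear.has_derivative[OF bounded_linear_Im has_derivative_mult[OF
            has_derivative_of_real[OF has_derivative_mult_right[OF has_derivative_r[OF x]]]
            has_derivative_mult[OF has_derivative_f1[OF x] has_derivative_m'[OF x]]]]])
      (simp add: fun_eq_iff df1_def algebra_simps)
qed

lemma D2_AA: "x \<in> S \<Longrightarrow> D2 L x (Some B) i (Some A) j = Im (of_real (2 * r x) * f2 x A B * (m x (axis i 1) * m x (axis j 1)))"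
  by (simp add: D2_A basis_vec_simps df1_basis dm_def isotropic_linear mult_ac)

lemma D2_0A:
  assumes x: "x \<in> S"
  shows "D2 L x None i (Some A) j = Im (f1 x A * (of_real (4 * cc x) * (m x (axis i 1) * m x (axis j 1))
      - of_real (2 / r x) * (of_real (x0 x $ i) * m x (axis j 1) + of_real (x0 x $ j) * m x (axis i 1)))
      - of_real (2 * r x) * (\<Sum>B\<in>UNIV. f2 x A B * of_real (ps x B)) * (m x (axis i 1) * m x (axis j 1)))"
proof -
  have r: "complex_of_real (r x) \<noteq> 0" using r_pos[OF x] by simp
  show ?thesis
    unfolding D2_A[OF x] basis_vec_simps df1_basis al_basis dm_def inner_axis
    using r by (intro arg_cong[where f=Im]) (simp add: field_simps power2_eq_square)
qed

lemma m_sq_sum: "x \<in> S \<Longrightarrow> m x (axis 1 1) * m x (axis 1 1) + m x (axis 2 1) * m x (axis 2 1) + m x (axis 3 1) * m x (axis 3 1) = 0"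
  using isotropic_isotropic[OF rho, of x] by (simp add: sum_3)

lemma m_x0_sum: "x \<in> S \<Longrightarrow> of_real (x0 x $ 1) * m x (axis 1 1) + of_real (x0 x $ 2) * m x (axis 2 1) + of_real (x0 x $ 3) * m x (axis 3 1) = 0"
  using m_expand[of x "x0 x"] isotropic_self[OF rho, of x] by (simp add: sum_3)

text \<open>The trace in which both derivatives fall on \<open>x0\<close>, and so also on
  \<open>ps\<close> and on the coefficients. Summed over the three directions, each term becomes a
  contraction of the vectors \<open>X\<close>, \<open>M\<close>, \<open>E\<close>: those with
  \<open>M\<close> against \<open>M\<close> or \<open>X\<close> vanish since \<open>m\<close> is
  isotropic and annihilates \<open>x0\<close>, and the rest cancels by Euler's relation.\<close>

lemma D2_trace_00:
  assumes x: "x \<in> S"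
  shows "D2 L x None 1 None 1 + D2 L x None 2 None 2 + D2 L x None 3 None 3 = 0"
proof -
  define P where "P y = (\<Sum>A\<in>UNIV. f1 y A * of_real (ps y A))" for y
  define M where "M j = m x (axis j 1)" for j :: 3
  define R where "R = complex_of_real (r x)"
  define X where "X j = complex_of_real (x0 x $ j)" for j
  have R: "R \<noteq> 0" using r_pos[OF x] by (simp add: R_def)
  define a where "a j = - X j / R^2 + X 1 / R * M j" for j
  have al: "al x (basis_vec None j) = a j" for j by (simp add: al_basis a_def X_def R_def M_def)
  define Q where "Q = (\<Sum>A\<in>UNIV. (\<Sum>B\<in>UNIV. f2 x A B * of_real (ps x B)) * of_real (ps x A))"
  define E where "E j = (\<Sum>A\<in>UNIV. f1 x A * of_real ((x $ Some A $ j - 2 * ps x A * x0 x $ j) / (r x)^2))" for j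
  define DM where "DM j = - (2 * X j * M j) / R^2 + X 1 / R * (M j * M j)" for j
  define g where "g j = 2 * f0 x * a j - P x * M j" for j
  define dP where "dP j = P x * a j - Q * M j + E j" for j
  have dPj: "(P has_derivative (\<lambda>v. \<Sum>A\<in>UNIV. df1 x A v * of_real (ps x A) + f1 x A * of_real (dps x A v))) (at x)"
    unfolding P_def[abs_def]
    by (rule has_derivative_eq_rhs[OF has_derivative_sum[OF has_derivative_mult[OF has_derivative_f1[OF x]
            has_derivative_of_real[OF has_derivative_ps[OF x]]]]]) (simp add: fun_eq_iff df1_def add.commute)
  have dPb: "(\<Sum>A\<in>UNIV. df1 x A (basis_vec None j) * of_real (ps x A) + f1 x A * of_real (dps x A (basis_vec None j))) = dP j" for j
  proof -
    have "df1 x A (basis_vec None j) * of_real (ps x A) + f1 x A * of_real (dps x A (basis_vec None j)) =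
       f1 x A * of_real (ps x A) * a j - (\<Sum>B\<in>UNIV. f2 x A B * of_real (ps x B)) * of_real (ps x A) * M j
       + f1 x A * of_real ((x $ Some A $ j - 2 * ps x A * x0 x $ j) / (r x)^2)" for A
      unfolding df1_basis al M_def[symmetric]
      by (simp add: dps_def basis_vec_simps inner_axis inner_commute[of _ "x $ _"] algebra_simps)
    then show ?thesis by (simp add: dP_def P_def Q_def E_def sum.distrib sum_subtractf sum_distrib_right)
  qed
  have df0b: "df0 x (basis_vec None j) = g j" for j
    by (simp add: df0_def al mw_basis M_def g_def P_def sum_negf sum_distrib_right mult.assoc)
  have dmb: "dm x (axis j 1) (axis j 1) = DM j" for j
    by (simp add: dm_def DM_def inner_axis X_def R_def M_def mult.assoc)
  define Z where "Z j = - 2 * ((1 / R - X j * X j / R^3) * f0 x + X j / R * g j) + 4 * (if j = 1 then 1 else 0) * (f0 x * M j)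
     + 4 * X 1 * (g j * M j + f0 x * DM j) - 2 * (X j / R) * (P x * M j) - 2 * R * (dP j * M j + P x * DM j)" for j
  have D: "D2 L x None j None j = Im (Z j)" for j
    unfolding D2_def
  proof (rule dird_dird_congI[OF openS x, THEN trans])
    show "dird L y (basis_vec None j) = Im (- 2 * (of_real (x0 y $ j / r y) * f0 y) + 4 * of_real (cc y) * (f0 y * m y (axis j 1))
       - 2 * of_real (r y) * (P y * m y (axis j 1)))" if "y \<in> S" for y
      unfolding dL_0[OF that] P_def by (simp add: sum_distrib_right)
    have dq: "((\<lambda>y. x0 y $ j / r y) has_derivative (\<lambda>v. (v $ None $ j * r x - x0 x $ j * ((x0 x \<bullet> v $ None) / r x)) / (r x * r x))) (at x)"
      using r_pos[OF x] by (intro has_derivative_divide' has_derivative_nth3 has_derivative_r x) auto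
    show "((\<lambda>y. Im (- 2 * (of_real (x0 y $ j / r y) * f0 y) + 4 * of_real (cc y) * (f0 y * m y (axis j 1))
       - 2 * of_real (r y) * (P y * m y (axis j 1)))) has_derivative
      (\<lambda>v. Im (- 2 * (of_real ((v $ None $ j * r x - x0 x $ j * ((x0 x \<bullet> v $ None) / r x)) / (r x * r x)) * f0 x + of_real (x0 x $ j / r x) * df0 x v)
       + 4 * (of_real (v $ None $ 1) * (f0 x * m x (axis j 1)) + of_real (cc x) * (df0 x v * m x (axis j 1) + f0 x * dm x (axis j 1) (v $ None)))
       - 2 * (of_real ((x0 x \<bullet> v $ None) / r x) * (P x * m x (axis j 1)) + of_real (r x) *
          ((\<Sum>A\<in>UNIV. df1 x A v * of_real (ps x A) + f1 x A * of_real (dps x A v)) * m x (axis j 1) + P x * dm x (axis j 1) (v $ None)))))) (at x)"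
      unfolding mult.assoc
      by (rule has_derivative_eq_rhs[OF bounded_linear.has_derivative[OF bounded_linear_Im
         has_derivative_diff[OF has_derivative_add[OF has_derivative_mult_right[OF has_derivative_mult[OF has_derivative_of_real[OF dq] has_derivative_f0[OF x]]]
          has_derivative_mult_right[OF has_derivative_mult[OF has_derivative_of_real[OF has_derivative_nth3] has_derivative_mult[OF has_derivative_f0[OF x] has_derivative_m'[OF x]]]]]
          has_derivative_mult_right[OF has_derivative_mult[OF has_derivative_of_real[OF has_derivative_r[OF x]] has_derivative_mult[OF dPj has_derivative_m'[OF x]]]]]]])
        (simp add: fun_eq_iff df0_def add.commute)
    show "Im (- 2 * (of_real ((basis_vec None j $ None $ j * r x - x0 x $ j * ((x0 x \<bullet> basis_vec None j $ None) / r x)) / (r x * r x)) * f0 x + of_real (x0 x $ j / r x) * df0 x (basis_vec None j))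
       + 4 * (of_real (basis_vec None j $ None $ 1) * (f0 x * m x (axis j 1)) + of_real (cc x) * (df0 x (basis_vec None j) * m x (axis j 1) + f0 x * dm x (axis j 1) (basis_vec None j $ None)))
       - 2 * (of_real ((x0 x \<bullet> basis_vec None j $ None) / r x) * (P x * m x (axis j 1)) + of_real (r x) *
          ((\<Sum>A\<in>UNIV. df1 x A (basis_vec None j) * of_real (ps x A) + f1 x A * of_real (dps x A (basis_vec None j))) * m x (axis j 1) + P x * dm x (axis j 1) (basis_vec None j $ None)))) = Im (Z j)"
      unfolding df0b dPb basis_vec_simps dmb M_def[symmetric] inner_axis
      using R by (intro arg_cong[where f=Im]) (simp add: Z_def X_def[symmetric] R_def[symmetric] axis_def field_simps power2_eq_square power3_eq_cube)
  qed
  have M2: "M 1 * M 1 + M 2 * M 2 + M 3 * M 3 = 0" unfolding M_def by (rule m_sq_sum[OF x])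
  have XM: "X 1 * M 1 + X 2 * M 2 + X 3 * M 3 = 0" unfolding M_def X_def by (rule m_x0_sum[OF x])
  have XX: "X 1 * X 1 + X 2 * X 2 + X 3 * X 3 = R^2"
  proof -
    have "x0 x $ 1 * x0 x $ 1 + x0 x $ 2 * x0 x $ 2 + x0 x $ 3 * x0 x $ 3 = (r x)^2"
      by (simp add: power2_norm_eq_inner inner_3)
    then show ?thesis unfolding X_def R_def 
      by (simp only: of_real_mult[symmetric] of_real_add[symmetric] of_real_power[symmetric])
  qed
  have M1: "M 1 = 1 / R" by (simp add: M_def m_axis1 R_def)
  \<comment> \<open>\<open>E\<close> stems from differentiating \<open>ps\<close>. Contracted with
    \<open>M\<close> it yields F_A chi^A, which is 2 F by Euler's relation.\<close>
  have EM: "E 1 * M 1 + E 2 * M 2 + E 3 * M 3 = 2 * f0 x / R^2"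
  proof -
    have "E 1 * M 1 + E 2 * M 2 + E 3 * M 3 = (\<Sum>A\<in>UNIV. f1 x A / R^2 *
       ((of_real (x $ Some A $ 1) * M 1 + of_real (x $ Some A $ 2) * M 2 + of_real (x $ Some A $ 3) * M 3)
        - 2 * of_real (ps x A) * (X 1 * M 1 + X 2 * M 2 + X 3 * M 3)))"
      unfolding E_def sum_distrib_right sum.distrib[symmetric]
      by (intro sum.cong refl) (simp add: X_def R_def algebra_simps add_divide_distrib diff_divide_distrib)
    also have "\<dots> = (\<Sum>A\<in>UNIV. f1 x A * chi x $ A) / R^2"
      unfolding XM sum_divide_distrib
      by (intro sum.cong refl) (simp add: chi_eq[OF x] m_expand[of x "x $ Some _"] sum_3 M_def)
    finally show ?thesis using euler0[OF chi_D[OF x]] by simp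
  qed
  have s1: "X 1 * g 1 + X 2 * g 2 + X 3 * g 3 = - 2 * f0 x"
  proof -
    have "X 1 * g 1 + X 2 * g 2 + X 3 * g 3 = 2 * f0 x * (- (X 1 * X 1 + X 2 * X 2 + X 3 * X 3) / R^2 + X 1 / R * (X 1 * M 1 + X 2 * M 2 + X 3 * M 3))
       - P x * (X 1 * M 1 + X 2 * M 2 + X 3 * M 3)"
      using R by (simp add: g_def a_def field_simps)
    then show ?thesis unfolding XM XX using R by simp
  qed
  have s2: "a 1 * M 1 + a 2 * M 2 + a 3 * M 3 = 0"
  proof -
    have "a 1 * M 1 + a 2 * M 2 + a 3 * M 3 = - (X 1 * M 1 + X 2 * M 2 + X 3 * M 3) / R^2 + X 1 / R * (M 1 * M 1 + M 2 * M 2 + M 3 * M 3)"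
      using R by (simp add: a_def field_simps)
    then show ?thesis unfolding XM M2 by simp
  qed
  have s3: "DM 1 + DM 2 + DM 3 = 0"
  proof -
    have "DM 1 + DM 2 + DM 3 = - 2 * (X 1 * M 1 + X 2 * M 2 + X 3 * M 3) / R^2 + X 1 / R * (M 1 * M 1 + M 2 * M 2 + M 3 * M 3)"
      using R by (simp add: DM_def field_simps)
    then show ?thesis unfolding XM M2 by simp
  qed
  have "Z 1 + Z 2 + Z 3 = - 2 * ((3 / R - (X 1 * X 1 + X 2 * X 2 + X 3 * X 3) / R^3) * f0 x + (X 1 * g 1 + X 2 * g 2 + X 3 * g 3) / R)
     + 4 * (f0 x * M 1)
     + 4 * X 1 * (2 * f0 x * (a 1 * M 1 + a 2 * M 2 + a 3 * M 3) - P x * (M 1 * M 1 + M 2 * M 2 + M 3 * M 3) + f0 x * (DM 1 + DM 2 + DM 3))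
     - 2 / R * P x * (X 1 * M 1 + X 2 * M 2 + X 3 * M 3)
     - 2 * R * (P x * (a 1 * M 1 + a 2 * M 2 + a 3 * M 3) - Q * (M 1 * M 1 + M 2 * M 2 + M 3 * M 3)
       + (E 1 * M 1 + E 2 * M 2 + E 3 * M 3) + P x * (DM 1 + DM 2 + DM 3))"
    unfolding Z_def dP_def g_def by (simp add: algebra_simps add_divide_distrib diff_divide_distrib)
  also have "\<dots> = 0"
    unfolding XX s1 s2 s3 M2 XM EM unfolding M1 using R by (simp add: field_simps power2_eq_square power3_eq_cube)
  finally have "Im (Z 1 + Z 2 + Z 3) = 0" by simp
  then show ?thesis unfolding D by simp
qed

lemma D2_swap_cmap: "x \<in> S \<Longrightarrow> D2 L x I i J j = D2 L x I j J i"
proof -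
  assume x: "x \<in> S"
  note c = D2_commute[OF openS smooth_L x]
  show ?thesis
  proof (cases I)
    case None
    then show ?thesis by (cases J) (use c[of None i None j] in \<open>auto simp: D2_0A[OF x] algebra_simps\<close>)
  next
    case (Some B)
    show ?thesis
    proof (cases J)
      case None
      then show ?thesis unfolding Some c[of "Some B"] by (simp add: D2_0A[OF x] algebra_simps)
    next
      case (Some A)
      then show ?thesis unfolding \<open>I = Some B\<close> by (simp add: D2_AA[OF x] algebra_simps)
    qed
  qed
qed

lemma D2_trace_cmap: "x \<in> S \<Longrightarrow> D2 L x I 1 J 1 + D2 L x I 2 J 2 + D2 L x I 3 J 3 = 0"
proof -
  assume x: "x \<in> S"
  note c = D2_commute[OF openS smooth_L x]
  have 0: "D2 L x None 1 (Some A) 1 + D2 L x None 2 (Some A) 2 + D2 L x None 3 (Some A) 3 = 0" for A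
  proof -
    have "D2 L x None 1 (Some A) 1 + D2 L x None 2 (Some A) 2 + D2 L x None 3 (Some A) 3 =
      Im ((f1 x A * of_real (4 * cc x) - of_real (2 * r x) * (\<Sum>B\<in>UNIV. f2 x A B * of_real (ps x B))) *
        (m x (axis 1 1) * m x (axis 1 1) + m x (axis 2 1) * m x (axis 2 1) + m x (axis 3 1) * m x (axis 3 1))
        - f1 x A * of_real (2 / r x) * 2 * (of_real (x0 x $ 1) * m x (axis 1 1) + of_real (x0 x $ 2) * m x (axis 2 1) + of_real (x0 x $ 3) * m x (axis 3 1)))"
      unfolding D2_0A[OF x] plus_complex.sel(2)[symmetric] by (intro arg_cong[where f=Im]) (simp add: algebra_simps)
    then show ?thesis by (simp add: m_sq_sum[OF x] m_x0_sum[OF x])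
  qed
  show ?thesis
  proof (cases I)
    case None
    then show ?thesis by (cases J) (use 0 D2_trace_00[OF x] in auto)
  next
    case (Some B)
    show ?thesis
    proof (cases J)
      case None
      then show ?thesis unfolding Some c[of "Some B"] using 0 by simp
    next
      case (Some A)
      have "D2 L x (Some B) 1 (Some A) 1 + D2 L x (Some B) 2 (Some A) 2 + D2 L x (Some B) 3 (Some A) 3 =
        Im (of_real (2 * r x) * f2 x A B * (m x (axis 1 1) * m x (axis 1 1) + m x (axis 2 1) * m x (axis 2 1) + m x (axis 3 1) * m x (axis 3 1)))"
        unfolding D2_AA[OF x] plus_complex.sel(2)[symmetric] by (intro arg_cong[where f=Im]) (simp add: algebra_simps)
      then show ?thesis unfolding Some \<open>I = Some B\<close> by (simp add: m_sq_sum[OF x])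
    qed
  qed
qed

lemma legendre_cmap: "legendre_equations S L"
  unfolding legendre_equations_iff[OF openS smooth_L]
proof (intro ballI allI conjI)
  fix x I J assume x: "x \<in> S"
  note c = D2_commute[OF openS smooth_L x]
  show "D2 L x I 1 J 1 + D2 L x I 2 J 2 + D2 L x I 3 J 3 = 0" by (rule D2_trace_cmap[OF x])
  show "D2 L x I 2 J 3 = D2 L x I 3 J 2" by (rule D2_swap_cmap[OF x])
  show "D2 L x I 1 J 2 = D2 L x J 1 I 2" "D2 L x I 1 J 3 = D2 L x J 1 I 3"
    using D2_swap_cmap[OF x, of I 1 J 2] D2_swap_cmap[OF x, of I 1 J 3] c[of I 2 J 1] c[of I 3 J 1] by simp_all
qed

subsection \<open>The Higgs field\<close>

definition nn :: "'n config \<Rightarrow> 'n \<Rightarrow> 'n \<Rightarrow> real" where "nn x A B = Im (f2 x A B)"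

lemma nn_sym: "x \<in> S \<Longrightarrow> nn x A B = nn x B A"
  unfolding nn_def using F2_sym[OF chi_D] by simp

lemma dL_A1_deriv:
  assumes x: "x \<in> S"
  shows "dird (\<lambda>y. dird L y (basis_vec (Some A) 1)) x v = 2 * Im (df1 x A v)"
proof (rule dird_dird_congI[OF openS x dL_A1])
  show "((\<lambda>y. 2 * Im (f1 y A)) has_derivative (\<lambda>v. 2 * Im (df1 x A v))) (at x)"
    unfolding df1_def
    by (intro has_derivative_mult_right bounded_linear.has_derivative[OF bounded_linear_Im has_derivative_f1[OF x]])
qed

lemma dL_01_deriv:
  assumes x: "x \<in> S"
  shows "dird (\<lambda>y. dird L y (basis_vec None 1)) x v =
     2 * (v $ None $ 1 / r x - cc x * (x0 x \<bullet> v $ None) / (r x)^3) * Im (f0 x) + 2 * (cc x / r x) * Im (df0 x v)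
     - 2 * (\<Sum>A\<in>UNIV. dps x A v * Im (f1 x A) + ps x A * Im (df1 x A v))"
proof (rule dird_dird_congI[OF openS x dL_01])
  have dq: "((\<lambda>y. cc y / r y) has_derivative (\<lambda>v. v $ None $ 1 / r x - cc x * (x0 x \<bullet> v $ None) / (r x)^3)) (at x)"
    by (rule has_derivative_eq_rhs[OF has_derivative_divide'[OF has_derivative_nth3 has_derivative_r[OF x]]])
      (use r_pos[OF x] in \<open>auto simp: fun_eq_iff field_simps power3_eq_cube\<close>)
  show "((\<lambda>y. 2 * (cc y / r y) * Im (f0 y) - 2 * (\<Sum>A\<in>UNIV. ps y A * Im (f1 y A))) has_derivative
    (\<lambda>v. 2 * (v $ None $ 1 / r x - cc x * (x0 x \<bullet> v $ None) / (r x)^3) * Im (f0 x) + 2 * (cc x / r x) * Im (df0 x v)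
     - 2 * (\<Sum>A\<in>UNIV. dps x A v * Im (f1 x A) + ps x A * Im (df1 x A v)))) (at x)"
    unfolding df0_def df1_def
    by (rule has_derivative_eq_rhs[OF has_derivative_diff[OF has_derivative_mult[OF has_derivative_mult_right[OF dq]
          bounded_linear.has_derivative[OF bounded_linear_Im has_derivative_f0[OF x]]]
          has_derivative_mult_right[OF has_derivative_sum[OF has_derivative_mult[OF has_derivative_ps[OF x]
            bounded_linear.has_derivative[OF bounded_linear_Im has_derivative_f1[OF x]]]]]]])
      (simp add: fun_eq_iff add.commute)
qed

lemma higgs_AB: "x \<in> S \<Longrightarrow> higgs L x $ Some A $ Some B = - nn x A B / r x"
  using dL_A1_deriv[of x B "basis_vec (Some A) 1"] nn_sym[of x A B]
  by (simp add: higgs_D2 D2_def df1_basis m_axis1 nn_def)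

lemma higgs_0A: "x \<in> S \<Longrightarrow> higgs L x $ None $ Some A = (\<Sum>B\<in>UNIV. nn x A B * ps x B) / r x"
proof -
  assume x: "x \<in> S"
  have "al x (basis_vec None 1) = 0"
    unfolding al_basis m_axis1 using r_pos[OF x] by (simp add: field_simps power2_eq_square)
  then show ?thesis
    using dL_A1_deriv[OF x, of A "basis_vec None 1"]
    by (simp add: higgs_D2 D2_def df1_basis m_axis1 nn_def sum_divide_distrib)
qed

lemma higgs_A0: "x \<in> S \<Longrightarrow> higgs L x $ Some A $ None = (\<Sum>B\<in>UNIV. nn x A B * ps x B) / r x"
  using higgs_0A[of x A] D2_commute[OF openS smooth_L, of x None 1 "Some A" 1] by (simp add: higgs_D2)

definition qq :: "'n config \<Rightarrow> real" where
  "qq x = (\<Sum>A\<in>UNIV. \<Sum>B\<in>UNIV. nn x A B * Re (chi x $ A * cnj (chi x $ B)))"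

text \<open>Euler's relations trade F and F_A for F_AB. The real part of F_AB drops out, being
  symmetric and contracted with an antisymmetric factor.\<close>

lemma qq_f1: "x \<in> S \<Longrightarrow> qq x = 2 * ((\<Sum>A\<in>UNIV. Re (chi x $ A) * Im (f1 x A)) - Im (f0 x))"
proof -
  assume x: "x \<in> S"
  have f1: "f1 x A = (\<Sum>B\<in>UNIV. f2 x A B * chi x $ B)" for A using euler1[OF chi_D[OF x]] by simp
  have "2 * ((\<Sum>A\<in>UNIV. Re (chi x $ A) * Im (f1 x A)) - Im (f0 x)) = 2 * (\<Sum>A\<in>UNIV. Re (chi x $ A) * Im (f1 x A)) - Im (\<Sum>A\<in>UNIV. f1 x A * chi x $ A)"
    using euler0[OF chi_D[OF x]] by simp
  also have "\<dots> = Im (\<Sum>A\<in>UNIV. f1 x A * cnj (chi x $ A))"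
    by (simp add: sum_distrib_left sum_subtractf[symmetric] algebra_simps del: sum_subtractf)
  also have "\<dots> = (\<Sum>A\<in>UNIV. \<Sum>B\<in>UNIV. nn x A B * Re (chi x $ A * cnj (chi x $ B)) + Re (f2 x A B) * Im (chi x $ B * cnj (chi x $ A)))"
    unfolding f1 sum_distrib_right Im_sum nn_def by (intro sum.cong refl) (simp add: algebra_simps)
  also have "\<dots> = qq x + (\<Sum>A\<in>UNIV. \<Sum>B\<in>UNIV. Re (f2 x A B) * Im (chi x $ B * cnj (chi x $ A)))"
    by (simp add: qq_def sum.distrib)
  also have "(\<Sum>A\<in>UNIV. \<Sum>B\<in>UNIV. Re (f2 x A B) * Im (chi x $ B * cnj (chi x $ A))) = 0"
    by (rule antisymmetric_double_sum) (use F2_sym[OF chi_D[OF x]] in \<open>simp add: algebra_simps\<close>)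
  finally show ?thesis by simp
qed

lemma xA1: "x \<in> S \<Longrightarrow> x $ Some A $ 1 = cc x * ps x A + rho2 (x0 x) / r x * Re (chi x $ A)"
  using isotropic_inner[OF rho, of x "x $ Some A" "axis 1 1"]
  by (simp add: inner_axis inner_axis' m_axis1 chi_eq ps_def inner_commute field_simps)

text \<open>Differentiating \<open>ps\<close> along the first axis produces the first component of
  x^A, which by \<open>xA1\<close> contains \<open>Re (chi x $ A)\<close>; \<open>qq_f1\<close> then
  collects these terms. The last summand is the block of the Higgs field belonging to
  \<open>x0\<close>.\<close>

lemma higgs_00:
  assumes x: "x \<in> S"
  shows "higgs L x $ None $ None = - (\<Sum>A\<in>UNIV. \<Sum>B\<in>UNIV. nn x A B * ps x A * ps x B) / r x + rho2 (x0 x) * qq x / (2 * (r x)^3)"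
proof -
  have rp: "r x > 0" by (rule r_pos[OF x])
  have al: "al x (basis_vec None 1) = 0"
    unfolding al_basis m_axis1 using rp by (simp add: field_simps power2_eq_square)
  have df0: "df0 x (basis_vec None 1) = - (\<Sum>A\<in>UNIV. f1 x A * of_real (ps x A)) / of_real (r x)"
    by (simp add: df0_def al mw_basis m_axis1 sum_negf sum_divide_distrib)
  have df1: "df1 x A (basis_vec None 1) = - (\<Sum>B\<in>UNIV. f2 x A B * of_real (ps x B)) / of_real (r x)" for A
    by (simp add: df1_basis al m_axis1)
  have dps: "dps x A (basis_vec None 1) = (x $ Some A $ 1 - 2 * ps x A * cc x) / (r x)^2" for A
    by (simp add: dps_def basis_vec_simps inner_axis inner_axis')
  have "dird (\<lambda>y. dird L y (basis_vec None 1)) x (basis_vec None 1) =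
     2 * (1 / r x - cc x * cc x / (r x)^3) * Im (f0 x) - 2 * (cc x / r x) * ((\<Sum>A\<in>UNIV. ps x A * Im (f1 x A)) / r x)
     - 2 * (\<Sum>A\<in>UNIV. (x $ Some A $ 1 - 2 * ps x A * cc x) / (r x)^2 * Im (f1 x A) - ps x A * (\<Sum>B\<in>UNIV. nn x A B * ps x B) / r x)"
  proof -
    have "Im (df0 x (basis_vec None 1)) = - (\<Sum>A\<in>UNIV. ps x A * Im (f1 x A)) / r x"
      unfolding df0 Im_divide_of_real by (simp add: mult.commute)
    moreover have "Im (df1 x A (basis_vec None 1)) = - (\<Sum>B\<in>UNIV. nn x A B * ps x B) / r x" for A
      unfolding df1 Im_divide_of_real by (simp add: nn_def)
    ultimately show ?thesis
      unfolding dL_01_deriv[OF x] dps by (simp add: basis_vec_simps inner_axis)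
  qed
  also have "1 / r x - cc x * cc x / (r x)^3 = rho2 (x0 x) / (r x)^3"
  proof -
    have "1 / r x = (r x)^2 / (r x)^3" using rp by (simp add: field_simps power2_eq_square power3_eq_cube)
    moreover have "(r x)^2 - cc x * cc x = rho2 (x0 x)" using norm_rho2[of "x0 x"] by (simp add: power2_eq_square)
    ultimately show ?thesis by (metis diff_divide_distrib)
  qed
  also have "(\<Sum>A\<in>UNIV. (x $ Some A $ 1 - 2 * ps x A * cc x) / (r x)^2 * Im (f1 x A) - ps x A * (\<Sum>B\<in>UNIV. nn x A B * ps x B) / r x)
    = rho2 (x0 x) / (r x)^3 * (\<Sum>A\<in>UNIV. Re (chi x $ A) * Im (f1 x A)) - cc x / (r x)^2 * (\<Sum>A\<in>UNIV. ps x A * Im (f1 x A))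
      - (\<Sum>A\<in>UNIV. \<Sum>B\<in>UNIV. nn x A B * ps x A * ps x B) / r x"
    unfolding xA1[OF x] sum_distrib_left sum_divide_distrib sum_subtractf[symmetric]
    using rp by (intro sum.cong refl) (simp add: field_simps power2_eq_square power3_eq_cube sum_distrib_left sum_distrib_right)
  finally have fin: "dird (\<lambda>y. dird L y (basis_vec None 1)) x (basis_vec None 1) =
     2 * (rho2 (x0 x) / (r x)^3) * Im (f0 x) - 2 * (cc x / r x) * ((\<Sum>A\<in>UNIV. ps x A * Im (f1 x A)) / r x)
     - 2 * (rho2 (x0 x) / (r x)^3 * (\<Sum>A\<in>UNIV. Re (chi x $ A) * Im (f1 x A)) - cc x / (r x)^2 * (\<Sum>A\<in>UNIV. ps x A * Im (f1 x A))
      - (\<Sum>A\<in>UNIV. \<Sum>B\<in>UNIV. nn x A B * ps x A * ps x B) / r x)" .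
  show ?thesis
    unfolding higgs_D2 D2_def fin qq_f1[OF x] using rp by (simp add: field_simps power2_eq_square power3_eq_cube)
qed

end

section \<open>Homogeneity and rotation invariance of the Higgs field\<close>

context cmap
begin

text \<open>Degree of homogeneity and rotation invariance are bundled because together they are
  stable under sums and additive under products, so that the Higgs field can be treated factor by
  factor instead of being differentiated as a whole.\<close>

definition cone_weight :: "'n config \<Rightarrow> ('n config \<Rightarrow> real) \<Rightarrow> real \<Rightarrow> bool" where
  "cone_weight x h k \<longleftrightarrow> (\<exists>h'. (h has_derivative h') (at x) \<and> h' x = k * h x \<and> (\<forall>a. h' (crossv a x) = 0))"

lemma cone_weightI:
  "(h has_derivative h') (at x) \<Longrightarrow> h' x = k * h x \<Longrightarrow> (\<And>a. h' (crossv a x) = 0) \<Longrightarrow> cone_weight x h k"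
  unfolding cone_weight_def by blast

lemma cone_weight_mult:
  "cone_weight x g j \<Longrightarrow> cone_weight x h k \<Longrightarrow> cone_weight x (\<lambda>y. g y * h y) (j + k)"
  unfolding cone_weight_def[of x g] cone_weight_def[of x h]
  by (elim exE conjE, rule cone_weightI[OF has_derivative_mult], assumption+) (auto simp: algebra_simps)

lemma cone_weight_sum:
  "(\<And>i. i \<in> I \<Longrightarrow> cone_weight x (h i) k) \<Longrightarrow> cone_weight x (\<lambda>y. \<Sum>i\<in>I. h i y) k"
  unfolding cone_weight_def
proof -
  assume "\<And>i. i \<in> I \<Longrightarrow> \<exists>h'. (h i has_derivative h') (at x) \<and> h' x = k * h i x \<and> (\<forall>a. h' (crossv a x) = 0)"
  then obtain h' where h': "\<And>i. i \<in> I \<Longrightarrow> (h i has_derivative h' i) (at x) \<and> h' i x = k * h i x \<and> (\<forall>a. h' i (crossv a x) = 0)"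
    by metis
  then show "\<exists>h'. ((\<lambda>y. \<Sum>i\<in>I. h i y) has_derivative h') (at x) \<and> h' x = k * (\<Sum>i\<in>I. h i x) \<and> (\<forall>a. h' (crossv a x) = 0)"
    by (intro exI[of _ "\<lambda>v. \<Sum>i\<in>I. h' i v"] conjI has_derivative_sum) (auto simp: sum_distrib_left)
qed

lemma cone_weight_const: "cone_weight x (\<lambda>_. c) 0"
  unfolding cone_weight_def by (intro exI[of _ "\<lambda>_. 0"]) auto

lemma cone_weight_inner: "cone_weight x (\<lambda>y. y $ I \<bullet> y $ J) 2"
proof -
  have d: "((\<lambda>y. y $ I \<bullet> y $ J) has_derivative (\<lambda>v. x $ I \<bullet> v $ J + v $ I \<bullet> x $ J)) (at x)"
    by (intro has_derivative_inner has_derivative_nth)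
  moreover have "u \<bullet> cross3 a w + cross3 a u \<bullet> w = 0" for a u w by (simp add: cross3_simps)
  ultimately show ?thesis by (intro cone_weightI[OF d]) (auto simp: crossv_def)
qed

lemma cone_weight_inverse_r: "x \<in> S \<Longrightarrow> cone_weight x (\<lambda>y. 1 / r y) (- 1)"
proof -
  assume x: "x \<in> S"
  have d: "((\<lambda>y. 1 / r y) has_derivative (\<lambda>v. (0 * r x - 1 * ((x0 x \<bullet> v $ None) / r x)) / (r x * r x))) (at x)"
    using r_pos[OF x] by (intro has_derivative_divide' has_derivative_const has_derivative_r x) auto
  moreover have "u \<bullet> cross3 a u = 0" for a u :: "real^3" by (simp add: dot_cross_self)
  ultimately show ?thesis using r_pos[OF x]
    by (intro cone_weightI[OF d]) (auto simp: crossv_def power2_norm_eq_inner[symmetric] power2_eq_square)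
qed

text \<open>Along scalings and rotations \<open>mw\<close> is a complex multiple of
  \<open>chi\<close>, for rotations because \<open>m\<close> is an eigenvector of rotations about
  \<open>x0\<close>. Since F_AB has degree zero, Euler's relation annihilates its derivative in such
  a direction.\<close>

lemma cone_weight_nn:
  assumes x: "x \<in> S"
  shows "cone_weight x (\<lambda>y. nn y A B) 0"
proof -
  have d: "((\<lambda>y. nn y A B) has_derivative (\<lambda>v. Im (\<Sum>C\<in>UNIV. F3 A B C (chi x) * mw x C v))) (at x)"
    unfolding nn_def by (rule bounded_linear.has_derivative[OF bounded_linear_Im has_derivative_f2[OF x]])
  have "x0 x \<bullet> x0 x = (r x)^2" by (simp add: power2_norm_eq_inner)
  then have perp: "(x $ Some C - ps x C *\<^sub>R x0 x) \<bullet> x0 x = 0" for C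
    using r_pos[OF x] by (simp add: inner_diff_left ps_def inner_commute[of "x $ Some C"])
  have c: "m x (x $ Some C - ps x C *\<^sub>R x0 x) = chi x $ C" for C
    by (simp add: isotropic_linear isotropic_self[OF rho[OF x]] chi_eq[OF x])
  have "mw x C x = chi x $ C" for C by (simp add: mw_def c)
  moreover have "mw x C (crossv a x) = \<i> / of_real (r x) * of_real (a \<bullet> x0 x) * chi x $ C" for C a
  proof -
    have "crossv a x $ Some C - ps x C *\<^sub>R crossv a x $ None = cross3 a (x $ Some C - ps x C *\<^sub>R x0 x)"
      by (simp add: crossv_def Cross3.right_diff_distrib cross_mult_right)
    then show ?thesis
      unfolding mw_def using isotropic_cross[OF rho[OF x], of a "x $ Some C - ps x C *\<^sub>R x0 x"] perp[of C]
      by (simp add: c)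
  qed
  moreover have "(\<Sum>C\<in>UNIV. F3 A B C (chi x) * (k * chi x $ C)) = 0" for k
    using euler2[OF chi_D[OF x], of A B] by (simp add: mult.left_commute[of _ k] sum_distrib_left[symmetric])
  ultimately have "(\<Sum>C\<in>UNIV. F3 A B C (chi x) * mw x C (crossv a x)) = 0" "(\<Sum>C\<in>UNIV. F3 A B C (chi x) * mw x C x) = 0" for a
    using euler2[OF chi_D[OF x], of A B] by (simp_all only:)
  then show ?thesis by (intro cone_weightI[OF d]) (simp_all only: zero_complex.sel mult_zero_left)
qed

text \<open>Neither factor on the left is rotation invariant by itself. The right side consists of
  \<open>nn\<close> and inner products only, to which the weights apply.\<close>

lemma rho_qq: "x \<in> S \<Longrightarrow> rho2 (x0 x) * qq x = (\<Sum>A\<in>UNIV. \<Sum>B\<in>UNIV. nn x A B * (x $ Some A \<bullet> x $ Some B - (x $ Some A \<bullet> x0 x) * (x $ Some B \<bullet> x0 x) / (r x)^2))"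
  unfolding qq_def sum_distrib_left
proof (intro sum.cong refl)
  fix A B assume x: "x \<in> S"
  show "rho2 (x0 x) * (nn x A B * Re (chi x $ A * cnj (chi x $ B))) =
    nn x A B * (x $ Some A \<bullet> x $ Some B - (x $ Some A \<bullet> x0 x) * (x $ Some B \<bullet> x0 x) / (r x)^2)"
    unfolding isotropic_inner[OF rho[OF x], of "x $ Some A" "x $ Some B"] chi_eq[OF x] by simp
qed

lemma cone_weight_higgs:
  assumes x: "x \<in> S"
  shows "cone_weight x (\<lambda>y. higgs L y $ I $ J) (- 1)"
proof -
  have cong: "cone_weight x f k" if "cone_weight x g k" "\<And>y. y \<in> S \<Longrightarrow> f y = g y" for f g k
    using that has_derivative_cong_open[OF openS x, of f g] x unfolding cone_weight_def by auto
  note w = cone_weight_sum cone_weight_mult[of _ _ 0] 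
  have W1: "cone_weight x (\<lambda>y. - 1 * (1 / r y)) (- 1)"
    using cone_weight_mult[OF cone_weight_const[of x "- 1"] cone_weight_inverse_r[OF x]] by simp
  have r3: "cone_weight x (\<lambda>y. 1 / r y * (1 / r y) * (1 / r y)) (- 3)"
    using cone_weight_mult[OF cone_weight_mult[OF cone_weight_inverse_r[OF x] cone_weight_inverse_r[OF x]] cone_weight_inverse_r[OF x]] by simp
  have r5: "cone_weight x (\<lambda>y. (1 / r y * (1 / r y) * (1 / r y)) * (1 / r y * (1 / r y))) (- 5)"
    using cone_weight_mult[OF r3 cone_weight_mult[OF cone_weight_inverse_r[OF x] cone_weight_inverse_r[OF x]]] by simp
  note i = cone_weight_inner
  have W2: "cone_weight x (\<lambda>y. \<Sum>B\<in>UNIV. nn y A B * ((x0 y \<bullet> y $ Some B) * (1 / r y * (1 / r y) * (1 / r y)))) (- 1)" for A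
    using cone_weight_mult[OF cone_weight_nn[OF x] cone_weight_mult[OF i r3]] by (intro cone_weight_sum) simp
  have h1: "cone_weight x (\<lambda>y. nn y A B * ((y $ Some A \<bullet> y $ Some B) * (1 / r y * (1 / r y) * (1 / r y)))) (- 1)" for A B
    using cone_weight_mult[OF cone_weight_nn[OF x] cone_weight_mult[OF i r3]] by simp
  have h2: "cone_weight x (\<lambda>y. nn y A B * (((x0 y \<bullet> y $ Some A) * (x0 y \<bullet> y $ Some B)) * ((1 / r y * (1 / r y) * (1 / r y)) * (1 / r y * (1 / r y))))) (- 1)" for A B
    using cone_weight_mult[OF cone_weight_nn[OF x] cone_weight_mult[OF cone_weight_mult[OF i i] r5]] by simp
  have add: "cone_weight x (\<lambda>y. f y + g y) k" if "cone_weight x f k" "cone_weight x g k" for f g k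
  proof -
    obtain f' g' where fg: "(f has_derivative f') (at x)" "f' x = k * f x" "\<And>a. f' (crossv a x) = 0"
      "(g has_derivative g') (at x)" "g' x = k * g x" "\<And>a. g' (crossv a x) = 0"
      using \<open>cone_weight x f k\<close> \<open>cone_weight x g k\<close> unfolding cone_weight_def by blast
    then show ?thesis by (intro cone_weightI[OF has_derivative_add[OF fg(1,4)]]) (auto simp: algebra_simps)
  qed
  \<comment> \<open>The coefficient -3/2 adds -1 from the first term of \<open>higgs_00\<close> to
    -1/2 from the projection in \<open>rho_qq\<close>.\<close>
  have W3: "cone_weight x (\<lambda>y. \<Sum>A\<in>UNIV. \<Sum>B\<in>UNIV. (1/2) * (nn y A B * ((y $ Some A \<bullet> y $ Some B) * (1 / r y * (1 / r y) * (1 / r y))))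
     + (- (3/2)) * (nn y A B * (((x0 y \<bullet> y $ Some A) * (x0 y \<bullet> y $ Some B)) * ((1 / r y * (1 / r y) * (1 / r y)) * (1 / r y * (1 / r y)))))) (- 1)"
    using cone_weight_mult[OF cone_weight_const h1, of "1/2"] cone_weight_mult[OF cone_weight_const h2, of "- (3/2)"]
    by (intro cone_weight_sum add) simp_all
  have e2: "(\<Sum>B\<in>UNIV. nn y A B * ps y B) / r y = (\<Sum>B\<in>UNIV. nn y A B * ((x0 y \<bullet> y $ Some B) * (1 / r y * (1 / r y) * (1 / r y))))" if "y \<in> S" for y A
    unfolding sum_divide_distrib ps_def by (intro sum.cong refl) (simp add: power2_eq_square)
  show ?thesis
  proof (cases I)
    case None
    show ?thesis
    proof (cases J)
      case 0: None
      show ?thesis unfolding None 0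
      proof (rule cong[OF W3])
        fix y assume y: "y \<in> S"
        have "r y > 0" by (rule r_pos[OF y])
        then show "higgs L y $ None $ None = (\<Sum>A\<in>UNIV. \<Sum>B\<in>UNIV. (1/2) * (nn y A B * ((y $ Some A \<bullet> y $ Some B) * (1 / r y * (1 / r y) * (1 / r y))))
            + (- (3/2)) * (nn y A B * (((x0 y \<bullet> y $ Some A) * (x0 y \<bullet> y $ Some B)) * ((1 / r y * (1 / r y) * (1 / r y)) * (1 / r y * (1 / r y))))))"
          unfolding higgs_00[OF y] rho_qq[OF y] sum_negf[symmetric] sum_divide_distrib sum.distrib[symmetric]
          by (intro sum.cong refl) (simp add: ps_def inner_commute[of "x0 y"] field_simps power2_eq_square power3_eq_cube)
      qed
    next
      case (Some A)
      show ?thesis unfolding None Some by (rule cong[OF W2[of A]]) (simp add: higgs_0A e2)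
    qed
  next
    case (Some A)
    show ?thesis
    proof (cases J)
      case None
      show ?thesis unfolding None Some by (rule cong[OF W2[of A]]) (simp add: higgs_A0 e2)
    next
      case 0: (Some B)
      have "cone_weight x (\<lambda>y. nn y A B * (- 1 * (1 / r y))) (- 1)"
        using cone_weight_mult[OF cone_weight_nn[OF x] W1] by simp
      then show ?thesis unfolding Some 0 by (rule cong) (simp add: higgs_AB)
    qed
  qed
qed

end

locale cmap_cone = cmap F D S for F :: "complex^'n::finite \<Rightarrow> complex" and D S +
  fixes \<phi> :: "'n config \<Rightarrow> real^('n option)"
  assumes smoothphi: "smooth_on S \<phi>"
    and invH: "x \<in> S \<Longrightarrow> invertible (hessian_xx (cmap_L F) x)"
    and potential_nz: "x \<in> S \<Longrightarrow> hk_potential (cmap_L F) x \<noteq> 0"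
begin

sublocale gh: gh_cone S "cmap_L F" \<phi>
proof unfold_locales
  show "open S" "smooth_on S (cmap_L F)" "smooth_on S \<phi>" "legendre_equations S (cmap_L F)"
    by (rule openS smooth_L smoothphi legendre_cmap)+
  fix x assume x: "x \<in> S"
  show "invertible (hessian_xx (cmap_L F) x)" by (rule invH[OF x])
  fix I J
  obtain h' where h: "((\<lambda>y. higgs (cmap_L F) y $ I $ J) has_derivative h') (at x)"
    "h' x = - 1 * higgs (cmap_L F) x $ I $ J" "\<And>a. h' (crossv a x) = 0"
    using cone_weight_higgs[OF x, of I J] unfolding cone_weight_def by blast
  show "dird (\<lambda>y. higgs (cmap_L F) y $ I $ J) x x = - higgs (cmap_L F) x $ I $ J"
    "dird (\<lambda>y. higgs (cmap_L F) y $ I $ J) x (crossv a x) = 0" for a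
    using h by (simp_all add: dird_eq[OF h(1)])
qed

end

subsection \<open>Inhomogeneous coordinates\<close>

text \<open>The closed form of conjugating the imaginary quaternion \<open>v\<close>, with the
  conjugate of \<open>q\<close> on the left and \<open>q\<close> on the right.\<close>

definition qrot :: "real \<times> (real^3) \<Rightarrow> real^3 \<Rightarrow> real^3" where
  "qrot q v = ((fst q)^2 - snd q \<bullet> snd q) *\<^sub>R v + (2 * (snd q \<bullet> v)) *\<^sub>R snd q - (2 * fst q) *\<^sub>R cross3 (snd q) v"

definition qnorm :: "real \<times> (real^3) \<Rightarrow> real" where "qnorm q = (fst q)^2 + snd q \<bullet> snd q"

lemma qmult_assoc: "qmult (qmult a b) c = qmult a (qmult b c)"
  by (simp add: qmult_def vec_eq_iff forall_3 cross3_simps prod_eq_iff)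

lemma qmult_conjugation_gen: "qmult (qmult (qcnj q) (a, v)) q = (a * qnorm q, qrot q v)"
  by (simp add: qmult_def qcnj_def qrot_def qnorm_def vec_eq_iff forall_3 cross3_simps power2_eq_square)

lemma qmult_conjugation: "qmult (qmult (qcnj q) (0, v)) q = (0, qrot q v)"
  by (simp add: qmult_conjugation_gen)

lemma qrot_qmult: "qrot p (qrot q v) = qrot (qmult q p) v"
proof -
  have cnj: "qcnj (qmult a b) = qmult (qcnj b) (qcnj a)" for a b
    by (simp add: qmult_def qcnj_def vec_eq_iff forall_3 cross3_simps)
  have "(0, qrot (qmult q p) v) = (0 :: real, qrot p (qrot q v))"
    unfolding qmult_conjugation[symmetric] cnj qmult_assoc ..
  then show ?thesis by simp
qed

lemma qnorm_pos: "q \<noteq> 0 \<Longrightarrow> qnorm q > 0"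
  unfolding qnorm_def by (cases q) (auto simp: zero_prod_def add_nonneg_pos add_pos_nonneg)

lemma qnorm_qmult: "qnorm (qmult p q) = qnorm p * qnorm q"
  by (simp add: qnorm_def qmult_def cross3_simps power2_eq_square)

text \<open>Since \<open>q\<close> times its conjugate is the real number \<open>qnorm q\<close>,
  the quaternion product of two rotated vectors is \<open>qnorm q\<close> times the rotated product.
  Its real and imaginary parts are the two claims.\<close>

lemma
  shows qrot_inner: "qrot q v \<bullet> qrot q w = (qnorm q)^2 * (v \<bullet> w)"
    and qrot_cross: "cross3 (qrot q v) (qrot q w) = qnorm q *\<^sub>R qrot q (cross3 v w)"
proof -
  have n: "qmult q (qmult (qcnj q) a) = qnorm q *\<^sub>R a" for a
    unfolding qmult_assoc[symmetric] by (simp add: qmult_def qcnj_def qnorm_def prod_eq_iff power2_eq_square)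
  have lin: "qmult a (c *\<^sub>R b) = c *\<^sub>R qmult a b" for a b c
    by (simp add: qmult_def prod_eq_iff algebra_simps cross_mult_right)
  have "qmult (0, qrot q v) (0, qrot q w) = qnorm q *\<^sub>R qmult (qmult (qcnj q) (qmult (0, v) (0, w))) q"
    unfolding qmult_conjugation[symmetric] qmult_assoc n lin ..
  also have "qmult (0, v) (0, w) = (- (v \<bullet> w), cross3 v w)" by (simp add: qmult_def)
  finally have "qmult (0, qrot q v) (0, qrot q w) = qnorm q *\<^sub>R (- (v \<bullet> w) * qnorm q, qrot q (cross3 v w))"
    unfolding qmult_conjugation_gen .
  then show "qrot q v \<bullet> qrot q w = (qnorm q)^2 * (v \<bullet> w)"
    "cross3 (qrot q v) (qrot q w) = qnorm q *\<^sub>R qrot q (cross3 v w)"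
    by (simp_all add: qmult_def power2_eq_square algebra_simps)
qed

lemma qrot_linear: "qrot q (v + w) = qrot q v + qrot q w" "qrot q (c *\<^sub>R v) = c *\<^sub>R qrot q v"
  by (simp_all add: qrot_def vec_eq_iff forall_3 cross3_simps)

lemma vec3_expand: "v = v $ 1 *\<^sub>R axis 1 1 + v $ 2 *\<^sub>R axis 2 1 + v $ 3 *\<^sub>R axis (3::3) (1::real)"
  by (simp add: vec_eq_iff forall_3 axis_def)

lemma inner_cross_cross: "cross3 a b \<bullet> cross3 a b = (a \<bullet> a) * (b \<bullet> b) - (a \<bullet> b)^2"
  by (simp add: cross3_simps power2_eq_square)

lemma orthonormal_expand:
  assumes "e1 \<bullet> e1 = 1" "e2 \<bullet> e2 = 1" "e1 \<bullet> e2 = 0"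
  shows "v = (v \<bullet> e1) *\<^sub>R e1 + (v \<bullet> e2) *\<^sub>R e2 + (v \<bullet> cross3 e1 e2) *\<^sub>R cross3 e1 (e2 :: real^3)"
proof -
  let ?e3 = "cross3 e1 e2"
  let ?d = "v - ((v \<bullet> e1) *\<^sub>R e1 + (v \<bullet> e2) *\<^sub>R e2 + (v \<bullet> ?e3) *\<^sub>R ?e3)"
  have e3: "?e3 \<bullet> ?e3 = 1" using assms by (simp add: inner_cross_cross)
  have "?d \<bullet> e1 = 0" "?d \<bullet> e2 = 0" "?d \<bullet> ?e3 = 0"
    using assms e3 dot_cross_self[of e1 e2] inner_commute[of e2 e1]
    by (simp_all add: inner_diff_left inner_add_left dot_cross_self)
  moreover have "(d \<bullet> d) * (?e3 \<bullet> ?e3) = 0" if "d \<bullet> e1 = 0" "d \<bullet> e2 = 0" "d \<bullet> ?e3 = 0" for d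
  proof -
    have "cross3 ?e3 d = (d \<bullet> e1) *\<^sub>R e2 - (d \<bullet> e2) *\<^sub>R e1" by (simp add: vec_eq_iff forall_3 cross3_simps)
    then have "cross3 ?e3 d = 0" using that by simp
    then show ?thesis using inner_cross_cross[of ?e3 d] that(3)
      by (simp add: inner_commute[of ?e3 d] mult.commute)
  qed
  ultimately have "(?d \<bullet> ?d) * (?e3 \<bullet> ?e3) = 0" by blast
  then have "?d = 0" using e3 by simp
  then show ?thesis by (simp only: right_minus_eq)
qed

text \<open>An imaginary quaternion acts, up to scale, as a half turn about itself, and the half
  turn about the bisector exchanges two unit vectors. For opposite vectors the bisector vanishes;
  the second axis, perpendicular to both, takes its place.\<close>

lemma quaternion_first_axis:
  assumes "e \<bullet> e = 1"
  obtains q where "q \<noteq> 0" "qrot q (axis 1 1) = qnorm q *\<^sub>R e"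
proof (cases "e = - axis 1 1")
  case True
  have "qrot (0, axis 2 1) (axis 1 1) = qnorm (0, axis 2 1) *\<^sub>R e" "((0::real), axis 2 1 :: real^3) \<noteq> 0"
    using True by (simp_all add: qrot_def qnorm_def inner_axis_axis zero_prod_def axis_eq_0_iff)
  then show ?thesis using that by blast
next
  case False
  let ?u = "axis 1 1 + e"
  have "?u \<noteq> 0" using False by (metis add_eq_0_iff)
  moreover have "?u \<bullet> ?u = 2 * (?u \<bullet> axis 1 1)"
    using assms by (simp add: inner_add_left inner_add_right inner_axis_axis inner_commute)
  then have "qrot (0, ?u) (axis 1 1) = qnorm (0, ?u) *\<^sub>R e"
    by (simp add: qrot_def qnorm_def scaleR_add_right)
  ultimately show ?thesis using that[of "(0, ?u)"] by (simp add: zero_prod_def)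
qed

lemma quaternion_frame:
  assumes "e1 \<bullet> e1 = 1" "e2 \<bullet> e2 = 1" "e1 \<bullet> e2 = 0"
  obtains q where "q \<noteq> 0" "qrot q (axis 1 1) = qnorm q *\<^sub>R e1" "qrot q (axis 2 1) = qnorm q *\<^sub>R e2"
    "qrot q (axis 3 1) = qnorm q *\<^sub>R cross3 e1 e2"
proof -
  obtain p where p: "p \<noteq> 0" "qrot p (axis 1 1) = qnorm p *\<^sub>R e1" using quaternion_first_axis[OF assms(1)] by blast
  have np: "qnorm p > 0" by (rule qnorm_pos[OF p(1)])
  define f2 f3 where "f2 = (1 / qnorm p) *\<^sub>R qrot p (axis 2 1)" and "f3 = (1 / qnorm p) *\<^sub>R qrot p (axis 3 1)"
  have R: "qrot p (axis 2 1) = qnorm p *\<^sub>R f2" "qrot p (axis 3 1) = qnorm p *\<^sub>R f3"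
    using np by (simp_all add: f2_def f3_def)
  have f2: "f2 \<bullet> f2 = 1" "e1 \<bullet> f2 = 0"
    using qrot_inner[of p "axis 2 1" "axis 2 1"] qrot_inner[of p "axis 1 1" "axis 2 1"] np
    by (simp_all add: R p(2) inner_axis_axis power2_eq_square)
  have f3: "f3 = cross3 e1 f2"
    using qrot_cross[of p "axis 1 1" "axis 2 1"] np
    by (simp add: R p(2) cross_basis cross_mult_left cross_mult_right)
  define c d where "c = e2 \<bullet> f2" and "d = e2 \<bullet> f3"
  have e2: "e2 = c *\<^sub>R f2 + d *\<^sub>R f3"
    using orthonormal_expand[OF assms(1) f2, of e2] assms(3) by (simp add: c_def d_def f3 inner_commute)
  have f33: "f3 \<bullet> f3 = 1" "f2 \<bullet> f3 = 0"
    using assms(1) f2 unfolding f3 by (simp_all add: inner_cross_cross dot_cross_self)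
  have cd: "c^2 + d^2 = 1"
    using assms(2) f33 inner_commute[of f3 f2] unfolding e2
    by (simp add: inner_add_left inner_add_right f2 power2_eq_square)
  have "cross3 e1 f3 = - f2"
  proof -
    have "cross3 e1 (cross3 e1 f2) = (e1 \<bullet> f2) *\<^sub>R e1 - (e1 \<bullet> e1) *\<^sub>R f2"
      by (simp add: vec_eq_iff forall_3 cross3_simps)
    then show ?thesis using f2 assms(1) by (simp add: f3)
  qed
  then have e3: "cross3 e1 e2 = c *\<^sub>R f3 - d *\<^sub>R f2"
    unfolding e2 by (simp add: cross_add_right cross_mult_right f3[symmetric])
  \<comment> \<open>After aligning \<open>e1\<close> a rotation about the first axis remains, with
    cosine \<open>c\<close> and sine \<open>d\<close>. The quaternion with components
    \<open>a\<close>, \<open>b\<close> realises it when (a + \<i> b)^2 = c - \<i> d; the square root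
    is the half angle.\<close>
  define z where "z = csqrt (Complex c (- d))"
  have z: "z^2 = Complex c (- d)" by (simp add: z_def)
  define a b where "a = Re z" and "b = Im z"
  have ab: "a * a - b * b = c" "2 * (a * b) = - d"
    using z by (auto simp: complex_eq_iff power2_eq_square a_def b_def mult.commute)
  have ab1: "a * a + b * b = 1"
  proof -
    have "(a * a + b * b)^2 = (a * a - b * b)^2 + (2 * (a * b))^2" by (simp add: power2_eq_square algebra_simps)
    then have "(a * a + b * b)^2 = 1" using ab cd by simp
    then show ?thesis by (metis abs_of_nonneg abs_square_eq_1 add_nonneg_nonneg zero_le_square)
  qed
  define q where "q = (a, b *\<^sub>R axis 1 (1::real) :: real^3)"
  have nq: "qnorm q = 1" using ab1 by (simp add: q_def qnorm_def inner_axis_axis power2_eq_square)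
  have 1: "qrot q (axis 1 1) = axis 1 1" "qrot q (axis 2 1) = c *\<^sub>R axis 2 1 + d *\<^sub>R axis 3 1"
    "qrot q (axis 3 1) = c *\<^sub>R axis 3 1 - d *\<^sub>R axis 2 1"
  proof -
    have "a * a - b * b + 2 * (b * b) = 1" using ab1 by simp
    then show "qrot q (axis 1 1) = axis 1 1" "qrot q (axis 2 1) = c *\<^sub>R axis 2 1 + d *\<^sub>R axis 3 1"
      "qrot q (axis 3 1) = c *\<^sub>R axis 3 1 - d *\<^sub>R axis 2 1"
      using ab by (simp_all add: qrot_def q_def vec_eq_iff forall_3 inner_3 axis_def cross3_def power2_eq_square algebra_simps)
  qed
  have diff: "qrot p (u - v) = qrot p u - qrot p v" for u v
    using qrot_linear(1)[of p "u - v" v] by simp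
  have nqp: "qnorm (qmult q p) = qnorm p" by (simp add: qnorm_qmult nq)
  show ?thesis
  proof (rule that[of "qmult q p"])
    show "qmult q p \<noteq> 0" using nqp np by (auto simp: qnorm_def)
    show "qrot (qmult q p) (axis 1 1) = qnorm (qmult q p) *\<^sub>R e1"
      unfolding qrot_qmult[symmetric] 1 nqp p(2) ..
    show "qrot (qmult q p) (axis 2 1) = qnorm (qmult q p) *\<^sub>R e2"
      unfolding qrot_qmult[symmetric] 1 nqp qrot_linear R e2 by (simp add: scaleR_add_right mult.commute)
    show "qrot (qmult q p) (axis 3 1) = qnorm (qmult q p) *\<^sub>R cross3 e1 e2"
      unfolding qrot_qmult[symmetric] 1 nqp diff qrot_linear R e3 by (simp add: scaleR_diff_right mult.commute)
  qed
qed

text \<open>Here \<open>y\<close> is the part of x^1 orthogonal to x^0. Any admissible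
  \<open>q\<close> has \<open>qnorm q = norm (x $ None)\<close> and preserves inner and cross
  products up to powers of it, so these products determine the coordinates although \<open>q\<close>
  itself has a free sign.\<close>

lemma inhomogeneous_eqI:
  fixes x :: "'n::finite config"
  assumes y: "y = x $ Some o1 - ((x $ None \<bullet> x $ Some o1) / (norm (x $ None))^2) *\<^sub>R x $ None" and "x $ None \<noteq> 0" "y \<noteq> 0"
  shows "inhomogeneous o1 x $ I $ 1 = (x $ I \<bullet> x $ None) / (norm (x $ None))^2"
    and "inhomogeneous o1 x $ I $ 2 = (x $ I \<bullet> y) / (norm (x $ None) * norm y)"
    and "inhomogeneous o1 x $ I $ 3 = (x $ I \<bullet> cross3 (x $ None) y) / ((norm (x $ None))^2 * norm y)"
proof -
  define r where "r = norm (x $ None)"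
  have r: "r > 0" "x $ None \<bullet> x $ None = r * r" using assms(2) by (simp_all add: r_def power2_norm_eq_inner[symmetric] power2_eq_square)
  have y0: "y \<bullet> x $ None = 0" unfolding y r_def[symmetric] using r
    by (simp add: inner_diff_left inner_commute[of "x $ Some o1"] power2_eq_square)
  have y0': "x $ None \<bullet> y = 0" using y0 by (simp add: inner_commute)
  have ny: "norm y > 0" "y \<bullet> y = norm y * norm y" using assms(3) by (simp_all add: power2_norm_eq_inner[symmetric] power2_eq_square)
  define p where "p = (x $ None \<bullet> x $ Some o1) / r^2"
  have x1: "x $ Some o1 = y + p *\<^sub>R x $ None" unfolding y p_def r_def by simp
  let ?P = "\<lambda>\<rho>. (\<exists>q. q \<noteq> 0 \<and> (\<forall>I. (0, x $ I) = qmult (qmult (qcnj q) (0, \<rho> $ I)) q)) \<and>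
     \<rho> $ None = axis 1 1 \<and> \<rho> $ Some o1 $ 2 > 0 \<and> \<rho> $ Some o1 $ (3::3) = (0::real)"
  define \<rho> :: "'n config" where "\<rho> = (\<chi> I. vector [(x $ I \<bullet> x $ None) / r^2, (x $ I \<bullet> y) / (r * norm y), (x $ I \<bullet> cross3 (x $ None) y) / (r^2 * norm y)])"
  have ex: "?P \<rho>"
  proof -
    define e1 e2 where "e1 = (1 / r) *\<^sub>R x $ None" and "e2 = (1 / norm y) *\<^sub>R y"
    have e: "e1 \<bullet> e1 = 1" "e2 \<bullet> e2 = 1" "e1 \<bullet> e2 = 0"
      using r ny y0 by (simp_all add: e1_def e2_def inner_commute)
    obtain q where q: "q \<noteq> 0" "qrot q (axis 1 1) = qnorm q *\<^sub>R e1" "qrot q (axis 2 1) = qnorm q *\<^sub>R e2"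
      "qrot q (axis 3 1) = qnorm q *\<^sub>R cross3 e1 e2" by (rule quaternion_frame[OF e])
    have nq: "qnorm q > 0" by (rule qnorm_pos[OF q(1)])
    \<comment> \<open>Multiplying \<open>q\<close> by \<open>k\<close> multiplies
      \<open>qnorm q\<close> by k^2; this value turns it into \<open>r\<close>.\<close>
    define k where "k = sqrt (r / qnorm q)"
    have k: "k > 0" "k * k = r / qnorm q" using r nq by (simp_all add: k_def)
    have rotk: "qrot (k *\<^sub>R q) v = (k * k) *\<^sub>R qrot q v" for v
      by (simp add: qrot_def vec_eq_iff forall_3 cross3_simps power2_eq_square)
    have "x $ I = qrot (k *\<^sub>R q) (\<rho> $ I)" for I
    proof -
      have "qrot (k *\<^sub>R q) (\<rho> $ I) = (r / qnorm q) *\<^sub>R (\<rho> $ I $ 1 *\<^sub>R qnorm q *\<^sub>R e1 + \<rho> $ I $ 2 *\<^sub>R qnorm q *\<^sub>R e2 + \<rho> $ I $ 3 *\<^sub>R qnorm q *\<^sub>R cross3 e1 e2)"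
        unfolding rotk k(2) by (subst vec3_expand[of "\<rho> $ I"]) (simp add: qrot_linear q)
      also have "\<dots> = (r * \<rho> $ I $ 1) *\<^sub>R e1 + (r * \<rho> $ I $ 2) *\<^sub>R e2 + (r * \<rho> $ I $ 3) *\<^sub>R cross3 e1 e2"
        using nq by (simp add: scaleR_add_right)
      also have "r * \<rho> $ I $ 1 = x $ I \<bullet> e1" using r by (simp add: \<rho>_def e1_def power2_eq_square)
      also have "r * \<rho> $ I $ 2 = x $ I \<bullet> e2" using r by (simp add: \<rho>_def e2_def)
      also have "r * \<rho> $ I $ 3 = x $ I \<bullet> cross3 e1 e2" using r by (simp add: \<rho>_def e1_def e2_def cross_mult_left cross_mult_right power2_eq_square)
      finally show ?thesis using orthonormal_expand[OF e, of "x $ I"] by simp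
    qed
    moreover have "k *\<^sub>R q \<noteq> 0" using k(1) q(1) by simp
    moreover have "\<rho> $ None = axis 1 1"
      using r y0' by (simp add: \<rho>_def vec_eq_iff forall_3 axis_def dot_cross_self power2_eq_square)
    moreover have "\<rho> $ Some o1 $ 2 > 0" using r ny y0'
      by (simp add: \<rho>_def x1 inner_add_left)
    moreover have "\<rho> $ Some o1 $ 3 = 0" by (simp add: \<rho>_def x1 inner_add_left dot_cross_self)
    ultimately show ?thesis unfolding qmult_conjugation by (intro conjI exI[of _ "k *\<^sub>R q"]) auto
  qed
  have uniq: "\<sigma> = \<rho>" if P: "?P \<sigma>" for \<sigma>
  proof -
    obtain q where q: "q \<noteq> 0" and qx: "\<And>I. x $ I = qrot q (\<sigma> $ I)" using P unfolding qmult_conjugation by auto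
    have \<sigma>: "\<sigma> $ None = axis 1 1" "\<sigma> $ Some o1 $ 2 > 0" "\<sigma> $ Some o1 $ 3 = 0" using P by auto
    have nq: "qnorm q > 0" by (rule qnorm_pos[OF q])
    have ii: "x $ I \<bullet> x $ J = (qnorm q)^2 * (\<sigma> $ I \<bullet> \<sigma> $ J)" for I J unfolding qx by (rule qrot_inner)
    have "r * r = (qnorm q)^2" using ii[of None None] r by (simp add: \<sigma> inner_axis_axis)
    then have rq: "qnorm q = r" using r(1) nq by (simp add: power2_eq_square power2_eq_iff_nonneg[unfolded power2_eq_square])
    have 1: "\<sigma> $ I $ 1 = (x $ I \<bullet> x $ None) / r^2" for I
      using ii[of I None] r(1) by (simp add: \<sigma> rq inner_axis)
    have yq: "y = qrot q (\<sigma> $ Some o1 $ 2 *\<^sub>R axis 2 1)"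
    proof -
      have "\<sigma> $ Some o1 $ 1 = p" by (simp add: 1 p_def inner_commute)
      then have "\<sigma> $ Some o1 = \<sigma> $ Some o1 $ 2 *\<^sub>R axis 2 1 + p *\<^sub>R \<sigma> $ None"
        by (simp add: \<sigma> vec_eq_iff forall_3 axis_def)
      then have "x $ Some o1 = qrot q (\<sigma> $ Some o1 $ 2 *\<^sub>R axis 2 1) + p *\<^sub>R x $ None"
        unfolding qx[of "Some o1"] qx[of None] by (metis qrot_linear)
      then show ?thesis using x1 by simp
    qed
    have s2: "norm y = r * \<sigma> $ Some o1 $ 2"
    proof -
      have "norm y * norm y = (r * \<sigma> $ Some o1 $ 2) * (r * \<sigma> $ Some o1 $ 2)"
        unfolding ny(2)[symmetric] by (simp add: yq qrot_inner rq inner_axis_axis power2_eq_square)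
      then show ?thesis using ny(1) r(1) \<sigma>(2) by (simp add: power2_eq_iff_nonneg[unfolded power2_eq_square])
    qed
    have 2: "\<sigma> $ I $ 2 = (x $ I \<bullet> y) / (r * norm y)" for I
    proof -
      have "x $ I \<bullet> y = r^2 * (\<sigma> $ I \<bullet> (\<sigma> $ Some o1 $ 2 *\<^sub>R axis 2 1))" unfolding yq qx[of I] qrot_inner rq ..
      then show ?thesis using r(1) \<sigma>(2) by (simp add: s2 inner_axis power2_eq_square)
    qed
    have 3: "\<sigma> $ I $ 3 = (x $ I \<bullet> cross3 (x $ None) y) / (r^2 * norm y)" for I
    proof -
      have "cross3 (x $ None) y = r *\<^sub>R qrot q (\<sigma> $ Some o1 $ 2 *\<^sub>R axis 3 1)"
        unfolding yq qx[of None] qrot_cross rq \<sigma>(1) by (simp add: cross_mult_right cross_basis)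
      then have "x $ I \<bullet> cross3 (x $ None) y = r * (r^2 * (\<sigma> $ I \<bullet> (\<sigma> $ Some o1 $ 2 *\<^sub>R axis 3 1)))"
        unfolding qx[of I] by (simp add: qrot_inner rq)
      then show ?thesis using r(1) \<sigma>(2) by (simp add: s2 inner_axis power2_eq_square)
    qed
    show ?thesis unfolding vec_eq_iff[where 'a="real^3"] vec_eq_iff[where 'a=real] forall_3
      by (simp add: \<rho>_def 1 2 3)
  qed
  have "inhomogeneous o1 x = \<rho>" unfolding inhomogeneous_def using ex uniq by (intro the_equality) blast+
  then show "inhomogeneous o1 x $ I $ 1 = (x $ I \<bullet> x $ None) / (norm (x $ None))^2"
    "inhomogeneous o1 x $ I $ 2 = (x $ I \<bullet> y) / (norm (x $ None) * norm y)"
    "inhomogeneous o1 x $ I $ 3 = (x $ I \<bullet> cross3 (x $ None) y) / ((norm (x $ None))^2 * norm y)"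
    by (simp_all add: \<rho>_def r_def)
qed

subsection \<open>The connection in invariant coordinates\<close>

context cmap
begin

abbreviation e1 :: "real^3" where "e1 \<equiv> axis 1 1"
abbreviation rho :: "'n config \<Rightarrow> real" where "rho x \<equiv> rho2 (x $ None)"

definition lam :: "'n config \<Rightarrow> 'n config \<Rightarrow> real" where "lam x v = (x0 x \<bullet> v $ None) / (r x)^2"
definition wv :: "'n config \<Rightarrow> 'n \<Rightarrow> 'n config \<Rightarrow> real^3" where "wv x A v = v $ Some A - ps x A *\<^sub>R v $ None"

lemma mw_wv: "mw x A v = m x (wv x A v)" by (simp add: mw_def wv_def)

lemma rho_r: "rho x = (r x)^2 - (cc x)^2" using norm_rho2[of "x0 x"] by simp

lemma first_component: "x \<in> S \<Longrightarrow> b $ 1 = cc x * (x0 x \<bullet> b) / (r x)^2 + rho x / r x * Re (m x b)"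
  using isotropic_inner[OF rho, of x b e1] r_pos[of x]
  by (simp add: inner_axis inner_axis' m_axis1 inner_commute)

lemma x0_x0: "x0 x \<bullet> x0 x = (r x)^2" by (simp add: power2_norm_eq_inner)

definition xp :: "'n config \<Rightarrow> 'n \<Rightarrow> real^3" where "xp x A = x $ Some A - ps x A *\<^sub>R x0 x"

lemma xp_x0: "x \<in> S \<Longrightarrow> xp x A \<bullet> x0 x = 0"
  using r_pos[of x] by (simp add: xp_def inner_diff_left ps_def inner_commute[of "x $ Some A"] x0_x0)

lemma m_xp: "x \<in> S \<Longrightarrow> m x (xp x A) = chi x $ A"
  by (simp add: xp_def isotropic_linear isotropic_self[OF rho] chi_eq)

lemma inner_xp: "x \<in> S \<Longrightarrow> b \<bullet> xp x A = rho x * Re (m x b * cnj (chi x $ A))"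
  using isotropic_inner[OF rho, of x b "xp x A"] xp_x0[of x A] m_xp[of x A] by simp

text \<open>The derivative of \<open>ps\<close> also contains the component of
  \<open>v $ None\<close> along the projected vector \<open>xp x A\<close>, hence the
  correction.\<close>

lemma wv_x0: "x \<in> S \<Longrightarrow> wv x A v \<bullet> x0 x = (r x)^2 * dps x A v - rho x * Re (chi x $ A * cnj (m x (v $ None)))"
proof -
  assume x: "x \<in> S"
  have "v $ None \<bullet> xp x A = rho x * Re (chi x $ A * cnj (m x (v $ None)))"
    unfolding inner_xp[OF x] by (simp add: algebra_simps)
  moreover have "(r x)^2 * dps x A v = x0 x \<bullet> v $ Some A + v $ None \<bullet> x $ Some A - 2 * ps x A * (x0 x \<bullet> v $ None)"
    using r_pos[OF x] unfolding dps_def by simp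
  moreover have "v $ None \<bullet> xp x A = v $ None \<bullet> x $ Some A - ps x A * (x0 x \<bullet> v $ None)"
    by (simp add: xp_def inner_diff_right inner_commute[of "x0 x"])
  ultimately show ?thesis
    by (simp add: wv_def inner_diff_left inner_commute[of "x0 x"])
qed

definition vh :: "'n config \<Rightarrow> 'n config" where "vh v = - crossv e1 v"

lemma vh_x0: "x \<in> S \<Longrightarrow> - cross3 e1 b \<bullet> x0 x = - rho x * Im (m x b)"
proof -
  assume x: "x \<in> S"
  have "- cross3 e1 b \<bullet> x0 x = - (b \<bullet> cross3 (x0 x) e1)" by (simp add: cross3_simps)
  also have "b \<bullet> cross3 (x0 x) e1 = rho x * Re (m x b * cnj (m x (cross3 (x0 x) e1)))"
    using isotropic_inner[OF rho[OF x], of b "cross3 (x0 x) e1"] by (simp add: dot_cross_self)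
  also have "m x (cross3 (x0 x) e1) = \<i>"
    unfolding isotropic_cross[OF rho[OF x]] m_axis1 isotropic_self[OF rho[OF x]] x0_x0 using r_pos[OF x]
    by (simp add: power2_eq_square)
  finally show ?thesis by simp
qed

lemma isotropic_surjective:
  assumes x: "x \<in> S"
  obtains a where "m x a = z" "a \<bullet> x0 x = s"
proof -
  have rp: "r x > 0" by (rule r_pos[OF x])
  \<comment> \<open>The coefficients invert the values m(x0) = 0, m(e1) = 1/r and m(x0 \<times> e1)
    = \<i>.\<close>
  let ?a = "(s - r x * cc x * Re z) *\<^sub>R ((1 / (r x)^2) *\<^sub>R x0 x) + (r x * Re z) *\<^sub>R e1 + Im z *\<^sub>R cross3 (x0 x) e1"
  have "m x ?a = z"
    using rp by (simp add: isotropic_linear isotropic_self[OF rho[OF x]] m_axis1 isotropic_cross[OF rho[OF x]] x0_x0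
        inner_axis' power2_eq_square complex_eq_iff)
  moreover have "?a \<bullet> x0 x = s"
    using rp by (simp add: inner_add_left x0_x0 dot_cross_self inner_axis' field_simps power2_eq_square)
  ultimately show ?thesis by (rule that)
qed

lemma m_vh: "x \<in> S \<Longrightarrow> m x (- cross3 e1 b) = - \<i> / of_real (r x) * (of_real (cc x) * m x b - of_real ((x0 x \<bullet> b) / r x))"
  unfolding isotropic_linear isotropic_cross[OF rho] m_axis1
  by (simp add: inner_axis' inner_commute algebra_simps)

lemma vh_nth: "vh v $ I = - cross3 e1 (v $ I)" by (simp add: vh_def crossv_def)

lemma wv_vh: "wv x A (vh v) = - cross3 e1 (wv x A v)"
  by (simp add: wv_def vh_nth Cross3.right_diff_distrib cross_mult_right)

lemma al_vh: "x \<in> S \<Longrightarrow> al x (vh v) = of_real (rho x / (r x)^2 * Im (m x (v $ None)))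
   - \<i> * of_real (cc x / (r x)^2) * (of_real (cc x) * m x (v $ None) - of_real ((x0 x \<bullet> v $ None) / r x))"
  unfolding al_def vh_nth m_vh using vh_x0[of x "v $ None"] by (simp add: inner_commute[of "x0 x"] power2_eq_square)

lemma mw_vh: "x \<in> S \<Longrightarrow> mw x A (vh v) = - \<i> / of_real (r x) * (of_real (cc x) * mw x A v - of_real ((wv x A v \<bullet> x0 x) / r x))"
  unfolding mw_wv wv_vh m_vh by (simp add: inner_commute)

lemma dps_vh: "x \<in> S \<Longrightarrow> dps x A (vh v) = (- rho x * Im (mw x A v) + rho x * Re (chi x $ A * cnj (m x (vh v $ None)))) / (r x)^2"
proof -
  assume x: "x \<in> S"
  have "(r x)^2 * dps x A (vh v) = wv x A (vh v) \<bullet> x0 x + rho x * Re (chi x $ A * cnj (m x (vh v $ None)))"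
    using wv_x0[OF x, of A "vh v"] by simp
  then show ?thesis using r_pos[OF x] unfolding wv_vh vh_x0[OF x] mw_wv by (simp add: field_simps)
qed

definition dq where "dq x v = v $ None $ 1 / r x - cc x * (x0 x \<bullet> v $ None) / (r x)^3"

lemma dq_eq: "x \<in> S \<Longrightarrow> dq x v = rho x / (r x)^2 * Re (m x (v $ None))"
  unfolding dq_def first_component[of x "v $ None"] using r_pos[of x]
  by (simp add: field_simps power2_eq_square power3_eq_cube)

lemma has_derivative_cr: "x \<in> S \<Longrightarrow> ((\<lambda>y. cc y / r y) has_derivative dq x) (at x)"
  unfolding dq_def
  by (rule has_derivative_eq_rhs[OF has_derivative_divide'[OF has_derivative_nth3 has_derivative_r]])
    (use r_pos[of x] in \<open>auto simp: fun_eq_iff field_simps power3_eq_cube\<close>)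

text \<open>The connection without the gauge shift, \<open>Im(L\<^bsub>x\<^sup>I z\<^sup>J\<^esub> dz\<^sup>J)\<close>; \<open>vh\<close> turns the real and imaginary parts
  of the \<open>z\<^sup>J\<close>.\<close>

definition A0 :: "'n config \<Rightarrow> 'n option \<Rightarrow> 'n config \<Rightarrow> real" where
  "A0 x I v = (1/2) * dird (\<lambda>y. dird L y (basis_vec I 1)) x (vh v)"

lemma A0_A: "x \<in> S \<Longrightarrow> A0 x (Some A) v = Im (df1 x A (vh v))"
  by (simp add: A0_def dL_A1_deriv)

text \<open>The terms with F_A collect to the real part of F_A times the conjugate of m(v^0), and
  Euler's relation turns F_A into F_AB chi^B. The real part of F_AB then cancels against the
  correction in \<open>wv_x0\<close>, so that only \<open>nn\<close> remains next to m(v^0).\<close>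

lemma connection_A:
  assumes x: "x \<in> S"
  shows "A0 x (Some A) v + dq x v * Re (f1 x A) + cc x / r x * Re (df1 x A v) =
    (\<Sum>B\<in>UNIV. Re (f2 x A B) * dps x B v) - rho x / (r x)^2 * (\<Sum>B\<in>UNIV. nn x A B * Im (chi x $ B * cnj (m x (v $ None))))"
proof -
  have r: "r x > 0" by (rule r_pos[OF x])
  let ?\<mu> = "m x (v $ None)"
  have 1: "Im (f1 x A * al x (vh v)) + dq x v * Re (f1 x A) + cc x / r x * Re (f1 x A * al x v) = rho x / (r x)^2 * Re (f1 x A * cnj ?\<mu>)"
  proof -
    have al_v: "al x v = - of_real ((x0 x \<bullet> v $ None) / r x / r x) + of_real (cc x / r x) * ?\<mu>" by (simp add: al_def power2_eq_square)
    show ?thesis unfolding al_vh[OF x] dq_eq[OF x] al_v using r by (simp add: field_simps power2_eq_square)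
  qed
  have 2: "Im (f2 x A B * mw x B (vh v)) + cc x / r x * Re (f2 x A B * mw x B v) = Re (f2 x A B) * (wv x B v \<bullet> x0 x) / (r x)^2" for B
    unfolding mw_vh[OF x] using r by (simp add: field_simps power2_eq_square)
  have "A0 x (Some A) v + dq x v * Re (f1 x A) + cc x / r x * Re (df1 x A v) =
    (Im (f1 x A * al x (vh v)) + dq x v * Re (f1 x A) + cc x / r x * Re (f1 x A * al x v))
    + (\<Sum>B\<in>UNIV. Im (f2 x A B * mw x B (vh v)) + cc x / r x * Re (f2 x A B * mw x B v))"
    unfolding A0_A[OF x] df1_def plus_complex.sel Im_sum Re_sum by (simp add: sum.distrib sum_distrib_left distrib_left)
  also have "\<dots> = rho x / (r x)^2 * Re ((\<Sum>B\<in>UNIV. f2 x A B * chi x $ B) * cnj ?\<mu>) + (\<Sum>B\<in>UNIV. Re (f2 x A B) * (wv x B v \<bullet> x0 x) / (r x)^2)"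
    unfolding 1 2 euler1[OF chi_D[OF x]] ..
  also have "\<dots> = (\<Sum>B\<in>UNIV. rho x / (r x)^2 * Re (f2 x A B * chi x $ B * cnj ?\<mu>) + Re (f2 x A B) * (wv x B v \<bullet> x0 x) / (r x)^2)"
    by (simp only: sum_distrib_right Re_sum sum_distrib_left sum.distrib)
  also have "\<dots> = (\<Sum>B\<in>UNIV. Re (f2 x A B) * dps x B v - rho x / (r x)^2 * (nn x A B * Im (chi x $ B * cnj ?\<mu>)))"
    unfolding wv_x0[OF x] nn_def using r
    by (intro sum.cong refl) (simp add: field_simps power2_eq_square)
  finally show ?thesis by (simp add: sum_subtractf sum_distrib_left)
qed

text \<open>The function \<open>g0\<close> and \<open>- (x\<^sup>0\<^sub>1/r\<^sup>0) Re F\<^sub>A\<close> are the gauge shifts that make \<open>\<psi>\<^sub>0\<close> and \<open>\<psi>\<^sub>A\<close> invariant: up to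
  their differentials the connection depends on \<open>v\<close> only through \<open>d\<psi>\<^sup>~\<close>, \<open>mw\<close> and \<open>m(v\<^sup>0)\<close>.\<close>

definition g0 :: "'n config \<Rightarrow> real" where
  "g0 x = - Re (f0 x) + (1/2) * (1 - (cc x / r x)^2) * (\<Sum>A\<in>UNIV. Re (f1 x A) * Re (chi x $ A)) + cc x / r x * (\<Sum>A\<in>UNIV. ps x A * Re (f1 x A))"

definition dg0 :: "'n config \<Rightarrow> 'n config \<Rightarrow> real" where
  "dg0 x v = - Re (df0 x v) - (cc x / r x) * dq x v * (\<Sum>A\<in>UNIV. Re (f1 x A) * Re (chi x $ A))
     + (1/2) * (rho x / (r x)^2) * (\<Sum>A\<in>UNIV. Re (df1 x A v) * Re (chi x $ A) + Re (f1 x A) * Re (al x v * chi x $ A + mw x A v))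
     + (\<Sum>A\<in>UNIV. ps x A * (dq x v * Re (f1 x A) + cc x / r x * Re (df1 x A v))) + cc x / r x * (\<Sum>A\<in>UNIV. dps x A v * Re (f1 x A))"

lemma has_derivative_g0:
  assumes x: "x \<in> S"
  shows "(g0 has_derivative dg0 x) (at x)"
proof -
  note Re = bounded_linear.has_derivative[OF bounded_linear_Re]
  have q2: "((\<lambda>y. 1 - (cc y / r y)^2) has_derivative (\<lambda>v. - (2 * (cc x / r x) * dq x v))) (at x)"
    by (rule has_derivative_eq_rhs[OF has_derivative_diff[OF has_derivative_const has_derivative_power[OF has_derivative_cr[OF x], of 2]]])
      (simp add: fun_eq_iff mult_ac)
  have rr: "1 - (cc x / r x)^2 = rho x / (r x)^2" using r_pos[OF x] by (simp add: rho_r field_simps)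
  show ?thesis
    unfolding g0_def[abs_def]
    by (rule has_derivative_eq_rhs[OF has_derivative_add[OF has_derivative_add[OF has_derivative_minus[OF Re[OF has_derivative_f0[OF x, folded df0_def]]]
       has_derivative_mult[OF has_derivative_mult_right[OF q2] has_derivative_sum[OF has_derivative_mult[OF Re[OF has_derivative_f1[OF x, folded df1_def]] Re[OF has_derivative_chi_nth[OF x]]]]]]
       has_derivative_mult[OF has_derivative_cr[OF x] has_derivative_sum[OF has_derivative_mult[OF has_derivative_ps[OF x] Re[OF has_derivative_f1[OF x, folded df1_def]]]]]]])
      (simp add: fun_eq_iff dg0_def rr sum.distrib[symmetric] sum_distrib_left sum_negf[symmetric] algebra_simps)
qed

lemma df1_chi_sum:
  assumes x: "x \<in> S"
  shows "(\<Sum>A\<in>UNIV. Re (df1 x A v) * Re (chi x $ A) + Re (f1 x A) * Re (al x v * chi x $ A + mw x A v)) =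
    (\<Sum>A\<in>UNIV. Re (f1 x A * al x v) * Re (chi x $ A) + Re (f1 x A) * Re (al x v * chi x $ A) + 2 * (Re (f1 x A) * Re (mw x A v)))
    - (\<Sum>A\<in>UNIV. \<Sum>B\<in>UNIV. nn x A B * Im (cnj (chi x $ A) * mw x B v))"
proof -
  have "(\<Sum>A\<in>UNIV. Re (f1 x A) * Re (mw x A v)) = (\<Sum>A\<in>UNIV. \<Sum>B\<in>UNIV. Re (f2 x A B * chi x $ B) * Re (mw x A v))"
    using euler1[OF chi_D[OF x]] by (simp only: Re_sum[symmetric] sum_distrib_right[symmetric])
  also have "\<dots> = (\<Sum>A\<in>UNIV. \<Sum>B\<in>UNIV. Re (f2 x B A * chi x $ A) * Re (mw x B v))" by (rule sum.swap)
  also have "\<dots> = (\<Sum>A\<in>UNIV. \<Sum>B\<in>UNIV. Re (f2 x A B * chi x $ A) * Re (mw x B v))"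
    by (intro sum.cong refl, subst F2_sym[OF chi_D[OF x]], rule refl)
  finally have f1w: "(\<Sum>A\<in>UNIV. Re (f1 x A) * Re (mw x A v)) = (\<Sum>A\<in>UNIV. \<Sum>B\<in>UNIV. Re (f2 x A B * chi x $ A) * Re (mw x B v))" .
  have "(\<Sum>A\<in>UNIV. Re (\<Sum>B\<in>UNIV. f2 x A B * mw x B v) * Re (chi x $ A)) =
     (\<Sum>A\<in>UNIV. \<Sum>B\<in>UNIV. Re (f2 x A B * chi x $ A) * Re (mw x B v) - nn x A B * Im (cnj (chi x $ A) * mw x B v))"
    unfolding Re_sum sum_distrib_right nn_def by (intro sum.cong refl) (simp add: algebra_simps)
  also have "\<dots> = (\<Sum>A\<in>UNIV. Re (f1 x A) * Re (mw x A v)) - (\<Sum>A\<in>UNIV. \<Sum>B\<in>UNIV. nn x A B * Im (cnj (chi x $ A) * mw x B v))"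
    unfolding f1w by (simp add: sum_subtractf)
  finally have 1: "(\<Sum>A\<in>UNIV. Re (\<Sum>B\<in>UNIV. f2 x A B * mw x B v) * Re (chi x $ A)) =
     (\<Sum>A\<in>UNIV. Re (f1 x A) * Re (mw x A v)) - (\<Sum>A\<in>UNIV. \<Sum>B\<in>UNIV. nn x A B * Im (cnj (chi x $ A) * mw x B v))" .
  have "(\<Sum>A\<in>UNIV. Re (df1 x A v) * Re (chi x $ A) + Re (f1 x A) * Re (al x v * chi x $ A + mw x A v)) =
    (\<Sum>A\<in>UNIV. Re (f1 x A * al x v) * Re (chi x $ A) + Re (f1 x A) * Re (al x v * chi x $ A) + Re (f1 x A) * Re (mw x A v))
    + (\<Sum>A\<in>UNIV. Re (\<Sum>B\<in>UNIV. f2 x A B * mw x B v) * Re (chi x $ A))"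
    unfolding sum.distrib[symmetric] df1_def plus_complex.sel(1) by (intro sum.cong refl) (simp only: algebra_simps)
  then show ?thesis unfolding 1 by (simp add: sum.distrib sum_distrib_left[symmetric])
qed

text \<open>The contribution of one index \<open>A\<close> to \<open>connection_0\<close>, with F_A,
  chi^A, mw^A and m(v^0) replaced by the variables \<open>f\<close>, \<open>h\<close>,
  \<open>w\<close>, \<open>\<mu>\<close> so that it becomes a plain identity of rational functions.
  The squared length of the transverse part of x^0 appears as r^2 - c^2.\<close>

lemma connection_0_term:
  fixes f h w \<mu> :: complex and r c a b :: real
  assumes "r > 0"
  shows "c * (r^2 - c^2) * Im \<mu> / r^3 * (Im (f * h) / 2)
     + c / r * Im (f * h * (of_real ((r^2 - c^2) / r^2 * Im \<mu>) - \<i> * of_real (c / r^2) * (of_real c * \<mu> - of_real a))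
         + f * (- \<i> / of_real r * (of_real c * w - of_real (b / r))))
     - (- (r^2 - c^2) * Im w + (r^2 - c^2) * Re (h * cnj (- \<i> / of_real r * (of_real c * \<mu> - of_real a)))) / r^2 * Im f
   = - Re (f * h * (- of_real (a / r) + of_real (c / r) * \<mu>) + f * w) - c / r * ((r^2 - c^2) / r^2 * Re \<mu>) * (Re f * Re h)
     + (1/2) * ((r^2 - c^2) / r^2) * (Re (f * (- of_real (a / r) + of_real (c / r) * \<mu>)) * Re h + Re f * Re ((- of_real (a / r) + of_real (c / r) * \<mu>) * h) + 2 * (Re f * Re w))
     + c / r * ((b + (r^2 - c^2) * Re (h * cnj \<mu>)) / r^2 * Re f)"
  using assms by (simp add: field_simps power2_eq_square power3_eq_cube)

text \<open>Adding ps^A times the \<open>Some A\<close> components removes the derivatives of F_A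
  that \<open>dL_01_deriv\<close> multiplies by \<open>ps\<close>. Since F is half of F_A chi^A,
  what is left is a sum over A that can be compared term by term; the term with \<open>nn\<close>
  comes from \<open>df1_chi_sum\<close>.\<close>

lemma connection_0:
  assumes x: "x \<in> S"
  shows "A0 x None v + (\<Sum>A\<in>UNIV. ps x A * A0 x (Some A) v) =
    dg0 x v - (\<Sum>A\<in>UNIV. ps x A * (dq x v * Re (f1 x A) + cc x / r x * Re (df1 x A v)))
     + (1/2) * (rho x / (r x)^2) * (\<Sum>A\<in>UNIV. \<Sum>B\<in>UNIV. nn x A B * Im (cnj (chi x $ A) * mw x B v))"
proof -
  have rp: "r x > 0" by (rule r_pos[OF x])
  let ?\<mu> = "m x (v $ None)" and ?a = "(x0 x \<bullet> v $ None) / r x"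
  have x0vh: "x0 x \<bullet> vh v $ None = - rho x * Im ?\<mu>"
    using vh_x0[OF x, of "v $ None"] by (simp add: vh_nth inner_commute)
  have vh1: "vh v $ None $ 1 = 0" by (simp add: vh_nth cross3_def axis_def)
  have f0: "f0 x = (\<Sum>A\<in>UNIV. f1 x A * chi x $ A) / 2" using euler0[OF chi_D[OF x]] by simp
  have al_v: "al x v = - of_real (?a / r x) + of_real (cc x / r x) * ?\<mu>" by (simp add: al_def power2_eq_square)
  have df0: "df0 x u = (\<Sum>A\<in>UNIV. f1 x A * chi x $ A * al x u + f1 x A * mw x A u)" for u
    unfolding df0_def f0 by (simp add: sum.distrib sum_distrib_right)
  have t: "dps x A v = (wv x A v \<bullet> x0 x + rho x * Re (chi x $ A * cnj ?\<mu>)) / (r x)^2" for A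
    using wv_x0[OF x, of A v] rp by (simp add: field_simps)
  have mvh: "m x (vh v $ None) = - \<i> / of_real (r x) * (of_real (cc x) * ?\<mu> - of_real ?a)"
    unfolding vh_nth m_vh[OF x] ..
  have "A0 x None v + (\<Sum>A\<in>UNIV. ps x A * A0 x (Some A) v) =
     cc x * rho x * Im ?\<mu> / (r x)^3 * Im (f0 x) + cc x / r x * Im (df0 x (vh v)) - (\<Sum>A\<in>UNIV. dps x A (vh v) * Im (f1 x A))"
    unfolding A0_A[OF x] unfolding A0_def dL_01_deriv[OF x] x0vh vh1
    by (simp add: sum.distrib algebra_simps)
  also have "\<dots> = (\<Sum>A\<in>UNIV. cc x * rho x * Im ?\<mu> / (r x)^3 * (Im (f1 x A * chi x $ A) / 2)
     + cc x / r x * Im (f1 x A * chi x $ A * al x (vh v) + f1 x A * mw x A (vh v)) - dps x A (vh v) * Im (f1 x A))"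
    unfolding df0 f0 by (simp only: Im_divide_numeral Im_sum plus_complex.sel sum_divide_distrib sum_distrib_left sum.distrib sum_subtractf distrib_left)
  also have "\<dots> = (\<Sum>A\<in>UNIV. - Re (f1 x A * chi x $ A * al x v + f1 x A * mw x A v) - cc x / r x * dq x v * (Re (f1 x A) * Re (chi x $ A))
     + (1/2) * (rho x / (r x)^2) * (Re (f1 x A * al x v) * Re (chi x $ A) + Re (f1 x A) * Re (al x v * chi x $ A) + 2 * (Re (f1 x A) * Re (mw x A v)))
     + cc x / r x * (dps x A v * Re (f1 x A)))"
  proof (intro sum.cong refl)
    fix A
    show "cc x * rho x * Im ?\<mu> / (r x)^3 * (Im (f1 x A * chi x $ A) / 2)
     + cc x / r x * Im (f1 x A * chi x $ A * al x (vh v) + f1 x A * mw x A (vh v)) - dps x A (vh v) * Im (f1 x A)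
     = - Re (f1 x A * chi x $ A * al x v + f1 x A * mw x A v) - cc x / r x * dq x v * (Re (f1 x A) * Re (chi x $ A))
     + (1/2) * (rho x / (r x)^2) * (Re (f1 x A * al x v) * Re (chi x $ A) + Re (f1 x A) * Re (al x v * chi x $ A) + 2 * (Re (f1 x A) * Re (mw x A v)))
     + cc x / r x * (dps x A v * Re (f1 x A))"
      unfolding dps_vh[OF x] al_vh[OF x] mw_vh[OF x] mvh al_v dq_eq[OF x] t rho_r
      by (rule connection_0_term[OF rp])
  qed
  also have "\<dots> = - Re (df0 x v) - cc x / r x * dq x v * (\<Sum>A\<in>UNIV. Re (f1 x A) * Re (chi x $ A))
     + (1/2) * (rho x / (r x)^2) * (\<Sum>A\<in>UNIV. Re (f1 x A * al x v) * Re (chi x $ A) + Re (f1 x A) * Re (al x v * chi x $ A) + 2 * (Re (f1 x A) * Re (mw x A v)))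
     + cc x / r x * (\<Sum>A\<in>UNIV. dps x A v * Re (f1 x A))"
    unfolding df0 by (simp only: Re_sum plus_complex.sel minus_add_distrib distrib_left sum_distrib_left sum.distrib sum_subtractf sum_negf add_ac diff_conv_add_uminus)
  finally show ?thesis unfolding dg0_def df1_chi_sum[OF x] by (simp add: algebra_simps)
qed

end

subsection \<open>The coordinates \<open>\<X>\<close> and \<open>\<psi>\<^sup>~\<close>\<close>

lemma has_derivative_rho2: "(rho2 has_derivative (\<lambda>v. 2 * (a $ 2 * v $ 2 + a $ 3 * v $ 3))) (at a)"
  unfolding rho2_def[abs_def]
  by (rule has_derivative_eq_rhs[OF has_derivative_add[OF has_derivative_power[OF has_derivative_nth] has_derivative_power[OF has_derivative_nth]]])
    (simp add: fun_eq_iff mult_ac)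

lemma log_derivative_quotient:
  fixes a b c x y z :: real
  assumes "b \<noteq> 0" "c \<noteq> 0"
  shows "(a * (2 * x) * (4 * (b * c)) - a * (4 * (b * (c * (2 * z)) + b * (2 * y) * c))) / (4 * (b * c) * (4 * (b * c)))
    = a / (4 * (b * c)) * (2 * (x - y - z))"
  using assms by (simp add: field_simps)

lemma log_derivative_sqrt:
  assumes "h > 0"
  shows "h * (2 * l) * (inverse (sqrt h) / 2) = sqrt h * l"
proof -
  have "h = sqrt h * sqrt h" using assms by simp
  then have "h * inverse (sqrt h) = sqrt h" by (metis assms less_irrefl nonzero_mult_div_cancel_right divide_inverse real_sqrt_eq_zero_cancel_iff)
  then show ?thesis by (simp add: mult_ac)
qed

context cmap
begin

text \<open>\<open>chi x $ o1\<close> is the value of \<open>m\<close> on the part of x^1 orthogonal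
  to x^0, and by \<open>inner_xp\<close> it vanishes only together with that part.\<close>

lemma noncollinear_iff: "x \<in> S \<Longrightarrow> \<not> collinear {0, x $ None, x $ Some o1} \<longleftrightarrow> chi x $ o1 \<noteq> 0"
proof -
  assume x: "x \<in> S"
  have x0: "x $ None \<noteq> 0" using r_pos[OF x] by auto
  have "collinear {0, x $ None, x $ Some o1} \<longleftrightarrow> (\<exists>c. x $ Some o1 = c *\<^sub>R x $ None)"
    using x0 unfolding collinear_lemma by (metis scaleR_zero_left)
  also have "\<dots> \<longleftrightarrow> chi x $ o1 = 0"
  proof
    assume "\<exists>c. x $ Some o1 = c *\<^sub>R x $ None"
    then show "chi x $ o1 = 0" by (auto simp: chi_eq[OF x] isotropic_linear isotropic_self[OF rho[OF x]])
  next
    assume "chi x $ o1 = 0"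
    then have "b \<bullet> xp x o1 = 0" for b using inner_xp[OF x, of b o1] by simp
    then have "xp x o1 = 0" using inner_eq_zero_iff by blast
    then show "\<exists>c. x $ Some o1 = c *\<^sub>R x $ None" by (auto simp: xp_def)
  qed
  finally show ?thesis by blast
qed

lemma rho_pos: "x \<in> S \<Longrightarrow> rho x > 0"
  using rho[of x] by (simp add: rho2_def less_le)

text \<open>\<open>\<X> = kk \<chi>\<close> where the phase of \<open>kk\<close> makes \<open>\<X>\<^sup>1\<close> real and positive, and \<open>|kk| = |z\<^sup>0| / r\<^sup>0\<close>.\<close>

definition sk :: "'n \<Rightarrow> 'n config \<Rightarrow> real" where
  "sk o1 x = sqrt (rho x / (4 * ((r x)^2 * ((Re (chi x $ o1))^2 + (Im (chi x $ o1))^2))))"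

definition kk :: "'n \<Rightarrow> 'n config \<Rightarrow> complex" where "kk o1 x = of_real (sk o1 x) * cnj (chi x $ o1)"

definition XX :: "'n \<Rightarrow> 'n config \<Rightarrow> complex^'n" where "XX o1 x = kk o1 x *s chi x"

abbreviation NS :: "'n \<Rightarrow> 'n config set" where "NS o1 \<equiv> {x\<in>S. chi x $ o1 \<noteq> 0}"

lemma open_NS: "open (NS o1)"
proof -
  have "continuous_on S (\<lambda>x. chi x $ o1)"
    using smooth_on_compose_linear[OF bounded_linear_vec_nth openS smooth_chi, of o1]
    unfolding smooth_on_def by (metis Ck_on.simps(1))
  then have "open (S \<inter> (\<lambda>x. chi x $ o1) -` (- {0}))"
    by (rule continuous_open_preimage[OF _ openS]) auto
  moreover have "S \<inter> (\<lambda>x. chi x $ o1) -` (- {0}) = NS o1" by auto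
  ultimately show ?thesis by simp
qed

lemma modulus_pos: "z \<noteq> 0 \<Longrightarrow> (Re z)^2 + (Im z)^2 > 0"
  by (metis complex_neq_0)

lemma sk_pos: "x \<in> NS o1 \<Longrightarrow> sk o1 x > 0"
  using rho_pos[of x] r_pos[of x] modulus_pos[of "chi x $ o1"] by (simp add: sk_def)

lemma sk_sq: "x \<in> NS o1 \<Longrightarrow> (sk o1 x)^2 = rho x / (4 * ((r x)^2 * ((Re (chi x $ o1))^2 + (Im (chi x $ o1))^2)))"
  using rho_pos[of x] unfolding sk_def by (subst real_sqrt_pow2) auto

lemma kk_nz: "x \<in> NS o1 \<Longrightarrow> kk o1 x \<noteq> 0"
  using sk_pos[of x o1] by (auto simp: kk_def)

lemma kk_norm: "x \<in> NS o1 \<Longrightarrow> kk o1 x * cnj (kk o1 x) = of_real (rho x / (4 * (r x)^2))"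
proof -
  assume x: "x \<in> NS o1"
  have "kk o1 x * cnj (kk o1 x) = of_real ((sk o1 x)^2) * (chi x $ o1 * cnj (chi x $ o1))"
    by (simp add: kk_def power2_eq_square mult_ac)
  also have "\<dots> = of_real ((sk o1 x)^2 * ((Re (chi x $ o1))^2 + (Im (chi x $ o1))^2))"
    unfolding complex_mult_cnj of_real_mult ..
  finally have "kk o1 x * cnj (kk o1 x) = of_real ((sk o1 x)^2 * ((Re (chi x $ o1))^2 + (Im (chi x $ o1))^2))" .
  then show ?thesis unfolding sk_sq[OF x] using modulus_pos[of "chi x $ o1"] x by (auto simp: complex_eq_iff)
qed

lemma XX_o1: "XX o1 x $ o1 = of_real (sk o1 x * ((Re (chi x $ o1))^2 + (Im (chi x $ o1))^2))"
  unfolding of_real_mult complex_mult_cnj[symmetric] by (simp add: XX_def kk_def mult_ac)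

text \<open>The components of x^A along \<open>xp x o1\<close> and along its cross product with x^0
  are, up to real factors, the real and imaginary parts of chi^A times the conjugate of chi^1;
  normalising them produces exactly \<open>kk\<close>.\<close>

lemma inhomogeneous_cmap:
  assumes x: "x \<in> NS o1"
  shows "psi_tilde o1 x $ A = ps x A" "cal_X o1 x = XX o1 x"
proof -
  have S: "x \<in> S" and c0: "chi x $ o1 \<noteq> 0" using x by auto
  let ?y = "xp x o1" and ?c = "chi x $ o1"
  have y: "?y = x $ Some o1 - ((x $ None \<bullet> x $ Some o1) / (norm (x $ None))^2) *\<^sub>R x $ None" by (simp add: xp_def ps_def)
  have x0: "x $ None \<noteq> 0" using r_pos[OF S] by auto
  have yy: "?y \<bullet> ?y = rho x * ((Re ?c)^2 + (Im ?c)^2)"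
    unfolding inner_xp[OF S] m_xp[OF S] by (simp add: power2_eq_square)
  then have y0: "?y \<noteq> 0" using rho_pos[OF S] modulus_pos[OF c0] by auto
  have ny: "norm ?y > 0" "(norm ?y)^2 = rho x * ((Re ?c)^2 + (Im ?c)^2)" using y0 yy by (simp_all add: power2_norm_eq_inner)
  note E = inhomogeneous_eqI[OF y x0 y0]
  show "psi_tilde o1 x $ A = ps x A"
    by (simp add: psi_tilde_def E ps_def inner_commute)
  have mc: "m x (cross3 (x0 x) ?y) = \<i> * of_real (r x) * ?c"
    unfolding isotropic_cross[OF rho[OF S]] isotropic_self[OF rho[OF S]] x0_x0 m_xp[OF S] using r_pos[OF S]
    by (simp add: power2_eq_square)
  have cr: "b \<bullet> cross3 (x0 x) ?y = rho x * r x * Im (m x b * cnj ?c)" for b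
    unfolding isotropic_inner[OF rho[OF S], of b "cross3 (x0 x) ?y"] mc by (simp add: dot_cross_self algebra_simps)
  have sk: "sk o1 x = rho x / (2 * r x * norm ?y)"
  proof -
    have "(sk o1 x)^2 = (rho x / (2 * r x * norm ?y))^2"
      unfolding sk_sq[OF x] power_divide power_mult_distrib ny(2) using rho_pos[OF S] by (simp add: power2_eq_square)
    moreover have "rho x / (2 * r x * norm ?y) > 0" using rho_pos[OF S] r_pos[OF S] ny(1) by simp
    ultimately show ?thesis using sk_pos[OF x] by (simp add: power2_eq_iff_nonneg)
  qed
  have "cal_X o1 x $ A = XX o1 x $ A" for A
    unfolding cal_X_def XX_def kk_def zc_def sk using ny(1) r_pos[OF S]
    by (simp add: E inner_xp[OF S] cr chi_eq[OF S] complex_eq_iff power2_eq_square mult_ac)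
  then show "cal_X o1 x = XX o1 x" by (simp add: vec_eq_iff)
qed

lemma XX_o1_real: "x \<in> NS o1 \<Longrightarrow> Im (XX o1 x $ o1) = 0 \<and> Re (XX o1 x $ o1) > 0"
  unfolding XX_o1 using sk_pos[of x o1] modulus_pos[of "chi x $ o1"] by simp

lemma noncollinear_part_eq: "noncollinear_part o1 S = NS o1 \<times> UNIV"
  unfolding noncollinear_part_def using noncollinear_iff by auto

text \<open>\<open>kap\<close> is the motion of \<open>v\<close> along the orbits by which \<open>dXX\<close> differs from \<open>kk mw\<close>: its real part is the scaling of
  \<open>x\<^sup>0\<close>, its imaginary part the rotation about \<open>x\<^sup>0\<close>.\<close>

definition eta :: "'n \<Rightarrow> 'n config \<Rightarrow> 'n config \<Rightarrow> complex" where "eta o1 x v = mw x o1 v / chi x $ o1"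
definition kap :: "'n \<Rightarrow> 'n config \<Rightarrow> 'n config \<Rightarrow> complex" where "kap o1 x v = Complex (lam x v) (Im (eta o1 x v))"
definition dXX :: "'n \<Rightarrow> 'n config \<Rightarrow> 'n config \<Rightarrow> complex^'n" where
  "dXX o1 x v = (\<chi> A. kk o1 x * mw x A v - kap o1 x v * XX o1 x $ A)"

text \<open>\<open>sk\<close> is the square root of a quotient of products, so the logarithmic
  derivatives of the factors are computed separately and the square root halves their
  combination.\<close>

lemma has_derivative_sk:
  assumes x: "x \<in> NS o1"
  shows "(sk o1 has_derivative (\<lambda>v. sk o1 x * (lam x v - 2 * (cc x / r x) * Re (m x (v $ None)) - Re (eta o1 x v)))) (at x)"
proof -
  have S: "x \<in> S" and c0: "chi x $ o1 \<noteq> 0" using x by auto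
  note rp = r_pos[OF S]
  let ?c = "chi x $ o1" and ?n = "\<lambda>x. (Re (chi x $ o1))^2 + (Im (chi x $ o1))^2"
  have n: "?n x > 0" by (rule modulus_pos[OF c0])
  have dn: "(?n has_derivative (\<lambda>v. ?n x * (2 * Re (al x v + eta o1 x v)))) (at x)"
  proof -
    have "al x v * ?c + mw x o1 v = (al x v + eta o1 x v) * ?c" for v using c0 by (simp add: eta_def field_simps)
    then show ?thesis
    by (intro has_derivative_eq_rhs[OF has_derivative_add[OF
      has_derivative_power[OF bounded_linear.has_derivative[OF bounded_linear_Re has_derivative_chi_nth[OF S]]]
      has_derivative_power[OF bounded_linear.has_derivative[OF bounded_linear_Im has_derivative_chi_nth[OF S]]]]])
      (simp add: fun_eq_iff power2_eq_square algebra_simps)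
  qed
  have drho: "(rho has_derivative (\<lambda>v. rho x * (2 * (lam x v - (cc x / r x) * Re (m x (v $ None)))))) (at x)"
  proof (rule has_derivative_eq_rhs[OF has_derivative_compose[OF has_derivative_nth has_derivative_rho2]], rule ext)
    fix v :: "'n config"
    let ?b = "v $ None"
    have 1: "x0 x $ 2 * ?b $ 2 + x0 x $ 3 * ?b $ 3 = x0 x \<bullet> ?b - cc x * ?b $ 1" by (simp add: inner_3)
    show "2 * (x0 x $ 2 * ?b $ 2 + x0 x $ 3 * ?b $ 3) = rho x * (2 * (lam x v - (cc x / r x) * Re (m x ?b)))"
      unfolding 1 first_component[OF S, of ?b] lam_def rho_r using rp by (simp add: field_simps power2_eq_square)
  qed
  have dr2: "((\<lambda>y. (r y)^2) has_derivative (\<lambda>v. (r x)^2 * (2 * lam x v))) (at x)"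
    by (rule has_derivative_eq_rhs[OF has_derivative_power[OF has_derivative_r[OF S]]])
      (use rp in \<open>simp add: fun_eq_iff lam_def power2_eq_square\<close>)
  let ?l = "\<lambda>v. lam x v - 2 * (cc x / r x) * Re (m x (v $ None)) - Re (eta o1 x v)"
  let ?h = "\<lambda>x. rho x / (4 * ((r x)^2 * ?n x))"
  have Re_al: "Re (al x v) = - lam x v + cc x / r x * Re (m x (v $ None))" for v by (simp add: al_def lam_def)
  have dh: "(?h has_derivative (\<lambda>v. ?h x * (2 * ?l v))) (at x)"
  proof (rule has_derivative_eq_rhs[OF has_derivative_divide'[OF drho has_derivative_mult_right[OF has_derivative_mult[OF dr2 dn]]]], goal_cases)
    case 1
    show ?case using rp c0 by (simp add: complex_eq_iff)
  next
    case 2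
    have l: "?l v = (lam x v - (cc x / r x) * Re (m x (v $ None))) - lam x v - Re (al x v + eta o1 x v)" for v
      by (simp add: Re_al)
    show ?case unfolding l by (rule ext, rule log_derivative_quotient) (use rp n in auto)
  qed
  have hp: "?h x > 0" using rho_pos[OF S] rp n by simp
  have "((\<lambda>x. sqrt (?h x)) has_derivative (\<lambda>v. ?h x * (2 * ?l v) * (inverse (sqrt (?h x)) / 2))) (at x)"
    using has_derivative_compose[OF dh DERIV_real_sqrt[OF hp, THEN DERIV_subset, OF subset_UNIV, unfolded has_field_derivative_def]]
    by (simp add: mult.commute)
  then show ?thesis unfolding sk_def[abs_def] log_derivative_sqrt[OF hp] .
qed

lemma has_derivative_kk:
  assumes x: "x \<in> NS o1"
  shows "(kk o1 has_derivative (\<lambda>v. - (al x v + kap o1 x v) * kk o1 x)) (at x)"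
proof -
  have S: "x \<in> S" and c0: "chi x $ o1 \<noteq> 0" using x by auto
  let ?l = "\<lambda>v. lam x v - 2 * (cc x / r x) * Re (m x (v $ None)) - Re (eta o1 x v)"
  have "mw x o1 v = eta o1 x v * chi x $ o1" for v using c0 by (simp add: eta_def)
  moreover have "of_real (?l v) + cnj (al x v + eta o1 x v) = - (al x v + kap o1 x v)" for v
    by (simp add: complex_eq_iff kap_def al_def lam_def)
  moreover have "of_real (sk o1 x) * cnj (al x v * chi x $ o1 + eta o1 x v * chi x $ o1) + of_real (sk o1 x * ?l v) * cnj (chi x $ o1)
     = (of_real (?l v) + cnj (al x v + eta o1 x v)) * kk o1 x" for v
    by (simp add: kk_def distrib_left distrib_right mult_ac)
  ultimately have "of_real (sk o1 x) * cnj (al x v * chi x $ o1 + mw x o1 v) + of_real (sk o1 x * ?l v) * cnj (chi x $ o1)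
     = - (al x v + kap o1 x v) * kk o1 x" for v
    by (simp only:)
  then show ?thesis unfolding kk_def[abs_def]
    by (intro has_derivative_eq_rhs[OF has_derivative_mult[OF has_derivative_of_real[OF has_derivative_sk[OF x]]
      bounded_linear.has_derivative[OF bounded_linear_cnj has_derivative_chi_nth[OF S]]]]) (simp add: fun_eq_iff kk_def)
qed

lemma has_derivative_XX:
  assumes x: "x \<in> NS o1"
  shows "(XX o1 has_derivative dXX o1 x) (at x)"
proof -
  have S: "x \<in> S" using x by auto
  have "((\<lambda>y. XX o1 y $ A) has_derivative (\<lambda>v. dXX o1 x v $ A)) (at x)" for A
    unfolding XX_def[abs_def] vector_smult_component dXX_def vec_lambda_beta
    by (rule has_derivative_eq_rhs[OF has_derivative_mult[OF has_derivative_kk[OF x] has_derivative_chi_nth[OF S]]])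
      (simp add: fun_eq_iff algebra_simps)
  then show ?thesis
    by (subst has_derivative_componentwise_within)
      (auto simp: Basis_vec_def inner_axis intro!: has_derivative_inner_left)
qed

lemma smooth_XX: "smooth_on (NS o1) (XX o1)"
proof -
  note sub = smooth_on_subset[of S _ "NS o1"]
  have c: "smooth_on (NS o1) (\<lambda>x. chi x $ A)" for A
    by (rule sub[OF smooth_on_compose_linear[OF bounded_linear_vec_nth openS smooth_chi]]) auto
  have n: "smooth_on (NS o1) (\<lambda>x. x $ I $ i)" for I i by (intro smooth_intros open_NS)
  have r: "smooth_on (NS o1) r" by (rule sub[OF smooth_r]) auto
  have rho: "smooth_on (NS o1) rho" unfolding rho2_def by (intro smooth_intros open_NS n)
  have pos: "4 * ((r x)^2 * ((Re (chi x $ o1))^2 + (Im (chi x $ o1))^2)) > 0" if "x \<in> NS o1" for x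
    using r_pos[of x] modulus_pos[of "chi x $ o1"] that by simp
  have h: "smooth_on (NS o1) (\<lambda>x. rho x / (4 * ((r x)^2 * ((Re (chi x $ o1))^2 + (Im (chi x $ o1))^2))))"
    by (rule smooth_on_divide[OF open_NS rho _ less_imp_neq[OF pos, symmetric]]) (intro smooth_intros open_NS c r)
  have "smooth_on (NS o1) (sk o1)"
    unfolding sk_def[abs_def]
    by (rule smooth_on_sqrt[OF open_NS h], rule divide_pos_pos[OF rho_pos pos]) auto
  then have "smooth_on (NS o1) (\<lambda>x. XX o1 x $ A)" for A
    unfolding XX_def kk_def vector_smult_component by (intro smooth_intros open_NS c)
  then show ?thesis by (rule smooth_on_vec[OF open_NS])
qed

lemma smooth_ps: "smooth_on S (\<lambda>x. ps x A)"
  unfolding ps_def by (intro smooth_intros openS smooth_r) (use r_pos in force)+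

end

subsection \<open>Invariant fiber coordinates\<close>

text \<open>The condition that \<X>^1 be real cuts a hyperplane out of a space of dimension 4n +
  1.\<close>

lemma dim_base_tangent: "dim (base_tangent (o1 :: 'n::finite)) = 4 * CARD('n)"
proof -
  let ?a = "(0, 0, axis o1 \<i>) :: 'n base"
  have "base_tangent o1 = {v. ?a \<bullet> v = 0}"
    by (auto simp: base_tangent_def inner_prod_def inner_axis' inner_complex_def)
  moreover have "?a \<noteq> 0" by (simp add: zero_prod_def axis_eq_0_iff)
  ultimately have "dim (base_tangent o1) = DIM('n base) - 1" using dim_hyperplane by metis
  then show ?thesis by simp
qed

context cmap_cone
begin

lemma th_eq: "fst p \<in> S \<Longrightarrow> gh.th p v $ I = snd v $ I + A0 (fst p) I (fst v) + dird (\<lambda>y. \<phi> y $ I) (fst p) (fst v)"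
proof -
  assume x: "fst p \<in> S"
  have d: "dird (\<lambda>y. dird L y (basis_vec I 1)) (fst p) (vh w) =
     (\<Sum>J\<in>UNIV. D2 L (fst p) J 2 I 1 * w $ J $ 3 - D2 L (fst p) J 3 I 1 * w $ J $ 2)" for w
  proof -
    have "linear (dird (\<lambda>y. dird L y (basis_vec I 1)) (fst p))"
      by (rule smooth_on_linear_dird[OF smooth_on_dird[OF smooth_L] x])
    from linear_config_expansion[OF this, of "vh w"] show ?thesis
      by (simp add: vh_nth sum_3 cross3_def axis_def D2_def mult.commute)
  qed
  show ?thesis
    by (simp add: gh.th_def gh.A_def gh.connection_form_eq[OF x] A0_def d)
qed

definition PA :: "'n total \<Rightarrow> 'n \<Rightarrow> real" where
  "PA p A = snd p $ Some A + \<phi> (fst p) $ Some A - cc (fst p) / r (fst p) * Re (f1 (fst p) A)"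

definition Psi :: "'n total \<Rightarrow> real^('n option)" where
  "Psi p = (\<chi> I. case I of None \<Rightarrow> snd p $ None + \<phi> (fst p) $ None + g0 (fst p) + (1/2) * (\<Sum>A\<in>UNIV. ps (fst p) A * PA p A)
     | Some A \<Rightarrow> PA p A)"

definition dPA :: "'n total \<Rightarrow> 'n \<Rightarrow> 'n total \<Rightarrow> real" where
  "dPA p A v = snd v $ Some A + dird (\<lambda>y. \<phi> y $ Some A) (fst p) (fst v)
     - (dq (fst p) (fst v) * Re (f1 (fst p) A) + cc (fst p) / r (fst p) * Re (df1 (fst p) A (fst v)))"

definition dPsi :: "'n total \<Rightarrow> 'n total \<Rightarrow> real^('n option)" where
  "dPsi p v = (\<chi> I. case I of None \<Rightarrow> snd v $ None + dird (\<lambda>y. \<phi> y $ None) (fst p) (fst v) + dg0 (fst p) (fst v)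
       + (1/2) * (\<Sum>A\<in>UNIV. ps (fst p) A * dPA p A v + dps (fst p) A (fst v) * PA p A)
     | Some A \<Rightarrow> dPA p A v)"

lemma Psi_simps [simp]: "Psi p $ Some A = PA p A" "dPsi p v $ Some A = dPA p A v"
  by (simp_all add: Psi_def dPsi_def)

lemma has_derivative_PA:
  assumes x: "fst p \<in> S"
  shows "((\<lambda>q. PA q A) has_derivative dPA p A) (at p)"
proof -
  note fst = has_derivative_compose[OF has_derivative_fst[OF has_derivative_ident]]
  have c: "((\<lambda>q. cc (fst q) / r (fst q)) has_derivative (\<lambda>v. dq (fst p) (fst v))) (at p)"
    by (rule fst) (rule has_derivative_cr[OF x])
  have f: "((\<lambda>q. Re (f1 (fst q) A)) has_derivative (\<lambda>v. Re (df1 (fst p) A (fst v)))) (at p)"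
    by (rule fst, rule bounded_linear.has_derivative[OF bounded_linear_Re has_derivative_f1[OF x, folded df1_def]])
  have ph: "((\<lambda>q. \<phi> (fst q) $ Some A) has_derivative (\<lambda>v. dird (\<lambda>y. \<phi> y $ Some A) (fst p) (fst v))) (at p)"
    by (rule fst, rule smooth_on_has_derivative[OF gh.smooth_phi_nth x])
  have s: "((\<lambda>q :: 'n total. snd q $ Some A) has_derivative (\<lambda>v. snd v $ Some A)) (at p)"
    by (rule bounded_linear.has_derivative[OF bounded_linear_vec_nth has_derivative_snd[OF has_derivative_ident]])
  show ?thesis unfolding PA_def
    by (rule has_derivative_eq_rhs[OF has_derivative_diff[OF has_derivative_add[OF s ph] has_derivative_mult[OF c f]]])
      (simp add: fun_eq_iff dPA_def)
qed

lemma has_derivative_Psi: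
  assumes x: "fst p \<in> S"
  shows "(Psi has_derivative dPsi p) (at p)"
proof -
  note fst = has_derivative_compose[OF has_derivative_fst[OF has_derivative_ident]]
  have ph: "((\<lambda>q. \<phi> (fst q) $ None) has_derivative (\<lambda>v. dird (\<lambda>y. \<phi> y $ None) (fst p) (fst v))) (at p)"
    by (rule fst, rule smooth_on_has_derivative[OF gh.smooth_phi_nth x])
  have s: "((\<lambda>q :: 'n total. snd q $ None) has_derivative (\<lambda>v. snd v $ None)) (at p)"
    by (rule bounded_linear.has_derivative[OF bounded_linear_vec_nth has_derivative_snd[OF has_derivative_ident]])
  have g: "((\<lambda>q. g0 (fst q)) has_derivative (\<lambda>v. dg0 (fst p) (fst v))) (at p)"
    by (rule fst, rule has_derivative_g0[OF x])
  have t: "((\<lambda>q. ps (fst q) A) has_derivative (\<lambda>v. dps (fst p) A (fst v))) (at p)" for A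
    by (rule fst, rule has_derivative_ps[OF x])
  have "((\<lambda>q. Psi q $ I) has_derivative (\<lambda>v. dPsi p v $ I)) (at p)" for I
  proof (cases I)
    case None
    show ?thesis unfolding None Psi_def dPsi_def vec_lambda_beta option.case
      by (intro has_derivative_add has_derivative_mult_right has_derivative_sum s ph g has_derivative_mult t has_derivative_PA x)
  next
    case (Some A)
    then show ?thesis using has_derivative_PA[OF x] by simp
  qed
  then show ?thesis
    by (subst has_derivative_componentwise_within)
      (auto simp: Basis_vec_def inner_axis intro!: has_derivative_inner_left)
qed

lemma th_A:
  assumes x: "fst p \<in> S"
  shows "gh.th p v $ Some A = dPsi p v $ Some A + (\<Sum>B\<in>UNIV. Re (f2 (fst p) A B) * dps (fst p) B (fst v))
     - rho (fst p) / (r (fst p))^2 * (\<Sum>B\<in>UNIV. nn (fst p) A B * Im (chi (fst p) $ B * cnj (m (fst p) (fst v $ None))))"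
  unfolding th_eq[OF x] Psi_simps dPA_def using connection_A[OF x, of A "fst v"] by linarith

lemma th_0:
  assumes x: "fst p \<in> S"
  shows "gh.th p v $ None + (\<Sum>A\<in>UNIV. ps (fst p) A * gh.th p v $ Some A) =
     dPsi p v $ None + (1/2) * (\<Sum>A\<in>UNIV. ps (fst p) A * dPsi p v $ Some A - Psi p $ Some A * dps (fst p) A (fst v))
     + (1/2) * (rho (fst p) / (r (fst p))^2) * (\<Sum>A\<in>UNIV. \<Sum>B\<in>UNIV. nn (fst p) A B * Im (cnj (chi (fst p) $ A) * mw (fst p) B (fst v)))"
proof -
  let ?x = "fst p" and ?y = "fst v"
  define a where "a A = snd v $ Some A + dird (\<lambda>y. \<phi> y $ Some A) ?x ?y" for A
  define b where "b A = dq ?x ?y * Re (f1 ?x A) + cc ?x / r ?x * Re (df1 ?x A ?y)" for A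
  have 1: "(\<Sum>A\<in>UNIV. ps ?x A * gh.th p v $ Some A) = (\<Sum>A\<in>UNIV. ps ?x A * a A) + (\<Sum>A\<in>UNIV. ps ?x A * A0 ?x (Some A) ?y)"
    unfolding th_eq[OF x] a_def by (simp add: sum.distrib[symmetric] algebra_simps)
  have 2: "dPsi p v $ None = snd v $ None + dird (\<lambda>y. \<phi> y $ None) ?x ?y + dg0 ?x ?y
     + (1/2) * (\<Sum>A\<in>UNIV. ps ?x A * (a A - b A) + dps ?x A ?y * PA p A)"
    by (simp add: dPsi_def dPA_def a_def b_def)
  have 3: "(\<Sum>A\<in>UNIV. ps ?x A * dPsi p v $ Some A - Psi p $ Some A * dps ?x A ?y) =
     (\<Sum>A\<in>UNIV. ps ?x A * (a A - b A) - PA p A * dps ?x A ?y)"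
    by (simp add: dPA_def a_def b_def)
  have 4: "(1/2) * (\<Sum>A\<in>UNIV. ps ?x A * (a A - b A) + dps ?x A ?y * PA p A) + (1/2) * (\<Sum>A\<in>UNIV. ps ?x A * (a A - b A) - PA p A * dps ?x A ?y)
     = (\<Sum>A\<in>UNIV. ps ?x A * a A) - (\<Sum>A\<in>UNIV. ps ?x A * b A)"
    unfolding distrib_left[symmetric] sum.distrib[symmetric] sum_subtractf[symmetric] sum_distrib_left
    by (intro sum.cong refl) (simp add: algebra_simps)
  show ?thesis unfolding 1 2 3
    using 4 connection_0[OF x, of ?y, folded b_def] th_eq[OF x, of v None] by linarith
qed

text \<open>Invariance of the fibre coordinates reduces to a comparison of vertical components: when
  \<open>dps\<close> vanishes, the derivative of \<open>Psi\<close> is zero once the vertical part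
  equals the terms with \<open>nn\<close> in \<open>th_A\<close> and \<open>th_0\<close>.\<close>

lemma dPsi_A_eq_0:
  assumes x: "fst p \<in> S" and t: "\<And>A. dps (fst p) A (fst v) = 0"
    and A: "\<And>A. gh.th p v $ Some A = - rho (fst p) / (r (fst p))^2 * (\<Sum>B\<in>UNIV. nn (fst p) A B * Im (chi (fst p) $ B * cnj (m (fst p) (fst v $ None))))"
    and 0: "gh.th p v $ None + (\<Sum>A\<in>UNIV. ps (fst p) A * gh.th p v $ Some A)
      = (1/2) * (rho (fst p) / (r (fst p))^2) * (\<Sum>A\<in>UNIV. \<Sum>B\<in>UNIV. nn (fst p) A B * Im (cnj (chi (fst p) $ A) * mw (fst p) B (fst v)))"
  shows "dPsi p v = 0"
proof -
  have 1: "dPsi p v $ Some A = 0" for A using th_A[OF x, of v A] unfolding A t by simp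
  have 2: "dPsi p v $ None = 0" using th_0[OF x, of v] unfolding 0 t 1 by simp
  have "dPsi p v $ I = 0" for I using 1 2 by (cases I) auto
  then show ?thesis by (simp add: vec_eq_iff)
qed

lemma scaling_data:
  assumes x: "x \<in> NS o1"
  shows "dps x A x = 0" "mw x A x = chi x $ A" "lam x x = 1" "dXX o1 x x = 0"
proof -
  have S: "x \<in> S" and c0: "chi x $ o1 \<noteq> 0" using x by auto
  show 1: "mw x A x = chi x $ A" for A
    using m_xp[OF S, of A] by (simp add: mw_def xp_def)
  show 2: "lam x x = 1" using r_pos[OF S] by (simp add: lam_def x0_x0)
  show "dps x A x = 0" using r_pos[OF S] by (simp add: dps_def ps_def x0_x0)
  have "kap o1 x x = 1" using c0 by (simp add: kap_def eta_def 1 2 complex_eq_iff)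
  then show "dXX o1 x x = 0" by (simp add: dXX_def 1 vec_eq_iff XX_def)
qed

lemma rotation_data:
  assumes x: "x \<in> NS o1"
  shows "dps x A (crossv a x) = 0" "mw x A (crossv a x) = \<i> * of_real ((a \<bullet> x0 x) / r x) * chi x $ A"
    "lam x (crossv a x) = 0" "dXX o1 x (crossv a x) = 0" "eta o1 x (crossv a x) = \<i> * of_real ((a \<bullet> x0 x) / r x)"
    "m x (crossv a x $ None) = - \<i> * of_real (r x) * m x a"
proof -
  have S: "x \<in> S" and c0: "chi x $ o1 \<noteq> 0" using x by auto
  have "wv x A (crossv a x) = cross3 a (xp x A)" for A
    by (simp add: wv_def xp_def crossv_def Cross3.right_diff_distrib cross_mult_right)
  then show 1: "mw x A (crossv a x) = \<i> * of_real ((a \<bullet> x0 x) / r x) * chi x $ A" for A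
    by (simp add: mw_wv isotropic_cross[OF rho[OF S]] xp_x0[OF S] m_xp[OF S])
  show 2: "lam x (crossv a x) = 0" by (simp add: lam_def crossv_def dot_cross_self)
  have "x0 x \<bullet> cross3 a b + cross3 a (x0 x) \<bullet> b = 0" for b by (simp add: cross3_simps)
  then show "dps x A (crossv a x) = 0" by (simp add: dps_def crossv_def dot_cross_self)
  show 3: "eta o1 x (crossv a x) = \<i> * of_real ((a \<bullet> x0 x) / r x)" using c0 by (simp add: eta_def 1)
  have "kap o1 x (crossv a x) = \<i> * of_real ((a \<bullet> x0 x) / r x)" by (simp add: kap_def 2 3 complex_eq_iff)
  then show "dXX o1 x (crossv a x) = 0" by (simp add: dXX_def 1 vec_eq_iff XX_def mult_ac)
  show "m x (crossv a x $ None) = - \<i> * of_real (r x) * m x a"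
    using r_pos[OF S] by (simp add: crossv_def isotropic_cross[OF rho[OF S]] isotropic_self[OF rho[OF S]] x0_x0 power2_eq_square)
qed

lemma dPsi_Sc:
  assumes x: "fst p \<in> NS o1"
  shows "dPsi p (gh.Sc p) = 0"
proof (rule dPsi_A_eq_0)
  show S: "fst p \<in> S" using x by auto
  let ?x = "fst p"
  have "(\<Sum>A\<in>UNIV. \<Sum>B\<in>UNIV. nn ?x A B * Im (cnj (chi ?x $ A) * chi ?x $ B)) = 0"
    by (rule antisymmetric_double_sum) (simp add: nn_sym[OF S, of _ A for A] nn_sym[OF S] algebra_simps)
  then show "gh.th p (gh.Sc p) $ None + (\<Sum>A\<in>UNIV. ps ?x A * gh.th p (gh.Sc p) $ Some A)
      = (1/2) * (rho ?x / (r ?x)^2) * (\<Sum>A\<in>UNIV. \<Sum>B\<in>UNIV. nn ?x A B * Im (cnj (chi ?x $ A) * mw ?x B (fst (gh.Sc p))))"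
    by (simp add: scaling_data[OF x])
qed (simp_all add: scaling_data[OF x] isotropic_self[OF rho] x[simplified])

lemma dPsi_Rt:
  assumes x: "fst p \<in> NS o1"
  shows "dPsi p (gh.Rt a p) = 0"
proof (rule dPsi_A_eq_0)
  show S: "fst p \<in> S" using x by auto
  let ?x = "fst p"
  have rp: "r ?x > 0" by (rule r_pos[OF S])
  note R = rotation_data[OF x]
  show "dps ?x A (fst (gh.Rt a p)) = 0" for A by (simp add: R)
  have th: "gh.th p (gh.Rt a p) $ I = gh.H ?x $ I $ None * (x0 ?x \<bullet> a) + (\<Sum>B\<in>UNIV. gh.H ?x $ I $ Some B * (?x $ Some B \<bullet> a))" for I
    by (simp add: gh.mu_def matrix_vector_mult_def slice_def UNIV_option_conv sum.reindex)
  have tA: "gh.th p (gh.Rt a p) $ Some A = - (1 / r ?x) * (\<Sum>B\<in>UNIV. nn ?x A B * (a \<bullet> xp ?x B))" for A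
    unfolding th higgs_A0[OF S] higgs_AB[OF S] xp_def
    by (simp add: sum_distrib_right sum_distrib_left sum_divide_distrib sum.distrib[symmetric] inner_diff_right inner_commute[of a] algebra_simps diff_divide_distrib flip: sum_negf sum_subtractf)
  show A: "gh.th p (gh.Rt a p) $ Some A = - rho ?x / (r ?x)^2 * (\<Sum>B\<in>UNIV. nn ?x A B * Im (chi ?x $ B * cnj (m ?x (fst (gh.Rt a p) $ None))))" for A
    unfolding tA inner_xp[OF S] gh.fst_Rt R sum_distrib_left using rp
    by (intro sum.cong refl) (simp add: field_simps power2_eq_square)
  have t0: "gh.th p (gh.Rt a p) $ None + (\<Sum>A\<in>UNIV. ps ?x A * gh.th p (gh.Rt a p) $ Some A) = rho ?x * qq ?x / (2 * (r ?x)^3) * (x0 ?x \<bullet> a)"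
  proof -
    \<comment> \<open>\<open>c0\<close> and \<open>cB\<close> express that the Higgs field is block
      diagonal: this combination of rows pairs with x^0 only.\<close>
    have c0: "gh.H ?x $ None $ None + (\<Sum>A\<in>UNIV. ps ?x A * gh.H ?x $ Some A $ None) = rho ?x * qq ?x / (2 * (r ?x)^3)"
      unfolding higgs_00[OF S] higgs_A0[OF S] by (simp add: sum_distrib_left sum_divide_distrib mult_ac)
    have cB: "gh.H ?x $ None $ Some B + (\<Sum>A\<in>UNIV. ps ?x A * gh.H ?x $ Some A $ Some B) = 0" for B
      unfolding higgs_0A[OF S] higgs_AB[OF S] by (simp add: sum_distrib_left sum_divide_distrib sum_negf mult_ac nn_sym[OF S, of B])
    have "(\<Sum>A\<in>UNIV. ps ?x A * gh.th p (gh.Rt a p) $ Some A) = (\<Sum>A\<in>UNIV. ps ?x A * gh.H ?x $ Some A $ None) * (x0 ?x \<bullet> a)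
       + (\<Sum>B\<in>UNIV. (\<Sum>A\<in>UNIV. ps ?x A * gh.H ?x $ Some A $ Some B) * (?x $ Some B \<bullet> a))"
      unfolding th distrib_left sum.distrib sum_distrib_left sum_distrib_right
      by (intro arg_cong2[where f="(+)"] sum.cong refl sum.swap[THEN trans]) (simp_all add: mult.assoc)
    then have "gh.th p (gh.Rt a p) $ None + (\<Sum>A\<in>UNIV. ps ?x A * gh.th p (gh.Rt a p) $ Some A) =
      (gh.H ?x $ None $ None + (\<Sum>A\<in>UNIV. ps ?x A * gh.H ?x $ Some A $ None)) * (x0 ?x \<bullet> a)
       + (\<Sum>B\<in>UNIV. (gh.H ?x $ None $ Some B + (\<Sum>A\<in>UNIV. ps ?x A * gh.H ?x $ Some A $ Some B)) * (?x $ Some B \<bullet> a))"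
      unfolding th[of None] distrib_right sum.distrib by simp
    then show ?thesis unfolding c0 cB by simp
  qed
  show "gh.th p (gh.Rt a p) $ None + (\<Sum>A\<in>UNIV. ps ?x A * gh.th p (gh.Rt a p) $ Some A)
      = (1/2) * (rho ?x / (r ?x)^2) * (\<Sum>A\<in>UNIV. \<Sum>B\<in>UNIV. nn ?x A B * Im (cnj (chi ?x $ A) * mw ?x B (fst (gh.Rt a p))))"
    unfolding t0 gh.fst_Rt R qq_def sum_distrib_left sum_distrib_right sum_divide_distrib using rp
    by (intro sum.cong refl) (simp add: field_simps power2_eq_square power3_eq_cube inner_commute)
qed

section \<open>The projection to the base, its kernel and its range\<close>

definition proj :: "'n \<Rightarrow> 'n total \<Rightarrow> 'n base" where
  "proj o1 p = (Psi p, \<chi> A. ps (fst p) A, XX o1 (fst p))"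

definition dproj :: "'n \<Rightarrow> 'n total \<Rightarrow> 'n total \<Rightarrow> 'n base" where
  "dproj o1 p v = (dPsi p v, \<chi> A. dps (fst p) A (fst v), dXX o1 (fst p) (fst v))"

abbreviation NP :: "'n \<Rightarrow> 'n total set" where "NP o1 \<equiv> NS o1 \<times> UNIV"

lemma open_NP: "open (NP o1)" by (intro open_Times open_NS open_UNIV)

lemma base_proj_eq: "p \<in> NP o1 \<Longrightarrow> base_proj o1 Psi p = proj o1 p"
  by (auto simp: base_proj_def proj_def inhomogeneous_cmap vec_eq_iff)

lemma has_derivative_proj:
  assumes p: "p \<in> NP o1"
  shows "(proj o1 has_derivative dproj o1 p) (at p)"
proof -
  have x: "fst p \<in> NS o1" and S: "fst p \<in> S" using p by auto
  note fst = has_derivative_compose[OF has_derivative_fst[OF has_derivative_ident]]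
  have t: "((\<lambda>q. ps (fst q) A) has_derivative (\<lambda>v. dps (fst p) A (fst v))) (at p)" for A
    by (rule fst, rule has_derivative_ps[OF S])
  have "((\<lambda>q. \<chi> A. ps (fst q) A) has_derivative (\<lambda>v. \<chi> A. dps (fst p) A (fst v))) (at p)"
    by (subst has_derivative_componentwise_within)
      (auto simp: Basis_vec_def inner_axis intro!: t)
  moreover have "((\<lambda>q. XX o1 (fst q)) has_derivative (\<lambda>v. dXX o1 (fst p) (fst v))) (at p)"
    by (rule fst, rule has_derivative_XX[OF x])
  ultimately show ?thesis unfolding proj_def dproj_def
    by (intro has_derivative_Pair has_derivative_Psi S)
qed

lemma dird_base_proj: "p \<in> NP o1 \<Longrightarrow> dird (base_proj o1 Psi) p v = dproj o1 p v"
  by (rule dird_dird_congI[OF open_NP _ base_proj_eq has_derivative_proj])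

lemma linear_dproj: "p \<in> NP o1 \<Longrightarrow> linear (dproj o1 p)"
  using has_derivative_linear[OF has_derivative_proj] .

lemma dproj_orbit:
  assumes p: "p \<in> NP o1"
  shows "dproj o1 p (gh.Sc p) = 0" "dproj o1 p (gh.Rt a p) = 0"
proof -
  have x: "fst p \<in> NS o1" using p by auto
  show "dproj o1 p (gh.Sc p) = 0"
    by (simp add: dproj_def dPsi_Sc[OF x] scaling_data[OF x] zero_prod_def vec_eq_iff)
  show "dproj o1 p (gh.Rt a p) = 0"
    by (simp add: dproj_def dPsi_Rt[OF x] rotation_data[OF x] zero_prod_def vec_eq_iff)
qed

lemma dproj_orbit_tangent:
  assumes p: "p \<in> NP o1" and v: "v \<in> orbit_tangent gh.Sc gh.Rt p"
  shows "dproj o1 p v = 0"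
proof -
  have "orbit_tangent gh.Sc gh.Rt p \<subseteq> {v. dproj o1 p v = 0}"
    unfolding orbit_tangent_def
    by (rule span_minimal) (use dproj_orbit[OF p] linear_subspace_kernel[OF linear_dproj[OF p]] in auto)
  then show ?thesis using v by blast
qed

text \<open>A combination of scaling and rotation that moves x^0 and the phase of
  \<open>chi x $ o1\<close> exactly as \<open>v\<close> does is subtracted. The remainder has no
  component left that the projection does not see, so it vanishes.\<close>

lemma kernel_dproj:
  assumes p: "p \<in> NP o1" and v: "dproj o1 p v = 0"
  shows "v \<in> orbit_tangent gh.Sc gh.Rt p"
proof -
  let ?x = "fst p"
  have x: "?x \<in> NS o1" and S: "?x \<in> S" using p by auto
  have rp: "r ?x > 0" by (rule r_pos[OF S])
  define l where "l = lam ?x (fst v)"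
  define om where "om = Im (eta o1 ?x (fst v))"
  \<comment> \<open>The first summand turns x^0 as \<open>v\<close> does; the second, a rotation
    about x^0, reproduces the phase rate \<open>om\<close>.\<close>
  define a where "a = (1 / (r ?x)^2) *\<^sub>R cross3 (x0 ?x) (fst v $ None) + (om / r ?x) *\<^sub>R x0 ?x"
  define u where "u = v - (l *\<^sub>R gh.Sc p + gh.Rt a p)"
  have fu: "fst u = fst v - (l *\<^sub>R ?x + crossv a ?x)" by (simp add: u_def)
  have a0: "a \<bullet> x0 ?x = r ?x * om"
    using rp by (simp add: a_def inner_add_left dot_cross_self x0_x0 power2_eq_square)
  have "cross3 (cross3 b c) b = (b \<bullet> b) *\<^sub>R c - (b \<bullet> c) *\<^sub>R b" for b c :: "real^3"
    by (simp add: vec_eq_iff forall_3 cross3_simps)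
  then have "cross3 a (x0 ?x) = fst v $ None - l *\<^sub>R x0 ?x"
    using rp by (simp add: a_def cross_add_left cross_mult_left x0_x0 l_def lam_def scaleR_diff_right)
  then have u0: "fst u $ None = 0" by (simp add: fu crossv_def)
  have lin: "linear (dproj o1 p)" by (rule linear_dproj[OF p])
  have du: "dproj o1 p u = 0"
    by (simp add: u_def linear_diff[OF lin] linear_add[OF lin] linear_scale[OF lin] v dproj_orbit[OF p])
  have tu: "dps ?x A (fst u) = 0" for A using du by (simp add: dproj_def zero_prod_def vec_eq_iff)
  have Pu: "dPsi p u = 0" using du by (simp add: dproj_def zero_prod_def)
  have mwu: "mw ?x A (fst u) = 0" for A
  proof -
    have "dXX o1 ?x (fst v) $ A = 0" using v by (simp add: dproj_def zero_prod_def)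
    then have "kk o1 ?x * (mw ?x A (fst v) - kap o1 ?x (fst v) * chi ?x $ A) = 0"
      by (simp add: dXX_def XX_def algebra_simps)
    then have "mw ?x A (fst v) = kap o1 ?x (fst v) * chi ?x $ A" using kk_nz[OF x] by simp
    also have "kap o1 ?x (fst v) = of_real l + \<i> * of_real om" by (simp add: kap_def l_def om_def complex_eq_iff)
    finally have "mw ?x A (fst v) = (of_real l + \<i> * of_real om) * chi ?x $ A" .
    moreover have "mw ?x A (fst u) = mw ?x A (fst v) - (of_real l * mw ?x A ?x + mw ?x A (crossv a ?x))"
      unfolding fu mw_def by (simp add: isotropic_linear right_diff_distrib distrib_left mult.left_commute)
    ultimately show ?thesis using rp by (simp add: scaling_data[OF x] rotation_data[OF x] a0 algebra_simps)
  qed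
  have uA: "fst u $ Some A = 0" for A
  proof -
    have "x0 ?x \<bullet> fst u $ Some A = 0" using tu[of A] rp by (simp add: dps_def u0)
    moreover have "m ?x (fst u $ Some A) = 0" using mwu[of A] by (simp add: mw_def u0)
    ultimately have "fst u $ Some A \<bullet> fst u $ Some A = 0"
      unfolding isotropic_inner[OF rho[OF S], of "fst u $ Some A" "fst u $ Some A"] by (simp add: inner_commute)
    then show ?thesis by simp
  qed
  have f0: "fst u = 0"
  proof -
    have "fst u $ I = 0" for I using u0 uA by (cases I) auto
    then show ?thesis by (simp add: vec_eq_iff)
  qed
  have tA: "gh.th p u $ Some A = 0" for A
    unfolding th_A[OF S] tu Pu u0 by (simp add: isotropic_def)
  have "gh.th p u $ None = 0"
    using th_0[OF S, of u] unfolding tA tu Pu mwu by simp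
  then have "gh.th p u $ I = 0" for I using tA by (cases I) auto
  then have "gh.th p u = gh.th p 0" by (simp add: linear_0[OF gh.linear_th[OF S]] vec_eq_iff)
  then have "u = 0" using f0 by (intro gh.total_eqI[of u 0 p]) auto
  then have "v = l *\<^sub>R gh.Sc p + gh.Rt a p" by (simp add: u_def)
  moreover have "l *\<^sub>R gh.Sc p + gh.Rt a p \<in> orbit_tangent gh.Sc gh.Rt p" unfolding orbit_tangent_def
    by (rule span_add[OF span_scale[OF span_base] span_base]) auto
  ultimately show ?thesis by simp
qed

lemma obtain_dPsi:
  assumes S: "fst p \<in> S"
  obtains s where "dPsi p (h, s) = t"
proof -
  \<comment> \<open>The system is triangular: the components \<open>Some A\<close> do not involve
    \<open>snd v $ None\<close>, so they are solved first and the component \<open>None\<close> is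
    adjusted afterwards.\<close>
  define s where "s = (\<chi> I. case I of None \<Rightarrow> t $ None - (dPsi p (h, \<chi> I. case I of None \<Rightarrow> 0 | Some A \<Rightarrow> t $ Some A - dPA p A (h, 0)) $ None)
     | Some A \<Rightarrow> t $ Some A - dPA p A (h, 0))"
  have A: "dPA p A (h, s) = t $ Some A" for A by (simp add: dPA_def s_def)
  have A': "dPA p A (h, \<chi> I. case I of None \<Rightarrow> 0 | Some A \<Rightarrow> t $ Some A - dPA p A (h, 0)) = t $ Some A" for A by (simp add: dPA_def)
  have "dPsi p (h, s) $ None = t $ None" unfolding dPsi_def vec_lambda_beta option.case A
    by (simp add: s_def, simp add: dPsi_def A')
  then have "dPsi p (h, s) $ I = t $ I" for I using A by (cases I) auto
  then have "dPsi p (h, s) = t" by (simp add: vec_eq_iff)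
  then show ?thesis by (rule that)
qed

lemma range_dproj:
  assumes p: "p \<in> NP o1"
  shows "range (dproj o1 p) = base_tangent o1"
proof
  let ?x = "fst p"
  have x: "?x \<in> NS o1" and S: "?x \<in> S" and c0: "chi ?x $ o1 \<noteq> 0" using p by auto
  have rp: "r ?x > 0" by (rule r_pos[OF S])
  have X1: "XX o1 ?x $ o1 = of_real (Re (XX o1 ?x $ o1))" using XX_o1_real[OF x] by (simp add: complex_eq_iff)
  have kmw: "kk o1 ?x * mw ?x o1 v = eta o1 ?x v * XX o1 ?x $ o1" for v using c0 by (simp add: eta_def XX_def)
  have "Im (dXX o1 ?x v $ o1) = 0" for v
    unfolding dXX_def vec_lambda_beta kmw by (subst (1 2) X1) (simp add: kap_def)
  then show "range (dproj o1 p) \<subseteq> base_tangent o1" by (auto simp: dproj_def base_tangent_def)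
  show "base_tangent o1 \<subseteq> range (dproj o1 p)"
  proof
    fix t :: "'n base" assume "t \<in> base_tangent o1"
    then obtain a b c where t: "t = (a, b, c)" and c1: "Im (c $ o1) = 0" by (auto simp: base_tangent_def)
    define z where "z A = c $ A / kk o1 ?x" for A
    have "\<exists>f. \<forall>A. m ?x (f A) = z A \<and> f A \<bullet> x0 ?x = (r ?x)^2 * b $ A"
      by (intro choice allI) (meson isotropic_surjective[OF S])
    then obtain f where f: "m ?x (f A) = z A" "f A \<bullet> x0 ?x = (r ?x)^2 * b $ A" for A by blast
    \<comment> \<open>Leaving x^0 fixed makes \<open>lam\<close> vanish, and since c^1 and \<X>^1
      are real the phase rate vanishes too. Hence \<open>kap\<close> is zero and \<open>z\<close>
      alone determines the derivative of \<open>XX\<close>.\<close>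
    define h where "h = (\<chi> I. case I of None \<Rightarrow> 0 | Some A \<Rightarrow> f A)"
    have h0: "h $ None = 0" by (simp add: h_def)
    have mh: "m ?x (h $ Some A) = z A" for A by (simp add: h_def f)
    have "x0 ?x \<bullet> h $ Some A = (r ?x)^2 * b $ A" for A by (simp add: h_def f inner_commute)
    then have dh: "dps ?x A h = b $ A" for A using rp by (simp add: dps_def h0)
    have mwh: "mw ?x A h = z A" for A by (simp add: mw_def h0 mh)
    have "eta o1 ?x h * XX o1 ?x $ o1 = c $ o1"
      unfolding kmw[symmetric] mwh z_def using kk_nz[OF x] by simp
    then have "Im (eta o1 ?x h) * Re (XX o1 ?x $ o1) = 0" using c1 X1 by (metis Im_complex_of_real Re_complex_of_real add.right_neutral mult_zero_right times_complex.simps(2) add_0)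
    then have "kap o1 ?x h = 0" using XX_o1_real[OF x] by (simp add: kap_def lam_def h0 complex_eq_iff)
    then have "dXX o1 ?x h = c" using kk_nz[OF x] by (simp add: dXX_def mwh z_def vec_eq_iff)
    moreover obtain s where "dPsi p (h, s) = a" by (rule obtain_dPsi[OF S])
    ultimately have "dproj o1 p (h, s) = t" by (simp add: dproj_def t dh)
    then show "t \<in> range (dproj o1 p)" by blast
  qed
qed

lemma smooth_proj: "smooth_on (NP o1) Psi" "smooth_on (NP o1) (proj o1)"
proof -
  have sub: "smooth_on (NP o1) (\<lambda>p. f (fst p))" if "smooth_on S f" for f :: "'n config \<Rightarrow> 'z::real_normed_vector"
    by (rule smooth_on_compose_fst[OF open_NS smooth_on_subset[OF that]]) auto
  have q: "smooth_on S (\<lambda>x. cc x / r x)"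
    by (intro smooth_intros openS smooth_r) (use r_pos in force)
  have f: "smooth_on S (\<lambda>x. Re (f1 x A))" "smooth_on S (\<lambda>x. Re (f0 x))" for A
    by (intro smooth_intros openS smooth_hol_chi hol1 holF)+
  have c: "smooth_on S (\<lambda>x. chi x $ A)" for A
    by (rule smooth_on_compose_linear[OF bounded_linear_vec_nth openS smooth_chi])
  have g: "smooth_on S g0" unfolding g0_def[abs_def] by (intro smooth_intros openS q f c smooth_ps)
  have s: "smooth_on (NP o1) (\<lambda>p. snd p $ I)" for I
    by (rule smooth_on_linear[OF open_NP]) (intro bounded_linear_compose[OF bounded_linear_vec_nth] bounded_linear_snd)
  have A: "smooth_on (NP o1) (\<lambda>p. PA p A)" for A
    unfolding PA_def by (intro smooth_intros open_NP s sub[OF q] sub[OF f(1)] sub[OF gh.smooth_phi_nth])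
  show P: "smooth_on (NP o1) Psi"
  proof (rule smooth_on_vec[OF open_NP])
    fix I show "smooth_on (NP o1) (\<lambda>p. Psi p $ I)"
    proof (cases I)
      case None
      show ?thesis unfolding None Psi_def vec_lambda_beta option.case
        by (intro smooth_intros open_NP s A sub[OF g] sub[OF gh.smooth_phi_nth] sub[OF smooth_ps])
    qed (simp add: A)
  qed
  have "smooth_on (NP o1) (\<lambda>p. \<chi> A. ps (fst p) A)"
    by (rule smooth_on_vec[OF open_NP]) (simp add: sub[OF smooth_ps])
  then show "smooth_on (NP o1) (proj o1)" unfolding proj_def[abs_def]
    by (intro smooth_intros open_NP P smooth_on_compose_fst[OF open_NS smooth_XX])
qed

lemma invariant_coordinates_Psi: "invariant_coordinates o1 S gh.Sc gh.Rt Psi"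
  unfolding invariant_coordinates_def noncollinear_part_eq
proof (intro conjI ballI allI)
  show "smooth_on (NP o1) Psi" by (rule smooth_proj)
  show "smooth_on (NP o1) (base_proj o1 Psi)"
    by (rule smooth_on_cong[OF open_NP base_proj_eq, THEN iffD2, OF _ smooth_proj(2)])
  show "inj_on (\<lambda>p. (fst p, Psi p)) (NP o1)"
  proof (rule inj_onI)
    fix p q :: "'n total" assume "(fst p, Psi p) = (fst q, Psi q)"
    then have f: "fst p = fst q" and P: "Psi p $ I = Psi q $ I" for I by auto
    have A: "PA p A = PA q A" for A using P[of "Some A"] by simp
    have "snd p $ I = snd q $ I" for I
    proof (cases I)
      case None
      then show ?thesis using P[of None] A f by (simp add: Psi_def)
    next
      case (Some B)
      then show ?thesis using A[of B] f by (simp add: PA_def)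
    qed
    then show "p = q" using f by (simp add: prod_eq_iff vec_eq_iff)
  qed
  fix p :: "'n total" assume p: "p \<in> NP o1"
  then have x: "fst p \<in> NS o1" and S: "fst p \<in> S" by auto
  have d: "((\<lambda>q. (fst q, Psi q)) has_derivative (\<lambda>v. (fst v, dPsi p v))) (at p)"
    by (intro has_derivative_Pair has_derivative_fst has_derivative_ident has_derivative_Psi S)
  have "inj (\<lambda>v. (fst v, dPsi p v))"
  proof (rule linear_injective_0[THEN iffD2, OF has_derivative_linear[OF d]], intro allI impI)
    fix v assume "(fst v, dPsi p v) = 0"
    then have f: "fst v = 0" and P: "dPsi p v = dPsi p 0"
      using linear_0[OF has_derivative_linear[OF has_derivative_Psi[OF S]]] by (auto simp: zero_prod_def)
    have A: "dPA p A v = dPA p A 0" for A using P by (metis Psi_simps(2))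
    have "snd v $ I = 0" for I
    proof (cases I)
      case None
      then show ?thesis using arg_cong[OF P, of "\<lambda>t. t $ None"] A f by (simp add: dPsi_def)
    next
      case (Some B)
      then show ?thesis using A[of B] f by (simp add: dPA_def)
    qed
    then show "v = 0" using f by (simp add: prod_eq_iff vec_eq_iff)
  qed
  then have "bij (\<lambda>v. (fst v, dPsi p v))"
    using linear_injective_imp_surjective[OF has_derivative_linear[OF d]] by (simp add: bij_def)
  then show "bij (dird (\<lambda>q. (fst q, Psi q)) p)" by (simp add: dird_eq[OF d, abs_def])
  show "dird Psi p (gh.Sc p) = 0" "dird Psi p (gh.Rt a p) = 0" for a
    by (simp_all add: dird_eq[OF has_derivative_Psi[OF S]] dPsi_Sc[OF x] dPsi_Rt[OF x])
  show "Im (cal_X o1 (fst p) $ o1) = 0" "Re (cal_X o1 (fst p) $ o1) > 0"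
    using XX_o1_real[OF x] by (simp_all add: inhomogeneous_cmap[OF x])
  have D: "dird (base_proj o1 Psi) p = dproj o1 p" by (rule ext) (rule dird_base_proj[OF p])
  show "range (dird (base_proj o1 Psi) p) = base_tangent o1" unfolding D by (rule range_dproj[OF p])
  show "{v. dird (base_proj o1 Psi) p v = 0} = orbit_tangent gh.Sc gh.Rt p"
    unfolding D using kernel_dproj[OF p] dproj_orbit_tangent[OF p] by auto
qed

end

subsection \<open>Algebra of a symmetric form and a vector\<close>

text \<open>Complex bilinear rather than Hermitian, with conjugations written out by
  \<open>cnjv\<close>: besides the Hermitian value of N on X, the formula for \<tau> contains the
  bilinear one.\<close>

definition cdot :: "complex^'n::finite \<Rightarrow> complex^'n \<Rightarrow> complex" where
  "cdot a b = (\<Sum>A\<in>UNIV. a $ A * b $ A)"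

definition cmul :: "real^'n^'n \<Rightarrow> complex^'n::finite \<Rightarrow> complex^'n" where
  "cmul M a = (\<chi> A. \<Sum>B\<in>UNIV. of_real (M $ A $ B) * a $ B)"

definition cvec :: "('n \<Rightarrow> real) \<Rightarrow> complex^'n::finite" where "cvec t = (\<chi> A. of_real (t A))"

lemma cdot_linear:
  "cdot (a + b) c = cdot a c + cdot b c" "cdot c (a + b) = cdot c a + cdot c b"
  "cdot (a - b) c = cdot a c - cdot b c" "cdot c (a - b) = cdot c a - cdot c b"
  "cdot (k *s a) c = k * cdot a c" "cdot c (k *s a) = k * cdot c a"
  "cdot 0 c = 0" "cdot c 0 = 0"
  by (simp_all add: cdot_def sum.distrib sum_subtractf sum_distrib_left algebra_simps)

lemma cdot_commute: "cdot a b = cdot b a" by (simp add: cdot_def mult.commute)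

lemma cmul_linear:
  "cmul M (a + b) = cmul M a + cmul M b" "cmul M (a - b) = cmul M a - cmul M b" "cmul M (k *s a) = k *s cmul M a" "cmul M 0 = 0"
  by (simp_all add: cmul_def vec_eq_iff sum.distrib sum_subtractf sum_distrib_left algebra_simps)

lemma cnjv_simps [simp]: "cnjv (cnjv a) = a" "cnjv (a + b) = cnjv a + cnjv b" "cnjv (a - b) = cnjv a - cnjv b"
  "cnjv (k *s a) = cnj k *s cnjv a" "cnjv (cmul M a) = cmul M (cnjv a)" "cnjv (cvec t) = cvec t" "cnjv 0 = 0"
  by (simp_all add: cnjv_def cmul_def cvec_def vec_eq_iff)

lemma cnj_cdot: "cnj (cdot a b) = cdot (cnjv a) (cnjv b)" by (simp add: cdot_def cnjv_def)

lemma cdot_cmul: "cdot a (cmul M b) = (\<Sum>A\<in>UNIV. \<Sum>B\<in>UNIV. of_real (M $ A $ B) * a $ A * b $ B)"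
  by (simp add: cdot_def cmul_def sum_distrib_left mult_ac)

lemma cmul_sym: "transpose M = M \<Longrightarrow> cdot (cmul M a) b = cdot a (cmul M b)"
proof -
  assume "transpose M = M"
  then have "M $ A $ B = M $ B $ A" for A B by (metis transpose_def vec_lambda_beta)
  then show ?thesis
    unfolding cdot_commute[of "cmul M a"] cdot_cmul by (subst sum.swap) (simp add: mult_ac)
qed

lemma cmul_mult: "cmul A (cmul B c) = cmul (A ** B) c"
proof -
  have "(\<Sum>j\<in>UNIV. \<Sum>k\<in>UNIV. of_real (A $ i $ j) * (of_real (B $ j $ k) * c $ k)) =
    (\<Sum>k\<in>UNIV. \<Sum>j\<in>UNIV. of_real (A $ i $ j) * (of_real (B $ j $ k) * c $ k))" for i by (rule sum.swap)
  then show ?thesis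
    by (simp add: cmul_def vec_eq_iff matrix_matrix_mult_def sum_distrib_left sum_distrib_right mult.assoc)
qed

lemma cmul_axis: "cmul M (axis B 1) $ A = of_real (M $ A $ B)"
proof -
  have "of_real (M $ A $ C) * axis B 1 $ C = (if C = B then complex_of_real (M $ A $ B) else 0)" for C
    by (simp add: axis_def)
  then show ?thesis by (simp add: cmul_def)
qed

lemma cmul_mat_1: "cmul (mat 1) c = c"
proof -
  have "of_real (mat 1 $ A $ B) * c $ B = (if B = A then c $ A else 0)" for A B by (simp add: mat_def)
  then show ?thesis by (simp add: cmul_def vec_eq_iff)
qed

lemma matrix_inv_cmulI:
  assumes "\<And>c. cmul A (cmul B c) = c"
  shows "matrix_inv A = B"
proof -
  have "of_real ((A ** B) $ i $ j) = (of_real (mat 1 $ i $ j) :: complex)" for i j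
    using assms[of "axis j 1"] cmul_mat_1[of "axis j 1"] unfolding cmul_mult by (metis cmul_axis)
  then have AB: "A ** B = mat 1" unfolding of_real_eq_iff vec_eq_iff by blast
  then have "B ** A = mat 1" by (simp add: matrix_left_right_inverse)
  then have "invertible A" using AB unfolding invertible_def by blast
  then have "matrix_inv A ** A = mat 1" by (rule matrix_inv_mult)
  then show ?thesis using AB by (metis matrix_mul_assoc matrix_mul_lid matrix_mul_rid)
qed

locale special_form =
  fixes N Ni :: "real^'n::finite^'n" and X :: "complex^'n"
  assumes N_sym: "transpose N = N"
    and inverse: "cmul Ni (cmul N a) = a" "cmul N (cmul Ni a) = a"
    and Q_nz: "cdot (cnjv X) (cmul N X) \<noteq> 0"
begin

abbreviation Q where "Q \<equiv> cdot (cnjv X) (cmul N X)"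
abbreviation P where "P \<equiv> cdot X (cmul N X)"
abbreviation Pb where "Pb \<equiv> cdot (cnjv X) (cmul N (cnjv X))"

lemma cmul_N: "cdot (cmul N a) b = cdot a (cmul N b)" by (rule cmul_sym[OF N_sym])

lemma cmul_Ni: "cdot (cmul Ni a) b = cdot a (cmul Ni b)"
  using cmul_N[of "cmul Ni a" "cmul Ni b"] by (simp add: inverse)

lemma N_swap: "cdot a (cmul N b) = cdot b (cmul N a)" and Ni_swap: "cdot a (cmul Ni b) = cdot b (cmul Ni a)"
  by (metis cdot_commute cmul_N) (metis cdot_commute cmul_Ni)

lemma X_N: "cdot a (cmul N X) = cdot X (cmul N a)" "cdot a (cmul N (cnjv X)) = cdot (cnjv X) (cmul N a)"
  by (rule N_swap)+

lemma cnj_Q: "cnj Q = Q" by (simp add: cnj_cdot X_N(2)[symmetric])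
lemma cnj_P: "cnj P = Pb" by (simp add: cnj_cdot)
lemma Q_alt: "cdot X (cmul N (cnjv X)) = Q" by (rule X_N)

text \<open>With b_A = d\<psi>_A + Re(F_AB) dps^B, which is \<open>bb\<close>, and t = dps, this is
  X^A contracted with d\<psi>_A + F_AB dps^B.\<close>

definition h where "h b t = cdot X b + \<i> * cdot X (cmul N t)"

text \<open>The value of \<open>\<nu>\<close> is forced by orthogonality to the rotations that move \<open>x\<^sup>0\<close>, see \<open>rotation_condition\<close>.\<close>

lemma fibre_part:
  assumes real: "cnjv t = t" "cnjv b = b" "cnjv t' = t'" "cnjv b' = b'"
    and nu: "\<nu> = - \<i> * h b t / (2 * Q)" and nu': "\<nu>' = - \<i> * h b' t' / (2 * Q)"
    and T: "T = t - (2 * cnj \<nu>) *s X - (2 * \<nu>) *s cnjv X" and T': "T' = t' - (2 * cnj \<nu>') *s X - (2 * \<nu>') *s cnjv X"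
    and B: "B = b + (2 * \<i>) *s cmul N (cnj \<nu> *s X - \<nu> *s cnjv X)" and B': "B' = b' + (2 * \<i>) *s cmul N (cnj \<nu>' *s X - \<nu>' *s cnjv X)"
  shows "cdot T (cmul N T') + cdot B (cmul Ni B') - 4 * Q * (\<nu> * cnj \<nu>' + cnj \<nu> * \<nu>') =
    cdot t (cmul N t') + cdot b (cmul Ni b') - (h b t * cnj (h b' t') + cnj (h b t) * h b' t') / Q"
proof -
  have ch: "cnj (h b t) = cdot (cnjv X) b - \<i> * cdot (cnjv X) (cmul N t)" "cnj (h b' t') = cdot (cnjv X) b' - \<i> * cdot (cnjv X) (cmul N t')"
    by (simp_all add: h_def cnj_cdot real)
  have n: "2 * Q * \<nu> = - \<i> * h b t" "2 * Q * \<nu>' = - \<i> * h b' t'"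
    "2 * Q * cnj \<nu> = \<i> * cnj (h b t)" "2 * Q * cnj \<nu>' = \<i> * cnj (h b' t')"
    using Q_nz by (simp_all add: nu nu' cnj_Q)
  have 1: "cdot T (cmul N T') = cdot t (cmul N t') - 2 * (cnj \<nu> * cdot X (cmul N t') + \<nu> * cdot (cnjv X) (cmul N t') + cnj \<nu>' * cdot X (cmul N t) + \<nu>' * cdot (cnjv X) (cmul N t))
     + 4 * (cnj \<nu> * cnj \<nu>' * P + (cnj \<nu> * \<nu>' + \<nu> * cnj \<nu>') * Q + \<nu> * \<nu>' * Pb)"
    unfolding T T' cdot_linear cmul_linear X_N[of t] Q_alt by (simp add: algebra_simps)
  have 2: "cdot B (cmul Ni B') = cdot b (cmul Ni b') + 2 * \<i> * (cnj \<nu> * cdot X b' - \<nu> * cdot (cnjv X) b' + cnj \<nu>' * cdot X b - \<nu>' * cdot (cnjv X) b)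
     - 4 * (cnj \<nu> * cnj \<nu>' * P - (cnj \<nu> * \<nu>' + \<nu> * cnj \<nu>') * Q + \<nu> * \<nu>' * Pb)"
    unfolding B B' cdot_linear cmul_linear cmul_N inverse Q_alt cdot_commute[of b X] cdot_commute[of b "cnjv X"]
    by (simp add: algebra_simps)
  have 3: "cdot T (cmul N T') + cdot B (cmul Ni B') - 4 * Q * (\<nu> * cnj \<nu>' + cnj \<nu> * \<nu>') = cdot t (cmul N t') + cdot b (cmul Ni b')
     + 2 * \<i> * (cnj \<nu> * h b' t' - \<nu> * cnj (h b' t') + cnj \<nu>' * h b t - \<nu>' * cnj (h b t)) + 4 * Q * (\<nu> * cnj \<nu>' + cnj \<nu> * \<nu>')"
    unfolding 1 2 ch unfolding h_def by (simp add: algebra_simps)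
  have \<nu>: "cnj \<nu> = \<i> * cnj (h b t) / (2 * Q)" "cnj \<nu>' = \<i> * cnj (h b' t') / (2 * Q)"
    by (simp_all add: nu nu' cnj_Q)
  show ?thesis unfolding 3 unfolding \<nu> unfolding nu nu' using Q_nz by (simp add: field_simps)
qed

definition y where "y = cmul N (cnjv X)"

definition Kform where "Kform c = cmul Ni c - (1 / Q) *s (cdot (cnjv X) c *s X + cdot X c *s cnjv X)"

text \<open>\<open>(Im \<tau>)\<^sup>-\<^sup>1 = N\<^sup>-\<^sup>1 - (X X\<^sup>\<dagger> + cnj)/Q\<close>\<close>

lemma tau_inverse:
  assumes P: "Pb \<noteq> 0" and I: "\<And>c. cmul I c = cmul N c - (cdot y c / Pb) *s y - (cdot (cnjv y) c / P) *s cnjv y"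
    and K: "\<And>c. cmul K c = Kform c"
  shows "cmul I (cmul K c) = c"
proof -
  have P': "P \<noteq> 0" using P cnj_P by auto
  have yK: "cdot y (Kform c) = - (Pb / Q) * cdot X c" 
    using Q_nz by (simp add: Kform_def y_def cdot_linear cmul_N inverse Q_alt field_simps)
  have yK': "cdot (cnjv y) (Kform c) = - (P / Q) * cdot (cnjv X) c"
    using Q_nz by (simp add: Kform_def y_def cdot_linear cmul_N inverse Q_alt field_simps)
  show ?thesis unfolding I K yK yK' using Q_nz P P'
    by (simp add: Kform_def y_def cmul_linear inverse vec_eq_iff field_simps)
qed

text \<open>N^-1 maps \<open>y\<close> to the conjugate of X, so all terms with \<open>y\<close> can
  be evaluated, and those depending on \<open>P\<close> and \<open>Pb\<close> cancel. The
  symmetrisation removes the antisymmetric remainder \<i> (b' t - b t').\<close>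

lemma tau_form:
  assumes P: "Pb \<noteq> 0" and real: "cnjv t = t" "cnjv b = b" "cnjv t' = t'" "cnjv b' = b'"
    and z: "z = b + \<i> *s cmul N t - (2 * \<i> * cdot y t / Pb) *s y" and z': "z' = b' + \<i> *s cmul N t' - (2 * \<i> * cdot y t' / Pb) *s y"
  shows "cdot z (Kform (cnjv z')) + cdot z' (Kform (cnjv z)) =
    2 * (cdot t (cmul N t') + cdot b (cmul Ni b') - (h b t * cnj (h b' t') + cnj (h b t) * h b' t') / Q)"
proof -
  have P': "P \<noteq> 0" using P cnj_P by auto
  have *: "cdot z (Kform (cnjv z')) = cdot t (cmul N t') + cdot b (cmul Ni b') + \<i> * (cdot b' t - cdot b t') - (h b t * cnj (h b' t') + cnj (h b t) * h b' t') / Q"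
    if real: "cnjv t = t" "cnjv b = b" "cnjv t' = t'" "cnjv b' = b'"
    and z: "z = b + \<i> *s cmul N t - (2 * \<i> * cdot y t / Pb) *s y" and z': "z' = b' + \<i> *s cmul N t' - (2 * \<i> * cdot y t' / Pb) *s y"
    for z t b z' t' b'
  proof -
    define e e' where "e = b + \<i> *s cmul N t" and "e' = b' - \<i> *s cmul N t'"
    define s s' where "s = cdot (cnjv X) (cmul N t)" and "s' = cdot X (cmul N t')"
    have dy: "cdot y t = s" "cdot y t' = cdot (cnjv X) (cmul N t')" by (simp_all add: y_def cmul_N s_def)
    have ze: "z = e - (2 * \<i> * s / Pb) *s y" by (simp add: z e_def dy)
    have cz: "cnjv z' = e' + (2 * \<i> * s' / P) *s cnjv y" 
      by (simp add: z' e'_def dy real cnj_cdot s'_def vec_eq_iff)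
    have K: "cdot a (Kform c) = cdot a (cmul Ni c) - (cdot (cnjv X) c * cdot X a + cdot X c * cdot (cnjv X) a) / Q" for a c
      by (simp add: Kform_def cdot_linear cdot_commute[of a] add_divide_distrib)
    have y1: "cdot a (cmul Ni y) = cdot a (cnjv X)" "cdot a (cmul Ni (cnjv y)) = cdot a X" "cdot y (cmul Ni a) = cdot (cnjv X) a" for a
      by (simp_all add: y_def inverse cmul_N)
    have y2: "cdot X y = Q" "cdot (cnjv X) y = Pb" "cdot X (cnjv y) = P" "cdot (cnjv X) (cnjv y) = Q" "cdot y X = Q"
      by (simp_all add: y_def Q_alt cmul_N)
    have ee: "cdot e (cmul Ni e') = cdot t (cmul N t') + cdot b (cmul Ni b') + \<i> * (cdot b' t - cdot b t')"
      by (simp add: e_def e'_def cdot_linear cmul_linear inverse cmul_N cdot_commute[of t b'] algebra_simps)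
    have xe: "cdot X e = h b t" "cdot (cnjv X) e = cnj (h b t) + 2 * \<i> * s" "cdot (cnjv X) e' = cnj (h b' t')" "cdot X e' = h b' t' - 2 * \<i> * s'"
      by (simp_all add: e_def e'_def h_def cdot_linear s_def s'_def cnj_cdot real)
    have "cdot z (Kform (cnjv z')) = cdot e (cmul Ni e') - (cdot (cnjv X) e' * cdot X e + cdot X e' * cdot (cnjv X) e) / Q
       - 2 * \<i> * s / Pb * (cdot (cnjv X) e' - (cdot (cnjv X) e' * Q + cdot X e' * Pb) / Q)
       + 2 * \<i> * s' / P * (cdot X e - (Q * cdot X e + P * cdot (cnjv X) e) / Q)
       + 4 * s * s' / (P * Pb) * (Q - (Q * Q + P * Pb) / Q)"
      unfolding ze cz K cdot_linear cmul_linear y1 y2 cdot_commute[of e "cnjv X"] cdot_commute[of e X]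
      using P P' Q_nz by (simp add: field_simps)
    also have "\<dots> = cdot e (cmul Ni e') - (cdot (cnjv X) e' * cdot X e + cdot X e' * cdot (cnjv X) e) / Q
       + 2 * \<i> * s * cdot X e' / Q - 2 * \<i> * s' * cdot (cnjv X) e / Q - 4 * s * s' / Q"
      using P P' Q_nz by (simp add: field_simps)
    also have "\<dots> = cdot t (cmul N t') + cdot b (cmul Ni b') + \<i> * (cdot b' t - cdot b t') - (h b t * cnj (h b' t') + cnj (h b t) * h b' t') / Q"
      unfolding xe ee using Q_nz by (simp add: field_simps)
    finally show ?thesis .
  qed
  show ?thesis unfolding *[OF real z z'] *[OF real(3,4,1,2) z' z]
    unfolding N_swap[of t' t] Ni_swap[of b' b] cdot_commute[of b t'] cdot_commute[of b' t] by (simp add: algebra_simps)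
qed

text \<open>Hypothesis \<open>0\<close> is real linear in \<open>\<nu>'\<close>, and the terms with
  \<open>P\<close> and \<open>Pb\<close> cancel; it reads cnj(\<nu>') E + \<nu>' cnj(E) = 0 for all
  \<open>\<nu>'\<close>, and E = 0 is the claim.\<close>

lemma rotation_condition:
  assumes real: "cnjv t = t" "cnjv b = b"
    and T: "T = t - (2 * cnj \<nu>) *s X - (2 * \<nu>) *s cnjv X"
    and B: "B = b + (2 * \<i>) *s cmul N (cnj \<nu> *s X - \<nu> *s cnjv X)"
    and 0: "\<And>\<nu>'. cdot T (cmul N (- (2 * cnj \<nu>') *s X - (2 * \<nu>') *s cnjv X)) + cdot B (cmul Ni ((2 * \<i>) *s cmul N (cnj \<nu>' *s X - \<nu>' *s cnjv X)))
      - 4 * Q * (\<nu> * cnj \<nu>' + cnj \<nu> * \<nu>') = 0"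
  shows "\<nu> = - \<i> * h b t / (2 * Q)"
proof -
  define E where "E = 2 * \<i> * h b t + 4 * \<nu> * Q"
  have cE: "cnj E = - 2 * \<i> * cnj (h b t) + 4 * cnj \<nu> * Q" by (simp add: E_def cnj_Q)
  have ch: "cnj (h b t) = cdot (cnjv X) b - \<i> * cdot (cnjv X) (cmul N t)" by (simp add: h_def cnj_cdot real)
  have 1: "cdot T (cmul N (- (2 * cnj \<nu>') *s X - (2 * \<nu>') *s cnjv X)) = - 2 * (cnj \<nu>' * cdot X (cmul N t) + \<nu>' * cdot (cnjv X) (cmul N t))
     + 4 * (cnj \<nu> * cnj \<nu>' * P + (cnj \<nu> * \<nu>' + \<nu> * cnj \<nu>') * Q + \<nu> * \<nu>' * Pb)" for \<nu>'
    unfolding T cdot_linear cmul_linear X_N[of t] Q_alt by (simp add: algebra_simps)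
  have 2: "cdot B (cmul Ni ((2 * \<i>) *s cmul N (cnj \<nu>' *s X - \<nu>' *s cnjv X))) = 2 * \<i> * (cnj \<nu>' * cdot X b - \<nu>' * cdot (cnjv X) b)
     - 4 * (cnj \<nu> * cnj \<nu>' * P - (cnj \<nu> * \<nu>' + \<nu> * cnj \<nu>') * Q + \<nu> * \<nu>' * Pb)" for \<nu>'
    unfolding B cdot_linear cmul_linear cmul_N inverse Q_alt cdot_commute[of b X] cdot_commute[of b "cnjv X"]
    by (simp add: algebra_simps)
  have "cnj \<nu>' * E + \<nu>' * cnj E = 0" for \<nu>'
    using 0[of \<nu>', unfolded 1 2] unfolding cE ch unfolding E_def h_def by (simp add: algebra_simps)
  \<comment> \<open>The choice \<open>\<nu>' = E\<close> gives twice the squared modulus of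
    \<open>E\<close>.\<close>
  from this[of E] have "E * cnj E = 0" by (simp add: mult.commute)
  then have "E = 0" by simp
  then have "2 * (\<nu> * (2 * Q)) = 2 * (- \<i> * h b t)" by (simp add: E_def eq_neg_iff_add_eq_0 algebra_simps)
  then have "\<nu> * (2 * Q) = - \<i> * h b t" by (simp only: mult_cancel_left) simp
  then show ?thesis using Q_nz by (simp add: field_simps)
qed

text \<open>\<open>w\<close> exceeds \<open>d\<close> by a motion along the orbit. The equations
  \<open>l\<close> and \<open>al\<close> eliminate its two real parameters, after which both sides
  are the same expression in the real and imaginary parts of X N d and in d N d'.\<close>

lemma base_part:
  fixes r q l o' l' o'' al al' :: real
  assumes q: "Q = of_real q" and r: "r \<noteq> 0"
    and w: "w = d + Complex l o' *s X" and w': "w' = d' + Complex l' o'' *s X"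
    and l: "l * q = - 2 * Re (cdot (cnjv X) (cmul N d))" "l' * q = - 2 * Re (cdot (cnjv X) (cmul N d'))"
    and al: "al = 2 * Im (cdot (cnjv X) (cmul N d)) + 2 * o' * q" "al' = 2 * Im (cdot (cnjv X) (cmul N d')) + 2 * o'' * q"
  shows "- of_real r * (2 * (cdot w (cmul N (cnjv w')) + cdot (cnjv w) (cmul N w'))) + 2 * of_real (q * r) * of_real (l * l')
       + of_real (r / (2 * q)) * of_real ((al + 2 * Im (cdot (cnjv X) (cmul N w))) * (al' + 2 * Im (cdot (cnjv X) (cmul N w'))))
    = - 2 * of_real (r * q) * (
       (Q * (cdot (cnjv d) (cmul N d') + cdot (cnjv d') (cmul N d)) - (cdot (cnjv d) (cmul N X) * cdot (cnjv X) (cmul N d') + cdot (cnjv d') (cmul N X) * cdot (cnjv X) (cmul N d))) / Q^2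
       - 2 * of_real (Re (cdot (cnjv X) (cmul N d)) * Re (cdot (cnjv X) (cmul N d'))) / Q^2
       - of_real (al * al') / (2 * Q^2))"
proof -
  define z z' where "z = cdot (cnjv X) (cmul N d)" and "z' = cdot (cnjv X) (cmul N d')"
  have q0: "q \<noteq> 0" using q Q_nz by auto
  have c: "cdot (cnjv d) (cmul N X) = cnj z" "cdot (cnjv d') (cmul N X) = cnj z'" "cdot X (cmul N (cnjv d)) = cnj z" "cdot X (cmul N (cnjv d')) = cnj z'"
     "cdot d (cmul N (cnjv X)) = z" "cdot d' (cmul N (cnjv X)) = z'"
    by (simp_all add: z_def z'_def cnj_cdot N_swap)
  define D D' where "D = cdot d (cmul N (cnjv d'))" and "D' = cdot (cnjv d) (cmul N d')"
  have D: "cdot (cnjv d') (cmul N d) = D" by (simp add: D_def N_swap)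
  have cD: "D' = cnj D" by (simp add: D_def D'_def cnj_cdot)
  have o: "o' = (al / 2 - Im z) / q" "o'' = (al' / 2 - Im z') / q" using al q0 by (simp_all add: z_def z'_def field_simps)
  have l: "l = - 2 * Re z / q" "l' = - 2 * Re z' / q" using l q0 by (simp_all add: z_def z'_def field_simps)
  let ?k = "Complex l o'" and ?k' = "Complex l' o''"
  have ww: "cdot w (cmul N (cnjv w')) = D + ?k * cnj z' + cnj ?k' * z + ?k * cnj ?k' * of_real q"
    unfolding w w' cnjv_simps cmul_linear cdot_linear c D_def Q_alt q by (simp add: algebra_simps)
  have ww': "cdot (cnjv w) (cmul N w') = D' + cnj ?k * z' + ?k' * cnj z + cnj ?k * ?k' * of_real q"
    unfolding w w' cnjv_simps cmul_linear cdot_linear c D'_def z'_def[symmetric] q by (simp add: algebra_simps)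
  have Xw: "cdot (cnjv X) (cmul N w) = z + ?k * of_real q" "cdot (cnjv X) (cmul N w') = z' + ?k' * of_real q"
    unfolding w w' cmul_linear cdot_linear z_def z'_def q by simp_all
  have im: "Im (z + ?k * of_real q) = al / 2" "Im (z' + ?k' * of_real q) = al' / 2" using q0 by (simp_all add: o)
  have sum: "cdot w (cmul N (cnjv w')) + cdot (cnjv w) (cmul N w') = of_real (2 * (Re D + (al * al' / 4 - Im z * Im z') / q))"
    unfolding ww ww' cD o l using q0 by (simp add: complex_eq_iff field_simps)
  have psk: "Q * (D' + D) - (cnj z * z' + cnj z' * z) = of_real (2 * (q * Re D - (Re z * Re z' + Im z * Im z')))"
    unfolding q cD by (simp add: complex_eq_iff algebra_simps)
  have two: "(2 :: complex) = of_real 2" by simp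
  show ?thesis
    unfolding sum Xw im c D D'_def[symmetric] z_def[symmetric] z'_def[symmetric] psk unfolding q l
    unfolding two of_real_power[symmetric] of_real_minus[symmetric] of_real_mult[symmetric] of_real_divide[symmetric]
      of_real_diff[symmetric] of_real_add[symmetric] of_real_eq_iff
    using q0 r by (simp add: field_simps power2_eq_square)
qed

end

subsection \<open>The metric on the orbit complement\<close>

lemma sum_option: "(\<Sum>I\<in>UNIV. f (I :: 'n::finite option)) = f None + (\<Sum>A\<in>UNIV. f (Some A))"
  by (simp add: UNIV_option_conv sum.reindex)

context cmap_cone
begin

definition NN :: "'n config \<Rightarrow> real^'n^'n" where "NN x = (\<chi> A B. nn x A B)"
text \<open>The value of the Hermitian form N on \<open>XX\<close>, as
  \<open>special_form_cmap\<close> shows: the factor in front of \<open>qq\<close> is the squared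
  modulus of \<open>kk\<close>.\<close>

definition qc :: "'n config \<Rightarrow> real" where "qc x = rho x * qq x / (4 * (r x)^2)"

abbreviation Ni :: "'n config \<Rightarrow> real^'n^'n" where "Ni x \<equiv> matrix_inv (NN x)"

lemma NN_nth [simp]: "NN x $ A $ B = nn x A B" by (simp add: NN_def)

lemma transpose_NN: "x \<in> S \<Longrightarrow> transpose (NN x) = NN x"
  using nn_sym[of x] by (simp add: transpose_def vec_eq_iff)

text \<open>In the frame \<open>v\<^sup>0\<close>, \<open>v\<^sup>A - \<psi>\<^sup>~\<^sup>A v\<^sup>0\<close> the Higgs field is block diagonal with blocks \<open>2 Q/r\<^sup>0\<close> and \<open>- N/r\<^sup>0\<close>,
  \<open>Q = cnj \<X> N \<X>\<close>.\<close>

lemma higgs_mult: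
  assumes x: "x \<in> S"
  shows "(gh.H x *v u) $ Some A = - (NN x *v (\<chi> B. u $ Some B - ps x B * u $ None)) $ A / r x"
    "(gh.H x *v u) $ None + (\<Sum>A\<in>UNIV. ps x A * (gh.H x *v u) $ Some A) = 2 * qc x / r x * u $ None"
proof -
  have rp: "r x > 0" by (rule r_pos[OF x])
  show 1: "(gh.H x *v u) $ Some A = - (NN x *v (\<chi> B. u $ Some B - ps x B * u $ None)) $ A / r x" for A
    unfolding matrix_vector_mult_def vec_lambda_beta sum_option higgs_A0[OF x] higgs_AB[OF x]
    by (simp add: right_diff_distrib sum_subtractf sum_distrib_left sum_distrib_right sum_divide_distrib sum_negf mult_ac diff_divide_distrib)
  have swap: "(\<Sum>A\<in>UNIV. ps x A * (NN x *v w) $ A) = (\<Sum>B\<in>UNIV. (\<Sum>A\<in>UNIV. nn x B A * ps x A) * w $ B)" for w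
    unfolding matrix_vector_mult_def vec_lambda_beta sum_distrib_left sum_distrib_right NN_nth
    by (subst sum.swap) (intro sum.cong refl, simp add: nn_sym[OF x] mult_ac)
  have 2: "(\<Sum>A\<in>UNIV. ps x A * (gh.H x *v u) $ Some A) = - (\<Sum>B\<in>UNIV. (\<Sum>A\<in>UNIV. nn x B A * ps x A) * (u $ Some B - ps x B * u $ None)) / r x"
  proof -
    have "(\<Sum>A\<in>UNIV. ps x A * (gh.H x *v u) $ Some A) = - (\<Sum>A\<in>UNIV. ps x A * (NN x *v (\<chi> B. u $ Some B - ps x B * u $ None)) $ A) / r x"
      unfolding 1 by (simp add: sum_divide_distrib sum_negf)
    then show ?thesis unfolding swap by simp
  qed
  have 3: "(gh.H x *v u) $ None = gh.H x $ None $ None * u $ None + (\<Sum>B\<in>UNIV. (\<Sum>A\<in>UNIV. nn x B A * ps x A) * u $ Some B) / r x"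
    unfolding matrix_vector_mult_def vec_lambda_beta sum_option higgs_0A[OF x] by (simp add: sum_divide_distrib[symmetric])
  have 4: "(\<Sum>A\<in>UNIV. \<Sum>B\<in>UNIV. nn x A B * ps x A * ps x B) = (\<Sum>A\<in>UNIV. (\<Sum>B\<in>UNIV. nn x A B * ps x B) * ps x A)"
    by (simp add: sum_distrib_left sum_distrib_right mult_ac)
  have 5: "(\<Sum>B\<in>UNIV. s B * (u $ Some B - ps x B * u $ None)) = (\<Sum>B\<in>UNIV. s B * u $ Some B) - (\<Sum>A\<in>UNIV. s A * ps x A) * u $ None" for s :: "'n \<Rightarrow> real"
    by (simp add: right_diff_distrib sum_subtractf sum_distrib_left mult_ac)
  show "(gh.H x *v u) $ None + (\<Sum>A\<in>UNIV. ps x A * (gh.H x *v u) $ Some A) = 2 * qc x / r x * u $ None"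
    unfolding 2 3 higgs_00[OF x] 4 5 qc_def using rp by (simp add: field_simps power2_eq_square power3_eq_cube)
qed

lemma higgs_form:
  assumes x: "x \<in> S"
  shows "(gh.H x *v u) \<bullet> t = - (NN x *v (\<chi> B. u $ Some B - ps x B * u $ None)) \<bullet> (\<chi> B. t $ Some B - ps x B * t $ None) / r x
     + 2 * qc x / r x * u $ None * t $ None"
proof -
  have "(gh.H x *v u) \<bullet> t = (gh.H x *v u) $ None * t $ None + (\<Sum>A\<in>UNIV. (gh.H x *v u) $ Some A * t $ Some A)"
    by (simp add: inner_vec_def sum_option)
  also have "\<dots> = ((gh.H x *v u) $ None + (\<Sum>A\<in>UNIV. ps x A * (gh.H x *v u) $ Some A)) * t $ None
     + (\<Sum>A\<in>UNIV. (gh.H x *v u) $ Some A * (t $ Some A - ps x A * t $ None))"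
    by (simp add: right_diff_distrib sum_subtractf sum_distrib_left sum_distrib_right distrib_left distrib_right mult_ac)
  also have "\<dots> = 2 * qc x / r x * u $ None * t $ None - (NN x *v (\<chi> B. u $ Some B - ps x B * u $ None)) \<bullet> (\<chi> B. t $ Some B - ps x B * t $ None) / r x"
    unfolding higgs_mult(2)[OF x] unfolding higgs_mult(1)[OF x] inner_vec_def by (simp add: sum_divide_distrib sum_negf)
  finally show ?thesis by simp
qed

lemma blockmul_higgs:
  assumes x: "x \<in> S"
  shows "blockmul (gh.H x) v \<bullet> v' = - (\<Sum>A\<in>UNIV. \<Sum>B\<in>UNIV. nn x A B * (wv x A v \<bullet> wv x B v')) / r x + 2 * qc x / r x * (v $ None \<bullet> v' $ None)"
proof -
  have "blockmul (gh.H x) v \<bullet> v' = (\<Sum>i\<in>UNIV. slice (axis i 1) (blockmul (gh.H x) v) \<bullet> slice (axis i 1) v')"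
  proof -
    have "slice (axis i 1) u \<bullet> slice (axis i 1) w = (\<Sum>I\<in>UNIV. u $ I $ i * w $ I $ i)" for u w :: "'n config" and i
      by (simp add: slice_def inner_axis) (simp add: inner_vec_def)
    then show ?thesis by (simp add: inner_vec_def[where 'a="real^3"]) (subst sum.swap, simp add: inner_vec_def)
  qed
  also have "\<dots> = (\<Sum>i\<in>UNIV. - (\<Sum>A\<in>UNIV. \<Sum>B\<in>UNIV. nn x A B * (wv x A v' $ i * wv x B v $ i)) / r x + 2 * qc x / r x * (v $ None $ i * v' $ None $ i))"
  proof -
    have e: "slice (axis i 1) u = (\<chi> I. u $ I $ i)" for i and u :: "(real^3)^'i::finite"
      by (simp add: slice_def inner_axis)
    have f: "(M *v a) \<bullet> b = (\<Sum>A\<in>UNIV. \<Sum>B\<in>UNIV. M $ A $ B * (b $ A * a $ B))" for M :: "real^'n^'n" and a b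
      by (simp add: inner_vec_def matrix_vector_mult_def sum_distrib_left mult_ac)
    show ?thesis unfolding slice_blockmul higgs_form[OF x] e inner_minus_left f by (simp add: wv_def mult.assoc)
  qed
  also have "\<dots> = - (\<Sum>A\<in>UNIV. \<Sum>B\<in>UNIV. nn x A B * (wv x A v' \<bullet> wv x B v)) / r x + 2 * qc x / r x * (v $ None \<bullet> v' $ None)"
    by (simp add: sum_3 inner_3 sum.distrib distrib_left add_divide_distrib diff_divide_distrib)
  also have "(\<Sum>A\<in>UNIV. \<Sum>B\<in>UNIV. nn x A B * (wv x A v' \<bullet> wv x B v)) = (\<Sum>A\<in>UNIV. \<Sum>B\<in>UNIV. nn x A B * (wv x A v \<bullet> wv x B v'))"
  proof (subst sum.swap, intro sum.cong refl)
    fix A B show "nn x B A * (wv x B v' \<bullet> wv x A v) = nn x A B * (wv x A v \<bullet> wv x B v')"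
      using nn_sym[OF x, of A B] by (simp add: inner_commute)
  qed
  finally show ?thesis .
qed

text \<open>Evaluated on x itself, the transverse block contributes -4 r \<open>qc\<close> and the
  block of x^0 contributes 2 r \<open>qc\<close>; the potential is twice their sum.\<close>

lemma potential_qc:
  assumes x: "x \<in> S"
  shows "hk_potential L x = - 4 * r x * qc x" "qc x \<noteq> 0"
proof -
  have rp: "r x > 0" by (rule r_pos[OF x])
  have "(\<Sum>A\<in>UNIV. \<Sum>B\<in>UNIV. nn x A B * (wv x A x \<bullet> wv x B x)) = rho x * qq x"
  proof -
    have "wv x A x = xp x A" for A by (simp add: wv_def xp_def)
    then show ?thesis unfolding qq_def sum_distrib_left
      by (intro sum.cong refl) (simp add: inner_xp[OF x] m_xp[OF x])
  qed
  then show 1: "hk_potential L x = - 4 * r x * qc x"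
    unfolding gh.hk_potential_blockmul inner_commute[of x] blockmul_higgs[OF x] x0_x0 qc_def using rp
    by (simp add: field_simps power2_eq_square)
  then show "qc x \<noteq> 0" using potential_nz[OF x] by auto
qed

text \<open>N is a block of the Higgs field, so a kernel vector of N, extended by zero in the
  component \<open>None\<close>, is a kernel vector of the Higgs field.\<close>

lemma invertible_NN:
  assumes x: "x \<in> S"
  shows "invertible (NN x)"
proof -
  have "w = 0" if w: "NN x *v w = 0" for w
  proof -
    define u where "u = (\<chi> I. case I of None \<Rightarrow> 0 | Some A \<Rightarrow> w $ A)"
    have u: "(\<chi> B. u $ Some B - ps x B * u $ None) = w" by (simp add: u_def vec_eq_iff)
    have A: "(gh.H x *v u) $ Some A = 0" for A unfolding higgs_mult(1)[OF x] u w by simp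
    have "(gh.H x *v u) $ None = 0" using higgs_mult(2)[OF x, of u] unfolding A by (simp add: u_def)
    then have "(gh.H x *v u) $ I = 0" for I using A by (cases I) auto
    then have "gh.H x *v u = 0" by (simp add: vec_eq_iff)
    then have "u = 0" using gh.VH[OF x, of u] by simp
    then show ?thesis using u by (simp add: vec_eq_iff)
  qed
  then show ?thesis using matrix_left_invertible_ker[of "NN x"] invertible_left_inverse by blast
qed

lemma inverse_higgs_form:
  assumes x: "x \<in> S"
  shows "(gh.V x *v t) \<bullet> t' = - r x * ((Ni x *v (\<chi> A. t $ Some A)) \<bullet> (\<chi> A. t' $ Some A))
    + r x / (2 * qc x) * (t $ None + (\<Sum>A\<in>UNIV. ps x A * t $ Some A)) * (t' $ None + (\<Sum>A\<in>UNIV. ps x A * t' $ Some A))"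
proof -
  have rp: "r x > 0" by (rule r_pos[OF x])
  note q = potential_qc(2)[OF x]
  define u where "u = gh.V x *v t"
  have Hu: "gh.H x *v u = t" unfolding u_def by (rule gh.HV[OF x])
  have u0: "u $ None = r x / (2 * qc x) * (t $ None + (\<Sum>A\<in>UNIV. ps x A * t $ Some A))"
    using higgs_mult(2)[OF x, of u] q rp unfolding Hu by (simp add: field_simps)
  define w where "w = (\<chi> B. u $ Some B - ps x B * u $ None)"
  have "NN x *v w = - r x *\<^sub>R (\<chi> A. t $ Some A)"
    using higgs_mult(1)[OF x, of u] rp unfolding Hu w_def[symmetric] by (simp add: vec_eq_iff field_simps)
  then have "Ni x *v (NN x *v w) = - r x *\<^sub>R (Ni x *v (\<chi> A. t $ Some A))"
    by (simp only: matrix_vector_mult_scaleR)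
  moreover have "Ni x *v (NN x *v w) = w"
    by (simp add: matrix_vector_mul_assoc matrix_inv_mult[OF invertible_NN[OF x]])
  ultimately have w: "w = - r x *\<^sub>R (Ni x *v (\<chi> A. t $ Some A))" by simp
  have "u \<bullet> t' = u $ None * t' $ None + (\<Sum>A\<in>UNIV. (w $ A + ps x A * u $ None) * t' $ Some A)"
    by (simp add: inner_vec_def sum_option w_def)
  also have "\<dots> = u $ None * (t' $ None + (\<Sum>A\<in>UNIV. ps x A * t' $ Some A)) + w \<bullet> (\<chi> A. t' $ Some A)"
    by (simp add: inner_vec_def distrib_right sum.distrib distrib_left sum_distrib_left mult_ac)
  also have "w \<bullet> (\<chi> A. t' $ Some A) = - r x * ((Ni x *v (\<chi> A. t $ Some A)) \<bullet> (\<chi> A. t' $ Some A))" unfolding w by simp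
  finally show ?thesis unfolding u0 by (simp add: u_def)
qed

lemma of_real_form: "of_real ((M *v t) \<bullet> t') = cdot (cvec (\<lambda>A. t' $ A)) (cmul M (cvec (\<lambda>A. t $ A)))"
  by (simp add: inner_vec_def matrix_vector_mult_def cdot_def cmul_def cvec_def mult.commute)

lemma special_form_cmap:
  assumes x: "x \<in> NS o1"
  shows "special_form (NN x) (Ni x) (XX o1 x)" "cdot (cnjv (XX o1 x)) (cmul (NN x) (XX o1 x)) = of_real (qc x)"
proof -
  have S: "x \<in> S" using x by auto
  have s: "cdot (cmul (NN x) a) b = cdot a (cmul (NN x) b)" for a b by (rule cmul_sym[OF transpose_NN[OF S]])
  have "cnj (cdot (cnjv (chi x)) (cmul (NN x) (chi x))) = cdot (cnjv (chi x)) (cmul (NN x) (chi x))"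
    by (simp add: cnj_cdot cdot_commute[of "chi x"] s)
  then have "Im (cdot (cnjv (chi x)) (cmul (NN x) (chi x))) = 0" by (simp add: complex_eq_iff)
  moreover have "Re (cdot (cnjv (chi x)) (cmul (NN x) (chi x))) = qq x"
    unfolding cdot_cmul qq_def Re_sum by (intro sum.cong refl) (simp add: cnjv_def algebra_simps)
  ultimately have "cdot (cnjv (chi x)) (cmul (NN x) (chi x)) = of_real (qq x)" by (simp add: complex_eq_iff)
  then show q: "cdot (cnjv (XX o1 x)) (cmul (NN x) (XX o1 x)) = of_real (qc x)"
  proof -
    assume q: "cdot (cnjv (chi x)) (cmul (NN x) (chi x)) = of_real (qq x)"
    have "cdot (cnjv (XX o1 x)) (cmul (NN x) (XX o1 x)) = (kk o1 x * cnj (kk o1 x)) * of_real (qq x)"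
      by (simp add: XX_def cmul_linear cdot_linear q)
    then show ?thesis unfolding kk_norm[OF x] by (simp add: qc_def)
  qed
  show "special_form (NN x) (Ni x) (XX o1 x)"
    by unfold_locales (simp_all add: transpose_NN[OF S] cmul_mult matrix_inv_mult[OF invertible_NN[OF S]] cmul_mat_1 q potential_qc(2)[OF S])
qed

text \<open>\<open>TT\<close>, \<open>ww\<close>, \<open>nu\<close>, \<open>TH\<close>,
  \<open>b0\<close>, together with \<open>lam\<close>, are the components of a tangent vector in
  which the metric is block diagonal: \<open>TT\<close> and \<open>lam\<close> along x^0,
  \<open>ww\<close> and \<open>nu\<close> transverse to it and normalised by \<open>kk\<close>,
  \<open>TH\<close> and \<open>b0\<close> vertical.\<close>

definition TT :: "'n config \<Rightarrow> 'n config \<Rightarrow> complex^'n" where "TT x v = cvec (\<lambda>A. (wv x A v \<bullet> x0 x) / (r x)^2)"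
definition ww :: "'n \<Rightarrow> 'n config \<Rightarrow> 'n config \<Rightarrow> complex^'n" where "ww o1 x v = (\<chi> A. kk o1 x * mw x A v)"
definition nu :: "'n \<Rightarrow> 'n config \<Rightarrow> 'n config \<Rightarrow> complex" where "nu o1 x v = kk o1 x * m x (v $ None)"
definition TH :: "'n total \<Rightarrow> 'n total \<Rightarrow> complex^'n" where "TH p v = cvec (\<lambda>A. gh.th p v $ Some A)"
definition b0 :: "'n total \<Rightarrow> 'n total \<Rightarrow> real" where
  "b0 p v = gh.th p v $ None + (\<Sum>A\<in>UNIV. ps (fst p) A * gh.th p v $ Some A)"

lemma rho_kk: "x \<in> NS o1 \<Longrightarrow> of_real (rho x) * (z * cnj w) = of_real (4 * (r x)^2) * ((kk o1 x * z) * cnj (kk o1 x * w))"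
  using kk_norm[of x o1] r_pos[of x] by (simp add: field_simps)

text \<open>The factors 2 in front of the transverse terms arise because \<open>rho2\<close> divided
  by r^2 is four times the squared modulus of \<open>kk\<close>, and because a real part is half a
  sum of conjugates.\<close>

lemma metric_formula:
  assumes p: "p \<in> NP o1" and x: "x = fst p" and N: "N = NN x"
  shows "of_real (gh.G p v v') =
    - of_real (r x) * (cdot (TT x (fst v)) (cmul N (TT x (fst v')))
       + 2 * (cdot (ww o1 x (fst v)) (cmul N (cnjv (ww o1 x (fst v')))) + cdot (cnjv (ww o1 x (fst v))) (cmul N (ww o1 x (fst v')))))
    + 2 * of_real (qc x * r x) * (of_real (lam x (fst v) * lam x (fst v')) + 2 * (nu o1 x (fst v) * cnj (nu o1 x (fst v')) + cnj (nu o1 x (fst v)) * nu o1 x (fst v')))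
    - of_real (r x) * cdot (TH p v) (cmul (Ni x) (TH p v')) + of_real (r x / (2 * qc x)) * of_real (b0 p v * b0 p v')"
proof -
  have xN: "x \<in> NS o1" and S: "x \<in> S" and fS: "fst p \<in> S" using p x by auto
  have rp: "r x > 0" by (rule r_pos[OF S])
  interpret special_form "NN x" "Ni x" "XX o1 x" by (rule special_form_cmap[OF xN])
  have inn: "of_real (a \<bullet> b) = of_real ((a \<bullet> x0 x) * (b \<bullet> x0 x) / (r x)^2)
     + of_real (2 * (r x)^2) * ((kk o1 x * m x a) * cnj (kk o1 x * m x b) + cnj (kk o1 x * m x a) * (kk o1 x * m x b))" for a b
  proof -
    have *: "of_real (rho x * Re (m x a * cnj (m x b))) = (of_real (rho x) * (m x a * cnj (m x b)) + of_real (rho x) * (m x b * cnj (m x a))) / 2"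
      by (simp add: complex_eq_iff algebra_simps)
    show ?thesis unfolding isotropic_inner[OF rho[OF S], of a b] of_real_add * rho_kk[OF xN] by (simp add: field_simps)
  qed
  have wi: "of_real (wv x A u \<bullet> wv x B u') = of_real ((r x)^2) * (TT x u $ A * TT x u' $ B
      + 2 * (ww o1 x u $ A * cnj (ww o1 x u' $ B) + cnj (ww o1 x u $ A) * ww o1 x u' $ B))" for A B u u'
    unfolding inn using rp by (simp add: TT_def cvec_def ww_def mw_wv field_simps power2_eq_square)
  have W: "of_real (\<Sum>A\<in>UNIV. \<Sum>B\<in>UNIV. nn x A B * (wv x A u \<bullet> wv x B u')) = of_real ((r x)^2) * (cdot (TT x u) (cmul N (TT x u'))
       + 2 * (cdot (ww o1 x u) (cmul N (cnjv (ww o1 x u'))) + cdot (cnjv (ww o1 x u)) (cmul N (ww o1 x u'))))" for u u'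
    unfolding cdot_cmul of_real_sum of_real_mult wi N
    by (simp add: sum_distrib_left sum.distrib distrib_left cnjv_def mult_ac)
  have V0: "of_real (v $ None \<bullet> v' $ None) = of_real ((r x)^2) * (of_real (lam x v * lam x v') + 2 * (nu o1 x v * cnj (nu o1 x v') + cnj (nu o1 x v) * nu o1 x v'))"
    for v v' :: "'n config"
    unfolding inn using rp by (simp add: nu_def lam_def field_simps power2_eq_square inner_commute)
  have H: "of_real (blockmul (gh.H x) (fst v) \<bullet> fst v') = - of_real (r x) * (cdot (TT x (fst v)) (cmul N (TT x (fst v')))
       + 2 * (cdot (ww o1 x (fst v)) (cmul N (cnjv (ww o1 x (fst v')))) + cdot (cnjv (ww o1 x (fst v))) (cmul N (ww o1 x (fst v')))))
    + 2 * of_real (qc x * r x) * (of_real (lam x (fst v) * lam x (fst v')) + 2 * (nu o1 x (fst v) * cnj (nu o1 x (fst v')) + cnj (nu o1 x (fst v)) * nu o1 x (fst v')))"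
    unfolding blockmul_higgs[OF S] of_real_add of_real_minus of_real_divide of_real_mult[of _ "fst v $ None \<bullet> fst v' $ None"] W V0 
    using rp by (simp add: field_simps power2_eq_square)
  have V: "of_real ((gh.V x *v gh.th p v) \<bullet> gh.th p v') = - of_real (r x) * cdot (TH p v) (cmul (Ni x) (TH p v')) + of_real (r x / (2 * qc x)) * of_real (b0 p v * b0 p v')"
  proof -
    have "of_real ((Ni x *v (\<chi> A. gh.th p v $ Some A)) \<bullet> (\<chi> A. gh.th p v' $ Some A)) = cdot (TH p v) (cmul (Ni x) (TH p v'))"
      unfolding of_real_form TH_def vec_lambda_beta by (rule Ni_swap)
    then show ?thesis unfolding inverse_higgs_form[OF S] of_real_add of_real_mult[of "- r x"] by (simp add: b0_def x mult_ac)
  qed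
  show ?thesis unfolding gh.gh_metric_eq[OF fS] x[symmetric] of_real_add H V by simp
qed

lemma TT_eq:
  assumes x: "x \<in> NS o1"
  shows "TT x v = cvec (\<lambda>A. dps x A v) - (2 * cnj (nu o1 x v)) *s XX o1 x - (2 * nu o1 x v) *s cnjv (XX o1 x)"
proof -
  have S: "x \<in> S" using x by auto
  have rp: "r x > 0" by (rule r_pos[OF S])
  have "of_real (rho x) * (z * cnj w + cnj z * w) = of_real (4 * (r x)^2) * ((kk o1 x * z) * cnj (kk o1 x * w) + cnj (kk o1 x * z) * (kk o1 x * w))" for z w
  proof -
    have "of_real (rho x) * (z * cnj w + cnj z * w) = of_real (rho x) * (z * cnj w) + of_real (rho x) * (w * cnj z)"
      by (simp add: algebra_simps)
    then show ?thesis unfolding rho_kk[OF x] by (simp only: distrib_left mult.commute)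
  qed
  moreover have "complex_of_real (Re (z * cnj w)) = (z * cnj w + cnj z * w) / 2" for z w by (simp add: complex_eq_iff)
  ultimately have "of_real (rho x * Re (z * cnj w)) = of_real (4 * (r x)^2) * ((kk o1 x * z) * cnj (kk o1 x * w) + cnj (kk o1 x * z) * (kk o1 x * w)) / 2" for z w
    by (metis of_real_mult times_divide_eq_right)
  define c where "c A = rho x * Re (chi x $ A * cnj (m x (v $ None)))" for A
  have hc: "of_real (c A) = of_real (4 * (r x)^2) * (XX o1 x $ A * cnj (nu o1 x v) + cnj (XX o1 x $ A) * nu o1 x v) / 2" for A
    unfolding c_def nu_def XX_def vector_smult_component by fact
  have c: "of_real (c A) = of_real ((r x)^2) * (2 * cnj (nu o1 x v) * XX o1 x $ A + 2 * nu o1 x v * cnj (XX o1 x $ A))" for A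
    unfolding hc by (simp add: field_simps)
  have "TT x v $ A = of_real (dps x A v) - of_real (c A) / of_real ((r x)^2)" for A
    using rp unfolding TT_def cvec_def vec_lambda_beta wv_x0[OF S] c_def[symmetric] by (simp add: field_simps)
  moreover have "complex_of_real ((r x)^2) \<noteq> 0" using rp by simp
  ultimately have "TT x v $ A = of_real (dps x A v) - (2 * cnj (nu o1 x v) * XX o1 x $ A + 2 * nu o1 x v * cnj (XX o1 x $ A))" for A
    unfolding c by (simp only: nonzero_mult_div_cancel_left not_False_eq_True)
  then show ?thesis by (simp add: cvec_def cnjv_def vec_eq_iff)
qed

definition bb :: "'n total \<Rightarrow> 'n total \<Rightarrow> complex^'n" where
  "bb p v = cvec (\<lambda>A. dPsi p v $ Some A + (\<Sum>B\<in>UNIV. Re (f2 (fst p) A B) * dps (fst p) B (fst v)))"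

definition aa :: "'n total \<Rightarrow> 'n total \<Rightarrow> real" where
  "aa p v = dPsi p v $ None + (1/2) * (\<Sum>A\<in>UNIV. ps (fst p) A * dPsi p v $ Some A - Psi p $ Some A * dps (fst p) A (fst v))"

lemma kk_sq: "x \<in> NS o1 \<Longrightarrow> rho x / (r x)^2 * Im (z * cnj w) = 4 * Im ((kk o1 x * z) * cnj (kk o1 x * w))"
proof -
  assume x: "x \<in> NS o1"
  have "(kk o1 x * z) * cnj (kk o1 x * w) = of_real (rho x / (4 * (r x)^2)) * (z * cnj w)"
    unfolding kk_norm[OF x, symmetric] by (simp add: mult_ac)
  then show ?thesis by simp
qed

lemma TH_eq:
  assumes x: "fst p \<in> NS o1"
  shows "TH p v = bb p v + (2 * \<i>) *s cmul (NN (fst p)) (cnj (nu o1 (fst p) (fst v)) *s XX o1 (fst p) - nu o1 (fst p) (fst v) *s cnjv (XX o1 (fst p)))"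
proof -
  let ?x = "fst p"
  have S: "?x \<in> S" using x by auto
  have im: "2 * \<i> * (cnj n * X - n * cnj X) = - of_real (4 * Im (X * cnj n))" for n X by (simp add: complex_eq_iff)
  have 1: "2 * \<i> * (cnj (nu o1 ?x (fst v)) * XX o1 ?x $ B - nu o1 ?x (fst v) * cnj (XX o1 ?x $ B)) =
     - of_real (rho ?x / (r ?x)^2 * Im (chi ?x $ B * cnj (m ?x (fst v $ None))))" for B
    unfolding kk_sq[OF x] nu_def XX_def vector_smult_component by (rule im)
  have 2: "2 * \<i> * (\<Sum>B\<in>UNIV. of_real (nn ?x A B) * (cnj (nu o1 ?x (fst v)) * XX o1 ?x $ B - nu o1 ?x (fst v) * cnj (XX o1 ?x $ B)))
     = (\<Sum>B\<in>UNIV. of_real (nn ?x A B) * (2 * \<i> * (cnj (nu o1 ?x (fst v)) * XX o1 ?x $ B - nu o1 ?x (fst v) * cnj (XX o1 ?x $ B))))" for A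
    unfolding sum_distrib_left by (intro sum.cong refl) (simp only: mult_ac)
  have "TH p v $ A = (bb p v + (2 * \<i>) *s cmul (NN ?x) (cnj (nu o1 ?x (fst v)) *s XX o1 ?x - nu o1 ?x (fst v) *s cnjv (XX o1 ?x))) $ A" for A
    unfolding TH_def bb_def cvec_def vec_lambda_beta th_A[OF S] vector_add_component vector_smult_component cmul_def NN_nth
      vector_minus_component cnjv_def 2 unfolding 1 by (simp add: sum_distrib_left sum_negf mult_ac)
  then show ?thesis by (simp add: vec_eq_iff)
qed

lemma b0_eq:
  assumes x: "fst p \<in> NS o1"
  shows "b0 p v = aa p v + 2 * Im (cdot (cnjv (XX o1 (fst p))) (cmul (NN (fst p)) (ww o1 (fst p) (fst v))))"
proof -
  let ?x = "fst p"
  have S: "?x \<in> S" using x by auto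
  have "(1/2) * (rho ?x / (r ?x)^2) * (\<Sum>A\<in>UNIV. \<Sum>B\<in>UNIV. nn ?x A B * Im (cnj (chi ?x $ A) * mw ?x B (fst v))) =
    (1/2) * (\<Sum>A\<in>UNIV. \<Sum>B\<in>UNIV. nn ?x A B * (rho ?x / (r ?x)^2 * Im (mw ?x B (fst v) * cnj (chi ?x $ A))))"
    by (simp add: sum_distrib_left mult_ac)
  also have "\<dots> = 2 * Im (cdot (cnjv (XX o1 ?x)) (cmul (NN ?x) (ww o1 ?x (fst v))))"
    unfolding kk_sq[OF x] cdot_cmul Im_sum sum_distrib_left
    by (intro sum.cong refl) (simp add: cnjv_def XX_def ww_def algebra_simps)
  finally show ?thesis unfolding b0_def th_0[OF S] aa_def by simp
qed

lemma ww_eq: "ww o1 x v = dXX o1 x v + kap o1 x v *s XX o1 x"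
  by (simp add: ww_def dXX_def vec_eq_iff)

end

lemma cmul_rank_two:
  assumes "\<And>A B. complex_of_real (I $ A $ B) = of_real (N $ A $ B) - a $ A * a' $ B / p - b $ A * b' $ B / q"
  shows "cmul I c = cmul N c - (cdot a' c / p) *s a - (cdot b' c / q) *s b"
  by (simp add: cmul_def cdot_def assms vec_eq_iff left_diff_distrib right_diff_distrib sum_subtractf sum_divide_distrib sum_distrib_right sum_distrib_left mult_ac)

section \<open>Orthogonality to the orbits\<close>

context cmap_cone
begin

lemma scaling_metric_data:
  assumes x: "fst p \<in> NS o1"
  shows "TT (fst p) (fst (gh.Sc p)) = 0" "ww o1 (fst p) (fst (gh.Sc p)) = XX o1 (fst p)" "lam (fst p) (fst (gh.Sc p)) = 1"
    "nu o1 (fst p) (fst (gh.Sc p)) = 0" "TH p (gh.Sc p) = 0" "b0 p (gh.Sc p) = 0"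
proof -
  have S: "fst p \<in> S" using x by auto
  have "wv (fst p) A (fst p) = xp (fst p) A" for A by (simp add: wv_def xp_def)
  then show "TT (fst p) (fst (gh.Sc p)) = 0" unfolding TT_def gh.fst_Sc
    by (simp only: xp_x0[OF S] div_0) (simp add: cvec_def vec_eq_iff)
qed (use x in \<open>auto simp: ww_def XX_def scaling_data[OF x] nu_def isotropic_self[OF rho] TH_def cvec_def b0_def vec_eq_iff\<close>)

lemma rotation_metric_data:
  fixes a :: "real^3"
  assumes x: "fst p \<in> NS o1"
  defines "n \<equiv> nu o1 (fst p) (fst (gh.Rt a p))" and "c \<equiv> (a \<bullet> x0 (fst p)) / r (fst p)"
  shows "TT (fst p) (fst (gh.Rt a p)) = - (2 * cnj n) *s XX o1 (fst p) - (2 * n) *s cnjv (XX o1 (fst p))"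
    "ww o1 (fst p) (fst (gh.Rt a p)) = (\<i> * of_real c) *s XX o1 (fst p)" "lam (fst p) (fst (gh.Rt a p)) = 0"
    "TH p (gh.Rt a p) = (2 * \<i>) *s cmul (NN (fst p)) (cnj n *s XX o1 (fst p) - n *s cnjv (XX o1 (fst p)))"
    "b0 p (gh.Rt a p) = 2 * c * qc (fst p)"
    "n = - \<i> * of_real (r (fst p)) * (kk o1 (fst p) * m (fst p) a)"
proof -
  note R = rotation_data[OF x]
  have z: "dPsi p (gh.Rt a p) $ I = 0" for I by (simp add: dPsi_Rt[OF x])
  show "TT (fst p) (fst (gh.Rt a p)) = - (2 * cnj n) *s XX o1 (fst p) - (2 * n) *s cnjv (XX o1 (fst p))"
    unfolding TT_eq[OF x] n_def by (simp add: R cvec_def vec_eq_iff)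
  show w: "ww o1 (fst p) (fst (gh.Rt a p)) = (\<i> * of_real c) *s XX o1 (fst p)"
    by (simp add: ww_def R XX_def c_def vec_eq_iff mult_ac)
  show "lam (fst p) (fst (gh.Rt a p)) = 0" by (simp add: R)
  have "bb p (gh.Rt a p) = 0" unfolding bb_def z by (simp add: R cvec_def vec_eq_iff)
  then show "TH p (gh.Rt a p) = (2 * \<i>) *s cmul (NN (fst p)) (cnj n *s XX o1 (fst p) - n *s cnjv (XX o1 (fst p)))"
    unfolding TH_eq[OF x] n_def by simp
  have "aa p (gh.Rt a p) = 0" unfolding aa_def z by (simp add: R)
  then show "b0 p (gh.Rt a p) = 2 * c * qc (fst p)"
    unfolding b0_eq[OF x] w by (simp add: cmul_linear cdot_linear special_form_cmap(2)[OF x])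
  show "n = - \<i> * of_real (r (fst p)) * (kk o1 (fst p) * m (fst p) a)" by (simp add: n_def nu_def R mult_ac)
qed

text \<open>Orthogonality to the scaling fixes \<open>lam\<close>, orthogonality to the rotation
  about x^0 ties the phase rate to \<alpha>, and orthogonality to the rotations that move x^0 fixes
  \<open>nu\<close>.\<close>

lemma horizontal_equations:
  fixes v :: "'n total"
  assumes p: "p \<in> NP o1" and x: "x = fst p" and Sc: "gh.G p v (gh.Sc p) = 0" and Rt: "\<And>a. gh.G p v (gh.Rt a p) = 0"
  defines "z \<equiv> cdot (cnjv (XX o1 x)) (cmul (NN x) (dXX o1 x (fst v)))"
  shows "lam x (fst v) * qc x = - 2 * Re z"
    "aa p v = 2 * Im z + 2 * Im (eta o1 x (fst v)) * qc x"
    "nu o1 x (fst v) = - \<i> * special_form.h (NN x) (XX o1 x) (bb p v) (cvec (\<lambda>A. dps x A (fst v))) / (2 * of_real (qc x))"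
proof -
  have xN: "fst p \<in> NS o1" and xN': "x \<in> NS o1" and S: "x \<in> S" using p x by auto
  have rp: "r x > 0" by (rule r_pos[OF S])
  note q0 = potential_qc(2)[OF S]
  interpret special_form "NN x" "Ni x" "XX o1 x" by (rule special_form_cmap[OF xN'])
  note Q = special_form_cmap(2)[OF xN']
  note MF = metric_formula[OF p x refl]
  define Z where "Z = cdot (cnjv (XX o1 x)) (cmul (NN x) (ww o1 x (fst v)))"
  have Zz: "Z = z + kap o1 x (fst v) * of_real (qc x)"
    unfolding Z_def z_def ww_eq cmul_linear cdot_linear Q ..
  have cZ: "cdot (ww o1 x (fst v)) (cmul (NN x) (cnjv (XX o1 x))) = Z" "cdot (cnjv (ww o1 x (fst v))) (cmul (NN x) (XX o1 x)) = cnj Z"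
    by (simp_all add: Z_def N_swap[of "ww o1 x (fst v)"] cnj_cdot N_swap[of "XX o1 x"])
  note D = scaling_metric_data[OF xN, folded x]
  have "of_real (- 4 * r x * Re Z + 2 * (qc x * r x) * lam x (fst v)) = complex_of_real 0"
    using MF[of v "gh.Sc p"] unfolding D Sc cZ
    by (simp add: cmul_linear cdot_linear complex_eq_iff)
  then have "r x * (- 4 * Re Z + 2 * qc x * lam x (fst v)) = 0" unfolding of_real_eq_iff by (simp add: algebra_simps)
  then have "- 4 * Re Z + 2 * qc x * lam x (fst v) = 0" using rp unfolding mult_eq_0_iff by linarith
  then show 1: "lam x (fst v) * qc x = - 2 * Re z" unfolding Zz by (simp add: kap_def algebra_simps)
  note R = rotation_metric_data[OF xN, folded x]
  \<comment> \<open>A rotation axis along x^0: the rotation then does not move x^0, and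
    \<open>nu\<close> of it vanishes.\<close>
  obtain a where a: "m x a = 0" "a \<bullet> x0 x = r x" by (rule isotropic_surjective[OF S])
  have n0: "nu o1 x (fst (gh.Rt a p)) = 0" unfolding R(6) a by simp
  have ci: "cdot (ww o1 x (fst v)) (cmul (NN x) (cnjv ((\<i> * of_real c) *s XX o1 x))) = - \<i> * of_real c * Z" for c
    by (simp only: cnjv_simps cmul_linear cdot_linear cZ) simp
  have "of_real (- 4 * r x * Im Z + r x * b0 p v) = complex_of_real 0"
    using MF[of v "gh.Rt a p"] rp q0 unfolding R(1-5) n0 Rt ci a
    by (simp add: cmul_linear cdot_linear cZ complex_eq_iff)
  then have "b0 p v = 4 * Im Z" unfolding of_real_eq_iff using rp by (simp add: algebra_simps)
  then show "aa p v = 2 * Im z + 2 * Im (eta o1 x (fst v)) * qc x"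
    unfolding b0_eq[OF xN, folded x] Z_def[symmetric] unfolding Zz by (simp add: kap_def)
  show "nu o1 x (fst v) = - \<i> * h (bb p v) (cvec (\<lambda>A. dps x A (fst v))) / (2 * of_real (qc x))"
    unfolding Q[symmetric]
  proof (rule rotation_condition[OF _ _ TT_eq[OF xN'] TH_eq[OF xN, folded x]])
    fix n' :: complex
    \<comment> \<open>A rotation axis perpendicular to x^0, chosen so that \<open>nu\<close> of the
      rotation takes the prescribed value; this covers all \<open>n'\<close>.\<close>
    obtain a where a: "m x a = \<i> * n' / (of_real (r x) * kk o1 x)" "a \<bullet> x0 x = 0" by (rule isotropic_surjective[OF S])
    have n': "nu o1 x (fst (gh.Rt a p)) = n'" unfolding R(6) a using rp kk_nz[OF xN'] by simp
    have "- of_real (r x) * (cdot (TT x (fst v)) (cmul (NN x) (- (2 * cnj n') *s XX o1 x - (2 * n') *s cnjv (XX o1 x)))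
      + cdot (TH p v) (cmul (Ni x) ((2 * \<i>) *s cmul (NN x) (cnj n' *s XX o1 x - n' *s cnjv (XX o1 x))))
      - 4 * of_real (qc x) * (nu o1 x (fst v) * cnj n' + cnj (nu o1 x (fst v)) * n')) = 0"
      using MF[of v "gh.Rt a p"] unfolding R(1-5) n' Rt a
      by (simp add: cmul_linear(4) cdot_linear(7,8) algebra_simps)
    then show "cdot (TT x (fst v)) (cmul (NN x) (- (2 * cnj n') *s XX o1 x - (2 * n') *s cnjv (XX o1 x)))
      + cdot (TH p v) (cmul (Ni x) ((2 * \<i>) *s cmul (NN x) (cnj n' *s XX o1 x - n' *s cnjv (XX o1 x))))
      - 4 * cdot (cnjv (XX o1 x)) (cmul (NN x) (XX o1 x)) * (nu o1 x (fst v) * cnj n' + cnj (nu o1 x (fst v)) * n') = 0"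
      using rp unfolding Q by simp
  qed (simp_all add: bb_def)
qed

lemma XX_D: "x \<in> NS o1 \<Longrightarrow> XX o1 x \<in> D"
  unfolding XX_def using D_scale[OF chi_D kk_nz[of x o1]] by auto

lemma F2_XX: "x \<in> NS o1 \<Longrightarrow> F2 F A B (XX o1 x) = f2 x A B"
  unfolding XX_def using F2_hom[OF chi_D kk_nz[of x o1]] by auto

lemma Nform_XX: "x \<in> NS o1 \<Longrightarrow> Nform F (XX o1 x) a b = cdot a (cmul (NN x) b)"
  by (simp add: Nform_def Nmat_def F2_XX cdot_cmul nn_def mult_ac)

end

section \<open>The derivative of R\<close>

context cmap
begin

lemma F3_sym:
  assumes X: "X \<in> D"
  shows "F3 A B C X = F3 A C B X" "F3 A B C X = F3 B A C X"
proof -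
  show "F3 A B C X = F3 A C B X"
    unfolding F2_def F1_def[of "\<lambda>X. dird _ X _"] by (rule dird_commute[OF open_D smooth_on_holomorphic[OF open_D hol1] X])
  show "F3 A B C X = F3 B A C X"
    unfolding F1_def[of "F2 F _ _"] by (rule dird_cong_open[OF open_D X F2_sym])
qed

text \<open>N can be treated as constant: F_AB has degree zero, so by Euler's relation and the
  symmetry of the third derivatives the derivative of N, contracted with X and its conjugate,
  vanishes.\<close>

lemma has_derivative_R_FS:
  assumes X: "X \<in> D" and N: "N = (\<chi> A B. Im (F2 F A B X))"
  shows "(R_FS F has_derivative (\<lambda>d. - 2 * (cdot (cnjv d) (cmul N X) + cdot (cnjv X) (cmul N d)))) (at X)"
proof -
  define G where "G d A B = complex_of_real (Im (\<Sum>C\<in>UNIV. F3 A B C X * d $ C))" for d A B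
  have nth: "((\<lambda>Y. Y $ A) has_derivative (\<lambda>d. d $ A)) (at X)" for A by (rule has_derivative_nth)
  have f2: "((\<lambda>Y. complex_of_real (Im (F2 F A B Y))) has_derivative (\<lambda>d. G d A B)) (at X)" for A B
    unfolding G_def
    by (intro has_derivative_of_real bounded_linear.has_derivative[OF bounded_linear_Im] holomorphic_vec_on_has_derivative[OF hol2 X])
  have R: "R_FS F = (\<lambda>Y. - 2 * (\<Sum>A\<in>UNIV. \<Sum>B\<in>UNIV. cnj (Y $ A) * of_real (Im (F2 F A B Y)) * Y $ B))"
    by (simp add: R_FS_def[abs_def] Nform_def Nmat_def cnjv_def)
  have e: "(\<Sum>C\<in>UNIV. F3 A B C X * X $ C) = 0" for A B by (rule euler2[OF X])
  have e1: "(\<Sum>B\<in>UNIV. F3 A B C X * X $ B) = 0" for A C using e[of A C] F3_sym(1)[OF X, of A] by simp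
  have e2: "(\<Sum>A\<in>UNIV. F3 A B C X * X $ A) = 0" for B C using e1[of B C] F3_sym(2)[OF X, of _ B C] by simp
  have zero: "(\<Sum>A\<in>UNIV. \<Sum>B\<in>UNIV. cnj (X $ A) * G d A B * X $ B) = 0" for d
  proof -
    \<comment> \<open>Written as a difference of conjugates, the derivative of N splits into a part
      annihilated by the contraction with X in the index \<open>B\<close> and a part annihilated by
      the contraction with the conjugate of X in the index \<open>A\<close>.\<close>
    have h: "G d A B = ((\<Sum>C\<in>UNIV. F3 A B C X * d $ C) - cnj (\<Sum>C\<in>UNIV. F3 A B C X * d $ C)) / (2 * \<i>)" for A B
      by (simp add: G_def complex_eq_iff del: Im_sum Re_sum cnj_sum)
    have 1: "(\<Sum>B\<in>UNIV. (\<Sum>C\<in>UNIV. F3 A B C X * d $ C) * X $ B) = 0" for A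
    proof -
      have "(\<Sum>B\<in>UNIV. (\<Sum>C\<in>UNIV. F3 A B C X * d $ C) * X $ B) = (\<Sum>C\<in>UNIV. (\<Sum>B\<in>UNIV. F3 A B C X * X $ B) * d $ C)"
        unfolding sum_distrib_right by (subst sum.swap) (simp add: mult_ac)
      then show ?thesis by (simp add: e1)
    qed
    have 2: "(\<Sum>A\<in>UNIV. cnj (X $ A) * cnj (\<Sum>C\<in>UNIV. F3 A B C X * d $ C)) = 0" for B
    proof -
      have "(\<Sum>A\<in>UNIV. X $ A * (\<Sum>C\<in>UNIV. F3 A B C X * d $ C)) = (\<Sum>C\<in>UNIV. (\<Sum>A\<in>UNIV. F3 A B C X * X $ A) * d $ C)"
        unfolding sum_distrib_left sum_distrib_right by (subst sum.swap) (simp add: mult_ac)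
      then have "cnj (\<Sum>A\<in>UNIV. X $ A * (\<Sum>C\<in>UNIV. F3 A B C X * d $ C)) = 0" by (simp add: e2)
      then show ?thesis by simp
    qed
    have "(\<Sum>A\<in>UNIV. \<Sum>B\<in>UNIV. cnj (X $ A) * G d A B * X $ B) =
      ((\<Sum>A\<in>UNIV. cnj (X $ A) * (\<Sum>B\<in>UNIV. (\<Sum>C\<in>UNIV. F3 A B C X * d $ C) * X $ B))
       - (\<Sum>A\<in>UNIV. \<Sum>B\<in>UNIV. cnj (X $ A) * cnj (\<Sum>C\<in>UNIV. F3 A B C X * d $ C) * X $ B)) / (2 * \<i>)"
      unfolding sum_distrib_left[of "cnj _"] sum_subtractf[symmetric] sum_divide_distrib h
      by (intro sum.cong refl) (simp add: field_simps)
    also have "(\<Sum>A\<in>UNIV. \<Sum>B\<in>UNIV. cnj (X $ A) * cnj (\<Sum>C\<in>UNIV. F3 A B C X * d $ C) * X $ B) =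
      (\<Sum>B\<in>UNIV. (\<Sum>A\<in>UNIV. cnj (X $ A) * cnj (\<Sum>C\<in>UNIV. F3 A B C X * d $ C)) * X $ B)"
      unfolding sum_distrib_right[of _ _ "X $ _"] by (rule sum.swap)
    finally show ?thesis unfolding 1 2 by simp
  qed
  have "(R_FS F has_derivative (\<lambda>d. - 2 * (\<Sum>A\<in>UNIV. \<Sum>B\<in>UNIV. (cnj (X $ A) * of_real (Im (F2 F A B X))) * d $ B
      + (cnj (X $ A) * G d A B + cnj (d $ A) * of_real (Im (F2 F A B X))) * X $ B))) (at X)"
    unfolding R
    by (intro has_derivative_mult_right has_derivative_sum has_derivative_mult f2 nth
      bounded_linear.has_derivative[OF bounded_linear_cnj nth])
  moreover have "(\<Sum>A\<in>UNIV. \<Sum>B\<in>UNIV. (cnj (X $ A) * of_real (Im (F2 F A B X))) * d $ B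
      + (cnj (X $ A) * G d A B + cnj (d $ A) * of_real (Im (F2 F A B X))) * X $ B)
    = (cdot (cnjv d) (cmul N X) + cdot (cnjv X) (cmul N d)) + (\<Sum>A\<in>UNIV. \<Sum>B\<in>UNIV. cnj (X $ A) * G d A B * X $ B)" for d
    unfolding cdot_cmul N sum.distrib[symmetric] by (intro sum.cong refl) (simp add: cnjv_def algebra_simps)
  ultimately show ?thesis unfolding zero by simp
qed

end


section \<open>Comparison with the Ferrara-Sabharwal metric\<close>

context cmap_cone
begin

lemma tau_XX:
  assumes x: "x \<in> NS o1"
  shows "tau F (XX o1 x) A B = f2 x A B - 2 * \<i> * (cmul (NN x) (cnjv (XX o1 x)) $ A * cmul (NN x) (cnjv (XX o1 x)) $ B)
     / cdot (cnjv (XX o1 x)) (cmul (NN x) (cnjv (XX o1 x)))"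
  unfolding tau_def F2_XX[OF x] Nform_XX[OF x] Nmat_def by (simp add: cmul_def nn_def cnjv_def)

lemma tau_mult:
  assumes x: "x \<in> NS o1"
  shows "(\<chi> A. of_real (s A) + (\<Sum>C\<in>UNIV. tau F (XX o1 x) A C * of_real (t C))) =
    cvec (\<lambda>A. s A + (\<Sum>C\<in>UNIV. Re (f2 x A C) * t C)) + \<i> *s cmul (NN x) (cvec t)
     - (2 * \<i> * cdot (cmul (NN x) (cnjv (XX o1 x))) (cvec t) / cdot (cnjv (XX o1 x)) (cmul (NN x) (cnjv (XX o1 x)))) *s cmul (NN x) (cnjv (XX o1 x))"
proof -
  define y where "y = cmul (NN x) (cnjv (XX o1 x))"
  define P where "P = cdot (cnjv (XX o1 x)) y"
  have 1: "f2 x A C = of_real (Re (f2 x A C)) + \<i> * of_real (nn x A C)" for A C by (simp add: nn_def complex_eq_iff)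
  have "(\<Sum>C\<in>UNIV. tau F (XX o1 x) A C * of_real (t C)) = (\<Sum>C\<in>UNIV. of_real (Re (f2 x A C) * t C)) + \<i> * (\<Sum>C\<in>UNIV. of_real (nn x A C) * of_real (t C))
     - (2 * \<i> * (\<Sum>C\<in>UNIV. y $ C * of_real (t C)) / P) * y $ A" for A
    unfolding tau_XX[OF x] y_def[symmetric] P_def[symmetric] sum_distrib_left sum_distrib_right sum_divide_distrib sum.distrib[symmetric] sum_subtractf[symmetric]
    by (intro sum.cong refl, subst 1) (simp add: algebra_simps)
  then show ?thesis
    unfolding y_def[symmetric] P_def[symmetric] by (simp add: vec_eq_iff cvec_def cmul_def cdot_def)
qed

lemma g_T_eq:
  assumes p: "p \<in> NP o1" and x: "x = fst p" and P: "cdot (cnjv (XX o1 x)) (cmul (NN x) (cnjv (XX o1 x))) \<noteq> 0"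
  defines "t \<equiv> \<lambda>v. cvec (\<lambda>A. dps x A (fst v))" and "hh \<equiv> special_form.h (NN x) (XX o1 x)"
  shows "g_T F (proj o1 p) (dproj o1 p v) (dproj o1 p v') = cdot (t v) (cmul (NN x) (t v')) + cdot (bb p v) (cmul (Ni x) (bb p v'))
    - (hh (bb p v) (t v) * cnj (hh (bb p v') (t v')) + cnj (hh (bb p v) (t v)) * hh (bb p v') (t v')) / of_real (qc x)"
proof -
  have xN: "x \<in> NS o1" and S: "x \<in> S" using p x by auto
  interpret special_form "NN x" "Ni x" "XX o1 x" by (rule special_form_cmap[OF xN])
  note Q = special_form_cmap(2)[OF xN]
  define X where "X = XX o1 x"
  define I :: "real^'n^'n" where "I = (\<chi> A B. Im (tau F X A B))"
  define K :: "real^'n^'n" where "K = (\<chi> A B. Ni x $ A $ B - 2 * Re (X $ A * cnj (X $ B)) / qc x)"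
  \<comment> \<open>Im \<tau> is N minus a correction of rank at most two, the form that
    \<open>tau_inverse\<close> inverts.\<close>
  have mI: "cmul I c = cmul (NN x) c - (cdot y c / Pb) *s y - (cdot (cnjv y) c / P) *s cnjv y" for c
  proof -
    have "complex_of_real (Im (tau F X A B)) = of_real (nn x A B) - y $ A * y $ B / Pb - cnjv y $ A * cnjv y $ B / P" for A B
    proof -
      define w where "w = y $ A * y $ B / Pb"
      have "cnj Pb = P" by (simp add: cnj_cdot)
      then have "cnjv y $ A * cnjv y $ B / P = cnj w" unfolding w_def complex_cnj_divide complex_cnj_mult by (simp add: cnjv_def)
      moreover have "Im (tau F X A B) = nn x A B - 2 * Re w" unfolding X_def tau_XX[OF xN] w_def y_def nn_def by (simp add: mult.assoc times_divide_eq_right[symmetric] del: times_divide_eq_right)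
      moreover have "complex_of_real (2 * Re w) = w + cnj w" by (simp add: complex_eq_iff)
      ultimately show ?thesis unfolding w_def[symmetric] by simp
    qed
    then show ?thesis by (intro cmul_rank_two) (simp add: I_def)
  qed
  have mK: "cmul K c = Kform c" for c
  proof -
    have "complex_of_real (2 * Re (X $ A * cnj (X $ B)) / qc x) = X $ A * cnjv X $ B / Q + cnjv X $ A * X $ B / Q" for A B
      unfolding Q by (simp add: complex_eq_iff cnjv_def add_divide_distrib[symmetric])
    then have "cmul K c = cmul (Ni x) c - (cdot (cnjv X) c / Q) *s X - (cdot X c / Q) *s cnjv X"
      by (intro cmul_rank_two) (simp add: K_def)
    then show ?thesis by (simp add: Kform_def X_def vec_eq_iff distrib_left)
  qed
  have inv: "matrix_inv I = K"
    by (rule matrix_inv_cmulI) (rule tau_inverse[OF P mI mK])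
  define z where "z v = bb p v + \<i> *s cmul (NN x) (t v) - (2 * \<i> * cdot y (t v) / Pb) *s y" for v
  have z: "of_real (fst (dproj o1 p v) $ Some A) + (\<Sum>C\<in>UNIV. tau F X A C * of_real (fst (snd (dproj o1 p v)) $ C)) = z v $ A" for A v
  proof -
    have "(\<chi> A. of_real (dPsi p v $ Some A) + (\<Sum>C\<in>UNIV. tau F (XX o1 x) A C * of_real (dps x C (fst v)))) = z v"
      unfolding tau_mult[OF xN] z_def bb_def x[symmetric] t_def y_def by simp
    from arg_cong[OF this, of "\<lambda>w. w $ A"] show ?thesis by (simp add: dproj_def X_def x)
  qed
  have cz: "of_real (fst (dproj o1 p v) $ Some A) + (\<Sum>C\<in>UNIV. cnj (tau F X A C) * of_real (fst (snd (dproj o1 p v)) $ C)) = cnj (z v $ A)" for A v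
    unfolding z[symmetric] by simp
  have snd: "snd (snd (proj o1 p)) = X" by (simp add: proj_def X_def x)
  have gT: "g_T F (proj o1 p) v1 v2 = 1/2 * (\<Sum>A\<in>UNIV. \<Sum>B\<in>UNIV. of_real (matrix_inv I $ A $ B) *
      sprod (\<lambda>t. of_real (fst t $ Some A) + (\<Sum>C\<in>UNIV. tau F X A C * of_real (fst (snd t) $ C)))
            (\<lambda>t. of_real (fst t $ Some B) + (\<Sum>D\<in>UNIV. cnj (tau F X B D) * of_real (fst (snd t) $ D))) v1 v2)" for v1 v2
    by (simp add: g_T_def I_def proj_def X_def x)
  have "g_T F (proj o1 p) (dproj o1 p v) (dproj o1 p v') = 1/2 * (\<Sum>A\<in>UNIV. \<Sum>B\<in>UNIV. of_real (K $ A $ B) * (z v $ A * cnj (z v' $ B) + z v' $ A * cnj (z v $ B)))"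
    unfolding gT inv sprod_def z cz by (simp only: mult.commute)
  also have "\<dots> = 1/2 * (cdot (z v) (Kform (cnjv (z v'))) + cdot (z v') (Kform (cnjv (z v))))"
    unfolding mK[symmetric] cdot_cmul sum.distrib[symmetric] by (simp add: cnjv_def distrib_left mult_ac)
  also have "\<dots> = cdot (t v) (cmul (NN x) (t v')) + cdot (bb p v) (cmul (Ni x) (bb p v'))
    - (hh (bb p v) (t v) * cnj (hh (bb p v') (t v')) + cnj (hh (bb p v) (t v)) * hh (bb p v') (t v')) / of_real (qc x)"
    unfolding hh_def Q[symmetric]
    by (subst tau_form[OF P _ _ _ _ z_def z_def]) (simp_all add: t_def bb_def)
  finally show ?thesis .
qed

text \<open>The block form of the metric separates. The part with \<open>ww\<close>,
  \<open>lam\<close> and \<open>b0\<close> becomes \<open>g_PSK\<close> and the squares of dR and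
  \<alpha> by \<open>base_part\<close>; the part with \<open>TT\<close>, \<open>TH\<close> and
  \<open>nu\<close> becomes \<open>g_T\<close> by \<open>fibre_part\<close>.\<close>

lemma ferrara_sabharwal_horizontal:
  assumes p: "p \<in> NP o1" and x: "x = fst p" and P: "cdot (cnjv (XX o1 x)) (cmul (NN x) (cnjv (XX o1 x))) \<noteq> 0"
    and v: "gh.G p v (gh.Sc p) = 0" "\<And>a. gh.G p v (gh.Rt a p) = 0"
    and v': "gh.G p v' (gh.Sc p) = 0" "\<And>a. gh.G p v' (gh.Rt a p) = 0"
  shows "of_real (gh.G p v v') = - 2 * of_real (r x * qc x) * ferrara_sabharwal F (proj o1 p) (dproj o1 p v) (dproj o1 p v')"
proof -
  have xN: "x \<in> NS o1" and xN': "fst p \<in> NS o1" and S: "x \<in> S" using p x by auto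
  have rp: "r x > 0" by (rule r_pos[OF S])
  note q0 = potential_qc(2)[OF S]
  interpret special_form "NN x" "Ni x" "XX o1 x" by (rule special_form_cmap[OF xN])
  note Q = special_form_cmap(2)[OF xN]
  note E = horizontal_equations[OF p x v] and E' = horizontal_equations[OF p x v']
  let ?t = "\<lambda>v. cvec (\<lambda>A. dps x A (fst v))"
  let ?d = "dXX o1 x (fst v)" and ?d' = "dXX o1 x (fst v')"
  have F: "cdot (TT x (fst v)) (cmul (NN x) (TT x (fst v'))) + cdot (TH p v) (cmul (Ni x) (TH p v'))
      - 4 * Q * (nu o1 x (fst v) * cnj (nu o1 x (fst v')) + cnj (nu o1 x (fst v)) * nu o1 x (fst v')) = g_T F (proj o1 p) (dproj o1 p v) (dproj o1 p v')"
    unfolding g_T_eq[OF p x P] Q[symmetric]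
    by (rule fibre_part[OF _ _ _ _ _ _ TT_eq[OF xN] TT_eq[OF xN] TH_eq[OF xN', folded x] TH_eq[OF xN', folded x]])
      (simp_all add: bb_def E(3) E'(3) Q)
  note B = base_part[OF Q less_imp_neq[OF rp, symmetric], OF ww_eq[of o1 x "fst v", unfolded kap_def] ww_eq[of o1 x "fst v'", unfolded kap_def] E(1) E'(1) E(2) E'(2)]
  have "of_real (gh.G p v v') = (- of_real (r x) * (2 * (cdot (ww o1 x (fst v)) (cmul (NN x) (cnjv (ww o1 x (fst v')))) + cdot (cnjv (ww o1 x (fst v))) (cmul (NN x) (ww o1 x (fst v')))))
       + 2 * of_real (qc x * r x) * of_real (lam x (fst v) * lam x (fst v'))
       + of_real (r x / (2 * qc x)) * of_real (b0 p v * b0 p v'))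
     - of_real (r x) * (cdot (TT x (fst v)) (cmul (NN x) (TT x (fst v'))) + cdot (TH p v) (cmul (Ni x) (TH p v'))
      - 4 * Q * (nu o1 x (fst v) * cnj (nu o1 x (fst v')) + cnj (nu o1 x (fst v)) * nu o1 x (fst v')))"
    unfolding metric_formula[OF p x refl] Q by (simp add: algebra_simps)
  also have "\<dots> = - 2 * of_real (r x * qc x) * ((Q * (cdot (cnjv ?d) (cmul (NN x) ?d') + cdot (cnjv ?d') (cmul (NN x) ?d))
       - (cdot (cnjv ?d) (cmul (NN x) (XX o1 x)) * cdot (cnjv (XX o1 x)) (cmul (NN x) ?d') + cdot (cnjv ?d') (cmul (NN x) (XX o1 x)) * cdot (cnjv (XX o1 x)) (cmul (NN x) ?d))) / Q^2
       - 2 * of_real (Re (cdot (cnjv (XX o1 x)) (cmul (NN x) ?d)) * Re (cdot (cnjv (XX o1 x)) (cmul (NN x) ?d'))) / Q^2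
       - of_real (aa p v * aa p v') / (2 * Q^2))
     - of_real (r x) * g_T F (proj o1 p) (dproj o1 p v) (dproj o1 p v')"
    unfolding F b0_eq[OF xN', folded x] B ..
  also have "\<dots> = - 2 * of_real (r x * qc x) * ferrara_sabharwal F (proj o1 p) (dproj o1 p v) (dproj o1 p v')"
  proof -
    have R: "R_FS F (XX o1 x) = - 2 * Q" by (simp add: R_FS_def Nform_XX[OF xN])
    have N: "NN x = (\<chi> A B. Im (F2 F A B (XX o1 x)))" by (simp add: NN_def F2_XX[OF xN] nn_def)
    have dR: "dR_FS F (proj o1 p) (dproj o1 p u) = - 4 * of_real (Re (cdot (cnjv (XX o1 x)) (cmul (NN x) (dXX o1 x (fst u)))))" for u
    proof -
      have "dR_FS F (proj o1 p) (dproj o1 p u) = - 2 * (cdot (cnjv (dXX o1 x (fst u))) (cmul (NN x) (XX o1 x)) + cdot (cnjv (XX o1 x)) (cmul (NN x) (dXX o1 x (fst u))))"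
        unfolding dR_FS_def proj_def dproj_def by (simp add: dird_eq[OF has_derivative_R_FS[OF XX_D[OF xN] N]] x[symmetric])
      moreover have "cdot (cnjv (dXX o1 x (fst u))) (cmul (NN x) (XX o1 x)) = cnj (cdot (cnjv (XX o1 x)) (cmul (NN x) (dXX o1 x (fst u))))"
        by (simp add: cnj_cdot N_swap[of "XX o1 x"])
      ultimately show ?thesis by (simp add: complex_eq_iff)
    qed
    have al: "alpha_FS (proj o1 p) (dproj o1 p u) = of_real (aa p u)" for u
      unfolding alpha_FS_def proj_def dproj_def aa_def by simp
    have psk: "g_PSK F (proj o1 p) (dproj o1 p v) (dproj o1 p v') = (Q * (cdot (cnjv ?d) (cmul (NN x) ?d') + cdot (cnjv ?d') (cmul (NN x) ?d))
       - (cdot (cnjv ?d) (cmul (NN x) (XX o1 x)) * cdot (cnjv (XX o1 x)) (cmul (NN x) ?d') + cdot (cnjv ?d') (cmul (NN x) (XX o1 x)) * cdot (cnjv (XX o1 x)) (cmul (NN x) ?d))) / Q^2"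
      unfolding cdot_cmul[of "cnjv ?d" "NN x" ?d'] cdot_cmul[of "cnjv ?d'" "NN x" ?d] sum.distrib[symmetric]
      by (simp add: g_PSK_def proj_def dproj_def Nform_XX[OF xN] Nmat_def F2_XX[OF xN] nn_def sprod_def x[symmetric] cnjv_def distrib_left mult_ac)
    have s: "snd (snd (proj o1 p)) = XX o1 x" by (simp add: proj_def x)
    show ?thesis unfolding ferrara_sabharwal_def Let_def s R sprod_def dR al psk Q using q0 rp
      by (simp add: field_simps power2_eq_square)
  qed
  finally show ?thesis .
qed

section \<open>Splitting off the orbits, and the metric of the base\<close>

text \<open>On the generators of an orbit the metric is \<open>k\<close> times the Euclidean inner
  product of their parameters, and \<open>k\<close> is half the potential. So the orbit directions
  are nondegenerate even when the metric is indefinite.\<close>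

lemma orbit_metric:
  assumes p: "fst p \<in> S"
  defines "k \<equiv> fst p \<bullet> blockmul (gh.H (fst p)) (fst p)"
  shows "gh.G p (gh.Sc p) (gh.Sc p) = k" "gh.G p (gh.Sc p) (gh.Rt a p) = 0" "gh.G p (gh.Rt a p) (gh.Sc p) = 0"
    "gh.G p (gh.Rt a p) (gh.Rt b p) = (a \<bullet> b) * k" "k \<noteq> 0"
proof -
  let ?x = "fst p"
  have sym: "gh.H ?x $ I $ J = gh.H ?x $ J $ I" for I J
    using arg_cong[OF gh.transpose_H[OF p], of "\<lambda>M. M $ J $ I"] by (simp add: transpose_def)
  have B: "blockmul (gh.H ?x) u \<bullet> w = (\<Sum>I\<in>UNIV. \<Sum>J\<in>UNIV. gh.H ?x $ I $ J * (u $ J \<bullet> w $ I))" for u w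
    by (simp add: blockmul_def inner_vec_def[where 'a="real^3"] inner_sum_left)
  show "k \<noteq> 0" using potential_nz[OF p] by (simp add: k_def gh.hk_potential_blockmul)
  show "gh.G p (gh.Sc p) (gh.Sc p) = k" by (simp add: gh.gh_metric_eq[OF p] k_def inner_commute)
  have c0: "blockmul (gh.H ?x) ?x \<bullet> crossv a ?x = 0"
    unfolding B by (rule antisymmetric_double_sum) (simp add: sym[of _ i for i] crossv_def cross3_simps)
  then show "gh.G p (gh.Sc p) (gh.Rt a p) = 0" by (simp add: gh.gh_metric_eq[OF p])
  show "gh.G p (gh.Rt a p) (gh.Sc p) = 0" using c0
    by (simp add: gh.gh_metric_eq[OF p] gh.blockH_inner[OF p, of "crossv a ?x"] inner_commute[of "crossv a ?x"])
  have "(gh.V ?x *v gh.mu a ?x) \<bullet> gh.mu b ?x = (\<Sum>I\<in>UNIV. \<Sum>J\<in>UNIV. gh.H ?x $ I $ J * ((?x $ I \<bullet> a) * (?x $ J \<bullet> b)))"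
    unfolding gh.mu_def gh.VH[OF p] by (simp add: inner_vec_def matrix_vector_mult_def slice_def sum_distrib_left mult_ac)
  moreover have "(a \<bullet> b) * k = (\<Sum>I\<in>UNIV. \<Sum>J\<in>UNIV. gh.H ?x $ I $ J * ((a \<bullet> b) * (?x $ J \<bullet> ?x $ I)))"
    unfolding k_def inner_commute[of ?x] B sum_distrib_left by (simp add: mult_ac)
  moreover have "cross3 a u \<bullet> cross3 b w + (w \<bullet> a) * (u \<bullet> b) = (a \<bullet> b) * (u \<bullet> w)" for u w
    by (simp add: cross3_simps)
  ultimately show "gh.G p (gh.Rt a p) (gh.Rt b p) = (a \<bullet> b) * k"
    by (simp add: gh.gh_metric_eq[OF p] B crossv_def sum.distrib[symmetric] distrib_left[symmetric])
qed

text \<open>For an indefinite metric a vector need not split along a subspace and its orthogonal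
  space. Here the splitting is explicit, with \<open>orbit_metric\<close> allowing division by
  \<open>k\<close>.\<close>

lemma horizontal_decomposition:
  assumes p: "p \<in> NP o1"
  obtains v a where "u = v + a" "v \<in> orbit_complement L \<phi> gh.Sc gh.Rt p" "a \<in> orbit_tangent gh.Sc gh.Rt p"
proof -
  have S: "fst p \<in> S" and Mt: "p \<in> gh.Mt" using p by auto
  define k where "k = fst p \<bullet> blockmul (gh.H (fst p)) (fst p)"
  note O = orbit_metric[OF S, folded k_def]
  have l: "linear (\<lambda>w. gh.G p w z)" and r: "linear (gh.G p z)" for z
    using gh.bilinear_gh_metric[OF Mt] unfolding bilinear_def by blast+
  have lR: "linear (\<lambda>a. gh.Rt a p)" by (rule gh.linear_Rt[OF Mt])
  have lGR: "linear (\<lambda>a. gh.G p u (gh.Rt a p))" using linear_compose[OF lR r] by (simp add: o_def)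
  define c where "c = (\<chi> i. gh.G p u (gh.Rt (axis i 1) p) / k)"
  have c: "c \<bullet> a = gh.G p u (gh.Rt a p) / k" for a
  proof -
    have "gh.G p u (gh.Rt a p) = (\<Sum>i\<in>UNIV. a $ i * gh.G p u (gh.Rt (axis i 1) p))"
      by (subst vec3_expand[of a]) (simp add: linear_add[OF lGR] linear_scale[OF lGR] sum_3)
    then show ?thesis by (simp add: c_def inner_vec_def sum_divide_distrib mult.commute)
  qed
  define a where "a = (gh.G p u (gh.Sc p) / k) *\<^sub>R gh.Sc p + gh.Rt c p"
  have "a \<in> orbit_tangent gh.Sc gh.Rt p" unfolding a_def orbit_tangent_def
    by (rule span_add[OF span_scale[OF span_base] span_base]) auto
  moreover have "u - a \<in> orbit_complement L \<phi> gh.Sc gh.Rt p"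
  proof -
    have "gh.G p (u - a) (gh.Sc p) = 0" "gh.G p (u - a) (gh.Rt b p) = 0" for b
      using O(5) by (simp_all add: a_def linear_diff[OF l] linear_add[OF l] linear_scale[OF l] O(1-4) c)
    then have "insert (gh.Sc p) (range (\<lambda>a. gh.Rt a p)) \<subseteq> {w. gh.G p (u - a) w = 0}" by auto
    then have "orbit_tangent gh.Sc gh.Rt p \<subseteq> {w. gh.G p (u - a) w = 0}"
      unfolding orbit_tangent_def by (rule span_minimal) (rule linear_subspace_kernel[OF r])
    then show ?thesis by (auto simp: orbit_complement_def)
  qed
  ultimately show ?thesis using that[of "u - a" a] by simp
qed

lemma tau_defined_part_NP: "p \<in> tau_defined_part o1 F S \<Longrightarrow> p \<in> NP o1 \<and>
    cdot (cnjv (XX o1 (fst p))) (cmul (NN (fst p)) (cnjv (XX o1 (fst p)))) \<noteq> 0"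
  unfolding tau_defined_part_def noncollinear_part_eq
  by (auto simp: Let_def inhomogeneous_cmap Nform_XX)

text \<open>The origin of the 2 in 2 s g: the metric is -2 r Q times the Ferrara-Sabharwal form, the
  potential is -4 r Q, so their quotient is one half of that form.\<close>

lemma complement_eq:
  assumes p: "p \<in> NP o1" and P: "cdot (cnjv (XX o1 (fst p))) (cmul (NN (fst p)) (cnjv (XX o1 (fst p)))) \<noteq> 0"
    and v: "v \<in> orbit_complement L \<phi> gh.Sc gh.Rt p" and w: "w \<in> orbit_complement L \<phi> gh.Sc gh.Rt p"
  shows "complex_of_real (2 * (gh.G p v w / (1/2 * gh.G p (2 *\<^sub>R gh.Sc p) (2 *\<^sub>R gh.Sc p)))) =
    ferrara_sabharwal F (proj o1 p) (dproj o1 p v) (dproj o1 p w)"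
proof -
  have S: "fst p \<in> S" using p by auto
  have h: "gh.G p v (gh.Sc p) = 0" "gh.G p v (gh.Rt a p) = 0" if "v \<in> orbit_complement L \<phi> gh.Sc gh.Rt p" for v a
    using that by (auto simp: orbit_complement_def orbit_tangent_def span_base)
  have nz: "complex_of_real (r (fst p) * qc (fst p)) \<noteq> 0" using r_pos[OF S] potential_qc(2)[OF S] by auto
  have "complex_of_real (2 * (gh.G p v w / (1/2 * gh.G p (2 *\<^sub>R gh.Sc p) (2 *\<^sub>R gh.Sc p)))) =
    of_real (gh.G p v w) / (- 2 * of_real (r (fst p) * qc (fst p)))"
    unfolding gh.hk_potential_eq[OF S] potential_qc(1)[OF S] using r_pos[OF S] potential_qc(2)[OF S] by (simp add: field_simps)
  also have "\<dots> = ferrara_sabharwal F (proj o1 p) (dproj o1 p v) (dproj o1 p w)"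
    unfolding ferrara_sabharwal_horizontal[OF p refl P h(1)[OF v] h(2)[OF v] h(1)[OF w] h(2)[OF w]] using nz by simp
  finally show ?thesis .
qed

text \<open>Every tangent vector of the base is the image of a vector orthogonal to the orbit, and
  orbit directions project to zero. So the defining condition of \<open>g\<close> tests it on all
  pairs of base vectors, and only there.\<close>

lemma swann_base_metric_iff:
  assumes s: "s \<noteq> 0"
  shows "swann_base_metric L \<phi> gh.Sc gh.Rt (tau_defined_part o1 F S) (base_proj o1 Psi) s g \<longleftrightarrow>
    (\<forall>p\<in>tau_defined_part o1 F S. \<forall>v\<in>base_tangent o1. \<forall>w\<in>base_tangent o1.
       complex_of_real (2 * s * g (base_proj o1 Psi p) v w) = ferrara_sabharwal F (base_proj o1 Psi p) v w)"
  unfolding swann_base_metric_def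
proof (intro iffI ballI)
  fix p v w assume H: "\<forall>p\<in>tau_defined_part o1 F S. \<forall>v\<in>orbit_complement L \<phi> gh.Sc gh.Rt p. \<forall>w\<in>orbit_complement L \<phi> gh.Sc gh.Rt p.
        \<forall>a\<in>orbit_tangent gh.Sc gh.Rt p. \<forall>b\<in>orbit_tangent gh.Sc gh.Rt p.
        s * g (base_proj o1 Psi p) (dird (base_proj o1 Psi) p (v + a)) (dird (base_proj o1 Psi) p (w + b)) =
        gh.G p v w / (1/2 * gh.G p (2 *\<^sub>R gh.Sc p) (2 *\<^sub>R gh.Sc p))"
    and pt: "p \<in> tau_defined_part o1 F S" and v: "v \<in> base_tangent o1" and w: "w \<in> base_tangent o1"
  note p = conjunct1[OF tau_defined_part_NP[OF pt]] and P = conjunct2[OF tau_defined_part_NP[OF pt]]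
  have lift: "\<exists>u\<in>orbit_complement L \<phi> gh.Sc gh.Rt p. dproj o1 p u = t" if t: "t \<in> base_tangent o1" for t
  proof -
    obtain u where u: "dproj o1 p u = t" using t unfolding range_dproj[OF p, symmetric] by blast
    obtain v a where "u = v + a" "v \<in> orbit_complement L \<phi> gh.Sc gh.Rt p" "a \<in> orbit_tangent gh.Sc gh.Rt p"
      by (rule horizontal_decomposition[OF p])
    then show ?thesis using u dproj_orbit_tangent[OF p] by (auto simp: linear_add[OF linear_dproj[OF p]])
  qed
  obtain v' w' where v': "v' \<in> orbit_complement L \<phi> gh.Sc gh.Rt p" "dproj o1 p v' = v"
    and w': "w' \<in> orbit_complement L \<phi> gh.Sc gh.Rt p" "dproj o1 p w' = w" using lift[OF v] lift[OF w] by blast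
  have z: "0 \<in> orbit_tangent gh.Sc gh.Rt p" unfolding orbit_tangent_def by (rule span_zero)
  have "s * g (base_proj o1 Psi p) v w = gh.G p v' w' / (1/2 * gh.G p (2 *\<^sub>R gh.Sc p) (2 *\<^sub>R gh.Sc p))"
    using H[rule_format, OF pt v'(1) w'(1) z z] by (simp add: dird_base_proj[OF p] v' w')
  then have "2 * s * g (base_proj o1 Psi p) v w = 2 * (gh.G p v' w' / (1/2 * gh.G p (2 *\<^sub>R gh.Sc p) (2 *\<^sub>R gh.Sc p)))" by simp
  then show "complex_of_real (2 * s * g (base_proj o1 Psi p) v w) = ferrara_sabharwal F (base_proj o1 Psi p) v w"
    unfolding complement_eq[OF p P v'(1) w'(1), unfolded v' w', symmetric] base_proj_eq[OF p] by (simp only:)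
next
  fix p v w a b
  assume H: "\<forall>p\<in>tau_defined_part o1 F S. \<forall>v\<in>base_tangent o1. \<forall>w\<in>base_tangent o1.
       complex_of_real (2 * s * g (base_proj o1 Psi p) v w) = ferrara_sabharwal F (base_proj o1 Psi p) v w"
    and pt: "p \<in> tau_defined_part o1 F S" and v: "v \<in> orbit_complement L \<phi> gh.Sc gh.Rt p" and w: "w \<in> orbit_complement L \<phi> gh.Sc gh.Rt p"
    and a: "a \<in> orbit_tangent gh.Sc gh.Rt p" and b: "b \<in> orbit_tangent gh.Sc gh.Rt p"
  note p = conjunct1[OF tau_defined_part_NP[OF pt]] and P = conjunct2[OF tau_defined_part_NP[OF pt]]
  have bt: "dproj o1 p u \<in> base_tangent o1" for u using range_dproj[OF p] by blast
  have "complex_of_real (2 * s * g (base_proj o1 Psi p) (dproj o1 p v) (dproj o1 p w)) =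
    complex_of_real (2 * (gh.G p v w / (1/2 * gh.G p (2 *\<^sub>R gh.Sc p) (2 *\<^sub>R gh.Sc p))))"
    unfolding complement_eq[OF p P v w] using H pt bt unfolding base_proj_eq[OF p, symmetric] by blast
  then have "2 * s * g (base_proj o1 Psi p) (dproj o1 p v) (dproj o1 p w) = 2 * (gh.G p v w / (1/2 * gh.G p (2 *\<^sub>R gh.Sc p) (2 *\<^sub>R gh.Sc p)))"
    unfolding of_real_eq_iff .
  then have "s * g (base_proj o1 Psi p) (dproj o1 p v) (dproj o1 p w) = gh.G p v w / (1/2 * gh.G p (2 *\<^sub>R gh.Sc p) (2 *\<^sub>R gh.Sc p))"
    by (simp only: mult.assoc mult_cancel_left) simp
  then show "s * g (base_proj o1 Psi p) (dird (base_proj o1 Psi) p (v + a)) (dird (base_proj o1 Psi) p (w + b)) =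
        gh.G p v w / (1/2 * gh.G p (2 *\<^sub>R gh.Sc p) (2 *\<^sub>R gh.Sc p))"
    by (simp add: dird_base_proj[OF p] linear_add[OF linear_dproj[OF p]] dproj_orbit_tangent[OF p] a b)
qed

end

theorem mainTheorem4:
  fixes F :: "complex^'n \<Rightarrow> complex"
    and D :: "(complex^'n) set"
    and S :: "'n::finite config set"
    and \<phi> :: "'n config \<Rightarrow> real^('n option)"
    and o1 :: 'n
  defines "L \<equiv> cmap_L F"
  assumes "open D"
    and "\<forall>X\<in>D. \<forall>c::complex. c \<noteq> 0 \<longrightarrow> c *s X \<in> D"
    and "holomorphic_vec_on F D"
    and "\<forall>X\<in>D. \<forall>c::complex. c \<noteq> 0 \<longrightarrow> F (c *s X) = c^2 * F X"
    and "open S"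
    and "\<forall>x\<in>S. zc x None \<noteq> 0 \<and> chi_coord x \<in> D"
    and "\<forall>x\<in>S. invertible (hessian_xx L x)"
    and "\<forall>x\<in>S. hk_potential L x \<noteq> 0"
    and "smooth_on S \<phi>"
  shows "legendre_equations S L \<and>
    DIM('n total) = 4 * CARD('n) + 4 \<and> dim (base_tangent o1) = 4 * CARD('n) \<and>
    (\<exists>Sc R. hk_cone S L \<phi> Sc R \<and>
       (\<forall>p\<in>S \<times> UNIV.
          1/2 * gh_metric L \<phi> p (2 *\<^sub>R Sc p) (2 *\<^sub>R Sc p) = hk_potential L (fst p)) \<and>
       (\<exists>\<Psi>. invariant_coordinates o1 S Sc R \<Psi> \<and>
          (\<forall>s g. s \<noteq> 0 \<longrightarrow>
             (swann_base_metric L \<phi> Sc R (tau_defined_part o1 F S) (base_proj o1 \<Psi>) s g \<longleftrightarrow>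
              (\<forall>p\<in>tau_defined_part o1 F S. \<forall>v\<in>base_tangent o1. \<forall>w\<in>base_tangent o1.
                 complex_of_real (2 * s * g (base_proj o1 \<Psi> p) v w) =
                 ferrara_sabharwal F (base_proj o1 \<Psi> p) v w)))))"
proof -
  interpret cmap_cone F D S \<phi>
    using assms unfolding L_def by unfold_locales auto
  have "\<forall>p\<in>S \<times> UNIV. 1/2 * gh_metric L \<phi> p (2 *\<^sub>R gh.Sc p) (2 *\<^sub>R gh.Sc p) = hk_potential L (fst p)"
    unfolding L_def using gh.hk_potential_eq by auto
  then show ?thesis
    using legendre_cmap dim_base_tangent[of o1] gh.hk_cone_gh invariant_coordinates_Psi[of o1]
      swann_base_metric_iff[of _ o1]
    unfolding L_def
    by (intro conjI exI[of _ gh.Sc] exI[of _ gh.Rt] exI[of _ Psi] allI impI) auto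
qed

end
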